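(* Let $X$ be a non-compact differentiable manifold of class $C^1$. The Laplace operators associated to strongly equivalent complete RM-structures on $X$ have the same essential spectrum.
   Context: An R-structure on $X$ is the datum, for each $x\in X$, of a quadratic norm $\|\cdot\|_x$ (i.e. generated by a scalar product) on the cotangent space $T_x^*X$ such that: if $v$ is a continuous section of $T^*X$ over a compact set $K$ with $v(x)\ne0$ for $x\in K$, then $x\mapsto\|v(x)\|_x$ is a bounded Borel map on $K$ and $\|v(x)\|_x\ge c$ for some $c>0$ and all $x\in K$. Such a structure defines a metric on $X$ compatible with its topology, the distance between two points being the infimum of the lengths of the Lipschitz curves connecting them; the R-structure is complete if $X$ is complete for this metric. The spaces $T^*_xX$ and their scalar products are complexified, keeping the same notations. An RM-structure is a couple consisting of an R-structure and a positive measure $\mu$ on $X$ which is absolutely continuous, with density (in local charts) locally bounded and locally bounded from below by strictly positive constants. It is complete if its R-structure is complete. Given an RM-structure, let $\mathscr H=L^2(X,\mu)$ and let $\mathscr K$ be the completion of the space of continuous compactly supported sections of $T^*X$ for the norm $\|v\|_{\mathscr K}^2=\int_X\|v(x)\|_x^2\,d\mu(x)$. The exterior differentiation $\mathrm d:C^1_{\rm c}(X)\to\mathscr K$ is closable as an operator from $\mathscr H$ to $\mathscr K$; its closure is still denoted $\mathrm d$. The Laplace operator associated to the RM-structure is the self-adjoint operator $\Delta=\mathrm d^*\mathrm d$ in $\mathscr H$. Two RM-structures $(\{\|\cdot\|_x\},\mu)$ and $(\{\|\cdot\|_x'\},\mu')$ are equivalent if there are bounded Borel functions $\alpha,\beta,\lambda$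 on $X$ with $\alpha\ge c$ and $\lambda\ge c$ for some number $c>0$ such that $\alpha(x)\|\cdot\|_x\le\|\cdot\|_x'\le\beta(x)\|\cdot\|_x$ for all $x$ and $\mu'=\lambda\mu$. They are strongly equivalent if they are equivalent and $\alpha,\beta,\lambda$ can be chosen such that $\lambda(x)\to1$, $\alpha(x)\to1$ and $\beta(x)\to1$ as $x\to\infty$. The essential spectrum of $A$ is the set of $\lambda\in\mathbb C$ such that $A-\lambda$ is not Fredholm. *)

theory Defs
  imports "HOL-Analysis.Analysis"
begin

section \<open>Manifolds of class \<open>C\<^sup>1\<close>\<close>

text \<open>
  The underlying Hausdorff, second countable space of the manifold is a whole type. A chart is a
  pair of its domain and a total function, of which only the values on the domain matter.
  The differentiable structure is given by an atlas (not necessarily maximal); all notions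
  below depend only on the \<open>C\<^sup>1\<close> structure it generates.
\<close>

type_synonym ('a, 'e) chart = "'a set \<times> ('a \<Rightarrow> 'e)"

abbreviation chart_inv :: "('a, 'e) chart \<Rightarrow> 'e \<Rightarrow> 'a" where
  "chart_inv c \<equiv> inv_into (fst c) (snd c)"

definition C1_on :: "'b::real_normed_vector set \<Rightarrow> ('b \<Rightarrow> 'c::real_normed_vector) \<Rightarrow> bool" where
  "C1_on S f \<longleftrightarrow> (\<exists>D :: 'b \<Rightarrow> 'b \<Rightarrow>\<^sub>L 'c.
     (\<forall>p\<in>S. (f has_derivative blinfun_apply (D p)) (at p)) \<and> continuous_on S D)"

definition C1_atlas ::
  "('a::{t2_space,second_countable_topology}, 'e::euclidean_space) chart set \<Rightarrow> bool" where
  "C1_atlas A \<longleftrightarrow>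
     (\<Union>c\<in>A. fst c) = UNIV \<and>
     (\<forall>c\<in>A. open (fst c) \<and> open (snd c ` fst c) \<and>
        homeomorphism (fst c) (snd c ` fst c) (snd c) (chart_inv c)) \<and>
     (\<forall>c\<in>A. \<forall>c'\<in>A. C1_on (snd c ` (fst c \<inter> fst c')) (snd c' \<circ> chart_inv c))"

definition C1_functions ::
  "('a::{t2_space,second_countable_topology}, 'e::euclidean_space) chart set
     \<Rightarrow> ('a \<Rightarrow> complex) set" where
  "C1_functions A = {u. \<forall>c\<in>A. C1_on (snd c ` fst c) (u \<circ> chart_inv c)}"

definition C1c_functions ::
  "('a::{t2_space,second_countable_topology}, 'e::euclidean_space) chart set
     \<Rightarrow> ('a \<Rightarrow> complex) set" where
  "C1c_functions A = {u \<in> C1_functions A. compact (closure {x. u x \<noteq> 0})}"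

text \<open>The filter describing \<open>x \<rightarrow> \<infinity>\<close> in a locally compact space.\<close>

definition cocompact :: "'a::topological_space filter" where
  "cocompact = (INF K\<in>{K. compact K}. principal (- K))"


section \<open>Cotangent spaces\<close>

text \<open>
  A cotangent vector at \<open>x\<close> is the family of its coordinate expressions in all the charts around
  \<open>x\<close>, related by the transformation law of covectors. At charts that do not contain \<open>x\<close> the
  family is \<open>0\<close> by convention, so that equality of families is equality of cotangent vectors.
\<close>

type_synonym ('a, 'e) covec = "('a, 'e) chart \<Rightarrow> 'e \<Rightarrow>\<^sub>L real"

definition cotangent ::
  "('a, 'e::euclidean_space) chart set \<Rightarrow> 'a \<Rightarrow> ('a, 'e) covec set" where
  "cotangent A x = {\<xi>.
     (\<forall>c\<in>A. \<forall>c'\<in>A. x \<in> fst c \<inter> fst c' \<longrightarrow>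
        (\<forall>h. blinfun_apply (\<xi> c') h =
             blinfun_apply (\<xi> c)
               (frechet_derivative (snd c \<circ> chart_inv c') (at (snd c' x)) h))) \<and>
     (\<forall>c. c \<notin> A \<or> x \<notin> fst c \<longrightarrow> \<xi> c = 0)}"

definition cov_zero :: "('a, 'e::euclidean_space) covec" where
  "cov_zero = (\<lambda>_. 0)"

definition cov_add ::
  "('a, 'e::euclidean_space) covec \<Rightarrow> ('a, 'e) covec \<Rightarrow> ('a, 'e) covec" where
  "cov_add \<xi> \<eta> = (\<lambda>c. \<xi> c + \<eta> c)"

definition cov_scale :: "real \<Rightarrow> ('a, 'e::euclidean_space) covec \<Rightarrow> ('a, 'e) covec" where
  "cov_scale a \<xi> = (\<lambda>c. a *\<^sub>R \<xi> c)"

definition differential ::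
  "('a, 'e::euclidean_space) chart set \<Rightarrow> ('a \<Rightarrow> real) \<Rightarrow> 'a \<Rightarrow> ('a, 'e) covec" where
  "differential A u x = (\<lambda>c.
     if c \<in> A \<and> x \<in> fst c
     then Blinfun (frechet_derivative (u \<circ> chart_inv c) (at (snd c x))) else 0)"

definition continuous_section_on ::
  "('a::topological_space, 'e::euclidean_space) chart set \<Rightarrow> 'a set
     \<Rightarrow> ('a \<Rightarrow> ('a, 'e) covec) \<Rightarrow> bool" where
  "continuous_section_on A K v \<longleftrightarrow>
     (\<forall>x\<in>K. v x \<in> cotangent A x) \<and>
     (\<forall>c\<in>A. continuous_on (K \<inter> fst c) (\<lambda>x. v x c))"


section \<open>R-structures and RM-structures\<close>

type_synonym ('a, 'e) conorm = "'a \<Rightarrow> ('a, 'e) covec \<Rightarrow> real"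

definition quadratic_norm_on ::
  "('a, 'e::euclidean_space) covec set \<Rightarrow> (('a, 'e) covec \<Rightarrow> real) \<Rightarrow> bool" where
  "quadratic_norm_on S n \<longleftrightarrow> (\<exists>B.
     (\<forall>\<xi>\<in>S. \<forall>\<eta>\<in>S. B \<xi> \<eta> = B \<eta> \<xi>) \<and>
     (\<forall>\<xi>\<in>S. \<forall>\<eta>\<in>S. \<forall>\<zeta>\<in>S. B (cov_add \<xi> \<eta>) \<zeta> = B \<xi> \<zeta> + B \<eta> \<zeta>) \<and>
     (\<forall>a. \<forall>\<xi>\<in>S. \<forall>\<eta>\<in>S. B (cov_scale a \<xi>) \<eta> = a * B \<xi> \<eta>) \<and>
     (\<forall>\<xi>\<in>S. \<xi> \<noteq> cov_zero \<longrightarrow> B \<xi> \<xi> > 0) \<and>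
     (\<forall>\<xi>\<in>S. n \<xi> = sqrt (B \<xi> \<xi>)))"

definition R_structure ::
  "('a::{t2_space,second_countable_topology}, 'e::euclidean_space) chart set
     \<Rightarrow> ('a, 'e) conorm \<Rightarrow> bool" where
  "R_structure A N \<longleftrightarrow>
     (\<forall>x. quadratic_norm_on (cotangent A x) (N x)) \<and>
     (\<forall>K v. compact K \<and> continuous_section_on A K v \<and> (\<forall>x\<in>K. v x \<noteq> cov_zero) \<longrightarrow>
        (\<lambda>x. N x (v x)) \<in> borel_measurable (restrict_space borel K) \<and>
        bounded ((\<lambda>x. N x (v x)) ` K) \<and>
        (\<exists>k>0. \<forall>x\<in>K. N x (v x) \<ge> k))"

text \<open>The Lipschitz property is taken in charts; curves are parametrised by the unit interval.\<close>

definition lipschitz_curve ::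
  "('a, 'e::euclidean_space) chart set \<Rightarrow> (real \<Rightarrow> 'a) \<Rightarrow> bool" where
  "lipschitz_curve A \<gamma> \<longleftrightarrow>
     (\<forall>t\<in>{0..1}. \<forall>c\<in>A. \<gamma> t \<in> fst c \<longrightarrow>
        (\<exists>e>0. \<exists>L. \<gamma> ` ({0..1} \<inter> ball t e) \<subseteq> fst c \<and>
                  L-lipschitz_on ({0..1} \<inter> ball t e) (snd c \<circ> \<gamma>)))"

text \<open>
  The norm of the velocity in the tangent space, dual to \<open>N\<close>. Where \<open>\<gamma>\<close> is differentiable the
  pairing of \<open>\<xi>\<close> with the velocity does not depend on the chart \<open>c\<close>; the remaining parameters
  form a null set for a Lipschitz curve and do not contribute to the length.
\<close>

definition speed ::
  "('a, 'e::euclidean_space) chart set \<Rightarrow> ('a, 'e) conorm \<Rightarrow> (real \<Rightarrow> 'a) \<Rightarrow> real \<Rightarrow> ennreal" where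
  "speed A N \<gamma> t =
     (SUP c\<in>{c\<in>A. \<gamma> t \<in> fst c}. SUP \<xi>\<in>{\<xi> \<in> cotangent A (\<gamma> t). N (\<gamma> t) \<xi> \<le> 1}.
        ennreal (blinfun_apply (\<xi> c) (vector_derivative (snd c \<circ> \<gamma>) (at t))))"

definition curve_length ::
  "('a, 'e::euclidean_space) chart set \<Rightarrow> ('a, 'e) conorm \<Rightarrow> (real \<Rightarrow> 'a) \<Rightarrow> ennreal" where
  "curve_length A N \<gamma> = (\<integral>\<^sup>+t\<in>{0..1}. speed A N \<gamma> t \<partial>lebesgue)"

text \<open>The distance is \<open>\<infinity>\<close> between different connected components.\<close>

definition R_dist ::
  "('a, 'e::euclidean_space) chart set \<Rightarrow> ('a, 'e) conorm \<Rightarrow> 'a \<Rightarrow> 'a \<Rightarrow> ennreal" where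
  "R_dist A N x y = (INF \<gamma>\<in>{\<gamma>. lipschitz_curve A \<gamma> \<and> \<gamma> 0 = x \<and> \<gamma> 1 = y}. curve_length A N \<gamma>)"

definition R_complete ::
  "('a, 'e::euclidean_space) chart set \<Rightarrow> ('a, 'e) conorm \<Rightarrow> bool" where
  "R_complete A N \<longleftrightarrow>
     (\<forall>X :: nat \<Rightarrow> 'a.
        (\<forall>e>0. \<exists>M. \<forall>m\<ge>M. \<forall>n\<ge>M. R_dist A N (X m) (X n) < e) \<longrightarrow>
        (\<exists>x. (\<lambda>n. R_dist A N (X n) x) \<longlonglongrightarrow> 0))"

definition admissible_measure ::
  "('a::{t2_space,second_countable_topology}, 'e::euclidean_space) chart set
     \<Rightarrow> 'a measure \<Rightarrow> bool" where
  "admissible_measure A \<mu> \<longleftrightarrow>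
     sets \<mu> = sets borel \<and>
     (\<forall>c\<in>A. \<exists>\<rho> :: 'e \<Rightarrow> real. \<rho> \<in> borel_measurable borel \<and>
        distr (restrict_space \<mu> (fst c)) borel (snd c) =
          density lborel (\<lambda>p. ennreal (\<rho> p) * indicator (snd c ` fst c) p) \<and>
        (\<forall>p\<in>snd c ` fst c. \<exists>W k C. open W \<and> p \<in> W \<and> k > 0 \<and>
           (\<forall>q\<in>W \<inter> snd c ` fst c. k \<le> \<rho> q \<and> \<rho> q \<le> C)))"

definition RM_structure ::
  "('a::{t2_space,second_countable_topology}, 'e::euclidean_space) chart set
     \<Rightarrow> ('a, 'e) conorm \<Rightarrow> 'a measure \<Rightarrow> bool" where
  "RM_structure A N \<mu> \<longleftrightarrow> R_structure A N \<and> admissible_measure A \<mu>"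

definition complete_RM_structure ::
  "('a::{t2_space,second_countable_topology}, 'e::euclidean_space) chart set
     \<Rightarrow> ('a, 'e) conorm \<Rightarrow> 'a measure \<Rightarrow> bool" where
  "complete_RM_structure A N \<mu> \<longleftrightarrow> RM_structure A N \<mu> \<and> R_complete A N"

definition RM_equivalent_via ::
  "('a::topological_space, 'e::euclidean_space) chart set
     \<Rightarrow> ('a, 'e) conorm \<Rightarrow> 'a measure \<Rightarrow> ('a, 'e) conorm \<Rightarrow> 'a measure
     \<Rightarrow> ('a \<Rightarrow> real) \<Rightarrow> ('a \<Rightarrow> real) \<Rightarrow> ('a \<Rightarrow> real) \<Rightarrow> bool" where
  "RM_equivalent_via A N \<mu> N' \<mu>' \<alpha> \<beta> \<kappa> \<longleftrightarrow>
     \<alpha> \<in> borel_measurable borel \<and> \<beta> \<in> borel_measurable borel \<and> \<kappa> \<in> borel_measurable borel \<and>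
     bounded (range \<alpha>) \<and> bounded (range \<beta>) \<and> bounded (range \<kappa>) \<and>
     (\<exists>k>0. \<forall>x. \<alpha> x \<ge> k \<and> \<kappa> x \<ge> k) \<and>
     (\<forall>x. \<forall>\<xi>\<in>cotangent A x. \<alpha> x * N x \<xi> \<le> N' x \<xi> \<and> N' x \<xi> \<le> \<beta> x * N x \<xi>) \<and>
     \<mu>' = density \<mu> (\<lambda>x. ennreal (\<kappa> x))"

definition RM_strongly_equivalent ::
  "('a::topological_space, 'e::euclidean_space) chart set
     \<Rightarrow> ('a, 'e) conorm \<Rightarrow> 'a measure \<Rightarrow> ('a, 'e) conorm \<Rightarrow> 'a measure \<Rightarrow> bool" where
  "RM_strongly_equivalent A N \<mu> N' \<mu>' \<longleftrightarrow> (\<exists>\<alpha> \<beta> \<kappa>.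
     RM_equivalent_via A N \<mu> N' \<mu>' \<alpha> \<beta> \<kappa> \<and>
     (\<alpha> \<longlongrightarrow> 1) cocompact \<and> (\<beta> \<longlongrightarrow> 1) cocompact \<and> (\<kappa> \<longlongrightarrow> 1) cocompact)"


section \<open>Operators in Hilbert spaces\<close>

text \<open>
  Complex (pre-)Hilbert spaces are given by representatives: \<open>hinner\<close> is only positive
  semidefinite and vectors at distance \<open>0\<close> are identified (for \<open>L\<^sup>2\<close>: functions equal almost
  everywhere). Operators are represented by their graphs. Scalar products are antilinear in
  the first argument.
\<close>

record 'h hspace =
  hvec :: "'h set"
  hzero :: "'h"
  hadd :: "'h \<Rightarrow> 'h \<Rightarrow> 'h"
  hscale :: "complex \<Rightarrow> 'h \<Rightarrow> 'h"
  hinner :: "'h \<Rightarrow> 'h \<Rightarrow> complex"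

definition hdiff :: "'h hspace \<Rightarrow> 'h \<Rightarrow> 'h \<Rightarrow> 'h" where
  "hdiff H x y = hadd H x (hscale H (- 1) y)"

definition hnorm :: "'h hspace \<Rightarrow> 'h \<Rightarrow> real" where
  "hnorm H x = sqrt (Re (hinner H x x))"

definition hequal :: "'h hspace \<Rightarrow> 'h \<Rightarrow> 'h \<Rightarrow> bool" where
  "hequal H x y \<longleftrightarrow> hnorm H (hdiff H x y) = 0"

definition htendsto :: "'h hspace \<Rightarrow> (nat \<Rightarrow> 'h) \<Rightarrow> 'h \<Rightarrow> bool" where
  "htendsto H X x \<longleftrightarrow> (\<lambda>n. hnorm H (hdiff H (X n) x)) \<longlonglongrightarrow> 0"

definition hCauchy :: "'h hspace \<Rightarrow> (nat \<Rightarrow> 'h) \<Rightarrow> bool" where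
  "hCauchy H X \<longleftrightarrow> (\<forall>e>0. \<exists>M. \<forall>m\<ge>M. \<forall>n\<ge>M. hnorm H (hdiff H (X m) (X n)) < e)"

text \<open>The completion by Cauchy sequences; a vector \<open>x\<close> is embedded as the constant sequence.\<close>

definition hcompletion :: "'h hspace \<Rightarrow> (nat \<Rightarrow> 'h) hspace" where
  "hcompletion H = \<lparr>
     hvec = {X. (\<forall>n. X n \<in> hvec H) \<and> hCauchy H X},
     hzero = (\<lambda>_. hzero H),
     hadd = (\<lambda>X Y n. hadd H (X n) (Y n)),
     hscale = (\<lambda>a X n. hscale H a (X n)),
     hinner = (\<lambda>X Y. lim (\<lambda>n. hinner H (X n) (Y n)))\<rparr>"

definition op_closure :: "'h hspace \<Rightarrow> 'k hspace \<Rightarrow> ('h \<times> 'k) set \<Rightarrow> ('h \<times> 'k) set" where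
  "op_closure H K T = {(u, w). u \<in> hvec H \<and> w \<in> hvec K \<and>
     (\<exists>us ws. (\<forall>n. (us n, ws n) \<in> T) \<and> htendsto H us u \<and> htendsto K ws w)}"

definition op_adjoint :: "'h hspace \<Rightarrow> 'k hspace \<Rightarrow> ('h \<times> 'k) set \<Rightarrow> ('k \<times> 'h) set" where
  "op_adjoint H K T = {(w, f). w \<in> hvec K \<and> f \<in> hvec H \<and>
     (\<forall>(u, v)\<in>T. hinner K w v = hinner H f u)}"

definition op_minus_scalar :: "'h hspace \<Rightarrow> ('h \<times> 'h) set \<Rightarrow> complex \<Rightarrow> ('h \<times> 'h) set" where
  "op_minus_scalar H T z = {(u, hdiff H f (hscale H z u)) | u f. (u, f) \<in> T}"

definition op_kernel :: "'h hspace \<Rightarrow> ('h \<times> 'h) set \<Rightarrow> 'h set" where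
  "op_kernel H T = {u. \<exists>f. (u, f) \<in> T \<and> hequal H f (hzero H)}"

primrec lincomb :: "'h hspace \<Rightarrow> (complex \<times> 'h) list \<Rightarrow> 'h" where
  "lincomb H [] = hzero H"
| "lincomb H (p # ps) = hadd H (hscale H (fst p) (snd p)) (lincomb H ps)"

text \<open>The quotient of the subspace \<open>S\<close> by its subspace \<open>R\<close> is finite-dimensional.\<close>

definition finite_dim_quotient :: "'h hspace \<Rightarrow> 'h set \<Rightarrow> 'h set \<Rightarrow> bool" where
  "finite_dim_quotient H S R \<longleftrightarrow>
     (\<exists>F. finite F \<and> F \<subseteq> S \<and>
        (\<forall>x\<in>S. \<exists>r\<in>R. \<exists>ps. snd ` set ps \<subseteq> F \<and> hequal H x (hadd H r (lincomb H ps))))"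

definition hclosed :: "'h hspace \<Rightarrow> 'h set \<Rightarrow> bool" where
  "hclosed H R \<longleftrightarrow> (\<forall>X y. (\<forall>n. X n \<in> R) \<and> y \<in> hvec H \<and> htendsto H X y \<longrightarrow> y \<in> R)"

text \<open>Meant for closed, densely defined operators (as \<open>\<Delta> - z\<close> is, \<open>\<Delta>\<close> being self-adjoint).\<close>

definition Fredholm :: "'h hspace \<Rightarrow> ('h \<times> 'h) set \<Rightarrow> bool" where
  "Fredholm H T \<longleftrightarrow>
     finite_dim_quotient H (op_kernel H T) {hzero H} \<and>
     hclosed H (Range T) \<and>
     finite_dim_quotient H (hvec H) (Range T)"

definition essential_spectrum :: "'h hspace \<Rightarrow> ('h \<times> 'h) set \<Rightarrow> complex set" where
  "essential_spectrum H T = {z. \<not> Fredholm H (op_minus_scalar H T z)}"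


section \<open>The Laplace operator\<close>

definition L2 :: "'a measure \<Rightarrow> ('a \<Rightarrow> complex) hspace" where
  "L2 \<mu> = \<lparr>
     hvec = {f \<in> borel_measurable \<mu>. integrable \<mu> (\<lambda>x. (cmod (f x))\<^sup>2)},
     hzero = (\<lambda>_. 0),
     hadd = (\<lambda>f g x. f x + g x),
     hscale = (\<lambda>a f x. a * f x),
     hinner = (\<lambda>f g. LINT x|\<mu>. cnj (f x) * g x)\<rparr>"

text \<open>
  The complexification of the cotangent space: the pair \<open>(\<xi>, \<eta>)\<close> stands for \<open>\<xi> + \<i> \<eta>\<close>. The scalar
  product is recovered from the quadratic norm by polarisation and extended sesquilinearly.
\<close>

type_synonym ('a, 'e) ccovec = "('a, 'e) covec \<times> ('a, 'e) covec"

definition ccov_zero :: "('a, 'e::euclidean_space) ccovec" where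
  "ccov_zero = (cov_zero, cov_zero)"

definition ccov_add ::
  "('a, 'e::euclidean_space) ccovec \<Rightarrow> ('a, 'e) ccovec \<Rightarrow> ('a, 'e) ccovec" where
  "ccov_add v w = (cov_add (fst v) (fst w), cov_add (snd v) (snd w))"

definition ccov_scale :: "complex \<Rightarrow> ('a, 'e::euclidean_space) ccovec \<Rightarrow> ('a, 'e) ccovec" where
  "ccov_scale a v =
     (cov_add (cov_scale (Re a) (fst v)) (cov_scale (- Im a) (snd v)),
      cov_add (cov_scale (Re a) (snd v)) (cov_scale (Im a) (fst v)))"

definition cov_inner ::
  "(('a, 'e::euclidean_space) covec \<Rightarrow> real) \<Rightarrow> ('a, 'e) covec \<Rightarrow> ('a, 'e) covec \<Rightarrow> real" where
  "cov_inner n \<xi> \<eta> = ((n (cov_add \<xi> \<eta>))\<^sup>2 - (n (cov_add \<xi> (cov_scale (- 1) \<eta>)))\<^sup>2) / 4"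

definition ccov_inner ::
  "(('a, 'e::euclidean_space) covec \<Rightarrow> real) \<Rightarrow> ('a, 'e) ccovec \<Rightarrow> ('a, 'e) ccovec \<Rightarrow> complex" where
  "ccov_inner n v w =
     Complex (cov_inner n (fst v) (fst w) + cov_inner n (snd v) (snd w))
             (cov_inner n (fst v) (snd w) - cov_inner n (snd v) (fst w))"

definition Cc_sections ::
  "('a::{t2_space,second_countable_topology}, 'e::euclidean_space) chart set
     \<Rightarrow> ('a, 'e) conorm \<Rightarrow> 'a measure \<Rightarrow> ('a \<Rightarrow> ('a, 'e) ccovec) hspace" where
  "Cc_sections A N \<mu> = \<lparr>
     hvec = {v. continuous_section_on A UNIV (fst \<circ> v) \<and>
                continuous_section_on A UNIV (snd \<circ> v) \<and>
                compact (closure {x. v x \<noteq> ccov_zero})},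
     hzero = (\<lambda>_. ccov_zero),
     hadd = (\<lambda>v w x. ccov_add (v x) (w x)),
     hscale = (\<lambda>a v x. ccov_scale a (v x)),
     hinner = (\<lambda>v w. LINT x|\<mu>. ccov_inner (N x) (v x) (w x))\<rparr>"

definition K_space ::
  "('a::{t2_space,second_countable_topology}, 'e::euclidean_space) chart set
     \<Rightarrow> ('a, 'e) conorm \<Rightarrow> 'a measure \<Rightarrow> (nat \<Rightarrow> 'a \<Rightarrow> ('a, 'e) ccovec) hspace" where
  "K_space A N \<mu> = hcompletion (Cc_sections A N \<mu>)"

definition cdifferential ::
  "('a, 'e::euclidean_space) chart set \<Rightarrow> ('a \<Rightarrow> complex) \<Rightarrow> 'a \<Rightarrow> ('a, 'e) ccovec" where
  "cdifferential A u x =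
     (differential A (\<lambda>y. Re (u y)) x, differential A (\<lambda>y. Im (u y)) x)"

definition d_closed ::
  "('a::{t2_space,second_countable_topology}, 'e::euclidean_space) chart set
     \<Rightarrow> ('a, 'e) conorm \<Rightarrow> 'a measure
     \<Rightarrow> (('a \<Rightarrow> complex) \<times> (nat \<Rightarrow> 'a \<Rightarrow> ('a, 'e) ccovec)) set" where
  "d_closed A N \<mu> =
     op_closure (L2 \<mu>) (K_space A N \<mu>) {(u, \<lambda>_. cdifferential A u) | u. u \<in> C1c_functions A}"

text \<open>The operator product \<open>d\<^sup>* d\<close>; \<open>O\<close> composes graphs from left to right.\<close>

definition Laplacian ::
  "('a::{t2_space,second_countable_topology}, 'e::euclidean_space) chart set
     \<Rightarrow> ('a, 'e) conorm \<Rightarrow> 'a measure \<Rightarrow> (('a \<Rightarrow> complex) \<times> ('a \<Rightarrow> complex)) set" where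
  "Laplacian A N \<mu> =
     d_closed A N \<mu> O op_adjoint (L2 \<mu>) (K_space A N \<mu>) (d_closed A N \<mu>)"

end

theory Submission
  imports Defs "HOL-Library.Function_Algebras"
begin

text \<open>For self-adjoint \<open>S\<close> and real \<open>z\<close> the operator \<open>S - z\<close> is Fredholm if and only if an estimate
  \<open>\<parallel>u\<parallel> \<le> C (\<parallel>(S - z) u\<parallel> + \<Sum>\<^sub>g |\<langle>g, u\<rangle>|)\<close> with finitely many \<open>g\<close> holds on the domain. For the Laplace operator
  this is equivalent to its form version on real \<open>C\<^sup>1\<close> functions with compact support, where \<open>\<parallel>u\<parallel>\<close> is replaced by
  the norm \<open>\<parallel>u\<parallel>\<^sub>1\<close> of the form domain and \<open>\<parallel>(S - z) u\<parallel>\<close> by the dual norm of the functional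
  \<open>v \<mapsto> \<integral> \<langle>du, dv\<rangle> - z \<integral> u v\<close>. For strongly equivalent structures these functionals differ in the dual norm
  by at most \<open>\<delta> \<parallel>u\<parallel>\<^sub>1 + T \<parallel>u\<parallel>\<^sub>1\<^sub>,\<^sub>K\<close>, where the last norm only sees a compact set \<open>K\<close> depending on \<open>\<delta>\<close>. By
  the Caccioppoli inequality and Rellich's theorem that local norm is at most \<open>\<epsilon> \<parallel>u\<parallel>\<^sub>1\<close> plus terms allowed on
  the right of the estimate, so the estimate passes from one structure to the other. The closure of \<open>d\<close> is
  handled as a linear relation, which makes its closability irrelevant.\<close>

section \<open>Semidefinite scalar products\<close>

text \<open>The coefficients are merely Borel, so the domains of the two operators need not be
  related. Their forms share the core of \<open>C\<^sup>1\<close> functions with compact support;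
  every criterion is therefore brought back to this core and to the dual norm of a functional on it.
  Compactness is expressed by an additive term with finitely many scalar products instead of
  subsequences, which makes Rellich's theorem and the Caccioppoli inequality estimates that can be
  added and absorbed. Rellich's theorem alone does not suffice: on a compact set the difference of
  the forms contains the gradient of \<open>u\<close>, and the Caccioppoli inequality trades it for
  the function and the dual norm. That dual norm is known in the target structure, so the local
  bound is applied there, while the estimate being transferred is applied in the other one. Each of
  the two resulting error terms is kept below a quarter of the norm to be estimated. Real functions
  suffice because the forms are complexified from real ones. Off the real axis the Fredholm property
  holds for every self-adjoint operator, so only real numbers are compared.\<close>

lemma quadratic_nonneg_imp_le:
  fixes a b c :: real
  assumes "\<And>s. 0 \<le> a - 2 * s * b + s\<^sup>2 * b * c" and "0 \<le> a" "0 \<le> b" "0 \<le> c"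
  shows "b \<le> a * c"
proof (cases "c = 0")
  case True
  have "b = 0"
  proof (rule ccontr)
    assume "b \<noteq> 0"
    then have "b > 0" using assms by simp
    \<comment> \<open>With \<open>c = 0\<close> the expression is affine in \<open>s\<close>, and
      this \<open>s\<close> gives it the value -1.\<close>
    then show False
      using assms(1)[of "(a + 1) / (2 * b)"] True by (simp add: field_simps)
  qed
  then show ?thesis using True by simp
next
  case False
  then show ?thesis
    using assms(1)[of "1 / c"] assms(4) by (simp add: field_simps power2_eq_square)
qed

text \<open>The vectors are representatives in an ambient group, of which only the subspace
  \<open>V\<close> carries the form; functions equal almost everywhere differ by a vector of
  seminorm 0. The form is therefore only semidefinite, limits are not unique, and spanning
  statements are formulated up to null vectors.\<close>

locale semi_inner = vector_space scale
  for scale :: "complex \<Rightarrow> 'h::ab_group_add \<Rightarrow> 'h" (infixr \<open>*c\<close> 75) +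
  fixes V :: "'h set" and ip :: "'h \<Rightarrow> 'h \<Rightarrow> complex"
  assumes subspace_V: "subspace V"
    and cnj_ip: "x \<in> V \<Longrightarrow> y \<in> V \<Longrightarrow> cnj (ip x y) = ip y x"
    and ip_add_right: "x \<in> V \<Longrightarrow> y \<in> V \<Longrightarrow> w \<in> V \<Longrightarrow> ip x (y + w) = ip x y + ip x w"
    and ip_scale_right: "x \<in> V \<Longrightarrow> y \<in> V \<Longrightarrow> ip x (a *c y) = a * ip x y"
    and ip_self_nonneg: "x \<in> V \<Longrightarrow> 0 \<le> Re (ip x x)"
begin

definition nrm :: "'h \<Rightarrow> real" where "nrm x = sqrt (Re (ip x x))"

definition tends :: "(nat \<Rightarrow> 'h) \<Rightarrow> 'h \<Rightarrow> bool" where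
  "tends X x \<longleftrightarrow> (\<lambda>n. nrm (X n - x)) \<longlonglongrightarrow> 0"

definition Cauchy_seq :: "(nat \<Rightarrow> 'h) \<Rightarrow> bool" where
  "Cauchy_seq X \<longleftrightarrow> (\<forall>e>0. \<exists>M. \<forall>m\<ge>M. \<forall>n\<ge>M. nrm (X m - X n) < e)"

lemma V_zero [simp, intro]: "0 \<in> V"
  and V_add [simp, intro]: "x \<in> V \<Longrightarrow> y \<in> V \<Longrightarrow> x + y \<in> V"
  and V_diff [simp, intro]: "x \<in> V \<Longrightarrow> y \<in> V \<Longrightarrow> x - y \<in> V"
  and V_minus [simp, intro]: "x \<in> V \<Longrightarrow> - x \<in> V"
  and V_scale [simp, intro]: "x \<in> V \<Longrightarrow> a *c x \<in> V"
  using subspace_V by (auto intro: subspace_0 subspace_add subspace_diff subspace_neg subspace_scale)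

lemma ip_add_left: "x \<in> V \<Longrightarrow> y \<in> V \<Longrightarrow> w \<in> V \<Longrightarrow> ip (x + y) w = ip x w + ip y w"
  by (metis cnj_ip complex_cnj_add ip_add_right V_add)

lemma ip_scale_left: "x \<in> V \<Longrightarrow> y \<in> V \<Longrightarrow> ip (a *c x) y = cnj a * ip x y"
  by (metis cnj_ip complex_cnj_mult ip_scale_right V_scale)

lemma ip_minus_right: "x \<in> V \<Longrightarrow> y \<in> V \<Longrightarrow> ip x (- y) = - ip x y"
  using ip_scale_right[of x y "-1"] by simp

lemma ip_minus_left: "x \<in> V \<Longrightarrow> y \<in> V \<Longrightarrow> ip (- x) y = - ip x y"
  using ip_scale_left[of x y "-1"] by simp

lemma ip_diff_right: "x \<in> V \<Longrightarrow> y \<in> V \<Longrightarrow> w \<in> V \<Longrightarrow> ip x (y - w) = ip x y - ip x w"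
  using ip_add_right[of x y "- w"] ip_minus_right[of x w] by simp

lemma ip_diff_left: "x \<in> V \<Longrightarrow> y \<in> V \<Longrightarrow> w \<in> V \<Longrightarrow> ip (x - y) w = ip x w - ip y w"
  using ip_add_left[of x "- y" w] ip_minus_left[of y w] by simp

lemma ip_zero_right [simp]: "x \<in> V \<Longrightarrow> ip x 0 = 0"
  using ip_scale_right[of x 0 0] by simp

lemma ip_zero_left [simp]: "x \<in> V \<Longrightarrow> ip 0 x = 0"
  using ip_scale_left[of 0 x 0] by simp

lemmas ip_simps = ip_add_left ip_add_right ip_diff_left ip_diff_right
  ip_minus_left ip_minus_right ip_scale_left ip_scale_right

lemma nrm_nonneg [simp]: "x \<in> V \<Longrightarrow> 0 \<le> nrm x"
  by (simp add: nrm_def ip_self_nonneg)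

lemma nrm_power2: "x \<in> V \<Longrightarrow> (nrm x)\<^sup>2 = Re (ip x x)"
  by (simp add: nrm_def ip_self_nonneg)

lemma ip_self: "x \<in> V \<Longrightarrow> ip x x = of_real ((nrm x)\<^sup>2)"
  using cnj_ip[of x x] by (simp add: nrm_power2 complex_eq_iff)

lemma nrm_zero [simp]: "nrm 0 = 0"
  by (simp add: nrm_def)

lemma nrm_scale: "x \<in> V \<Longrightarrow> nrm (a *c x) = cmod a * nrm x"
proof -
  assume x: "x \<in> V"
  have "ip (a *c x) (a *c x) = of_real ((cmod a)\<^sup>2 * (nrm x)\<^sup>2)"
    unfolding of_real_mult complex_norm_square using x ip_self[OF x] by (simp add: ip_simps mult_ac)
  then have "(nrm (a *c x))\<^sup>2 = (cmod a * nrm x)\<^sup>2"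
    unfolding nrm_power2[OF V_scale[OF x]] power_mult_distrib by (metis Re_complex_of_real)
  then show ?thesis
    by (rule power2_eq_imp_eq) (use x in simp_all)
qed

lemma nrm_minus: "x \<in> V \<Longrightarrow> nrm (- x) = nrm x"
  by (simp add: nrm_def ip_simps)

lemma nrm_minus_commute: "x \<in> V \<Longrightarrow> y \<in> V \<Longrightarrow> nrm (x - y) = nrm (y - x)"
  using nrm_minus[of "x - y"] by simp

text \<open>The coefficient of \<open>y\<close> carries the phase of the scalar product, so the
  cross term is real and the right side is a real quadratic in \<open>s\<close>, in the shape
  required by \<open>quadratic_nonneg_imp_le\<close>.\<close>

lemma nrm_diff_power2:
  fixes s :: real
  assumes "x \<in> V" "y \<in> V"
  shows "(nrm (x - (of_real s * cnj (ip x y)) *c y))\<^sup>2 =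
    (nrm x)\<^sup>2 - 2 * s * (cmod (ip x y))\<^sup>2 + s\<^sup>2 * (cmod (ip x y))\<^sup>2 * (nrm y)\<^sup>2"
proof -
  define t where "t = of_real s * cnj (ip x y)"
  have "ip (x - t *c y) (x - t *c y) =
      ip x x - t * ip x y - cnj (t * ip x y) + cnj t * t * ip y y"
    using assms by (simp add: ip_simps algebra_simps cnj_ip)
  moreover have "t * ip x y = of_real (s * (cmod (ip x y))\<^sup>2)"
    unfolding t_def of_real_mult complex_norm_square by (simp only: mult_ac)
  moreover have "cnj t * t = of_real (s\<^sup>2 * (cmod (ip x y))\<^sup>2)"
    unfolding t_def of_real_mult complex_norm_square by (simp add: power2_eq_square mult_ac)
  ultimately have "ip (x - t *c y) (x - t *c y) = of_real ((nrm x)\<^sup>2 - 2 * s * (cmod (ip x y))\<^sup>2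
      + s\<^sup>2 * (cmod (ip x y))\<^sup>2 * (nrm y)\<^sup>2)"
    using assms by (simp add: ip_self)
  then show ?thesis
    using assms nrm_power2[of "x - t *c y"] by (simp add: t_def del: of_real_mult of_real_power)
qed

lemma Cauchy_Schwarz_ip:
  assumes "x \<in> V" "y \<in> V"
  shows "cmod (ip x y) \<le> nrm x * nrm y"
proof -
  have "(cmod (ip x y))\<^sup>2 \<le> (nrm x)\<^sup>2 * (nrm y)\<^sup>2"
    by (rule quadratic_nonneg_imp_le)
      (use zero_le_power2 in \<open>simp_all flip: nrm_diff_power2[OF assms]\<close>)
  then have "(cmod (ip x y))\<^sup>2 \<le> (nrm x * nrm y)\<^sup>2"
    by (simp add: power_mult_distrib)
  then show ?thesis
    by (rule power2_le_imp_le) (use assms in simp)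
qed

lemma nrm_triangle:
  assumes "x \<in> V" "y \<in> V"
  shows "nrm (x + y) \<le> nrm x + nrm y"
proof -
  have "(nrm (x + y))\<^sup>2 = (nrm x)\<^sup>2 + Re (ip x y) + Re (ip y x) + (nrm y)\<^sup>2"
    using assms by (simp add: nrm_power2 ip_simps)
  also have "Re (ip y x) = Re (ip x y)"
    using cnj_ip[OF assms] by (metis cnj.simps(1))
  also have "Re (ip x y) \<le> nrm x * nrm y"
    using Cauchy_Schwarz_ip[OF assms] complex_Re_le_cmod order_trans by blast
  finally have "(nrm (x + y))\<^sup>2 \<le> (nrm x + nrm y)\<^sup>2"
    by (simp add: power2_sum algebra_simps)
  then show ?thesis
    by (rule power2_le_imp_le) (use assms in simp)
qed

lemma nrm_triangle_diff: "x \<in> V \<Longrightarrow> y \<in> V \<Longrightarrow> nrm (x - y) \<le> nrm x + nrm y"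
  using nrm_triangle[of x "- y"] by (simp add: nrm_minus)

lemma nrm_diff_triangle: "x \<in> V \<Longrightarrow> y \<in> V \<Longrightarrow> w \<in> V \<Longrightarrow> nrm (x - w) \<le> nrm (x - y) + nrm (y - w)"
  using nrm_triangle[of "x - y" "y - w"] by simp

lemma nrm_triangle2: "x \<in> V \<Longrightarrow> y \<in> V \<Longrightarrow> nrm x \<le> nrm y + nrm (x - y)"
  using nrm_triangle[of "y" "x - y"] by simp

lemma nrm_triangle3: "x \<in> V \<Longrightarrow> y \<in> V \<Longrightarrow> \<bar>nrm x - nrm y\<bar> \<le> nrm (x - y)"
  using nrm_triangle2[of x y] nrm_triangle2[of y x] by (simp add: nrm_minus_commute)

lemma parallelogram:
  assumes "x \<in> V" "y \<in> V"
  shows "(nrm (x + y))\<^sup>2 + (nrm (x - y))\<^sup>2 = 2 * (nrm x)\<^sup>2 + 2 * (nrm y)\<^sup>2"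
  using assms by (simp add: nrm_power2 ip_simps)

section \<open>Convergence with respect to a seminorm\<close>

lemma tends_const: "tends (\<lambda>n. x) x"
  by (simp add: tends_def)

lemma tends_add:
  assumes "\<And>n. X n \<in> V" "x \<in> V" "\<And>n. Y n \<in> V" "y \<in> V" "tends X x" "tends Y y"
  shows "tends (\<lambda>n. X n + Y n) (x + y)"
  unfolding tends_def
proof (rule tendsto_sandwich[OF _ _ tendsto_const])
  show "\<forall>\<^sub>F n in sequentially. 0 \<le> nrm (X n + Y n - (x + y))"
    using assms by (intro always_eventually allI nrm_nonneg) auto
  have "nrm (X n + Y n - (x + y)) \<le> nrm (X n - x) + nrm (Y n - y)" for n
  proof -
    have "X n + Y n - (x + y) = (X n - x) + (Y n - y)" by (simp add: algebra_simps)
    then show ?thesis using nrm_triangle[of "X n - x" "Y n - y"] assms by (metis V_diff)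
  qed
  then show "\<forall>\<^sub>F n in sequentially. nrm (X n + Y n - (x + y)) \<le> nrm (X n - x) + nrm (Y n - y)"
    by simp
  show "(\<lambda>n. nrm (X n - x) + nrm (Y n - y)) \<longlonglongrightarrow> 0"
    using assms by (auto simp: tends_def intro: tendsto_eq_intros)
qed

lemma tends_scale:
  assumes "\<And>n. X n \<in> V" "x \<in> V" "tends X x"
  shows "tends (\<lambda>n. a *c X n) (a *c x)"
  using assms by (simp add: tends_def nrm_scale flip: scale_right_diff_distrib)
    (auto intro: tendsto_eq_intros)

lemma tends_diff:
  assumes "\<And>n. X n \<in> V" "x \<in> V" "\<And>n. Y n \<in> V" "y \<in> V" "tends X x" "tends Y y"
  shows "tends (\<lambda>n. X n - Y n) (x - y)"
  using tends_add[of X x "\<lambda>n. (-1) *c Y n" "(-1) *c y"] tends_scale[of Y y "-1"] assms by simp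

lemma nrm_tendsto:
  assumes "\<And>n. X n \<in> V" "x \<in> V" "tends X x"
  shows "(\<lambda>n. nrm (X n)) \<longlonglongrightarrow> nrm x"
proof -
  have "(\<lambda>n. nrm (X n) - nrm x) \<longlonglongrightarrow> 0"
  proof (rule Lim_null_comparison)
    show "\<forall>\<^sub>F n in sequentially. norm (nrm (X n) - nrm x) \<le> nrm (X n - x)"
      using nrm_triangle3 assms by simp
    show "(\<lambda>n. nrm (X n - x)) \<longlonglongrightarrow> 0"
      using assms by (simp add: tends_def)
  qed
  then show ?thesis by (rule LIM_zero_cancel)
qed

lemma ip_tendsto_left:
  assumes "\<And>n. X n \<in> V" "x \<in> V" "y \<in> V" "tends X x"
  shows "(\<lambda>n. ip (X n) y) \<longlonglongrightarrow> ip x y"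
proof -
  have "(\<lambda>n. ip (X n) y - ip x y) \<longlonglongrightarrow> 0"
  proof (rule Lim_null_comparison[of _ "\<lambda>n. nrm (X n - x) * nrm y"])
    show "\<forall>\<^sub>F n in sequentially. cmod (ip (X n) y - ip x y) \<le> nrm (X n - x) * nrm y"
      using Cauchy_Schwarz_ip[of "X _ - x" y] assms by (simp add: ip_simps)
    show "(\<lambda>n. nrm (X n - x) * nrm y) \<longlonglongrightarrow> 0"
      using assms by (auto simp: tends_def intro: tendsto_eq_intros)
  qed
  then show ?thesis by (rule LIM_zero_cancel)
qed

lemma ip_tendsto_right:
  assumes "\<And>n. X n \<in> V" "x \<in> V" "y \<in> V" "tends X x"
  shows "(\<lambda>n. ip y (X n)) \<longlonglongrightarrow> ip y x"
  using tendsto_cnj[OF ip_tendsto_left[OF assms]] assms by (simp add: cnj_ip)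

lemma nrm_eq_cong:
  assumes "x \<in> V" "y \<in> V" "nrm (x - y) = 0"
  shows "nrm x = nrm y"
  using nrm_triangle3[OF assms(1,2)] assms(3) by simp

lemma ip_null_left: "x \<in> V \<Longrightarrow> y \<in> V \<Longrightarrow> nrm x = 0 \<Longrightarrow> ip x y = 0"
  using Cauchy_Schwarz_ip[of x y] by simp

lemma Cauchy_seq_bounded_by:
  assumes "\<And>m n. m \<le> n \<Longrightarrow> nrm (X m - X n) \<le> d m" "d \<longlonglongrightarrow> 0" "\<And>n. X n \<in> V"
  shows "Cauchy_seq X"
  unfolding Cauchy_seq_def
proof (intro allI impI)
  fix e :: real assume "e > 0"
  then obtain M where M: "\<And>n. n \<ge> M \<Longrightarrow> d n < e"
    using assms(2) by (metis order_tendstoD(2) eventually_sequentially)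
  have "nrm (X m - X n) < e" if "m \<ge> M" "n \<ge> M" for m n
  proof (cases "m \<le> n")
    case True
    then show ?thesis using assms(1)[of m n] M that by force
  next
    case False
    then show ?thesis using assms(1)[of n m] M[of n] that assms(3) nrm_minus_commute[of "X m" "X n"] by force
  qed
  then show "\<exists>M. \<forall>m\<ge>M. \<forall>n\<ge>M. nrm (X m - X n) < e" by blast
qed

lemma tends_imp_Cauchy_seq:
  assumes "\<And>n. X n \<in> V" "x \<in> V" "tends X x"
  shows "Cauchy_seq X"
  unfolding Cauchy_seq_def
proof (intro allI impI)
  fix e :: real assume "e > 0"
  then obtain M where M: "\<And>n. n \<ge> M \<Longrightarrow> nrm (X n - x) < e / 2"
    using order_tendstoD(2)[OF assms(3)[unfolded tends_def], of "e / 2"]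
    by (auto simp: eventually_sequentially)
  have "nrm (X m - X n) < e" if "m \<ge> M" "n \<ge> M" for m n
    using M[OF that(1)] M[OF that(2)] nrm_diff_triangle[of "X m" x "X n"] nrm_minus_commute[of x "X n"] assms
    by simp
  then show "\<exists>M. \<forall>m\<ge>M. \<forall>n\<ge>M. nrm (X m - X n) < e" by blast
qed

text \<open>The minimising sequence of the distance from \<open>x\<close> to \<open>S\<close>; neither completeness of the
  space nor closedness of \<open>S\<close> is involved.\<close>

lemma approximate_projection:
  assumes "subspace S" "S \<subseteq> V" "x \<in> V"
  obtains m d where "\<And>n. m n \<in> S" "Cauchy_seq m" "d \<longlonglongrightarrow> 0"
    "\<And>n y. y \<in> S \<Longrightarrow> cmod (ip (x - m n) y) \<le> d n * nrm y"
proof -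
  define D where "D = (INF s\<in>S. (nrm (x - s))\<^sup>2)"
  have "0 \<in> S" using assms subspace_0 by blast
  have bdd: "bdd_below ((\<lambda>s. (nrm (x - s))\<^sup>2) ` S)"
    by (rule bdd_belowI[of _ 0]) auto
  have D: "D \<le> (nrm (x - s))\<^sup>2" if "s \<in> S" for s
    unfolding D_def using bdd that by (rule cINF_lower)
  have "\<exists>s\<in>S. (nrm (x - s))\<^sup>2 < D + 1 / (real n + 1)" for n
    using cInf_lessD[of "(\<lambda>s. (nrm (x - s))\<^sup>2) ` S" "D + 1 / (real n + 1)"] \<open>0 \<in> S\<close>
    unfolding D_def by (auto simp: field_simps)
  then obtain m where m: "\<And>n. m n \<in> S" "\<And>n. (nrm (x - m n))\<^sup>2 < D + 1 / (real n + 1)"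
    by metis
  have mV: "m n \<in> V" for n using m assms by blast
  have lim: "(\<lambda>n. 1 / (real n + 1)) \<longlonglongrightarrow> 0"
    using LIMSEQ_inverse_real_of_nat by (simp add: inverse_eq_divide add.commute)
  show ?thesis
  proof (rule that[of m "\<lambda>n. sqrt (1 / (real n + 1))"])
    show "m n \<in> S" for n by (fact m)
    show "(\<lambda>n. sqrt (1 / (real n + 1))) \<longlonglongrightarrow> 0"
      using tendsto_real_sqrt[OF lim] by simp
    show "Cauchy_seq m"
    proof (rule Cauchy_seq_bounded_by)
      show "(\<lambda>n. sqrt (4 * (1 / (real n + 1)))) \<longlonglongrightarrow> 0"
        using tendsto_real_sqrt[OF tendsto_mult_left[OF lim, of 4]] by simp
      show "m n \<in> V" for n by (fact mV)
      show "nrm (m i - m j) \<le> sqrt (4 * (1 / (real i + 1)))" if "i \<le> j" for i j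
      proof -
        \<comment> \<open>The midpoint lies in \<open>S\<close>, so its distance to \<open>x\<close>
          is at least the infimum; the parallelogram identity then bounds the distance of two almost
          minimal points.\<close>
        let ?h = "(1/2) *c (m i + m j)"
        have "?h \<in> S" using m assms(1) by (simp add: subspace_add subspace_scale)
        have e: "(x - m i) + (x - m j) = 2 *c (x - ?h)"
        proof -
          have "2 *c x = x + x" using scale_left_distrib[of 1 1 x] by simp
          then show ?thesis by (simp add: scale_right_diff_distrib)
        qed
        have "(nrm (m i - m j))\<^sup>2 = (nrm ((x - m i) - (x - m j)))\<^sup>2"
          using nrm_minus_commute[of "m i" "m j"] mV by simp
        also have "\<dots> = 2 * (nrm (x - m i))\<^sup>2 + 2 * (nrm (x - m j))\<^sup>2 - (nrm ((x - m i) + (x - m j)))\<^sup>2"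
          using parallelogram[of "x - m i" "x - m j"] assms mV by simp
        also have "nrm ((x - m i) + (x - m j)) = 2 * nrm (x - ?h)"
          unfolding e using assms mV by (subst nrm_scale) auto
        also have "2 * (nrm (x - m i))\<^sup>2 + 2 * (nrm (x - m j))\<^sup>2 - (2 * nrm (x - ?h))\<^sup>2
            \<le> 2 * (D + 1 / (real i + 1)) + 2 * (D + 1 / (real j + 1)) - 4 * D"
          using m(2)[of i] m(2)[of j] D[OF \<open>?h \<in> S\<close>] by (simp add: power_mult_distrib)
        also have "\<dots> \<le> 4 * (1 / (real i + 1))"
          using that frac_le[of 2 2 "real i + 1" "real j + 1"] by simp
        finally show ?thesis
          by (rule real_le_rsqrt)
      qed
    qed
    show "cmod (ip (x - m n) y) \<le> sqrt (1 / (real n + 1)) * nrm y" if y: "y \<in> S" for n y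
    proof -
      define w where "w = x - m n"
  have wV: "w \<in> V" and yV: "y \<in> V" using assms mV y by (auto simp: w_def)
      \<comment> \<open>Moving \<open>m n\<close> inside \<open>S\<close> in the direction of
        \<open>y\<close> cannot bring the squared distance below the infimum, while that of
        \<open>m n\<close> exceeds it by less than \<open>1 / (n + 1)\<close>; the infimum
        cancels.\<close>
      have "0 \<le> 1 / (real n + 1) - 2 * s * (cmod (ip w y))\<^sup>2 + s\<^sup>2 * (cmod (ip w y))\<^sup>2 * (nrm y)\<^sup>2"
        for s :: real
      proof -
        define t where "t = of_real s * cnj (ip w y)"
  have "m n + t *c y \<in> S"
          using m y assms(1) by (simp add: subspace_add subspace_scale)
        then have "D \<le> (nrm (x - (m n + t *c y)))\<^sup>2"
          by (rule D)
        also have "x - (m n + t *c y) = w - t *c y"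
          by (simp add: w_def)
        also have "(nrm (w - t *c y))\<^sup>2 = (nrm w)\<^sup>2 - 2 * s * (cmod (ip w y))\<^sup>2 + s\<^sup>2 * (cmod (ip w y))\<^sup>2 * (nrm y)\<^sup>2"
          unfolding t_def by (rule nrm_diff_power2[OF wV yV])
        finally show ?thesis
          using m(2)[of n, folded w_def] by linarith
      qed
      then have "(cmod (ip w y))\<^sup>2 \<le> (1 / (real n + 1)) * (nrm y)\<^sup>2"
        by (rule quadratic_nonneg_imp_le) simp_all
      also have "\<dots> = (sqrt (1 / (real n + 1)))\<^sup>2 * (nrm y)\<^sup>2"
        by (subst real_sqrt_pow2) auto
      also have "\<dots> = (sqrt (1 / (real n + 1)) * nrm y)\<^sup>2"
        by (rule power_mult_distrib[symmetric])
      finally show ?thesis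
        unfolding w_def by (rule power2_le_imp_le) (use yV in \<open>auto intro!: mult_nonneg_nonneg simp del: real_sqrt_divide\<close>)
    qed
  qed
qed

end

section \<open>Linear relations and the Fredholm property\<close>

locale complete_semi_inner = semi_inner scale V ip
  for scale :: "complex \<Rightarrow> 'h::ab_group_add \<Rightarrow> 'h" (infixr \<open>*c\<close> 75) and V ip +
  assumes complete: "(\<And>n. X n \<in> V) \<Longrightarrow> Cauchy_seq X \<Longrightarrow> \<exists>x\<in>V. tends X x"
begin

text \<open>A relation instead of an operator: with representatives, a closed graph contains all
  pairs \<open>(0, f)\<close> with \<open>f\<close> null, and nothing here excludes pairs
  \<open>(0, f)\<close> with \<open>f\<close> not null.\<close>

definition lin_rel :: "('h \<times> 'h) set \<Rightarrow> bool" where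
  "lin_rel \<Gamma> \<longleftrightarrow> \<Gamma> \<subseteq> V \<times> V \<and> (0, 0) \<in> \<Gamma> \<and>
     (\<forall>u f v g. (u, f) \<in> \<Gamma> \<longrightarrow> (v, g) \<in> \<Gamma> \<longrightarrow> (u + v, f + g) \<in> \<Gamma>) \<and>
     (\<forall>a u f. (u, f) \<in> \<Gamma> \<longrightarrow> (a *c u, a *c f) \<in> \<Gamma>)"

text \<open>Limits are only determined up to null vectors, so closedness includes invariance under
  changes by null vectors; \<open>closed_rel_null\<close> extracts this.\<close>

definition closed_rel :: "('h \<times> 'h) set \<Rightarrow> bool" where
  "closed_rel \<Gamma> \<longleftrightarrow> lin_rel \<Gamma> \<and>
     (\<forall>us fs u f. (\<forall>n. (us n, fs n) \<in> \<Gamma>) \<longrightarrow> u \<in> V \<longrightarrow> f \<in> V \<longrightarrow> tends us u \<longrightarrow> tends fs f \<longrightarrow> (u, f) \<in> \<Gamma>)"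

lemma lin_rel_V: "lin_rel \<Gamma> \<Longrightarrow> (u, f) \<in> \<Gamma> \<Longrightarrow> u \<in> V" "lin_rel \<Gamma> \<Longrightarrow> (u, f) \<in> \<Gamma> \<Longrightarrow> f \<in> V"
  by (auto simp: lin_rel_def)

lemma lin_rel_zero: "lin_rel \<Gamma> \<Longrightarrow> (0, 0) \<in> \<Gamma>"
  by (auto simp: lin_rel_def)

lemma lin_rel_add: "lin_rel \<Gamma> \<Longrightarrow> (u, f) \<in> \<Gamma> \<Longrightarrow> (v, g) \<in> \<Gamma> \<Longrightarrow> (u + v, f + g) \<in> \<Gamma>"
  by (auto simp: lin_rel_def)

lemma lin_rel_scale: "lin_rel \<Gamma> \<Longrightarrow> (u, f) \<in> \<Gamma> \<Longrightarrow> (a *c u, a *c f) \<in> \<Gamma>"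
  by (auto simp: lin_rel_def)

lemma lin_rel_diff: "lin_rel \<Gamma> \<Longrightarrow> (u, f) \<in> \<Gamma> \<Longrightarrow> (v, g) \<in> \<Gamma> \<Longrightarrow> (u - v, f - g) \<in> \<Gamma>"
  using lin_rel_add[of \<Gamma> u f "- v" "- g"] lin_rel_scale[of \<Gamma> v g "-1"] by simp

lemma closed_rel_lin: "closed_rel \<Gamma> \<Longrightarrow> lin_rel \<Gamma>"
  by (simp add: closed_rel_def)

lemma closed_rel_limit:
  "closed_rel \<Gamma> \<Longrightarrow> (\<And>n. (us n, fs n) \<in> \<Gamma>) \<Longrightarrow> u \<in> V \<Longrightarrow> f \<in> V \<Longrightarrow> tends us u \<Longrightarrow> tends fs f
    \<Longrightarrow> (u, f) \<in> \<Gamma>"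
  unfolding closed_rel_def by metis

lemma closed_rel_null:
  assumes "closed_rel \<Gamma>" "(u, f) \<in> \<Gamma>" "u' \<in> V" "f' \<in> V" "nrm (u - u') = 0" "nrm (f - f') = 0"
  shows "(u', f') \<in> \<Gamma>"
  using closed_rel_limit[of \<Gamma> "\<lambda>_. u" "\<lambda>_. f" u' f'] assms by (simp add: tends_def)

section \<open>Geometric series and uniform boundedness\<close>

lemma geometric_increments:
  assumes X: "\<And>n. X n \<in> V" and q: "0 < q" "q < 1" and K: "0 \<le> K"
    and inc: "\<And>n. nrm (X (Suc n) - X n) \<le> K * q ^ n"
  shows "m \<le> n \<Longrightarrow> nrm (X m - X n) \<le> K * q ^ m / (1 - q)" and "Cauchy_seq X"
proof -
  show *: "nrm (X m - X n) \<le> K * q ^ m / (1 - q)" if "m \<le> n" for m n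
  proof -
    \<comment> \<open>The exact partial sum of the geometric series is what the induction
      reproduces; the bound independent of \<open>n\<close> follows from it.\<close>
    have "nrm (X m - X n) \<le> K * (q ^ m - q ^ n) / (1 - q)"
      using that
    proof (induction n rule: dec_induct)
      case (step n)
      have "nrm (X m - X (Suc n)) \<le> nrm (X m - X n) + nrm (X n - X (Suc n))"
        using X by (intro nrm_diff_triangle) auto
      also have "\<dots> \<le> K * (q ^ m - q ^ n) / (1 - q) + K * q ^ n"
        using step.IH inc[of n] X nrm_minus_commute[of "X n" "X (Suc n)"] by simp
      also have "\<dots> = K * (q ^ m - q ^ Suc n) / (1 - q)"
        using q by (simp add: field_simps)
      finally show ?case .
    qed simp
    also have "\<dots> \<le> K * q ^ m / (1 - q)"
      using q K by (intro divide_right_mono mult_left_mono) auto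
    finally show ?thesis .
  qed
  show "Cauchy_seq X"
  proof (rule Cauchy_seq_bounded_by[OF * _ X])
    have "(\<lambda>n. q ^ n) \<longlonglongrightarrow> 0"
      using q by (intro LIMSEQ_power_zero) simp
    then show "(\<lambda>n. K * q ^ n / (1 - q)) \<longlonglongrightarrow> 0"
      by (intro tendsto_divide_zero tendsto_mult_right_zero)
  qed
qed

text \<open>Gliding hump: with signs chosen along the way, the sum of the \<open>3\<^sup>-\<^sup>n x\<^sub>n / \<parallel>x\<^sub>n\<parallel>\<close> has large
  scalar products with all the \<open>x\<^sub>n\<close>.\<close>

lemma uniform_boundedness:
  assumes R: "subspace R" "R \<subseteq> V"
    and closed: "\<And>X y. (\<And>n. X n \<in> R) \<Longrightarrow> y \<in> V \<Longrightarrow> tends X y \<Longrightarrow> y \<in> R"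
    and B: "B \<subseteq> R"
    and pointwise: "\<And>f. f \<in> R \<Longrightarrow> \<exists>C. \<forall>x\<in>B. cmod (ip f x) \<le> C"
  shows "\<exists>C. \<forall>x\<in>B. nrm x \<le> C"
proof (rule ccontr)
  assume "\<not> ?thesis"
  then have "\<forall>C. \<exists>x\<in>B. C < nrm x"
    by (auto simp: not_le)
  \<comment> \<open>The weight 3^(-n) of the n-th summand cancels the power of 3, and the factor
    \<open>n + 1\<close> is left to tend to infinity.\<close>
  then have "\<forall>n::nat. \<exists>x\<in>B. (real n + 1) * 3 ^ n < nrm x"
    by blast
  then obtain x where xB: "\<And>n. x n \<in> B" and x: "\<And>n. (real n + 1) * 3 ^ n < nrm (x n)"
    by metis
  have xR: "x n \<in> R" and xV: "x n \<in> V" for n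
    using xB B R by blast+
  have pos: "0 < nrm (x n)" for n
    using x[of n] by (rule order_le_less_trans[rotated]) simp
  have "\<exists>f. \<forall>n. f n \<in> R \<and> (nrm (f (Suc n) - f n) \<le> 1 * (1/3) ^ n \<and> (1/3) ^ n * nrm (x n) \<le> cmod (ip (f (Suc n)) (x n)))"
  proof (rule dependent_nat_choice)
    show "\<exists>f. f \<in> R" using R subspace_0 by blast
    fix f n assume f: "f \<in> R"
    define t :: complex where "t = of_real ((1/3) ^ n / nrm (x n))"
    have ct: "cnj t = t" by (simp add: t_def)
    have nt: "nrm (t *c x n) = (1/3) ^ n"
      using pos[of n] xV by (simp add: nrm_scale t_def norm_divide norm_power)
    have fV: "f \<in> V" using f R by blast
    have tx: "ip (t *c x n) (x n) = of_real ((1/3) ^ n * nrm (x n))"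
      using pos[of n] xV by (simp add: ip_scale_left ip_self ct power2_eq_square)
        (simp add: t_def)
    have "cmod (2 * ip (t *c x n) (x n)) = cmod (ip (f + t *c x n) (x n) - ip (f - t *c x n) (x n))"
      using fV xV by (simp add: ip_add_left ip_diff_left)
    also have "\<dots> \<le> cmod (ip (f + t *c x n) (x n)) + cmod (ip (f - t *c x n) (x n))"
      by (rule norm_triangle_ineq4)
    finally have "2 * ((1/3) ^ n * nrm (x n)) \<le> cmod (ip (f + t *c x n) (x n)) + cmod (ip (f - t *c x n) (x n))"
      unfolding tx using pos[of n] by (simp add: norm_mult norm_power norm_divide)
    \<comment> \<open>Two numbers whose sum is at least twice a quantity cannot both lie below it;
      this fixes the sign of the new summand.\<close>
    then consider "(1/3) ^ n * nrm (x n) \<le> cmod (ip (f + t *c x n) (x n))"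
      | "(1/3) ^ n * nrm (x n) \<le> cmod (ip (f - t *c x n) (x n))"
      by linarith
    then show "\<exists>g. g \<in> R \<and> (nrm (g - f) \<le> 1 * (1/3) ^ n \<and> (1/3) ^ n * nrm (x n) \<le> cmod (ip g (x n)))"
    proof cases
      case 1
      then show ?thesis
        using f xR nt R by (intro exI[of _ "f + t *c x n"]) (auto simp: subspace_add subspace_scale)
    next
      case 2
      then show ?thesis
        using f xR xV nt R by (intro exI[of _ "f - t *c x n"])
          (auto simp: subspace_diff subspace_scale nrm_minus)
    qed
  qed
  then obtain f where fR: "\<And>n. f n \<in> R" and inc: "\<And>n. nrm (f (Suc n) - f n) \<le> 1 * (1/3) ^ n"
    and big: "\<And>n. (1/3) ^ n * nrm (x n) \<le> cmod (ip (f (Suc n)) (x n))"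
    by blast
  have fV: "f n \<in> V" for n using fR R by blast
  have geo: "m \<le> n \<Longrightarrow> nrm (f m - f n) \<le> 1 * (1/3) ^ m / (1 - 1/3)" and Cau: "Cauchy_seq f" for m n
    using geometric_increments[OF fV _ _ _ inc] by auto
  obtain h where h: "h \<in> V" "tends f h"
    using complete[of f, OF fV Cau] by (elim bexE) (rule that)
  have hR: "h \<in> R" by (rule closed[of f, OF fR h])
  obtain C where C: "\<And>y. y \<in> B \<Longrightarrow> cmod (ip h y) \<le> C"
    using pointwise[OF hR] by blast
  have lower: "(real n + 1) / 2 \<le> cmod (ip h (x n))" for n
  proof -
    have "tends (\<lambda>k. f (Suc n) - f k) (f (Suc n) - h)"
      using fV h by (intro tends_diff tends_const) auto
    then have "(\<lambda>k. nrm (f (Suc n) - f k)) \<longlonglongrightarrow> nrm (f (Suc n) - h)"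
      using fV h by (intro nrm_tendsto) auto
    moreover have "nrm (f (Suc n) - f k) \<le> (1/3) ^ n / 2" if "k \<ge> Suc n" for k
      using geo[OF that] by simp
    \<comment> \<open>The tail beyond the n-th summand has at most half of its norm. With ratio 1/2
      in place of 1/3 the tail could be as large as the summand and cancel it.\<close>
    ultimately have d: "nrm (f (Suc n) - h) \<le> (1/3) ^ n / 2"
      by (intro LIMSEQ_le_const2) auto
    have "(1/3) ^ n * nrm (x n) \<le> cmod (ip h (x n)) + cmod (ip (f (Suc n) - h) (x n))"
      using big[of n] norm_triangle_ineq[of "ip h (x n)" "ip (f (Suc n) - h) (x n)"] fV h xV
      by (simp add: ip_diff_left)
    also have "cmod (ip (f (Suc n) - h) (x n)) \<le> ((1/3) ^ n / 2) * nrm (x n)"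
      using Cauchy_Schwarz_ip[of "f (Suc n) - h" "x n"] fV h xV d
      by (meson V_diff mult_right_mono nrm_nonneg order_trans)
    finally have "(1/3) ^ n * nrm (x n) / 2 \<le> cmod (ip h (x n))"
      by simp
    moreover have "(1/3) ^ n * ((real n + 1) * 3 ^ n) \<le> (1/3) ^ n * nrm (x n)"
      using x[of n] by (intro mult_left_mono) auto
    moreover have "(1/3) ^ n * ((real n + 1) * 3 ^ n) = real n + 1"
      by (simp add: power_divide)
    ultimately show ?thesis by simp
  qed
  obtain n :: nat where "2 * C < real n"
    using reals_Archimedean2 by blast
  then show False
    using lower[of n] C[OF xB, of n] by simp
qed

text \<open>Each functional cuts the space down to a subspace of codimension at most 1, and on the
  common kernel every vector is null. Adding at most one vector outside the kernel per functional
  yields the spanning set, up to null vectors.\<close>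

lemma finite_span_of_functionals:
  assumes "finite G" "G \<subseteq> V" "subspace W" "W \<subseteq> V"
    and "\<And>u. u \<in> W \<Longrightarrow> (\<And>g. g \<in> G \<Longrightarrow> ip g u = 0) \<Longrightarrow> nrm u = 0"
  shows "\<exists>F. finite F \<and> F \<subseteq> W \<and> (\<forall>u\<in>W. \<exists>v\<in>span F. nrm (u - v) = 0)"
  using assms
proof (induction arbitrary: W rule: finite_induct)
  case empty
  then show ?case by (intro exI[of _ "{}"]) auto
next
  case (insert g G)
  define W0 where "W0 = {u \<in> W. ip g u = 0}"
  have gV: "g \<in> V" using insert by simp
  have "subspace W0"
    using insert.prems(2,3) gV unfolding subspace_def W0_def
    by (auto simp: ip_simps subset_iff)
  moreover have "nrm u = 0" if "u \<in> W0" "\<And>g. g \<in> G \<Longrightarrow> ip g u = 0" for u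
    using that insert.prems(4)[of u] by (auto simp: W0_def)
  ultimately have "\<exists>F. finite F \<and> F \<subseteq> W0 \<and> (\<forall>u\<in>W0. \<exists>v\<in>span F. nrm (u - v) = 0)"
    using insert.prems by (intro insert.IH) (auto simp: W0_def)
  then obtain F where F: "finite F" "F \<subseteq> W0" "\<And>u. u \<in> W0 \<Longrightarrow> \<exists>v\<in>span F. nrm (u - v) = 0"
    by blast
  show ?case
  proof (cases "W0 = W")
    case True
    then show ?thesis using F by blast
  next
    case False
    then obtain w where w: "w \<in> W" "ip g w \<noteq> 0" by (auto simp: W0_def)
    have "\<exists>v\<in>span (insert w F). nrm (u - v) = 0" if u: "u \<in> W" for u
    proof -
      define a where "a = ip g u / ip g w"
      have "ip g (u - a *c w) = 0"
        using gV u w insert.prems by (simp add: a_def ip_simps subset_iff)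
      then have "u - a *c w \<in> W0"
        using u w insert.prems by (simp add: W0_def subspace_diff subspace_scale)
      then obtain v where v: "v \<in> span F" "nrm (u - a *c w - v) = 0"
        using F by blast
      have "a *c w + v \<in> span (insert w F)"
        using v(1) span_mono[of F "insert w F"] by (intro span_add span_scale) (auto intro: span_base)
      then show ?thesis
        using v by (intro bexI[of _ "a *c w + v"]) (auto simp: diff_diff_eq)
    qed
    then show ?thesis
      using F w by (intro exI[of _ "insert w F"]) (auto simp: W0_def)
  qed
qed

lemma ip_span_zero:
  assumes "F \<subseteq> V" "u \<in> V" "\<And>g. g \<in> F \<Longrightarrow> ip g u = 0" "v \<in> span F"
  shows "ip v u = 0"
proof -
  have "subspace {v \<in> V. ip v u = 0}"
    using assms(2) by (auto simp: subspace_def ip_simps)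
  then have "span F \<subseteq> {v \<in> V. ip v u = 0}"
    using assms by (intro span_minimal) auto
  then show ?thesis using assms(4) by blast
qed

text \<open>A bounded inverse of the relation modulo its kernel: every \<open>u\<close> is within
  \<open>C * nrm f\<close> of a kernel element. In this quotient form the notion makes sense for a
  nontrivial kernel, and it is what makes ranges closed.\<close>

definition lifting :: "('h \<times> 'h) set \<Rightarrow> real \<Rightarrow> bool" where
  "lifting \<Gamma> C \<longleftrightarrow> 0 \<le> C \<and> (\<forall>(u, f)\<in>\<Gamma>. \<exists>k. (k, 0) \<in> \<Gamma> \<and> nrm (u - k) \<le> C * nrm f)"

text \<open>Approximants of \<open>f\<close> in the range that converge geometrically have preimages
  that can be corrected, one after the other, by kernel elements so as to converge geometrically
  too; closedness of the relation identifies the limit.\<close>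

lemma closed_range_if_lifting:
  assumes \<Gamma>: "closed_rel \<Gamma>" and lift: "lifting \<Gamma> C"
    and fs: "\<And>n. fs n \<in> Range \<Gamma>" and f: "f \<in> V" "tends fs f"
  shows "f \<in> Range \<Gamma>"
proof -
  note lin = closed_rel_lin[OF \<Gamma>]
  have "C \<ge> 0" using lift by (simp add: lifting_def)
  have fsV: "fs n \<in> V" for n using fs[of n] lin_rel_V[OF lin] by blast
  have "\<exists>m. nrm (fs m - f) < (1/2) ^ n" for n
    using order_tendstoD(2)[OF f(2)[unfolded tends_def], of "(1/2) ^ n"]
    by (auto simp: eventually_sequentially)
  then obtain r where r: "\<And>n. nrm (fs (r n) - f) < (1/2) ^ n"
    by metis
  define g where "g n = fs (r n)" for n
  have gV: "g n \<in> V" for n using fsV by (simp add: g_def)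
  have g_inc: "nrm (g (Suc n) - g n) \<le> 2 * (1/2) ^ n" for n
    using nrm_diff_triangle[of "g (Suc n)" f "g n", OF gV f(1) gV] nrm_minus_commute[of f "g n", OF f(1) gV]
      r[of n, folded g_def] r[of "Suc n", folded g_def] zero_le_power[of "1/2 :: real" n]
    unfolding power_Suc by linarith
  have "\<exists>v. \<forall>n. (v n, g n) \<in> \<Gamma> \<and> nrm (v (Suc n) - v n) \<le> (C * 2) * (1/2) ^ n"
  proof (rule dependent_nat_choice)
    show "\<exists>x. (x, g 0) \<in> \<Gamma>" using fs by (auto simp: g_def)
    fix x n assume x: "(x, g n) \<in> \<Gamma>"
    obtain u where u: "(u, g (Suc n)) \<in> \<Gamma>" using fs by (auto simp: g_def)
    obtain k where k: "(k, 0) \<in> \<Gamma>" "nrm (u - x - k) \<le> C * nrm (g (Suc n) - g n)"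
      using lift lin_rel_diff[OF lin u x] unfolding lifting_def by blast
    have "(u - k, g (Suc n)) \<in> \<Gamma>"
      using lin_rel_diff[OF lin u k(1)] by simp
    moreover have "nrm (u - k - x) \<le> (C * 2) * (1/2) ^ n"
      using k(2) mult_left_mono[OF g_inc[of n] \<open>C \<ge> 0\<close>] by (simp add: algebra_simps)
    ultimately show "\<exists>y. (y, g (Suc n)) \<in> \<Gamma> \<and> nrm (y - x) \<le> (C * 2) * (1/2) ^ n"
      by blast
  qed
  then obtain v where v: "\<And>n. (v n, g n) \<in> \<Gamma>" "\<And>n. nrm (v (Suc n) - v n) \<le> (C * 2) * (1/2) ^ n"
    by blast
  have vV: "v n \<in> V" for n using v(1) lin_rel_V[OF lin] by blast
  have "Cauchy_seq v"
    using geometric_increments(2)[OF vV _ _ _ v(2)] \<open>C \<ge> 0\<close> by simp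
  from complete[of v, OF vV this] obtain w where w: "w \<in> V" "tends v w"
    by (elim bexE) (rule that)
  have "tends g f"
    unfolding tends_def
  proof (rule tendsto_sandwich[OF _ _ tendsto_const])
    show "(\<lambda>n. (1/2::real) ^ n) \<longlonglongrightarrow> 0" by (rule LIMSEQ_power_zero) simp
    show "\<forall>\<^sub>F n in sequentially. nrm (g n - f) \<le> (1/2) ^ n"
      using r by (simp add: g_def less_imp_le)
    show "\<forall>\<^sub>F n in sequentially. 0 \<le> nrm (g n - f)"
      using gV f by simp
  qed
  then have "(w, f) \<in> \<Gamma>"
    by (rule closed_rel_limit[of \<Gamma> v g, OF \<Gamma> v(1) w(1) f(1) w(2)])
  then show ?thesis by blast
qed

text \<open>Induction on the number of functionals. On the kernel of \<open>g\<close> the estimate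
  holds with one functional less, so \<open>\<Gamma>0\<close> lifts. To return to
  \<open>\<Gamma>\<close>, either a kernel vector on which \<open>g\<close> does not vanish removes
  \<open>ip g u\<close> at no cost, or \<open>g\<close> is bounded by the second component and a
  multiple of one fixed pair removes it at controlled cost.\<close>

lemma lifting_if_estimate:
  assumes "finite G" "G \<subseteq> V" "closed_rel \<Gamma>"
    and "\<exists>C. \<forall>(u, f)\<in>\<Gamma>. nrm u \<le> C * (nrm f + (\<Sum>g\<in>G. cmod (ip g u)))"
  shows "\<exists>C. lifting \<Gamma> C"
  using assms
proof (induction arbitrary: \<Gamma> rule: finite_induct)
  case empty
  then obtain C where C: "\<And>u f. (u, f) \<in> \<Gamma> \<Longrightarrow> nrm u \<le> C * nrm f" by auto
  note lin = closed_rel_lin[OF empty(2)]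
  have "nrm u \<le> max C 0 * nrm f" if "(u, f) \<in> \<Gamma>" for u f
    using C[OF that] lin_rel_V(2)[OF lin that] mult_right_mono[of C "max C 0" "nrm f"] by simp
  then have "lifting \<Gamma> (max C 0)"
    unfolding lifting_def using lin_rel_zero[OF lin] by (auto intro!: exI[of _ 0])
  then show ?case by blast
next
  case (insert g G)
  note lin = closed_rel_lin[OF insert.prems(2)]
  have gV: "g \<in> V" using insert by simp
  define \<Gamma>0 where "\<Gamma>0 = {(u, f). (u, f) \<in> \<Gamma> \<and> ip g u = 0}"
  have lin0: "lin_rel \<Gamma>0"
    unfolding lin_rel_def \<Gamma>0_def
    using lin_rel_V[OF lin] lin_rel_zero[OF lin] lin_rel_add[OF lin] lin_rel_scale[OF lin] gV
    by (auto simp: ip_simps)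
  have cl0: "closed_rel \<Gamma>0"
    unfolding closed_rel_def
  proof (intro conjI lin0 allI impI)
    fix us fs u f assume *: "\<forall>n. (us n, fs n) \<in> \<Gamma>0" "u \<in> V" "f \<in> V" "tends us u" "tends fs f"
    have "(u, f) \<in> \<Gamma>"
      using closed_rel_limit[OF insert.prems(2), of us fs] * by (auto simp: \<Gamma>0_def)
    moreover have "(\<lambda>n. ip g (us n)) \<longlonglongrightarrow> ip g u"
      using * gV lin_rel_V[OF lin0] by (intro ip_tendsto_right) blast+
    then have "ip g u = 0"
      using * by (auto simp: \<Gamma>0_def LIMSEQ_const_iff)
    ultimately show "(u, f) \<in> \<Gamma>0" by (simp add: \<Gamma>0_def)
  qed
  obtain C1 where C1: "\<And>u f. (u, f) \<in> \<Gamma> \<Longrightarrow> nrm u \<le> C1 * (nrm f + (\<Sum>g\<in>insert g G. cmod (ip g u)))"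
    using insert.prems(3) by blast
  have "\<forall>(u, f)\<in>\<Gamma>0. nrm u \<le> C1 * (nrm f + (\<Sum>g\<in>G. cmod (ip g u)))"
    using C1 insert.hyps by (fastforce simp: \<Gamma>0_def)
  then obtain C0 where C0: "lifting \<Gamma>0 C0"
    using insert.IH[OF _ cl0] insert.prems(1) by blast
  then have "C0 \<ge> 0" by (simp add: lifting_def)
  have lift0: "\<exists>k. (k, 0) \<in> \<Gamma> \<and> nrm (u - k) \<le> C0 * nrm f" if "(u, f) \<in> \<Gamma>" "ip g u = 0" for u f
    using C0 that unfolding lifting_def \<Gamma>0_def by blast
  show ?case
  proof (cases "\<exists>v. (v, 0) \<in> \<Gamma> \<and> ip g v \<noteq> 0")
    case True
    then obtain v where v: "(v, 0) \<in> \<Gamma>" "ip g v \<noteq> 0" by blast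
    have vV: "v \<in> V" using v lin_rel_V[OF lin] by blast
    have "\<exists>k. (k, 0) \<in> \<Gamma> \<and> nrm (u - k) \<le> C0 * nrm f" if uf: "(u, f) \<in> \<Gamma>" for u f
    proof -
      define a where "a = ip g u / ip g v"
      have av: "(a *c v, 0) \<in> \<Gamma>" using lin_rel_scale[OF lin v(1), of a] by simp
      have uV: "u \<in> V" using uf lin_rel_V[OF lin] by blast
      have "(u - a *c v, f) \<in> \<Gamma>"
        using lin_rel_diff[OF lin uf av] by simp
      moreover have "ip g (u - a *c v) = 0"
        using gV uV vV v(2) by (simp add: a_def ip_simps)
      ultimately obtain k where k: "(k, 0) \<in> \<Gamma>" "nrm (u - a *c v - k) \<le> C0 * nrm f"
        using lift0 by blast
      have "(a *c v + k, 0) \<in> \<Gamma>"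
        using lin_rel_add[OF lin av k(1)] by simp
      then show ?thesis
        using k(2) by (intro exI[of _ "a *c v + k"]) (simp add: diff_diff_eq)
    qed
    then show ?thesis using \<open>C0 \<ge> 0\<close> unfolding lifting_def by blast
  next
    case False
    \<comment> \<open>Otherwise there are pairs with \<open>ip g u = 1\<close> and second components
      tending to 0. Their differences with the first pair lie in \<open>\<Gamma>0\<close>, whose
      range is closed, so the negative of the second component of the first pair is attained in
      \<open>\<Gamma>0\<close>; adding the two pairs gives a kernel vector on which \<open>g\<close>
      is 1.\<close>
    have "\<exists>D. \<forall>(u, f)\<in>\<Gamma>. cmod (ip g u) \<le> D * nrm f"
    proof (rule ccontr)
      assume "\<not> ?thesis"
      then have "\<forall>D. \<exists>u f. (u, f) \<in> \<Gamma> \<and> D * nrm f < cmod (ip g u)"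
        unfolding not_ex Ball_def by (auto simp: not_le)
      then have "\<forall>n::nat. \<exists>u f. (u, f) \<in> \<Gamma> \<and> (real n + 1) * nrm f < cmod (ip g u)"
        by blast
      then obtain u f where uf: "\<And>n. (u n, f n) \<in> \<Gamma>" "\<And>n. (real n + 1) * nrm (f n) < cmod (ip g (u n))"
        by metis
      have V: "u n \<in> V" "f n \<in> V" for n using lin_rel_V[OF lin uf(1)] by blast+
      have nz: "ip g (u n) \<noteq> 0" for n
        using uf(2)[of n] mult_nonneg_nonneg[of "real n + 1" "nrm (f n)"] V by fastforce
      define u' f' where "u' n = (1 / ip g (u n)) *c u n" and "f' n = (1 / ip g (u n)) *c f n" for n
      have uf': "(u' n, f' n) \<in> \<Gamma>" for n
        unfolding u'_def f'_def by (rule lin_rel_scale[OF lin uf(1)])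
      have V': "u' n \<in> V" "f' n \<in> V" for n using lin_rel_V[OF lin uf'] by blast+
      have one: "ip g (u' n) = 1" for n
        using gV V nz by (simp add: u'_def ip_simps)
      have small: "nrm (f' n) \<le> 1 / (real n + 1)" for n
      proof -
        have "nrm (f' n) = nrm (f n) / cmod (ip g (u n))"
          using V by (simp add: f'_def nrm_scale norm_divide)
        also have "\<dots> \<le> 1 / (real n + 1)"
          using uf(2)[of n] nz[of n] by (simp add: field_simps)
        finally show ?thesis .
      qed
      have "tends f' 0"
        unfolding tends_def
      proof (rule tendsto_sandwich[OF _ _ tendsto_const])
        show "(\<lambda>n. 1 / (real n + 1)) \<longlonglongrightarrow> 0"
          using LIMSEQ_inverse_real_of_nat by (simp add: inverse_eq_divide add.commute)
        show "\<forall>\<^sub>F n in sequentially. nrm (f' n - 0) \<le> 1 / (real n + 1)"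
          using small by simp
        show "\<forall>\<^sub>F n in sequentially. 0 \<le> nrm (f' n - 0)"
          using V' by simp
      qed
      then have t: "tends (\<lambda>n. f' n - f' 0) (0 - f' 0)"
        using V' by (intro tends_diff tends_const) auto
      have "0 - f' 0 \<in> Range \<Gamma>0"
      proof (rule closed_range_if_lifting[OF cl0 C0 _ _ t])
        have "(u' n - u' 0, f' n - f' 0) \<in> \<Gamma>0" for n
          using lin_rel_diff[OF lin uf' uf'] one gV V' by (simp add: \<Gamma>0_def ip_simps)
        then show "f' n - f' 0 \<in> Range \<Gamma>0" for n by blast
        show "0 - f' 0 \<in> V" using V' by simp
      qed
      then obtain w where w: "(w, - f' 0) \<in> \<Gamma>" "ip g w = 0" by (auto simp: \<Gamma>0_def)
      have "(u' 0 + w, 0) \<in> \<Gamma>"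
        using lin_rel_add[OF lin uf'[of 0] w(1)] by simp
      moreover have "ip g (u' 0 + w) = 1"
        using one w gV V' lin_rel_V[OF lin w(1)] by (simp add: ip_simps)
      ultimately show False using False by force
    qed
    then obtain D where D: "\<And>u f. (u, f) \<in> \<Gamma> \<Longrightarrow> cmod (ip g u) \<le> D * nrm f" by blast
    show ?thesis
    proof (cases "\<exists>u f. (u, f) \<in> \<Gamma> \<and> ip g u \<noteq> 0")
      case True
      then obtain u1 f1 where uf1: "(u1, f1) \<in> \<Gamma>" "ip g u1 \<noteq> 0" by blast
      have V1: "u1 \<in> V" "f1 \<in> V" using lin_rel_V[OF lin uf1(1)] by blast+
      define E where "E = D / cmod (ip g u1)"
      define C where "C = C0 * (1 + E * nrm f1) + E * nrm u1"
      have lift: "\<exists>k. (k, 0) \<in> \<Gamma> \<and> nrm (u - k) \<le> C * nrm f" if uf: "(u, f) \<in> \<Gamma>" for u f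
      proof -
        define a where "a = ip g u / ip g u1"
        have uV: "u \<in> V" "f \<in> V" using lin_rel_V[OF lin uf] by blast+
        have a: "cmod a \<le> E * nrm f"
          using D[OF uf] uf1(2) by (simp add: a_def E_def norm_divide field_simps)
        have "(u - a *c u1, f - a *c f1) \<in> \<Gamma>"
          using lin_rel_diff[OF lin uf lin_rel_scale[OF lin uf1(1)]] by simp
        moreover have "ip g (u - a *c u1) = 0"
          using gV uV V1 uf1(2) by (simp add: a_def ip_simps)
        ultimately obtain k where k: "(k, 0) \<in> \<Gamma>" "nrm (u - a *c u1 - k) \<le> C0 * nrm (f - a *c f1)"
          using lift0 by blast
        have kV: "k \<in> V" using lin_rel_V[OF lin k(1)] by blast
        have "nrm (u - k) = nrm ((u - a *c u1 - k) + a *c u1)"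
          by (simp add: algebra_simps)
        also have "\<dots> \<le> nrm (u - a *c u1 - k) + cmod a * nrm u1"
          using nrm_triangle[of "u - a *c u1 - k" "a *c u1"] uV V1 kV by (simp add: nrm_scale)
        also have "nrm (u - a *c u1 - k) \<le> C0 * nrm (f - a *c f1)" by (rule k)
        also have "nrm (f - a *c f1) \<le> nrm f + cmod a * nrm f1"
          using nrm_triangle_diff[of f "a *c f1"] uV V1 by (simp add: nrm_scale)
        also have "cmod a * nrm f1 \<le> E * nrm f * nrm f1"
          using a V1 by (intro mult_right_mono) auto
        also have "cmod a * nrm u1 \<le> E * nrm f * nrm u1"
          using a V1 by (intro mult_right_mono) auto
        finally have "nrm (u - k) \<le> C0 * (nrm f + E * nrm f * nrm f1) + E * nrm f * nrm u1"
          using mult_left_mono[OF _ \<open>C0 \<ge> 0\<close>] by simp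
        then have "nrm (u - k) \<le> C * nrm f"
          by (simp add: C_def algebra_simps)
        then show ?thesis using k by blast
      qed
      \<comment> \<open>No sign is known for \<open>D\<close>, hence none for
        \<open>C\<close>.\<close>
      have "\<exists>k. (k, 0) \<in> \<Gamma> \<and> nrm (u - k) \<le> max C 0 * nrm f" if uf: "(u, f) \<in> \<Gamma>" for u f
      proof -
        have "C * nrm f \<le> max C 0 * nrm f"
          using lin_rel_V[OF lin uf] by (intro mult_right_mono) auto
        then show ?thesis using lift[OF uf] by (meson order_trans)
      qed
      then have "lifting \<Gamma> (max C 0)"
        unfolding lifting_def by auto
      then show ?thesis by blast
    next
      case False
      then have "\<Gamma>0 = \<Gamma>" by (auto simp: \<Gamma>0_def)
      then show ?thesis using C0 by blast
    qed
  qed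
qed

text \<open>An estimate on the common kernel of the functionals extends to all pairs: a pair
  \<open>(v, h)\<close> with \<open>ip g v \<noteq> 0\<close> absorbs the component detected by
  \<open>g\<close>, and its norms enter the constant \<open>E\<close>. If there is no such pair,
  \<open>g\<close> vanishes on the domain.\<close>

lemma estimate_from_kernel:
  assumes "finite G" "G \<subseteq> V" "lin_rel \<Gamma>"
    and "\<exists>C. \<forall>(u, f)\<in>\<Gamma>. (\<forall>g\<in>G. ip g u = 0) \<longrightarrow> nrm u \<le> C * nrm f"
  shows "\<exists>C\<ge>0. \<forall>(u, f)\<in>\<Gamma>. nrm u \<le> C * (nrm f + (\<Sum>g\<in>G. cmod (ip g u)))"
  using assms
proof (induction arbitrary: \<Gamma> rule: finite_induct)
  case empty
  then obtain C where C: "\<And>u f. (u, f) \<in> \<Gamma> \<Longrightarrow> nrm u \<le> C * nrm f" by auto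
  have "nrm u \<le> max C 0 * nrm f" if "(u, f) \<in> \<Gamma>" for u f
    using C[OF that] lin_rel_V(2)[OF empty(2) that] mult_right_mono[of C "max C 0" "nrm f"] by simp
  then show ?case by (intro exI[of _ "max C 0"]) auto
next
  case (insert g G)
  note lin = insert.prems(2)
  have gV: "g \<in> V" using insert by simp
  define \<Gamma>0 where "\<Gamma>0 = {(u, f). (u, f) \<in> \<Gamma> \<and> ip g u = 0}"
  have lin0: "lin_rel \<Gamma>0"
    unfolding lin_rel_def \<Gamma>0_def
    using lin_rel_V[OF lin] lin_rel_zero[OF lin] lin_rel_add[OF lin] lin_rel_scale[OF lin] gV
    by (auto simp: ip_simps)
  have "\<exists>C. \<forall>(u, f)\<in>\<Gamma>0. (\<forall>g\<in>G. ip g u = 0) \<longrightarrow> nrm u \<le> C * nrm f"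
    using insert.prems(3) by (auto simp: \<Gamma>0_def)
  then obtain C where C: "C \<ge> 0"
    "\<And>u f. (u, f) \<in> \<Gamma> \<Longrightarrow> ip g u = 0 \<Longrightarrow> nrm u \<le> C * (nrm f + (\<Sum>g\<in>G. cmod (ip g u)))"
    using insert.IH[OF _ lin0] insert.prems(1) by (auto simp: \<Gamma>0_def)
  show ?case
  proof (cases "\<exists>v h. (v, h) \<in> \<Gamma> \<and> ip g v \<noteq> 0")
    case True
    then obtain v h where v: "(v, h) \<in> \<Gamma>" "ip g v \<noteq> 0" by blast
    have vV: "v \<in> V" "h \<in> V" using v lin_rel_V[OF lin] by blast+
    define c where "c = 1 / cmod (ip g v)"
    have c: "c \<ge> 0" by (simp add: c_def)
    define E where "E = C * c * nrm h + C * c * (\<Sum>g'\<in>G. cmod (ip g' v)) + c * nrm v"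
    have "E \<ge> 0"
      unfolding E_def using C(1) c vV by (intro add_nonneg_nonneg mult_nonneg_nonneg sum_nonneg) auto
    have "nrm u \<le> (C + E) * (nrm f + (\<Sum>g\<in>insert g G. cmod (ip g u)))" if uf: "(u, f) \<in> \<Gamma>" for u f
    proof -
      define a where "a = ip g u / ip g v"
      have uV: "u \<in> V" "f \<in> V" using uf lin_rel_V[OF lin] by blast+
      have a: "cmod a = c * cmod (ip g u)" by (simp add: a_def c_def norm_divide)
      have "nrm (u - a *c v) \<le> C * (nrm (f - a *c h) + (\<Sum>g'\<in>G. cmod (ip g' (u - a *c v))))"
        using gV uV vV v(2) by (intro C lin_rel_diff[OF lin] lin_rel_scale[OF lin] uf v)
          (simp add: a_def ip_simps)
      also have "nrm (f - a *c h) \<le> nrm f + cmod a * nrm h"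
        using nrm_triangle_diff[of f "a *c h"] uV vV by (simp add: nrm_scale)
      also have "(\<Sum>g'\<in>G. cmod (ip g' (u - a *c v))) \<le> (\<Sum>g'\<in>G. cmod (ip g' u) + cmod a * cmod (ip g' v))"
      proof (rule sum_mono)
        fix g' assume "g' \<in> G"
        then have "g' \<in> V" using insert.prems by auto
        then have "ip g' (u - a *c v) = ip g' u - a * ip g' v" using uV vV by (simp add: ip_simps)
        then show "cmod (ip g' (u - a *c v)) \<le> cmod (ip g' u) + cmod a * cmod (ip g' v)"
          using norm_triangle_ineq4[of "ip g' u" "a * ip g' v"] by (simp add: norm_mult)
      qed
      also have "\<dots> = (\<Sum>g'\<in>G. cmod (ip g' u)) + cmod a * (\<Sum>g'\<in>G. cmod (ip g' v))"
        by (simp add: sum.distrib sum_distrib_left)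
      finally have 1: "nrm (u - a *c v) \<le> C * (nrm f + cmod a * nrm h
          + ((\<Sum>g'\<in>G. cmod (ip g' u)) + cmod a * (\<Sum>g'\<in>G. cmod (ip g' v))))"
        using C(1) by (simp add: mult_left_mono)
      have "nrm u \<le> nrm (u - a *c v) + cmod a * nrm v"
        using nrm_triangle[of "u - a *c v" "a *c v"] uV vV by (simp add: nrm_scale)
      also have "\<dots> \<le> C * (nrm f + (\<Sum>g'\<in>G. cmod (ip g' u))) + E * cmod (ip g u)"
        using 1 unfolding E_def a by (simp add: algebra_simps)
      also have "\<dots> \<le> (C + E) * (nrm f + (\<Sum>g\<in>insert g G. cmod (ip g u)))"
      proof -
        have s: "0 \<le> nrm f" "0 \<le> (\<Sum>g'\<in>G. cmod (ip g' u))" using uV by (auto intro: sum_nonneg)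
        have "0 \<le> E * (nrm f + (\<Sum>g'\<in>G. cmod (ip g' u))) + C * cmod (ip g u)"
          using \<open>E \<ge> 0\<close> C(1) s by (intro add_nonneg_nonneg mult_nonneg_nonneg) auto
        then show ?thesis
          using insert.hyps by (simp add: algebra_simps)
      qed
      finally show ?thesis .
    qed
    then show ?thesis using C(1) \<open>E \<ge> 0\<close> by (intro exI[of _ "C + E"]) auto
  next
    case False
    then have "nrm u \<le> C * (nrm f + (\<Sum>g\<in>insert g G. cmod (ip g u)))" if "(u, f) \<in> \<Gamma>" for u f
      using C(2)[OF that] that insert.hyps by force
    then show ?thesis using C(1) by blast
  qed
qed

end

text \<open>A symmetric relation for which \<open>1 + S\<close> is onto is self-adjoint. This form
  of self-adjointness is the one that the Riesz representation delivers for operators defined by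
  forms, and it is stated without adjoints.\<close>

locale selfadjoint_relation = complete_semi_inner scale V ip
  for scale :: "complex \<Rightarrow> 'h::ab_group_add \<Rightarrow> 'h" (infixr \<open>*c\<close> 75) and V ip +
  fixes S :: "('h \<times> 'h) set"
  assumes closed_S: "closed_rel S"
    and symmetric: "(u, f) \<in> S \<Longrightarrow> (v, g) \<in> S \<Longrightarrow> ip u g = ip f v"
    and onto: "h \<in> V \<Longrightarrow> \<exists>u. (u, h - u) \<in> S"
begin

lemmas lin_S = closed_rel_lin[OF closed_S]
lemmas S_V = lin_rel_V[OF lin_S]

definition shift :: "complex \<Rightarrow> ('h \<times> 'h) set" where
  "shift z = {(u, f - z *c u) | u f. (u, f) \<in> S}"

definition eigenspace :: "complex \<Rightarrow> 'h set" where
  "eigenspace z = {u. (u, z *c u) \<in> S}"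

definition estimate :: "complex \<Rightarrow> bool" where
  "estimate z \<longleftrightarrow> (\<exists>C G. 0 \<le> C \<and> finite G \<and> G \<subseteq> V \<and>
     (\<forall>(u, f)\<in>S. nrm u \<le> C * (nrm (f - z *c u) + (\<Sum>g\<in>G. cmod (ip g u)))))"

definition closed_range :: "complex \<Rightarrow> bool" where
  "closed_range z \<longleftrightarrow>
     (\<forall>fs f. (\<forall>n. fs n \<in> Range (shift z)) \<and> f \<in> V \<and> tends fs f \<longrightarrow> f \<in> Range (shift z))"

definition fredholm :: "complex \<Rightarrow> bool" where
  "fredholm z \<longleftrightarrow>
     (\<exists>F. finite F \<and> F \<subseteq> eigenspace z \<and> (\<forall>u\<in>eigenspace z. \<exists>v\<in>span F. nrm (u - v) = 0)) \<and>
     closed_range z \<and>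
     (\<exists>F. finite F \<and> F \<subseteq> V \<and> (\<forall>x\<in>V. \<exists>r\<in>Range (shift z). \<exists>v\<in>span F. nrm (x - (r + v)) = 0))"

lemma shiftI: "(u, f) \<in> S \<Longrightarrow> (u, f - z *c u) \<in> shift z"
  by (auto simp: shift_def)

lemma shift_iff: "(u, h) \<in> shift z \<longleftrightarrow> (u, h + z *c u) \<in> S"
  by (force simp: shift_def)

lemma closed_shift: "closed_rel (shift z)"
  unfolding closed_rel_def
proof (intro conjI allI impI)
  show lin: "lin_rel (shift z)"
    unfolding lin_rel_def
  proof (intro conjI allI impI)
    show "shift z \<subseteq> V \<times> V"
      using S_V by (auto simp: shift_def)
    show "(0, 0) \<in> shift z"
      using lin_rel_zero[OF lin_S] by (simp add: shift_iff)
    fix u f assume u: "(u, f) \<in> shift z"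
    show "(u + v, f + g) \<in> shift z" if "(v, g) \<in> shift z" for v g
      using u that lin_rel_add[OF lin_S, of u "f + z *c u" v "g + z *c v"]
      by (simp add: shift_iff algebra_simps)
    show "(a *c u, a *c f) \<in> shift z" for a
      using u lin_rel_scale[OF lin_S, of u "f + z *c u" a]
      by (simp add: shift_iff scale_right_distrib mult.commute)
  qed
  fix us fs u f
  assume *: "\<forall>n. (us n, fs n) \<in> shift z" "u \<in> V" "f \<in> V" "tends us u" "tends fs f"
  have V: "us n \<in> V" "fs n \<in> V" for n
    using * lin_rel_V[OF lin] by blast+
  have "tends (\<lambda>n. z *c us n) (z *c u)"
    by (rule tends_scale[OF V(1) *(2,4)])
  then have "tends (\<lambda>n. fs n + z *c us n) (f + z *c u)"
    by (rule tends_add[OF V(2) *(3) V_scale[OF V(1)] V_scale[OF *(2)] *(5)])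
  moreover have "(us n, fs n + z *c us n) \<in> S" for n
    using *(1) by (simp add: shift_iff)
  ultimately show "(u, f) \<in> shift z"
    unfolding shift_iff using *
    by - (rule closed_rel_limit[of S us "\<lambda>n. fs n + z *c us n", OF closed_S], simp_all)
qed

lemmas lin_shift = closed_rel_lin[OF closed_shift]
lemmas shift_V = lin_rel_V[OF lin_shift]

lemma subspace_range: "subspace (Range (shift z))"
  using lin_rel_zero[OF lin_shift, of z] lin_rel_add[OF lin_shift, of _ _ z] lin_rel_scale[OF lin_shift, of _ _ z]
  unfolding subspace_def by (auto simp: Range_iff) blast+

lemma range_subset: "Range (shift z) \<subseteq> V"
  using shift_V by blast

lemma eigenspace_iff: "u \<in> eigenspace z \<longleftrightarrow> (u, 0) \<in> shift z"
  by (simp add: eigenspace_def shift_iff)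

lemma subspace_eigenspace: "subspace (eigenspace z)"
  using lin_rel_zero[OF lin_shift, of z] lin_rel_add[OF lin_shift, of _ 0 z _ 0] lin_rel_scale[OF lin_shift, of _ 0 z]
  unfolding subspace_def by (auto simp: eigenspace_iff)

lemma eigenspace_subset: "eigenspace z \<subseteq> V"
  using shift_V by (auto simp: eigenspace_iff)

text \<open>The vector \<open>g\<close> is not known to be in the domain. Solving
  \<open>(1 + S) v = (1 + cnj z) g\<close> produces a vector of the domain with the same scalar
  products as \<open>g\<close> against every \<open>h\<close>, because \<open>h\<close> is itself of
  the form \<open>(1 + S) u\<close>; hence \<open>g\<close> and \<open>v\<close> differ by a null
  vector.\<close>

lemma orthogonal_range:
  assumes g: "g \<in> V" and orth: "\<And>h. h \<in> Range (shift z) \<Longrightarrow> ip g h = 0"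
  shows "g \<in> eigenspace (cnj z)"
proof -
  define k where "k = (1 + cnj z) *c g"
  have kV: "k \<in> V" using g by (simp add: k_def)
  obtain v where v: "(v, k - v) \<in> S" using onto[OF kV] by blast
  have vV: "v \<in> V" using S_V[OF v] by blast
  have "ip (g - v) h = 0" if h: "h \<in> V" for h
  proof -
    obtain u where u: "(u, h - u) \<in> S" using onto[OF h] by blast
    have uV: "u \<in> V" using S_V[OF u] by blast
    have "ip g (h - u - z *c u) = 0"
      using orth shiftI[OF u] by blast
    then have "ip g h = (1 + z) * ip g u"
      using g h uV by (simp add: ip_simps algebra_simps)
    also have "\<dots> = ip k u"
      using g uV by (simp add: k_def ip_scale_left)
    also have "\<dots> = ip (k - v) u + ip v u"
      using kV vV uV by (simp add: ip_simps)
    also have "ip (k - v) u = ip v (h - u)"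
      using symmetric[OF v u] by simp
    also have "ip v (h - u) + ip v u = ip v h"
      using h vV uV by (simp add: ip_simps)
    finally show ?thesis
      using g vV h by (simp add: ip_simps)
  qed
  from this[of "g - v"] have n: "nrm (g - v) = 0"
    using g vV by (simp add: nrm_def)
  have "(g, cnj z *c g) \<in> S"
  proof (rule closed_rel_null[OF closed_S v])
    show "nrm (v - g) = 0" using n nrm_minus_commute[OF g vV] by simp
    show "nrm (k - v - cnj z *c g) = 0"
      using n by (simp add: k_def scale_left_distrib)
  qed (use g in auto)
  then show ?thesis by (simp add: eigenspace_def)
qed

text \<open>The minimising sequence converges by completeness, and closedness of the range keeps the
  limit in it; the remainder is orthogonal to the range and so an eigenvector for the conjugate
  number.\<close>

lemma project_range:
  assumes closed: "closed_range z" and x: "x \<in> V"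
  obtains r where "r \<in> Range (shift z)" "x - r \<in> eigenspace (cnj z)"
    "\<And>y. y \<in> Range (shift z) \<Longrightarrow> ip (x - r) y = 0"
proof -
  obtain m d where m: "\<And>n. m n \<in> Range (shift z)" "Cauchy_seq m" "d \<longlonglongrightarrow> 0"
    "\<And>n y. y \<in> Range (shift z) \<Longrightarrow> cmod (ip (x - m n) y) \<le> d n * nrm y"
    using approximate_projection[OF subspace_range range_subset x] by blast
  have mV: "m n \<in> V" for n using m range_subset by blast
  obtain r where r: "r \<in> V" "tends m r"
    using complete[of m, OF mV m(2)] by (elim bexE) (rule that)
  have orth: "ip (x - r) y = 0" if y: "y \<in> Range (shift z)" for y
  proof -
    have yV: "y \<in> V" using y range_subset by blast
    have "(\<lambda>n. ip (x - m n) y) \<longlonglongrightarrow> ip (x - r) y"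
      using x mV r yV by (intro ip_tendsto_left tends_diff tends_const) auto
    moreover have "(\<lambda>n. ip (x - m n) y) \<longlonglongrightarrow> 0"
    proof (rule Lim_null_comparison)
      show "\<forall>\<^sub>F n in sequentially. cmod (ip (x - m n) y) \<le> d n * nrm y"
        using m(4)[OF y] by simp
      show "(\<lambda>n. d n * nrm y) \<longlonglongrightarrow> 0"
        by (rule tendsto_mult_left_zero[OF m(3)])
    qed
    ultimately show ?thesis by (rule LIMSEQ_unique)
  qed
  show ?thesis
  proof (rule that)
    show "r \<in> Range (shift z)" using closed m(1) r unfolding closed_range_def by blast
    show "x - r \<in> eigenspace (cnj z)"
      using x r(1) orth by (intro orthogonal_range) auto
  qed (rule orth)
qed

lemma finite_eigenspace:
  assumes "estimate z"
  shows "\<exists>F. finite F \<and> F \<subseteq> eigenspace z \<and> (\<forall>u\<in>eigenspace z. \<exists>v\<in>span F. nrm (u - v) = 0)"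
proof -
  obtain C G where G: "finite G" "G \<subseteq> V"
    and C: "\<And>u f. (u, f) \<in> S \<Longrightarrow> nrm u \<le> C * (nrm (f - z *c u) + (\<Sum>g\<in>G. cmod (ip g u)))"
    using assms unfolding estimate_def by blast
  have "nrm u = 0" if u: "u \<in> eigenspace z" and g: "\<And>g. g \<in> G \<Longrightarrow> ip g u = 0" for u
  proof -
    have "nrm u \<le> 0"
      using C[of u "z *c u"] u g by (simp add: eigenspace_def)
    moreover have "u \<in> V" using eigenspace_subset u by blast
    ultimately show ?thesis using nrm_nonneg[of u] by linarith
  qed
  then show ?thesis
    using G by (intro finite_span_of_functionals subspace_eigenspace eigenspace_subset) auto
qed

text \<open>The estimate for \<open>z\<close> gives closed range and finite-dimensional kernel, the
  one for \<open>cnj z\<close> a finite-dimensional orthogonal complement of the range.\<close>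

lemma fredholm_if_estimate:
  assumes z: "estimate z" and cz: "estimate (cnj z)"
  shows "fredholm z"
proof -
  obtain C G where G: "finite G" "G \<subseteq> V"
    and C: "\<And>u f. (u, f) \<in> S \<Longrightarrow> nrm u \<le> C * (nrm (f - z *c u) + (\<Sum>g\<in>G. cmod (ip g u)))"
    using z unfolding estimate_def by blast
  have "\<forall>(u, f)\<in>shift z. nrm u \<le> C * (nrm f + (\<Sum>g\<in>G. cmod (ip g u)))"
    using C by (auto simp: shift_def)
  then obtain C' where "lifting (shift z) C'"
    using lifting_if_estimate[OF G closed_shift] by blast
  then have closed: "closed_range z"
    unfolding closed_range_def using closed_range_if_lifting[OF closed_shift] by metis
  obtain F where F: "finite F" "F \<subseteq> eigenspace (cnj z)"
    "\<And>u. u \<in> eigenspace (cnj z) \<Longrightarrow> \<exists>v\<in>span F. nrm (u - v) = 0"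
    using finite_eigenspace[OF cz] by blast
  have "\<exists>r\<in>Range (shift z). \<exists>v\<in>span F. nrm (x - (r + v)) = 0" if x: "x \<in> V" for x
  proof -
    obtain r where r: "r \<in> Range (shift z)" "x - r \<in> eigenspace (cnj z)"
      using project_range[OF closed x] by blast
    then show ?thesis using F(3)[OF r(2)] by (auto simp: diff_diff_eq)
  qed
  moreover have "F \<subseteq> V" using F(2) eigenspace_subset by blast
  ultimately have "\<exists>F. finite F \<and> F \<subseteq> V \<and> (\<forall>x\<in>V. \<exists>r\<in>Range (shift z). \<exists>v\<in>span F. nrm (x - (r + v)) = 0)"
    using F(1) by (intro exI[of _ F]) simp
  then show ?thesis
    unfolding fredholm_def using finite_eigenspace[OF z] closed by (intro conjI)
qed

text \<open>On its closed range the operator \<open>S - z\<close> is bounded below: \<open>B\<close>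
  consists of the range vectors with image in the unit ball, and symmetry bounds the pairing of
  \<open>B\<close> with any range vector by the norm of a preimage of the latter. Uniform
  boundedness takes the place of the open mapping theorem.\<close>

lemma estimate_if_fredholm:
  assumes real: "cnj z = z" and fred: "fredholm z"
  shows "estimate z"
proof -
  let ?R = "Range (shift z)"
  obtain F where F: "finite F" "F \<subseteq> eigenspace z"
    "\<And>u. u \<in> eigenspace z \<Longrightarrow> \<exists>v\<in>span F. nrm (u - v) = 0"
    using fred[unfolded fredholm_def, THEN conjunct1] by blast
  have closed: "closed_range z"
    using fred[unfolded fredholm_def, THEN conjunct2, THEN conjunct1] .
  have FV: "F \<subseteq> V" using F(2) eigenspace_subset by blast
  define B where "B = {x \<in> ?R. \<exists>h. (x, h) \<in> shift z \<and> nrm h \<le> 1}"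
  have "\<exists>C. \<forall>x\<in>B. nrm x \<le> C"
  proof (rule uniform_boundedness[OF subspace_range range_subset])
    show "y \<in> ?R" if "\<And>n. X n \<in> ?R" "y \<in> V" "tends X y" for X y
      using closed that unfolding closed_range_def by blast
    show "B \<subseteq> ?R" by (auto simp: B_def)
    fix y assume "y \<in> ?R"
    then obtain u0 where u0: "(u0, y) \<in> shift z" by blast
    have V0: "u0 \<in> V" "y \<in> V" using shift_V[OF u0] by blast+
    have "cmod (ip y x) \<le> nrm u0" if "x \<in> B" for x
    proof -
      obtain h where h: "(x, h) \<in> shift z" "nrm h \<le> 1"
        using \<open>x \<in> B\<close> unfolding B_def by blast
      have V: "x \<in> V" "h \<in> V" using shift_V[OF h(1)] by blast+
      have "ip u0 (h + z *c x) = ip (y + z *c u0) x"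
        using symmetric u0 h(1) by (simp add: shift_iff)
      then have "ip y x = ip u0 h"
        using V V0 real by (simp add: ip_simps)
      also have "cmod \<dots> \<le> nrm u0 * nrm h"
        by (rule Cauchy_Schwarz_ip[OF V0(1) V(2)])
      also have "\<dots> \<le> nrm u0"
        using h(2) V0 mult_left_mono[of "nrm h" 1 "nrm u0"] by simp
      finally show ?thesis .
    qed
    then show "\<exists>C. \<forall>x\<in>B. cmod (ip y x) \<le> C" by blast
  qed
  then obtain C where C: "\<And>x. x \<in> B \<Longrightarrow> nrm x \<le> C" by blast
  have "0 \<in> B"
    using lin_rel_zero[OF lin_shift, of z] by (auto simp: B_def)
  then have "C \<ge> 0" using C by fastforce
  have bound: "nrm x \<le> C * nrm h" if x: "x \<in> ?R" and h: "(x, h) \<in> shift z" for x h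
  proof -
    have V: "x \<in> V" "h \<in> V" using shift_V[OF h] by blast+
    \<comment> \<open>The added \<open>e\<close> permits normalisation when \<open>h\<close> is
      null.\<close>
    have "nrm x \<le> C * (nrm h + e)" if e: "e > 0" for e
    proof -
      define s where "s = 1 / (nrm h + e)"
      have hs: "nrm h + e > 0" using e V by (simp add: add_nonneg_pos)
      have s: "s > 0" using hs by (simp add: s_def)
      have "nrm (of_real s *c h) \<le> 1"
        using V s hs e by (simp add: nrm_scale) (simp add: s_def)
      then have "of_real s *c x \<in> B"
        using x lin_rel_scale[OF lin_shift h, of "of_real s"] subspace_scale[OF subspace_range x]
        by (auto simp: B_def)
      from C[OF this] have "s * nrm x \<le> C"
        using V s by (simp add: nrm_scale)
      then show ?thesis using hs by (simp add: s_def field_simps)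
    qed
    then have "nrm x \<le> C * nrm h + C * e" if "e > 0" for e
      using that by (simp only: distrib_left[symmetric])
    note * = this
    show ?thesis
    proof (rule field_le_epsilon)
      fix e :: real assume "e > 0"
      then show "nrm x \<le> C * nrm h + e"
        using *[of "e / (C + 1)"] \<open>C \<ge> 0\<close> mult_right_mono[of C "C + 1" "e / (C + 1)"]
        by (simp add: add_nonneg_pos)
    qed
  qed
  have "nrm u \<le> C * nrm f" if uf: "(u, f) \<in> shift z" and orth: "\<And>g. g \<in> F \<Longrightarrow> ip g u = 0" for u f
  proof -
    have V: "u \<in> V" "f \<in> V" using shift_V[OF uf] by blast+
    \<comment> \<open>The remainder \<open>k = u - m\<close> is a kernel vector orthogonal to
      \<open>m\<close>. It is also orthogonal to \<open>u\<close>, because \<open>F\<close> spans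
      the kernel up to null vectors and is orthogonal to \<open>u\<close>; so \<open>k\<close> is
      null.\<close>
    obtain m where m: "m \<in> ?R" "u - m \<in> eigenspace (cnj z)" "\<And>y. y \<in> ?R \<Longrightarrow> ip (u - m) y = 0"
      using project_range[OF closed V(1)] by blast
    define k where "k = u - m"
    have mV: "m \<in> V" using m(1) range_subset by blast
    have kV: "k \<in> V" using V mV by (simp add: k_def)
    have kz: "(k, 0) \<in> shift z" using m(2) real by (simp add: k_def eigenspace_iff)
    have mf: "(m, f) \<in> shift z"
      using lin_rel_diff[OF lin_shift uf kz] by (simp add: k_def)
    obtain v where v: "v \<in> span F" "nrm (k - v) = 0"
      using F(3) kz by (auto simp: eigenspace_iff)
    have vV: "v \<in> V" using span_minimal[OF FV subspace_V] v by blast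
    have "ip v u = 0"
      by (rule ip_span_zero[OF FV V(1) orth v(1)])
    then have "ip k u = 0"
      using ip_null_left[of "k - v" u] kV vV V v(2) by (simp add: ip_diff_left)
    moreover have "ip k m = 0" using m(1,3) by (simp add: k_def)
    ultimately have "ip k k = 0"
      using ip_diff_right[of k u m] kV V mV by (simp add: k_def)
    then have "nrm (u - m) = 0" by (simp add: nrm_def k_def)
    then have "nrm u = nrm m" by (rule nrm_eq_cong[OF V(1) mV])
    then show ?thesis using bound[OF m(1) mf] by simp
  qed
  then have "\<exists>C. \<forall>(u, f)\<in>shift z. (\<forall>g\<in>F. ip g u = 0) \<longrightarrow> nrm u \<le> C * nrm f" by blast
  then obtain C' where "C' \<ge> 0" "\<And>u f. (u, f) \<in> shift z \<Longrightarrow> nrm u \<le> C' * (nrm f + (\<Sum>g\<in>F. cmod (ip g u)))"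
    using estimate_from_kernel[OF F(1) FV lin_shift] by blast
  then show ?thesis
    unfolding estimate_def using F(1) FV shiftI by (intro exI[of _ C'] exI[of _ F]) blast
qed

text \<open>By symmetry \<open>ip u f\<close> is real, so the imaginary part of
  \<open>ip u (f - z *c u)\<close> is \<open>- Im z * (nrm u)\<^sup>2\<close>.\<close>

lemma estimate_if_not_real:
  assumes "Im z \<noteq> 0"
  shows "estimate z"
proof -
  have "nrm u \<le> (1 / \<bar>Im z\<bar>) * nrm (f - z *c u)" if uf: "(u, f) \<in> S" for u f
  proof -
    have V: "u \<in> V" "f \<in> V" using S_V[OF uf] by blast+
    have "Im (ip u f) = 0"
      using symmetric[OF uf uf] cnj_ip[OF V] by (simp add: complex_eq_iff)
    then have "\<bar>Im z\<bar> * (nrm u)\<^sup>2 = \<bar>Im (ip u (f - z *c u))\<bar>"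
      using V by (simp add: ip_simps ip_self abs_mult)
    also have "\<dots> \<le> nrm u * nrm (f - z *c u)"
      using Cauchy_Schwarz_ip[of u "f - z *c u"] abs_Im_le_cmod[of "ip u (f - z *c u)"] V by simp
    finally have "nrm u * (\<bar>Im z\<bar> * nrm u) \<le> nrm u * nrm (f - z *c u)"
      by (simp add: power2_eq_square algebra_simps)
    then have "\<bar>Im z\<bar> * nrm u \<le> nrm (f - z *c u)"
      using V nrm_nonneg[of u] nrm_nonneg[of "f - z *c u"] by (cases "nrm u = 0") (auto simp: mult_le_cancel_left less_le)
    then show ?thesis using assms by (simp add: field_simps)
  qed
  then show ?thesis
    unfolding estimate_def by (intro exI[of _ "1 / \<bar>Im z\<bar>"] exI[of _ "{}"]) auto
qed

end

section \<open>Operators defined by forms\<close>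

text \<open>Completeness is asked of the first space; in the second, limits are asked for along
  images of core sequences. In a completion by Cauchy sequences these images are constant sequences,
  and their limits are immediate.\<close>

locale form_core = H: complete_semi_inner sH VH ipH + K: semi_inner sK VK ipK
  for sH :: "complex \<Rightarrow> 'h::ab_group_add \<Rightarrow> 'h" and VH ipH
    and sK :: "complex \<Rightarrow> 'k::ab_group_add \<Rightarrow> 'k" and VK ipK +
  fixes D :: "'h set" and d :: "'h \<Rightarrow> 'k"
  assumes D_sub: "D \<subseteq> VH" and D_subspace: "H.subspace D"
    and d_VK: "u \<in> D \<Longrightarrow> d u \<in> VK"
    and d_add: "u \<in> D \<Longrightarrow> v \<in> D \<Longrightarrow> d (u + v) = d u + d v"
    and d_scale: "u \<in> D \<Longrightarrow> d (sH a u) = sK a (d u)"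
    and graph_complete: "(\<And>n. us n \<in> D) \<Longrightarrow> K.Cauchy_seq (\<lambda>n. d (us n)) \<Longrightarrow>
      \<exists>w\<in>VK. K.tends (\<lambda>n. d (us n)) w"
begin

definition closure_graph :: "('h \<times> 'k) set" where
  "closure_graph = {(u, w). u \<in> VH \<and> w \<in> VK \<and>
     (\<exists>us. (\<forall>n. us n \<in> D) \<and> H.tends us u \<and> K.tends (\<lambda>n. d (us n)) w)}"

text \<open>The product of the closure and its adjoint, with the value \<open>w\<close> of the
  closure quantified because it may fail to be unique.\<close>

definition laplace :: "('h \<times> 'h) set" where
  "laplace = {(u, f). u \<in> VH \<and> f \<in> VH \<and>
     (\<exists>w. (u, w) \<in> closure_graph \<and> (\<forall>(p, q)\<in>closure_graph. ipK w q = ipH f p))}"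

definition gscale :: "complex \<Rightarrow> 'h \<times> 'k \<Rightarrow> 'h \<times> 'k" where
  "gscale a p = (sH a (fst p), sK a (snd p))"

text \<open>The scalar product of the graph; its norm on \<open>(u, d u)\<close> is the norm of the
  form domain.\<close>

definition gip :: "'h \<times> 'k \<Rightarrow> 'h \<times> 'k \<Rightarrow> complex" where
  "gip p q = ipH (fst p) (fst q) + ipK (snd p) (snd q)"

sublocale G: semi_inner gscale "VH \<times> VK" gip
proof -
  interpret vector_space gscale
    by unfold_locales
      (auto simp: gscale_def H.scale_right_distrib K.scale_right_distrib H.scale_left_distrib
        K.scale_left_distrib)
  show "semi_inner gscale (VH \<times> VK) gip"
  proof
    show "subspace (VH \<times> VK)"
      by (auto simp: subspace_def gscale_def zero_prod_def)
  qed (auto simp: gip_def gscale_def H.ip_simps K.ip_simps H.cnj_ip K.cnj_ip algebra_simps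
      H.ip_self_nonneg K.ip_self_nonneg)
qed

abbreviation n1 :: "'h \<Rightarrow> real" where "n1 u \<equiv> G.nrm (u, d u)"

lemma gnrm_power2: "a \<in> VH \<Longrightarrow> b \<in> VK \<Longrightarrow> (G.nrm (a, b))\<^sup>2 = (H.nrm a)\<^sup>2 + (K.nrm b)\<^sup>2"
  using G.nrm_power2[of "(a, b)"] by (simp add: gip_def H.nrm_power2 K.nrm_power2)

lemma nrmH_le: "a \<in> VH \<Longrightarrow> b \<in> VK \<Longrightarrow> H.nrm a \<le> G.nrm (a, b)"
  by (rule power2_le_imp_le) (auto simp: gnrm_power2)

lemma nrmK_le: "a \<in> VH \<Longrightarrow> b \<in> VK \<Longrightarrow> K.nrm b \<le> G.nrm (a, b)"
  by (rule power2_le_imp_le) (auto simp: gnrm_power2)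

lemma D_VH [simp]: "u \<in> D \<Longrightarrow> u \<in> VH"
  using D_sub by blast

lemma d_diff: "u \<in> D \<Longrightarrow> v \<in> D \<Longrightarrow> d (u - v) = d u - d v"
  using d_add[of u "sH (-1) v"] d_scale[of v "-1"] H.subspace_scale[OF D_subspace, of v "-1"] by simp

lemma D_add: "u \<in> D \<Longrightarrow> v \<in> D \<Longrightarrow> u + v \<in> D"
  and D_diff: "u \<in> D \<Longrightarrow> v \<in> D \<Longrightarrow> u - v \<in> D"
  and D_scale: "u \<in> D \<Longrightarrow> sH a u \<in> D"
  using D_subspace H.subspace_add H.subspace_diff H.subspace_scale by blast+

section \<open>The closure of the graph over the core\<close>

lemma closure_graph_V: "(u, w) \<in> closure_graph \<Longrightarrow> u \<in> VH" "(u, w) \<in> closure_graph \<Longrightarrow> w \<in> VK"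
  by (auto simp: closure_graph_def)

lemma closure_graphI:
  "u \<in> VH \<Longrightarrow> w \<in> VK \<Longrightarrow> (\<And>n. us n \<in> D) \<Longrightarrow> H.tends us u \<Longrightarrow> K.tends (\<lambda>n. d (us n)) w
    \<Longrightarrow> (u, w) \<in> closure_graph"
  unfolding closure_graph_def mem_Collect_eq prod.case
  by (intro conjI exI[of _ us] allI)

lemma closure_graphE:
  assumes "(u, w) \<in> closure_graph"
  obtains us where "\<And>n. us n \<in> D" "H.tends us u" "K.tends (\<lambda>n. d (us n)) w"
  using assms unfolding closure_graph_def by fast

lemma core_in_closure_graph: "u \<in> D \<Longrightarrow> (u, d u) \<in> closure_graph"
  by (rule closure_graphI[of _ _ "\<lambda>_. u"]) (auto simp: H.tends_const K.tends_const d_VK)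

lemma closure_graph_add:
  assumes "(u, w) \<in> closure_graph" "(v, y) \<in> closure_graph"
  shows "(u + v, w + y) \<in> closure_graph"
proof -
  obtain us where us: "\<And>n. us n \<in> D" "H.tends us u" "K.tends (\<lambda>n. d (us n)) w"
    by (rule closure_graphE[OF assms(1)], rule that)
  obtain vs where vs: "\<And>n. vs n \<in> D" "H.tends vs v" "K.tends (\<lambda>n. d (vs n)) y"
    by (rule closure_graphE[OF assms(2)], rule that)
  note V = closure_graph_V[OF assms(1)] closure_graph_V[OF assms(2)]
  show ?thesis
  proof (rule closure_graphI)
    show "us n + vs n \<in> D" for n using us vs D_add by blast
    show "H.tends (\<lambda>n. us n + vs n) (u + v)"
      using us vs V by (intro H.tends_add) auto
    have "K.tends (\<lambda>n. d (us n) + d (vs n)) (w + y)"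
      using us vs V d_VK by (intro K.tends_add) auto
    then show "K.tends (\<lambda>n. d (us n + vs n)) (w + y)"
      using us vs by (simp add: d_add)
  qed (use V in auto)
qed

lemma closure_graph_scale:
  assumes "(u, w) \<in> closure_graph"
  shows "(sH a u, sK a w) \<in> closure_graph"
proof -
  obtain us where us: "\<And>n. us n \<in> D" "H.tends us u" "K.tends (\<lambda>n. d (us n)) w"
    by (rule closure_graphE[OF assms(1)], rule that)
  note V = closure_graph_V[OF assms(1)]
  show ?thesis
  proof (rule closure_graphI)
    show "sH a (us n) \<in> D" for n using us D_scale by blast
    show "H.tends (\<lambda>n. sH a (us n)) (sH a u)"
      using us V by (intro H.tends_scale) auto
    have "K.tends (\<lambda>n. sK a (d (us n))) (sK a w)"
      using us V d_VK by (intro K.tends_scale) auto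
    then show "K.tends (\<lambda>n. d (sH a (us n))) (sK a w)"
      using us by (simp add: d_scale)
  qed (use V in auto)
qed

lemma closure_graph_diff:
  "(u, w) \<in> closure_graph \<Longrightarrow> (v, y) \<in> closure_graph \<Longrightarrow> (u - v, w - y) \<in> closure_graph"
  using closure_graph_add[of u w "sH (-1) v" "sK (-1) y"] closure_graph_scale[of v y "-1"] by simp

lemma closure_graph_zero: "(0, 0) \<in> closure_graph"
  using closure_graph_diff[of u w u w] core_in_closure_graph[of 0] H.subspace_0[OF D_subspace]
    closure_graph_diff[of 0 "d 0" 0 "d 0"] by simp

lemma orthogonal_closure_graph:
  assumes ab: "a \<in> VH" "b \<in> VK" and core: "\<And>u. u \<in> D \<Longrightarrow> ipH a u + ipK b (d u) = 0"
    and pq: "(p, q) \<in> closure_graph"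
  shows "ipH a p + ipK b q = 0"
proof -
  obtain us where us: "\<And>n. us n \<in> D" "H.tends us p" "K.tends (\<lambda>n. d (us n)) q"
    by (rule closure_graphE[OF pq], rule that)
  have "(\<lambda>n. ipH a (us n) + ipK b (d (us n))) \<longlonglongrightarrow> ipH a p + ipK b q"
    using us ab closure_graph_V[OF pq] d_VK
    by (intro tendsto_add H.ip_tendsto_right K.ip_tendsto_right) auto
  then show ?thesis
    using core us by (simp add: LIMSEQ_const_iff)
qed

text \<open>Orthogonal projection of \<open>(h, k)\<close> onto the closure of the graph over the
  core. The graph norm controls both components, so the minimising sequence has a limit in each
  space. For \<open>k = 0\<close> this solves the equation of \<open>1 + laplace\<close>; in general
  it represents a functional on the form domain.\<close>

lemma riesz:
  assumes hk: "h \<in> VH" "k \<in> VK"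
  obtains a b where "(a, b) \<in> closure_graph"
    "\<And>p q. (p, q) \<in> closure_graph \<Longrightarrow> ipH a p + ipK b q = ipH h p + ipK k q"
proof -
  define M where "M = {(u, d u) | u. u \<in> D}"
  have "G.subspace M"
    unfolding G.subspace_def
  proof (intro conjI allI ballI)
    have "d 0 = 0" using d_diff[of 0 0] H.subspace_0[OF D_subspace] by simp
    then show "0 \<in> M" using H.subspace_0[OF D_subspace] by (auto simp: M_def zero_prod_def)
    show "x + y \<in> M" if "x \<in> M" "y \<in> M" for x y
      using that D_add d_add unfolding M_def by auto
    show "gscale c x \<in> M" if "x \<in> M" for c x
      using that D_scale d_scale unfolding M_def gscale_def by auto
  qed
  moreover have "M \<subseteq> VH \<times> VK" using d_VK by (auto simp: M_def)
  moreover have "(h, k) \<in> VH \<times> VK" using hk by simp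
  ultimately obtain m e where m: "\<And>n. m n \<in> M" "G.Cauchy_seq m" "e \<longlonglongrightarrow> 0"
    "\<And>n y. y \<in> M \<Longrightarrow> cmod (gip ((h, k) - m n) y) \<le> e n * G.nrm y"
    using G.approximate_projection by blast
  define us where "us n = fst (m n)" for n
  have us: "us n \<in> D" and mus: "m n = (us n, d (us n))" for n
    using m(1)[of n] by (auto simp: M_def us_def)
  have usV: "us n \<in> VH" "d (us n) \<in> VK" for n using us d_VK by auto
  have "H.Cauchy_seq us"
    unfolding H.Cauchy_seq_def
  proof (intro allI impI)
    fix e :: real assume "e > 0"
    then obtain N where N: "\<And>i j. i \<ge> N \<Longrightarrow> j \<ge> N \<Longrightarrow> G.nrm (m i - m j) < e"
      using m(2) unfolding G.Cauchy_seq_def by blast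
    have "H.nrm (us i - us j) < e" if "i \<ge> N" "j \<ge> N" for i j
      using N[OF that] nrmH_le[of "us i - us j" "d (us i) - d (us j)"] usV by (simp add: mus)
    then show "\<exists>N. \<forall>i\<ge>N. \<forall>j\<ge>N. H.nrm (us i - us j) < e" by blast
  qed
  from H.complete[of us, OF usV(1) this] obtain a where a: "a \<in> VH" "H.tends us a"
    by (elim bexE) (rule that)
  have "K.Cauchy_seq (\<lambda>n. d (us n))"
    unfolding K.Cauchy_seq_def
  proof (intro allI impI)
    fix e :: real assume "e > 0"
    then obtain N where N: "\<And>i j. i \<ge> N \<Longrightarrow> j \<ge> N \<Longrightarrow> G.nrm (m i - m j) < e"
      using m(2) unfolding G.Cauchy_seq_def by blast
    have "K.nrm (d (us i) - d (us j)) < e" if "i \<ge> N" "j \<ge> N" for i j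
      using N[OF that] nrmK_le[of "us i - us j" "d (us i) - d (us j)"] usV by (simp add: mus)
    then show "\<exists>N. \<forall>i\<ge>N. \<forall>j\<ge>N. K.nrm (d (us i) - d (us j)) < e" by blast
  qed
  from graph_complete[of us, OF us this] obtain b where b: "b \<in> VK" "K.tends (\<lambda>n. d (us n)) b"
    by (elim bexE) (rule that)
  have ab: "(a, b) \<in> closure_graph"
    by (rule closure_graphI[OF a(1) b(1) us a(2) b(2)])
  have orth: "ipH (a - h) u + ipK (b - k) (d u) = 0" if u: "u \<in> D" for u
  proof -
    have uV: "u \<in> VH" "d u \<in> VK" using u d_VK by auto
    have "(\<lambda>n. ipH (h - us n) u + ipK (k - d (us n)) (d u)) \<longlonglongrightarrow> ipH (h - a) u + ipK (k - b) (d u)"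
      using a b hk uV usV
      by (intro tendsto_add H.ip_tendsto_left K.ip_tendsto_left H.tends_diff K.tends_diff
          H.tends_const K.tends_const) auto
    moreover have "(\<lambda>n. ipH (h - us n) u + ipK (k - d (us n)) (d u)) \<longlonglongrightarrow> 0"
    proof (rule Lim_null_comparison)
      have "(u, d u) \<in> M" using u by (auto simp: M_def)
      from m(4)[OF this]
      show "\<forall>\<^sub>F n in sequentially. norm (ipH (h - us n) u + ipK (k - d (us n)) (d u)) \<le> e n * n1 u"
        by (simp add: mus gip_def)
      show "(\<lambda>n. e n * n1 u) \<longlonglongrightarrow> 0"
        by (rule tendsto_mult_left_zero[OF m(3)])
    qed
    ultimately have "ipH (h - a) u + ipK (k - b) (d u) = 0" by (rule LIMSEQ_unique)
    then show ?thesis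
      using a b hk uV by (simp add: H.ip_simps K.ip_simps algebra_simps)
  qed
  show ?thesis
  proof (rule that[OF ab])
    fix p q assume pq: "(p, q) \<in> closure_graph"
    have "ipH (a - h) p + ipK (b - k) q = 0"
      using a b hk by (intro orthogonal_closure_graph[OF _ _ orth pq]) auto
    then show "ipH a p + ipK b q = ipH h p + ipK k q"
      using a b hk closure_graph_V[OF pq] by (simp add: H.ip_simps K.ip_simps algebra_simps)
  qed
qed

lemma laplaceI:
  assumes "(u, w) \<in> closure_graph" "f \<in> VH" "\<And>p q. (p, q) \<in> closure_graph \<Longrightarrow> ipK w q = ipH f p"
  shows "(u, f) \<in> laplace"
  using assms closure_graph_V unfolding laplace_def by blast

lemma laplaceE:
  assumes "(u, f) \<in> laplace"
  obtains w where "(u, w) \<in> closure_graph" "f \<in> VH" "\<And>p q. (p, q) \<in> closure_graph \<Longrightarrow> ipK w q = ipH f p"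
  using assms unfolding laplace_def by blast

lemma lin_laplace: "H.lin_rel laplace"
  unfolding H.lin_rel_def
proof (intro conjI allI impI)
  show "laplace \<subseteq> VH \<times> VH" by (auto simp: laplace_def)
  show "(0, 0) \<in> laplace"
  proof (rule laplaceI[OF closure_graph_zero])
    fix p q assume "(p, q) \<in> closure_graph"
    then show "ipK 0 q = ipH 0 p" using closure_graph_V[of p q] by simp
  qed simp
  fix u f assume u: "(u, f) \<in> laplace"
  then obtain w where w: "(u, w) \<in> closure_graph" "f \<in> VH"
    "\<And>p q. (p, q) \<in> closure_graph \<Longrightarrow> ipK w q = ipH f p" using laplaceE by blast
  show "(u + v, f + g) \<in> laplace" if vg: "(v, g) \<in> laplace" for v g
  proof -
    obtain y where y: "(v, y) \<in> closure_graph" "g \<in> VH"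
      "\<And>p q. (p, q) \<in> closure_graph \<Longrightarrow> ipK y q = ipH g p" using laplaceE[OF vg] by blast
    show ?thesis
    proof (rule laplaceI[OF closure_graph_add[OF w(1) y(1)]])
      fix p q assume pq: "(p, q) \<in> closure_graph"
      show "ipK (w + y) q = ipH (f + g) p"
        using w(2) y(2) w(3)[OF pq] y(3)[OF pq] closure_graph_V[OF pq] closure_graph_V[OF w(1)]
          closure_graph_V[OF y(1)] by (simp add: H.ip_simps K.ip_simps)
    qed (use w y in auto)
  qed
  show "(sH a u, sH a f) \<in> laplace" for a
  proof (rule laplaceI[OF closure_graph_scale[OF w(1)]])
    fix p q assume pq: "(p, q) \<in> closure_graph"
    show "ipK (sK a w) q = ipH (sH a f) p"
      using w(2) w(3)[OF pq] closure_graph_V[OF pq] closure_graph_V[OF w(1)]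
      by (simp add: H.ip_simps K.ip_simps)
  qed (use w in auto)
qed

text \<open>Convergence of \<open>us\<close> and \<open>fs\<close> forces convergence of the
  intermediate values \<open>w\<close>, since the square of \<open>K.nrm (w i - w j)\<close> is the
  pairing of \<open>fs i - fs j\<close> with \<open>us i - us j\<close>.\<close>

lemma closed_laplace: "H.closed_rel laplace"
  unfolding H.closed_rel_def
proof (intro conjI lin_laplace allI impI)
  fix us fs u f
  assume *: "\<forall>n. (us n, fs n) \<in> laplace" "u \<in> VH" "f \<in> VH" "H.tends us u" "H.tends fs f"
  have usV: "us n \<in> VH" and fsV: "fs n \<in> VH" for n
    using * H.lin_rel_V[OF lin_laplace] by blast+
  have "\<forall>n. \<exists>w. (us n, w) \<in> closure_graph \<and> (\<forall>p q. (p, q) \<in> closure_graph \<longrightarrow> ipK w q = ipH (fs n) p)"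
    using * laplaceE by meson
  then obtain w where w: "\<And>n. (us n, w n) \<in> closure_graph"
    "\<And>n p q. (p, q) \<in> closure_graph \<Longrightarrow> ipK (w n) q = ipH (fs n) p"
    by metis
  have wV: "w n \<in> VK" for n using w closure_graph_V by blast
  \<comment> \<open>The values \<open>w n\<close> belong to the closure, whereas limits in the
    second space are available along the core; each pair is replaced by a core pair within
    \<open>1 / (n + 1)\<close>.\<close>
  have "\<exists>v. v \<in> D \<and> H.nrm (v - us n) < 1 / (real n + 1) \<and> K.nrm (d v - w n) < 1 / (real n + 1)" for n
  proof -
    obtain vs where vs: "\<And>i. vs i \<in> D" "H.tends vs (us n)" "K.tends (\<lambda>i. d (vs i)) (w n)"
      by (rule closure_graphE[OF w(1)[of n]], rule that)
    have "\<forall>\<^sub>F i in sequentially. H.nrm (vs i - us n) < 1 / (real n + 1) \<and> K.nrm (d (vs i) - w n) < 1 / (real n + 1)"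
      using vs(2,3) unfolding H.tends_def K.tends_def
      by (intro eventually_conj order_tendstoD(2)) auto
    then show ?thesis using vs(1) by (auto simp: eventually_sequentially)
  qed
  then obtain v where v: "\<And>n. v n \<in> D" "\<And>n. H.nrm (v n - us n) < 1 / (real n + 1)"
    "\<And>n. K.nrm (d (v n) - w n) < 1 / (real n + 1)"
    by metis
  have vV: "v n \<in> VH" "d (v n) \<in> VK" for n using v(1) d_VK by auto
  have lim: "(\<lambda>n. 1 / (real n + 1)) \<longlonglongrightarrow> 0"
    using LIMSEQ_inverse_real_of_nat by (simp add: inverse_eq_divide add.commute)
  have v_lim: "H.tends v u"
    unfolding H.tends_def
  proof (rule tendsto_sandwich[OF _ _ tendsto_const])
    show "\<forall>\<^sub>F n in sequentially. 0 \<le> H.nrm (v n - u)" using vV * by simp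
    have "H.nrm (v n - u) \<le> 1 / (real n + 1) + H.nrm (us n - u)" for n
      using H.nrm_diff_triangle[OF vV(1) usV *(2), of n n] v(2)[of n] by simp
    then show "\<forall>\<^sub>F n in sequentially. H.nrm (v n - u) \<le> 1 / (real n + 1) + H.nrm (us n - u)"
      by simp
    show "(\<lambda>n. 1 / (real n + 1) + H.nrm (us n - u)) \<longlonglongrightarrow> 0"
      using tendsto_add[OF lim *(4)[unfolded H.tends_def]] by simp
  qed
  have w_dist: "(K.nrm (w i - w j))\<^sup>2 \<le> H.nrm (fs i - fs j) * H.nrm (us i - us j)" for i j
  proof -
    have "(us i - us j, w i - w j) \<in> closure_graph"
      by (rule closure_graph_diff[OF w(1) w(1)])
    then have "ipK (w i - w j) (w i - w j) = ipH (fs i - fs j) (us i - us j)"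
      using w(2)[of "us i - us j" "w i - w j"] wV fsV usV by (simp add: K.ip_diff_left H.ip_diff_left)
    then have "(K.nrm (w i - w j))\<^sup>2 = Re (ipH (fs i - fs j) (us i - us j))"
      using wV by (simp add: K.nrm_power2)
    also have "\<dots> \<le> H.nrm (fs i - fs j) * H.nrm (us i - us j)"
      using H.Cauchy_Schwarz_ip[of "fs i - fs j" "us i - us j"] fsV usV
        complex_Re_le_cmod[of "ipH (fs i - fs j) (us i - us j)"] by simp
    finally show ?thesis .
  qed
  have Cus: "H.Cauchy_seq us" by (rule H.tends_imp_Cauchy_seq[OF usV *(2,4)])
  have Cfs: "H.Cauchy_seq fs" by (rule H.tends_imp_Cauchy_seq[OF fsV *(3,5)])
  have Cw: "\<exists>N. \<forall>i\<ge>N. \<forall>j\<ge>N. K.nrm (w i - w j) < e" if "e > 0" for e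
  proof -
    obtain N1 where N1: "\<And>i j. i \<ge> N1 \<Longrightarrow> j \<ge> N1 \<Longrightarrow> H.nrm (us i - us j) < e"
      using Cus \<open>e > 0\<close> unfolding H.Cauchy_seq_def by meson
    obtain N2 where N2: "\<And>i j. i \<ge> N2 \<Longrightarrow> j \<ge> N2 \<Longrightarrow> H.nrm (fs i - fs j) < e"
      using Cfs \<open>e > 0\<close> unfolding H.Cauchy_seq_def by meson
    have "K.nrm (w i - w j) < e" if "i \<ge> max N1 N2" "j \<ge> max N1 N2" for i j
    proof -
      have "(K.nrm (w i - w j))\<^sup>2 < e * e"
        using w_dist[of i j] mult_strict_mono'[of "H.nrm (fs i - fs j)" e "H.nrm (us i - us j)" e]
          N1[of i j] N2[of i j] that usV fsV by (simp add: order_le_less_trans)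
      then show ?thesis
        using \<open>e > 0\<close> by (intro power2_less_imp_less[of _ e]) (simp_all add: power2_eq_square)
    qed
    then show ?thesis by blast
  qed
  have "K.Cauchy_seq (\<lambda>n. d (v n))"
    unfolding K.Cauchy_seq_def
  proof (intro allI impI)
    fix e :: real assume "e > 0"
    obtain N1 where N1: "\<And>i j. i \<ge> N1 \<Longrightarrow> j \<ge> N1 \<Longrightarrow> K.nrm (w i - w j) < e / 3"
      using Cw[of "e / 3"] \<open>e > 0\<close> by auto
    obtain N2 where N2: "\<And>i. i \<ge> N2 \<Longrightarrow> 1 / (real i + 1) < e / 3"
      using order_tendstoD(2)[OF lim, of "e / 3"] \<open>e > 0\<close> by (auto simp: eventually_sequentially)
    have "K.nrm (d (v i) - d (v j)) < e" if "i \<ge> max N1 N2" "j \<ge> max N1 N2" for i j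
      using K.nrm_diff_triangle[of "d (v i)" "w i" "d (v j)"] K.nrm_diff_triangle[of "w i" "w j" "d (v j)"]
        v(3)[of i] v(3)[of j] K.nrm_minus_commute[of "w j" "d (v j)"] N1[of i j] N2[of i] N2[of j] that wV vV
      by simp
    then show "\<exists>N. \<forall>i\<ge>N. \<forall>j\<ge>N. K.nrm (d (v i) - d (v j)) < e" by blast
  qed
  from graph_complete[of v, OF v(1) this] obtain y where y: "y \<in> VK" "K.tends (\<lambda>n. d (v n)) y"
    by (elim bexE) (rule that)
  have w_lim: "K.tends w y"
    unfolding K.tends_def
  proof (rule tendsto_sandwich[OF _ _ tendsto_const])
    show "\<forall>\<^sub>F n in sequentially. 0 \<le> K.nrm (w n - y)" using wV y by simp
    have "K.nrm (w n - y) \<le> 1 / (real n + 1) + K.nrm (d (v n) - y)" for n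
      using K.nrm_diff_triangle[OF wV vV(2) y(1), of n n] v(3)[of n] K.nrm_minus_commute[OF wV vV(2), of n n] by simp
    then show "\<forall>\<^sub>F n in sequentially. K.nrm (w n - y) \<le> 1 / (real n + 1) + K.nrm (d (v n) - y)"
      by simp
    show "(\<lambda>n. 1 / (real n + 1) + K.nrm (d (v n) - y)) \<longlonglongrightarrow> 0"
      using tendsto_add[OF lim y(2)[unfolded K.tends_def]] by simp
  qed
  show "(u, f) \<in> laplace"
  proof (rule laplaceI)
    show "(u, y) \<in> closure_graph"
      by (rule closure_graphI[OF *(2) y(1) v(1) v_lim y(2)])
    fix p q assume pq: "(p, q) \<in> closure_graph"
    have "(\<lambda>n. ipK (w n) q) \<longlonglongrightarrow> ipK y q"
      using wV y w_lim closure_graph_V[OF pq] by (intro K.ip_tendsto_left) auto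
    moreover have "(\<lambda>n. ipH (fs n) p) \<longlonglongrightarrow> ipH f p"
      using fsV * closure_graph_V[OF pq] by (intro H.ip_tendsto_left) auto
    ultimately show "ipK y q = ipH f p"
      using w(2)[OF pq] by (simp add: LIMSEQ_unique)
  qed (use * in auto)
qed

sublocale S: selfadjoint_relation sH VH ipH laplace
proof
  show "H.closed_rel laplace" by (rule closed_laplace)
  show "ipH u g = ipH f v" if uf: "(u, f) \<in> laplace" and vg: "(v, g) \<in> laplace" for u f v g
  proof -
    obtain w where w: "(u, w) \<in> closure_graph" "f \<in> VH"
      "\<And>p q. (p, q) \<in> closure_graph \<Longrightarrow> ipK w q = ipH f p" using laplaceE[OF uf] by blast
    obtain y where y: "(v, y) \<in> closure_graph" "g \<in> VH"
      "\<And>p q. (p, q) \<in> closure_graph \<Longrightarrow> ipK y q = ipH g p" using laplaceE[OF vg] by blast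
    have "ipH u g = cnj (ipH g u)"
      using y(2) closure_graph_V[OF w(1)] by (simp add: H.cnj_ip)
    also have "\<dots> = cnj (ipK y w)" using y(3)[OF w(1)] by simp
    also have "\<dots> = ipK w y"
      using closure_graph_V[OF w(1)] closure_graph_V[OF y(1)] by (simp add: K.cnj_ip)
    also have "\<dots> = ipH f v" using w(3)[OF y(1)] .
    finally show ?thesis .
  qed
  show "\<exists>u. (u, h - u) \<in> laplace" if h: "h \<in> VH" for h
  proof -
    obtain a b where ab: "(a, b) \<in> closure_graph"
      "\<And>p q. (p, q) \<in> closure_graph \<Longrightarrow> ipH a p + ipK b q = ipH h p + ipK 0 q"
      using riesz[OF h K.V_zero] by blast
    have aV: "a \<in> VH" using closure_graph_V[OF ab(1)] by blast
    have "(a, h - a) \<in> laplace"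
    proof (rule laplaceI[OF ab(1)])
      fix p q assume pq: "(p, q) \<in> closure_graph"
      show "ipK b q = ipH (h - a) p"
        using ab(2)[OF pq] h aV closure_graph_V[OF pq] by (simp add: H.ip_simps algebra_simps)
    qed (use h aV in auto)
    then show ?thesis by blast
  qed
qed

text \<open>The number \<open>M\<close> bounds the dual norm of the functional that \<open>u\<close>
  induces on the form domain; speaking of bounds avoids a supremum.\<close>

definition weakly_bounded :: "complex \<Rightarrow> 'h \<Rightarrow> real \<Rightarrow> bool" where
  "weakly_bounded z u M \<longleftrightarrow> (\<forall>p\<in>D. cmod (ipK (d u) (d p) - z * ipH u p) \<le> M * n1 p)"

definition form_estimate :: "complex \<Rightarrow> bool" where
  "form_estimate z \<longleftrightarrow> (\<exists>C G. 0 \<le> C \<and> finite G \<and> G \<subseteq> VH \<and>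
     (\<forall>u\<in>D. \<forall>M\<ge>0. weakly_bounded z u M \<longrightarrow> n1 u \<le> C * (M + (\<Sum>g\<in>G. cmod (ipH g u)))))"

text \<open>Core elements approximating a vector \<open>u\<close> of the operator domain satisfy the
  weak bound with numbers tending to the norm of \<open>f - sH z u\<close>, and the estimate
  survives the limit.\<close>

lemma estimate_if_form_estimate:
  assumes real: "cnj z = z" and est: "form_estimate z"
  shows "S.estimate z"
proof -
  obtain C G where C: "0 \<le> C" and G: "finite G" "G \<subseteq> VH"
    and est: "\<And>u M. u \<in> D \<Longrightarrow> M \<ge> 0 \<Longrightarrow> weakly_bounded z u M \<Longrightarrow> n1 u \<le> C * (M + (\<Sum>g\<in>G. cmod (ipH g u)))"
    using est unfolding form_estimate_def by blast
  have "H.nrm u \<le> C * (H.nrm (f - sH z u) + (\<Sum>g\<in>G. cmod (ipH g u)))" if uf: "(u, f) \<in> laplace" for u f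
  proof -
    obtain w where w: "(u, w) \<in> closure_graph" "f \<in> VH"
      "\<And>p q. (p, q) \<in> closure_graph \<Longrightarrow> ipK w q = ipH f p" using laplaceE[OF uf] by blast
    obtain us where us: "\<And>n. us n \<in> D" "H.tends us u" "K.tends (\<lambda>n. d (us n)) w"
      by (rule closure_graphE[OF w(1)], rule that)
    note V = closure_graph_V[OF w(1)]
    have usV: "us n \<in> VH" "d (us n) \<in> VK" for n using us(1) d_VK by auto
    \<comment> \<open>The functional of \<open>u\<close> is the pairing with
      \<open>f - sH z u\<close>; the other two summands bound the error of replacing
      \<open>u\<close> and \<open>w\<close> by \<open>us n\<close> and its image.\<close>
    define M where "M n = K.nrm (d (us n) - w) + cmod z * H.nrm (us n - u) + H.nrm (f - sH z u)" for n
    have M0: "M n \<ge> 0" for n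
      unfolding M_def using V usV w(2) by (intro add_nonneg_nonneg mult_nonneg_nonneg) auto
    have wb: "weakly_bounded z (us n) (M n)" for n
      unfolding weakly_bounded_def
    proof
      fix p assume p: "p \<in> D"
      have pV: "p \<in> VH" "d p \<in> VK" using p d_VK by auto
      have "ipK (d (us n)) (d p) - z * ipH (us n) p =
          ipK (d (us n) - w) (d p) - z * ipH (us n - u) p + ipH (f - sH z u) p"
        using w(3)[OF core_in_closure_graph[OF p]] V usV w(2) pV real
        by (simp add: H.ip_simps K.ip_simps algebra_simps)
      also have "cmod \<dots> \<le> cmod (ipK (d (us n) - w) (d p)) + cmod z * cmod (ipH (us n - u) p) + cmod (ipH (f - sH z u) p)"
        using norm_triangle_ineq[of "ipK (d (us n) - w) (d p) - z * ipH (us n - u) p" "ipH (f - sH z u) p"]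
          norm_triangle_ineq4[of "ipK (d (us n) - w) (d p)" "z * ipH (us n - u) p"]
        unfolding norm_mult by linarith
      also have "cmod (ipK (d (us n) - w) (d p)) \<le> K.nrm (d (us n) - w) * n1 p"
      proof -
        have "cmod (ipK (d (us n) - w) (d p)) \<le> K.nrm (d (us n) - w) * K.nrm (d p)"
          using V usV pV by (intro K.Cauchy_Schwarz_ip) auto
        also have "\<dots> \<le> K.nrm (d (us n) - w) * n1 p"
          using V usV pV by (intro mult_left_mono nrmK_le) auto
        finally show ?thesis .
      qed
      also have "cmod (ipH (us n - u) p) \<le> H.nrm (us n - u) * n1 p"
      proof -
        have "cmod (ipH (us n - u) p) \<le> H.nrm (us n - u) * H.nrm p"
          using V usV pV by (intro H.Cauchy_Schwarz_ip) auto
        also have "\<dots> \<le> H.nrm (us n - u) * n1 p"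
          using V usV pV by (intro mult_left_mono nrmH_le) auto
        finally show ?thesis .
      qed
      also have "cmod (ipH (f - sH z u) p) \<le> H.nrm (f - sH z u) * n1 p"
      proof -
        have "cmod (ipH (f - sH z u) p) \<le> H.nrm (f - sH z u) * H.nrm p"
          using V w(2) pV by (intro H.Cauchy_Schwarz_ip) auto
        also have "\<dots> \<le> H.nrm (f - sH z u) * n1 p"
          using V w(2) pV by (intro mult_left_mono nrmH_le) auto
        finally show ?thesis .
      qed
      finally have "cmod (ipK (d (us n)) (d p) - z * ipH (us n) p) \<le> K.nrm (d (us n) - w) * n1 p
          + cmod z * (H.nrm (us n - u) * n1 p) + H.nrm (f - sH z u) * n1 p"
        by (simp add: mult_left_mono)
      then show "cmod (ipK (d (us n)) (d p) - z * ipH (us n) p) \<le> M n * n1 p"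
        by (simp add: M_def algebra_simps)
    qed
    have "H.nrm (us n) \<le> C * (M n + (\<Sum>g\<in>G. cmod (ipH g (us n))))" for n
      using est[OF us(1) M0 wb, of n] nrmH_le[OF usV(1) usV(2), of n n] by linarith
    moreover have "(\<lambda>n. H.nrm (us n)) \<longlonglongrightarrow> H.nrm u"
      by (rule H.nrm_tendsto[OF usV(1) V(1) us(2)])
    moreover have "(\<lambda>n. C * (M n + (\<Sum>g\<in>G. cmod (ipH g (us n))))) \<longlonglongrightarrow>
        C * ((0 + cmod z * 0 + H.nrm (f - sH z u)) + (\<Sum>g\<in>G. cmod (ipH g u)))"
      unfolding M_def
      using us(2,3)[unfolded H.tends_def K.tends_def] usV V us(2) G
      by (intro tendsto_mult tendsto_add tendsto_const tendsto_sum tendsto_norm H.ip_tendsto_right) auto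
    ultimately show ?thesis
      using LIMSEQ_le[of "\<lambda>n. H.nrm (us n)" _ "\<lambda>n. C * (M n + (\<Sum>g\<in>G. cmod (ipH g (us n))))"] by simp
  qed
  then show ?thesis unfolding S.estimate_def using C G by blast
qed

text \<open>A functional of dual norm at most \<open>M\<close> is represented by a pair
  \<open>(a, b)\<close> of graph norm at most \<open>M\<close>. Subtracting \<open>a\<close> moves
  \<open>u\<close> into the operator domain, with \<open>(laplace - z) (u - a) = (1 + z) a\<close>,
  so the operator estimate applies to \<open>u - a\<close>.\<close>

lemma form_estimate_if_estimate:
  assumes real: "cnj z = z" and est: "S.estimate z"
  shows "form_estimate z"
proof -
  obtain C G where C: "0 \<le> C" and G: "finite G" "G \<subseteq> VH"
    and est: "\<And>u f. (u, f) \<in> laplace \<Longrightarrow> H.nrm u \<le> C * (H.nrm (f - sH z u) + (\<Sum>g\<in>G. cmod (ipH g u)))"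
    using est unfolding S.estimate_def by blast
  define E where "E = 1 + C * (cmod (1 + z) + (\<Sum>g\<in>G. H.nrm g))"
  have G_nonneg: "0 \<le> (\<Sum>g\<in>G. H.nrm g)" using G by (intro sum_nonneg) auto
  have "E \<ge> 1" unfolding E_def using C G_nonneg by simp
  define c where "c = 1 + cmod z"
  have "n1 u \<le> (1 + c * (E + C)) * (M + (\<Sum>g\<in>G. cmod (ipH g u)))"
    if u: "u \<in> D" and M: "M \<ge> 0" and wb: "weakly_bounded z u M" for u M
  proof -
    have uV: "u \<in> VH" "d u \<in> VK" using u d_VK by auto
    have s0: "0 \<le> (\<Sum>g\<in>G. cmod (ipH g u))" by (intro sum_nonneg) auto
    obtain a b where ab: "(a, b) \<in> closure_graph"
      "\<And>p q. (p, q) \<in> closure_graph \<Longrightarrow> ipH a p + ipK b q = ipH (sH (- z) u) p + ipK (d u) q"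
      using riesz[of "sH (- z) u" "d u"] uV by blast
    have aV: "a \<in> VH" "b \<in> VK" using closure_graph_V[OF ab(1)] by blast+
    \<comment> \<open>The functional is evaluated at its own representative, which is reached
      through core elements because the weak bound tests only these.\<close>
    have small: "G.nrm (a, b) \<le> M"
    proof -
      obtain as where as: "\<And>n. as n \<in> D" "H.tends as a" "K.tends (\<lambda>n. d (as n)) b"
        by (rule closure_graphE[OF ab(1)], rule that)
      have asV: "as n \<in> VH" "d (as n) \<in> VK" for n using as(1) d_VK by auto
      have "cmod (ipH a (as n) + ipK b (d (as n))) \<le> M * n1 (as n)" for n
        using wb as(1)[of n] ab(2)[OF core_in_closure_graph[OF as(1)[of n]]] uV asV[of n] real
        unfolding weakly_bounded_def by (simp add: H.ip_simps)
      moreover have "(\<lambda>n. cmod (ipH a (as n) + ipK b (d (as n)))) \<longlonglongrightarrow> cmod (ipH a a + ipK b b)"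
        using as asV aV by (intro tendsto_norm tendsto_add H.ip_tendsto_right K.ip_tendsto_right) auto
      moreover have "(\<lambda>n. M * n1 (as n)) \<longlonglongrightarrow> M * G.nrm (a, b)"
      proof (intro tendsto_mult tendsto_const G.nrm_tendsto)
        show "G.tends (\<lambda>n. (as n, d (as n))) (a, b)"
          unfolding G.tends_def
        proof (rule tendsto_sandwich[OF _ _ tendsto_const])
          show "\<forall>\<^sub>F n in sequentially. 0 \<le> G.nrm ((as n, d (as n)) - (a, b))"
            using asV aV by simp
          have "G.nrm ((as n, d (as n)) - (a, b)) \<le> H.nrm (as n - a) + K.nrm (d (as n) - b)" for n
          proof (rule power2_le_imp_le)
            show "(G.nrm ((as n, d (as n)) - (a, b)))\<^sup>2 \<le> (H.nrm (as n - a) + K.nrm (d (as n) - b))\<^sup>2"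
              using asV aV by (simp add: gnrm_power2 power2_sum)
          qed (use asV aV in simp)
          then show "\<forall>\<^sub>F n in sequentially. G.nrm ((as n, d (as n)) - (a, b)) \<le> H.nrm (as n - a) + K.nrm (d (as n) - b)"
            by simp
          show "(\<lambda>n. H.nrm (as n - a) + K.nrm (d (as n) - b)) \<longlonglongrightarrow> 0"
            using tendsto_add[OF as(2)[unfolded H.tends_def] as(3)[unfolded K.tends_def]] by simp
        qed
      qed (use asV aV in auto)
      ultimately have "cmod (ipH a a + ipK b b) \<le> M * G.nrm (a, b)"
        by (intro LIMSEQ_le[of "\<lambda>n. cmod (ipH a (as n) + ipK b (d (as n)))" _ "\<lambda>n. M * n1 (as n)"]) auto
      moreover have "(G.nrm (a, b))\<^sup>2 \<le> cmod (ipH a a + ipK b b)"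
        using G.nrm_power2[of "(a, b)"] aV complex_Re_le_cmod[of "ipH a a + ipK b b"] by (simp add: gip_def)
      ultimately have "G.nrm (a, b) * G.nrm (a, b) \<le> M * G.nrm (a, b)"
        by (simp add: power2_eq_square)
      then show ?thesis
        using M G.nrm_nonneg[of "(a, b)"] aV by (cases "G.nrm (a, b) = 0") (auto simp: mult_le_cancel_right less_le)
    qed
    then have aM: "H.nrm a \<le> M" using nrmH_le[OF aV] by linarith
    have "(u - a, a + sH z u) \<in> laplace"
    proof (rule laplaceI[OF closure_graph_diff[OF core_in_closure_graph[OF u] ab(1)]])
      fix p q assume pq: "(p, q) \<in> closure_graph"
      show "ipK (d u - b) q = ipH (a + sH z u) p"
        using ab(2)[OF pq] uV aV closure_graph_V[OF pq]
        by (simp add: H.ip_simps K.ip_simps algebra_simps)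
    qed (use uV aV in auto)
    from est[OF this] have "H.nrm (u - a) \<le> C * (H.nrm (a + sH z u - sH z (u - a)) + (\<Sum>g\<in>G. cmod (ipH g (u - a))))" .
    also have "a + sH z u - sH z (u - a) = sH (1 + z) a"
      by (simp add: H.scale_right_diff_distrib H.scale_left_distrib)
    also have "H.nrm (sH (1 + z) a) \<le> cmod (1 + z) * M"
      using aM aV by (simp add: H.nrm_scale mult_left_mono)
    also have "(\<Sum>g\<in>G. cmod (ipH g (u - a))) \<le> (\<Sum>g\<in>G. cmod (ipH g u) + H.nrm g * M)"
    proof (rule sum_mono)
      fix g assume "g \<in> G"
      then have gV: "g \<in> VH" using G by blast
      have "cmod (ipH g (u - a)) \<le> cmod (ipH g u) + cmod (ipH g a)"
        using gV uV aV by (simp add: H.ip_simps norm_triangle_ineq4)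
      also have "cmod (ipH g a) \<le> H.nrm g * H.nrm a"
        by (rule H.Cauchy_Schwarz_ip[OF gV aV(1)])
      also have "H.nrm g * H.nrm a \<le> H.nrm g * M"
        using aM gV by (intro mult_left_mono) auto
      finally show "cmod (ipH g (u - a)) \<le> cmod (ipH g u) + H.nrm g * M" by simp
    qed
    also have "\<dots> = (\<Sum>g\<in>G. cmod (ipH g u)) + (\<Sum>g\<in>G. H.nrm g) * M"
      by (simp add: sum.distrib sum_distrib_right)
    finally have *: "H.nrm (u - a) \<le> C * (cmod (1 + z) * M + ((\<Sum>g\<in>G. cmod (ipH g u)) + (\<Sum>g\<in>G. H.nrm g) * M))"
      using C by (simp add: mult_left_mono)
    have "H.nrm u \<le> M + H.nrm (u - a)"
      using H.nrm_triangle2[OF uV(1) aV(1)] aM by simp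
    also have "\<dots> \<le> E * M + C * (\<Sum>g\<in>G. cmod (ipH g u))"
      using * by (simp add: E_def algebra_simps)
    also have "\<dots> \<le> (E + C) * (M + (\<Sum>g\<in>G. cmod (ipH g u)))"
      using C M s0 \<open>E \<ge> 1\<close> by (simp add: algebra_simps add_nonneg_nonneg mult_nonneg_nonneg)
    finally have Hu: "H.nrm u \<le> (E + C) * (M + (\<Sum>g\<in>G. cmod (ipH g u)))" .
    \<comment> \<open>Testing the functional with \<open>u\<close> itself recovers the norm of
      \<open>d u\<close> from the norm of \<open>u\<close>.\<close>
    have "cmod (of_real ((K.nrm (d u))\<^sup>2) - z * of_real ((H.nrm u)\<^sup>2)) \<le> M * n1 u"
      using wb u uV unfolding weakly_bounded_def by (metis H.ip_self K.ip_self)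
    then have "cmod (of_real ((K.nrm (d u))\<^sup>2)) \<le> M * n1 u + cmod (z * of_real ((H.nrm u)\<^sup>2))"
      using norm_triangle_ineq2[of "of_real ((K.nrm (d u))\<^sup>2)" "z * of_real ((H.nrm u)\<^sup>2)"] by linarith
    then have "(K.nrm (d u))\<^sup>2 \<le> M * n1 u + cmod z * (H.nrm u)\<^sup>2"
      by (simp add: norm_mult norm_power del: of_real_power)
    then have sq: "(n1 u)\<^sup>2 \<le> M * n1 u + c * (H.nrm u)\<^sup>2"
      using uV by (simp add: gnrm_power2 c_def algebra_simps)
    have c1: "c \<ge> 1" by (simp add: c_def)
    \<comment> \<open>A root bound for the quadratic inequality \<open>sq\<close>: if
      \<open>n1 u\<close> were larger, \<open>n1 u * (n1 u - M)\<close> would exceed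
      \<open>c * (H.nrm u)\<^sup>2\<close>.\<close>
    have "n1 u \<le> M + c * H.nrm u"
    proof (rule ccontr)
      assume "\<not> ?thesis"
      then have gt: "n1 u > M + c * H.nrm u" by simp
      have h0: "0 \<le> c * H.nrm u" using c1 uV by simp
      have "c * (H.nrm u)\<^sup>2 \<le> (c * H.nrm u) * (c * H.nrm u)"
      proof -
        have "c * (H.nrm u)\<^sup>2 * 1 \<le> c * (H.nrm u)\<^sup>2 * c"
          using c1 by (intro mult_left_mono) auto
        then show ?thesis by (simp add: power2_eq_square mult_ac)
      qed
      also have "\<dots> \<le> n1 u * (c * H.nrm u)"
        using gt h0 M by (intro mult_right_mono) auto
      also have "\<dots> < n1 u * (n1 u - M)"
        using gt h0 M by (intro mult_strict_left_mono) auto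
      finally show False using sq by (simp add: power2_eq_square algebra_simps)
    qed
    also have "\<dots> \<le> M + c * ((E + C) * (M + (\<Sum>g\<in>G. cmod (ipH g u))))"
      using Hu c1 by (intro add_left_mono mult_left_mono) auto
    also have "\<dots> \<le> (1 + c * (E + C)) * (M + (\<Sum>g\<in>G. cmod (ipH g u)))"
      using s0 by (simp add: algebra_simps)
    finally show ?thesis .
  qed
  moreover have "0 \<le> 1 + c * (E + C)"
    using C \<open>E \<ge> 1\<close> by (simp add: c_def)
  ultimately show ?thesis
    unfolding form_estimate_def using G by blast
qed

text \<open>Off the real axis the estimate is automatic for \<open>z\<close> and its conjugate; on
  it the conditions for the two numbers coincide.\<close>

theorem fredholm_iff:
  "S.fredholm z \<longleftrightarrow> (Im z = 0 \<longrightarrow> form_estimate z)"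
proof (cases "Im z = 0")
  case True
  then have z: "cnj z = z" by (simp add: complex_eq_iff)
  have "S.fredholm z \<longleftrightarrow> S.estimate z"
    using S.fredholm_if_estimate[of z, unfolded z] S.estimate_if_fredholm[OF z] by blast
  also have "\<dots> \<longleftrightarrow> form_estimate z"
    using estimate_if_form_estimate[OF z] form_estimate_if_estimate[OF z] by blast
  finally show ?thesis
    using True by simp
next
  case False
  then show ?thesis
    using S.fredholm_if_estimate[of z] S.estimate_if_not_real[of z] S.estimate_if_not_real[of "cnj z"] by simp
qed

end

section \<open>Completions and \<open>L\<^sup>2\<close>\<close>

text \<open>In all the spaces concerned the addition of the record is the addition of the type,
  pointwise for functions; this lets the abstract theory use \<open>+\<close> and
  \<open>-\<close>.\<close>

locale semi_inner_hspace =
  fixes H :: "'h::ab_group_add hspace"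
  assumes hadd [simp]: "hadd H = (+)" and hzero [simp]: "hzero H = 0"
    and semi_inner: "semi_inner (hscale H) (hvec H) (hinner H)"
begin

sublocale semi_inner "hscale H" "hvec H" "hinner H"
  by (rule semi_inner)

lemma hdiff_eq [simp]: "hdiff H x y = x - y"
  by (simp add: hdiff_def)

lemma hnorm_eq [simp]: "hnorm H = nrm"
  by (simp add: hnorm_def nrm_def fun_eq_iff)

lemma hequal_iff [simp]: "hequal H x y \<longleftrightarrow> nrm (x - y) = 0"
  by (simp add: hequal_def)

lemma htendsto_eq [simp]: "htendsto H = tends"
  by (simp add: htendsto_def tends_def fun_eq_iff)

lemma hCauchy_eq [simp]: "hCauchy H = Cauchy_seq"
  by (simp add: hCauchy_def Cauchy_seq_def fun_eq_iff)

lemma lincomb_in_span: "snd ` set ps \<subseteq> F \<Longrightarrow> lincomb H ps \<in> span F"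
  by (induction ps) (auto intro: span_zero span_add span_scale span_base)

lemma span_imp_lincomb:
  assumes "v \<in> span F"
  shows "\<exists>ps. snd ` set ps \<subseteq> F \<and> lincomb H ps = v"
  using assms
proof (induction rule: span_induct_alt)
  case base
  show ?case by (intro exI[of _ "[]"]) simp
next
  case (step c x y)
  then obtain ps where "snd ` set ps \<subseteq> F" "lincomb H ps = y" by blast
  then show ?case using step by (intro exI[of _ "(c, x) # ps"]) auto
qed

lemma finite_dim_quotient_iff:
  "finite_dim_quotient H W R \<longleftrightarrow>
    (\<exists>F. finite F \<and> F \<subseteq> W \<and> (\<forall>x\<in>W. \<exists>r\<in>R. \<exists>v\<in>span F. nrm (x - (r + v)) = 0))"
proof -
  have "(\<exists>ps. snd ` set ps \<subseteq> F \<and> nrm (x - (r + lincomb H ps)) = 0) \<longleftrightarrow>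
      (\<exists>v\<in>span F. nrm (x - (r + v)) = 0)" for F x r
    using lincomb_in_span span_imp_lincomb by blast
  then show ?thesis by (simp add: finite_dim_quotient_def)
qed

end

text \<open>The main discrepancy is the kernel: \<open>op_kernel\<close> accepts a null vector as
  image, and closedness of the relation lets it be replaced by 0.\<close>

lemma Fredholm_iff:
  fixes H :: "'h::ab_group_add hspace"
  assumes "semi_inner_hspace H"
    and "selfadjoint_relation (hscale H) (hvec H) (hinner H) S"
  shows "Fredholm H (op_minus_scalar H S z) \<longleftrightarrow>
    selfadjoint_relation.fredholm (hscale H) (hvec H) (hinner H) S z"
proof -
  interpret semi_inner_hspace H by fact
  interpret selfadjoint_relation "hscale H" "hvec H" "hinner H" S by fact
  have shift: "op_minus_scalar H S z = shift z"
    by (simp add: op_minus_scalar_def shift_def)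
  have ker: "op_kernel H (shift z) = eigenspace z"
  proof -
    have "(u, 0) \<in> shift z" if "(u, f) \<in> shift z" "nrm f = 0" for u f
      using that closed_rel_null[OF closed_shift that(1)] shift_V[OF that(1)] by simp
    then show ?thesis
      by (auto simp: op_kernel_def eigenspace_iff intro!: exI[of _ 0])
  qed
  show ?thesis
    unfolding shift Fredholm_def fredholm_def ker finite_dim_quotient_iff
    by (simp add: hclosed_def closed_range_def conj_ac)
qed

lemma (in semi_inner_hspace) Cauchy_seq_bounded:
  assumes X: "\<And>n. X n \<in> hvec H" "Cauchy_seq X"
  obtains B where "B > 0" "\<And>n. nrm (X n) \<le> B"
proof -
  obtain M where M: "\<And>m n. m \<ge> M \<Longrightarrow> n \<ge> M \<Longrightarrow> nrm (X m - X n) < 1"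
    using X(2) unfolding Cauchy_seq_def by (metis zero_less_one)
  define B where "B = (\<Sum>n\<le>M. nrm (X n)) + 1"
  have B0: "0 \<le> (\<Sum>n\<le>M. nrm (X n))" using X by (intro sum_nonneg) auto
  have le: "nrm (X n) \<le> (\<Sum>n\<le>M. nrm (X n))" if "n \<le> M" for n
    using that X by (intro member_le_sum) auto
  have "nrm (X n) \<le> B" for n
  proof (cases "n \<le> M")
    case False
    then show ?thesis
      using nrm_triangle2[OF X(1) X(1), of n M] M[of n M] le[of M] by (simp add: B_def)
  qed (use le in \<open>simp add: B_def add_increasing2\<close>)
  then show ?thesis using that[of B] B0 by (simp add: B_def)
qed

lemma (in semi_inner_hspace) Cauchy_seq_add:
  assumes "\<And>n. X n \<in> hvec H" "\<And>n. Y n \<in> hvec H" "Cauchy_seq X" "Cauchy_seq Y"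
  shows "Cauchy_seq (\<lambda>n. X n + Y n)"
  unfolding Cauchy_seq_def
proof (intro allI impI)
  fix e :: real assume "e > 0"
  then obtain M1 M2 where M: "\<And>m n. m \<ge> M1 \<Longrightarrow> n \<ge> M1 \<Longrightarrow> nrm (X m - X n) < e / 2"
    "\<And>m n. m \<ge> M2 \<Longrightarrow> n \<ge> M2 \<Longrightarrow> nrm (Y m - Y n) < e / 2"
    using assms(3,4) half_gt_zero[OF \<open>e > 0\<close>] unfolding Cauchy_seq_def by meson
  have "nrm (X m + Y m - (X n + Y n)) < e" if "m \<ge> max M1 M2" "n \<ge> max M1 M2" for m n
  proof -
    have "X m + Y m - (X n + Y n) = (X m - X n) + (Y m - Y n)" by (simp add: algebra_simps)
    then have "nrm (X m + Y m - (X n + Y n)) \<le> nrm (X m - X n) + nrm (Y m - Y n)"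
      using nrm_triangle[of "X m - X n" "Y m - Y n"] assms(1,2) by (metis V_diff)
    then show ?thesis using M(1)[of m n] M(2)[of m n] that by simp
  qed
  then show "\<exists>M. \<forall>m\<ge>M. \<forall>n\<ge>M. nrm (X m + Y m - (X n + Y n)) < e" by blast
qed

lemma (in semi_inner_hspace) Cauchy_seq_scale:
  assumes "\<And>n. X n \<in> hvec H" "Cauchy_seq X"
  shows "Cauchy_seq (\<lambda>n. hscale H a (X n))"
  unfolding Cauchy_seq_def
proof (intro allI impI)
  fix e :: real assume "e > 0"
  then have "e / (cmod a + 1) > 0" by (simp add: add_nonneg_pos)
  then obtain M where M: "\<And>m n. m \<ge> M \<Longrightarrow> n \<ge> M \<Longrightarrow> nrm (X m - X n) < e / (cmod a + 1)"
    using assms(2) unfolding Cauchy_seq_def by meson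
  have "nrm (hscale H a (X m) - hscale H a (X n)) < e" if "m \<ge> M" "n \<ge> M" for m n
  proof -
    have "nrm (hscale H a (X m) - hscale H a (X n)) = cmod a * nrm (X m - X n)"
      using assms(1) by (simp add: nrm_scale flip: scale_right_diff_distrib)
    also have "\<dots> \<le> (cmod a + 1) * nrm (X m - X n)"
      using assms(1) by (intro mult_right_mono) auto
    also have "\<dots> < e"
      using M[OF that] by (simp add: pos_less_divide_eq add_nonneg_pos mult.commute)
    finally show ?thesis .
  qed
  then show "\<exists>M. \<forall>m\<ge>M. \<forall>n\<ge>M. nrm (hscale H a (X m) - hscale H a (X n)) < e" by blast
qed

lemma (in semi_inner_hspace) convergent_ip:
  assumes X: "\<And>n. X n \<in> hvec H" "Cauchy_seq X" and Y: "\<And>n. Y n \<in> hvec H" "Cauchy_seq Y"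
  shows "convergent (\<lambda>n. hinner H (X n) (Y n))"
proof (rule Cauchy_convergent, rule CauchyI)
  fix e :: real assume "e > 0"
  obtain A where A: "A > 0" "\<And>n. nrm (X n) \<le> A" using Cauchy_seq_bounded[OF X] by blast
  obtain B where B: "B > 0" "\<And>n. nrm (Y n) \<le> B" using Cauchy_seq_bounded[OF Y] by blast
  obtain M1 where M1: "\<And>m n. m \<ge> M1 \<Longrightarrow> n \<ge> M1 \<Longrightarrow> nrm (X m - X n) < e / (2 * B)"
    using X(2) \<open>e > 0\<close> B(1) unfolding Cauchy_seq_def
    by (metis divide_pos_pos mult_pos_pos zero_less_numeral)
  obtain M2 where M2: "\<And>m n. m \<ge> M2 \<Longrightarrow> n \<ge> M2 \<Longrightarrow> nrm (Y m - Y n) < e / (2 * A)"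
    using Y(2) \<open>e > 0\<close> A(1) unfolding Cauchy_seq_def
    by (metis divide_pos_pos mult_pos_pos zero_less_numeral)
  have "cmod (hinner H (X m) (Y m) - hinner H (X n) (Y n)) < e" if "m \<ge> max M1 M2" "n \<ge> max M1 M2" for m n
  proof -
    have "hinner H (X m) (Y m) - hinner H (X n) (Y n) =
        hinner H (X m - X n) (Y m) + hinner H (X n) (Y m - Y n)"
      using X(1) Y(1) by (simp add: ip_simps)
    also have "cmod \<dots> \<le> cmod (hinner H (X m - X n) (Y m)) + cmod (hinner H (X n) (Y m - Y n))"
      by (rule norm_triangle_ineq)
    also have "cmod (hinner H (X m - X n) (Y m)) \<le> nrm (X m - X n) * nrm (Y m)"
      using X Y by (intro Cauchy_Schwarz_ip) auto
    also have "nrm (X m - X n) * nrm (Y m) \<le> nrm (X m - X n) * B"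
      using X Y B by (intro mult_left_mono) auto
    also have "cmod (hinner H (X n) (Y m - Y n)) \<le> nrm (X n) * nrm (Y m - Y n)"
      using X Y by (intro Cauchy_Schwarz_ip) auto
    also have "nrm (X n) * nrm (Y m - Y n) \<le> A * nrm (Y m - Y n)"
      using X Y A by (intro mult_right_mono) auto
    also have "nrm (X m - X n) * B + A * nrm (Y m - Y n) < e / (2 * B) * B + A * (e / (2 * A))"
      using M1[of m n] M2[of m n] that A(1) B(1)
      by (intro add_strict_mono mult_strict_right_mono mult_strict_left_mono) auto
    also have "\<dots> = e" using A(1) B(1) by simp
    finally show ?thesis by simp
  qed
  then show "\<exists>M. \<forall>m\<ge>M. \<forall>n\<ge>M. norm (hinner H (X m) (Y m) - hinner H (X n) (Y n)) < e" by blast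
qed

lemma (in semi_inner_hspace) semi_inner_hcompletion: "semi_inner_hspace (hcompletion H)"
proof (rule semi_inner_hspace.intro)
  let ?C = "hcompletion H"
  show "hadd ?C = (+)" "hzero ?C = 0"
    by (simp_all add: hcompletion_def fun_eq_iff)
  have sc: "hscale ?C = (\<lambda>a X n. hscale H a (X n))" by (simp add: hcompletion_def)
  have vec: "X \<in> hvec ?C \<longleftrightarrow> (\<forall>n. X n \<in> hvec H) \<and> Cauchy_seq X" for X
    by (simp add: hcompletion_def)
  have inn: "hinner ?C X Y = lim (\<lambda>n. hinner H (X n) (Y n))" for X Y
    by (simp add: hcompletion_def)
  have lim: "(\<lambda>n. hinner H (X n) (Y n)) \<longlonglongrightarrow> hinner ?C X Y" if "X \<in> hvec ?C" "Y \<in> hvec ?C" for X Y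
    unfolding inn convergent_LIMSEQ_iff[symmetric] using that by (intro convergent_ip) (auto simp: vec)
  interpret C: vector_space "hscale ?C"
    by unfold_locales (auto simp: sc fun_eq_iff scale_right_distrib scale_left_distrib)
  have sub: "C.subspace (hvec ?C)"
    unfolding C.subspace_def
  proof (intro conjI ballI allI)
    show "0 \<in> hvec ?C" by (auto simp: vec Cauchy_seq_def)
    show "X + Y \<in> hvec ?C" if "X \<in> hvec ?C" "Y \<in> hvec ?C" for X Y
      using that Cauchy_seq_add[of X Y] by (auto simp: vec plus_fun_def)
    show "hscale ?C a X \<in> hvec ?C" if "X \<in> hvec ?C" for a X
      using that Cauchy_seq_scale[of X a] by (auto simp: vec sc)
  qed
  show "semi_inner (hscale ?C) (hvec ?C) (hinner ?C)"
  proof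
    show "C.subspace (hvec ?C)" by (rule sub)
    fix X assume X: "X \<in> hvec ?C"
    have XV: "X n \<in> hvec H" for n using X by (simp add: vec)
    show "0 \<le> Re (hinner ?C X X)"
      using tendsto_Re[OF lim[OF X X]] by (rule LIMSEQ_le_const) (use XV ip_self_nonneg in auto)
    fix Y assume Y: "Y \<in> hvec ?C"
    have YV: "Y n \<in> hvec H" for n using Y by (simp add: vec)
    have "(\<lambda>n. cnj (hinner H (X n) (Y n))) \<longlonglongrightarrow> cnj (hinner ?C X Y)"
      by (rule tendsto_cnj[OF lim[OF X Y]])
    then have "(\<lambda>n. hinner H (Y n) (X n)) \<longlonglongrightarrow> cnj (hinner ?C X Y)"
      using XV YV by (simp add: cnj_ip)
    then show "cnj (hinner ?C X Y) = hinner ?C Y X"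
      using lim[OF Y X] by (rule LIMSEQ_unique)
    have "(\<lambda>n. a * hinner H (X n) (Y n)) \<longlonglongrightarrow> a * hinner ?C X Y" for a
      by (rule tendsto_mult_left[OF lim[OF X Y]])
    then have "(\<lambda>n. hinner H (X n) (hscale ?C a Y n)) \<longlonglongrightarrow> a * hinner ?C X Y" for a
      using XV YV by (simp add: sc ip_scale_right)
    then show "hinner ?C X (hscale ?C a Y) = a * hinner ?C X Y" for a
      using lim[OF X C.subspace_scale[OF sub Y]] LIMSEQ_unique by blast
    fix W assume W: "W \<in> hvec ?C"
    have WV: "W n \<in> hvec H" for n using W by (simp add: vec)
    have "(\<lambda>n. hinner H (X n) (Y n) + hinner H (X n) (W n)) \<longlonglongrightarrow> hinner ?C X Y + hinner ?C X W"
      by (rule tendsto_add[OF lim[OF X Y] lim[OF X W]])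
    then have "(\<lambda>n. hinner H (X n) ((Y + W) n)) \<longlonglongrightarrow> hinner ?C X Y + hinner ?C X W"
      using XV YV WV by (simp add: ip_add_right)
    then show "hinner ?C X (Y + W) = hinner ?C X Y + hinner ?C X W"
      using lim[OF X C.subspace_add[OF sub Y W]] by (simp add: LIMSEQ_unique)
  qed
qed

lemma (in semi_inner_hspace) hcompletion_const:
  assumes "x \<in> hvec H"
  shows "(\<lambda>_. x) \<in> hvec (hcompletion H)"
  using assms by (simp add: hcompletion_def Cauchy_seq_def)

lemma (in semi_inner_hspace) hinner_hcompletion_const:
  "hinner (hcompletion H) (\<lambda>_. x) (\<lambda>_. y) = hinner H x y"
  by (simp add: hcompletion_def lim_const)

text \<open>A Cauchy sequence of constant sequences converges to the sequence of its values, which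
  is itself an element of the completion. This is the completeness that \<open>form_core\<close>
  asks for.\<close>

lemma (in semi_inner_hspace) hcompletion_complete:
  assumes X: "\<And>n. X n \<in> hvec H"
    and C: "semi_inner.Cauchy_seq (hinner (hcompletion H)) (\<lambda>n _. X n)"
  shows "\<exists>w\<in>hvec (hcompletion H). semi_inner.tends (hinner (hcompletion H)) (\<lambda>n _. X n) w"
proof -
  interpret C: semi_inner_hspace "hcompletion H" by (rule semi_inner_hcompletion)
  have lim: "(\<lambda>n. hinner H (Y n) (Z n)) \<longlonglongrightarrow> hinner (hcompletion H) Y Z"
    if "Y \<in> hvec (hcompletion H)" "Z \<in> hvec (hcompletion H)" for Y Z
  proof -
    have "convergent (\<lambda>n. hinner H (Y n) (Z n))"
      using that by (intro convergent_ip) (auto simp: hcompletion_def)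
    then show ?thesis by (simp add: hcompletion_def convergent_LIMSEQ_iff)
  qed
  have Cn: "C.nrm ((\<lambda>_. x) - (\<lambda>_. y)) = nrm (x - y)" for x y
    by (simp add: C.nrm_def nrm_def hinner_hcompletion_const fun_diff_def)
  have CX: "Cauchy_seq X"
    using C unfolding C.Cauchy_seq_def Cauchy_seq_def Cn .
  have XC: "X \<in> hvec (hcompletion H)"
    using X CX by (simp add: hcompletion_def)
  have "C.tends (\<lambda>n _. X n) X"
    unfolding C.tends_def
  proof (rule LIMSEQ_I)
    fix e :: real assume "e > 0"
    then obtain M where M: "\<And>m n. m \<ge> M \<Longrightarrow> n \<ge> M \<Longrightarrow> nrm (X m - X n) < e / 2"
      using CX half_gt_zero[OF \<open>e > 0\<close>] unfolding Cauchy_seq_def by meson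
    have "C.nrm ((\<lambda>_. X m) - X) \<le> e / 2" if m: "m \<ge> M" for m
    proof (rule power2_le_imp_le)
      have V: "(\<lambda>_. X m) - X \<in> hvec (hcompletion H)"
        using XC hcompletion_const[OF X] by simp
      have "(\<lambda>n. Re (hinner H (((\<lambda>_. X m) - X) n) (((\<lambda>_. X m) - X) n))) \<longlonglongrightarrow> (C.nrm ((\<lambda>_. X m) - X))\<^sup>2"
        using tendsto_Re[OF lim[OF V V]] V by (simp only: C.nrm_power2)
      then have "(\<lambda>n. (nrm (X m - X n))\<^sup>2) \<longlonglongrightarrow> (C.nrm ((\<lambda>_. X m) - X))\<^sup>2"
        using X by (simp add: nrm_power2)
      moreover have "(nrm (X m - X n))\<^sup>2 \<le> (e / 2)\<^sup>2" if "n \<ge> M" for n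
        using M[OF m that] X by (intro power_mono) auto
      ultimately show "(C.nrm ((\<lambda>_. X m) - X))\<^sup>2 \<le> (e / 2)\<^sup>2"
        by (intro LIMSEQ_le_const2) auto
    qed (use \<open>e > 0\<close> in simp)
    moreover have "0 \<le> C.nrm ((\<lambda>_. X n) - X)" for n
      using XC hcompletion_const[OF X] by simp
    ultimately show "\<exists>no. \<forall>n\<ge>no. norm (C.nrm ((\<lambda>_. X n) - X) - 0) < e"
      using \<open>e > 0\<close> by (intro exI[of _ M]) (force intro: order_le_less_trans)
  qed
  then show ?thesis using XC by blast
qed

section \<open>Square-integrable functions\<close>

lemma L2_vec_iff: "f \<in> hvec (L2 \<mu>) \<longleftrightarrow> f \<in> borel_measurable \<mu> \<and> integrable \<mu> (\<lambda>x. (cmod (f x))\<^sup>2)"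
  by (simp add: L2_def)

lemma hinner_L2: "hinner (L2 \<mu>) f g = (LINT x|\<mu>. cnj (f x) * g x)"
  by (simp add: L2_def)

lemma hscale_L2: "hscale (L2 \<mu>) a f = (\<lambda>x. a * f x)"
  by (simp add: L2_def)

lemma L2_product_integrable:
  assumes "f \<in> hvec (L2 \<mu>)" "g \<in> hvec (L2 \<mu>)"
  shows "integrable \<mu> (\<lambda>x. cnj (f x) * g x)"
proof (rule Bochner_Integration.integrable_bound)
  show "integrable \<mu> (\<lambda>x. (cmod (f x))\<^sup>2 + (cmod (g x))\<^sup>2)"
    using assms by (simp add: L2_vec_iff)
  have [measurable]: "f \<in> borel_measurable \<mu>" "g \<in> borel_measurable \<mu>"
    using assms by (simp_all add: L2_vec_iff)
  have "(\<lambda>x. cnj (f x)) \<in> borel_measurable \<mu>"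
    by (rule borel_measurable_continuous_on[OF continuous_on_cnj[OF continuous_on_id]]) simp
  then show "(\<lambda>x. cnj (f x) * g x) \<in> borel_measurable \<mu>"
    by measurable
  have "cmod (f x) * cmod (g x) \<le> (cmod (f x))\<^sup>2 + (cmod (g x))\<^sup>2" for x
    using sum_squares_bound[of "cmod (f x)" "cmod (g x)"]
      mult_nonneg_nonneg[OF norm_ge_zero norm_ge_zero, of "f x" "g x"]
    unfolding mult.assoc by linarith
  then show "AE x in \<mu>. norm (cnj (f x) * g x) \<le> norm ((cmod (f x))\<^sup>2 + (cmod (g x))\<^sup>2)"
    by (simp add: norm_mult)
qed

lemma L2_add_closed:
  assumes "f \<in> hvec (L2 \<mu>)" "g \<in> hvec (L2 \<mu>)"
  shows "(\<lambda>x. f x + g x) \<in> hvec (L2 \<mu>)"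
  unfolding L2_vec_iff
proof
  have [measurable]: "f \<in> borel_measurable \<mu>" "g \<in> borel_measurable \<mu>"
    using assms by (simp_all add: L2_vec_iff)
  show "(\<lambda>x. f x + g x) \<in> borel_measurable \<mu>"
    by measurable
  show "integrable \<mu> (\<lambda>x. (cmod (f x + g x))\<^sup>2)"
  proof (rule Bochner_Integration.integrable_bound)
    show "(\<lambda>x. (cmod (f x + g x))\<^sup>2) \<in> borel_measurable \<mu>"
      by measurable
    show "integrable \<mu> (\<lambda>x. 2 * (cmod (f x))\<^sup>2 + 2 * (cmod (g x))\<^sup>2)"
      using assms by (simp add: L2_vec_iff)
    have "(cmod (f x + g x))\<^sup>2 \<le> 2 * (cmod (f x))\<^sup>2 + 2 * (cmod (g x))\<^sup>2" for x
    proof -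
      have "(cmod (f x + g x))\<^sup>2 \<le> (cmod (f x) + cmod (g x))\<^sup>2"
        by (intro power_mono norm_triangle_ineq) auto
      also have "\<dots> \<le> 2 * (cmod (f x))\<^sup>2 + 2 * (cmod (g x))\<^sup>2"
        using sum_squares_bound[of "cmod (f x)" "cmod (g x)"] by (simp add: power2_sum)
      finally show ?thesis .
    qed
    then show "AE x in \<mu>. norm ((cmod (f x + g x))\<^sup>2) \<le> norm (2 * (cmod (f x))\<^sup>2 + 2 * (cmod (g x))\<^sup>2)"
      by simp
  qed
qed

lemma L2_scale_closed: "f \<in> hvec (L2 \<mu>) \<Longrightarrow> (\<lambda>x. a * f x) \<in> hvec (L2 \<mu>)"
  by (auto simp: L2_vec_iff norm_mult power_mult_distrib)

lemma semi_inner_L2: "semi_inner_hspace (L2 \<mu>)"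
proof (rule semi_inner_hspace.intro)
  show "hadd (L2 \<mu>) = (+)" "hzero (L2 \<mu>) = 0"
    by (simp_all add: L2_def fun_eq_iff)
  interpret vector_space "hscale (L2 \<mu>)"
    by unfold_locales (auto simp: hscale_L2 fun_eq_iff algebra_simps)
  show "semi_inner (hscale (L2 \<mu>)) (hvec (L2 \<mu>)) (hinner (L2 \<mu>))"
  proof
    show "subspace (hvec (L2 \<mu>))"
      unfolding subspace_def hscale_L2
    proof (intro conjI ballI allI)
      show "0 \<in> hvec (L2 \<mu>)" by (simp add: L2_vec_iff zero_fun_def)
      show "f + g \<in> hvec (L2 \<mu>)" if "f \<in> hvec (L2 \<mu>)" "g \<in> hvec (L2 \<mu>)" for f g
        using L2_add_closed[OF that] by (simp add: plus_fun_def)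
    qed (rule L2_scale_closed)
    fix f assume f: "f \<in> hvec (L2 \<mu>)"
    have sq: "cnj (f x) * f x = of_real ((cmod (f x))\<^sup>2)" for x
      by (simp add: complex_norm_square mult.commute del: of_real_power)
    show "0 \<le> Re (hinner (L2 \<mu>) f f)"
      unfolding hinner_L2 sq by (simp del: of_real_power)
    fix g assume g: "g \<in> hvec (L2 \<mu>)"
    show "cnj (hinner (L2 \<mu>) f g) = hinner (L2 \<mu>) g f"
      using Bochner_Integration.integral_cnj[of \<mu> "\<lambda>x. cnj (f x) * g x"] unfolding hinner_L2 by (simp add: mult.commute)
    show "hinner (L2 \<mu>) f (hscale (L2 \<mu>) a g) = a * hinner (L2 \<mu>) f g" for a
      unfolding hinner_L2 hscale_L2 by (simp add: mult.left_commute)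
    fix h assume h: "h \<in> hvec (L2 \<mu>)"
    show "hinner (L2 \<mu>) f (g + h) = hinner (L2 \<mu>) f g + hinner (L2 \<mu>) f h"
      using L2_product_integrable[OF f g] L2_product_integrable[OF f h]
      by (simp add: hinner_L2 distrib_left)
  qed
qed

lemma nrm_L2_power2:
  assumes "f \<in> hvec (L2 \<mu>)"
  shows "(semi_inner.nrm (hinner (L2 \<mu>)) f)\<^sup>2 = (LINT x|\<mu>. (cmod (f x))\<^sup>2)"
proof -
  interpret semi_inner_hspace "L2 \<mu>" by (rule semi_inner_L2)
  have sq: "cnj (f x) * f x = of_real ((cmod (f x))\<^sup>2)" for x
    by (simp add: complex_norm_square mult.commute del: of_real_power)
  show ?thesis
    unfolding nrm_power2[OF assms] hinner_L2 sq by (simp del: of_real_power)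
qed

lemma nn_integral_L2:
  assumes "f \<in> hvec (L2 \<mu>)"
  shows "(\<integral>\<^sup>+x. ennreal ((cmod (f x))\<^sup>2) \<partial>\<mu>) = ennreal ((semi_inner.nrm (hinner (L2 \<mu>)) f)\<^sup>2)"
  using assms by (simp add: nrm_L2_power2 nn_integral_eq_integral L2_vec_iff)

text \<open>Riesz-Fischer: a subsequence with rapidly decreasing increments converges almost
  everywhere, and Fatou's lemma bounds the distance to the pointwise limit.\<close>

lemma L2_complete: "complete_semi_inner (hscale (L2 \<mu>)) (hvec (L2 \<mu>)) (hinner (L2 \<mu>))"
proof -
  interpret semi_inner_hspace "L2 \<mu>" by (rule semi_inner_L2)
  have "\<exists>f\<in>hvec (L2 \<mu>). tends X f" if X: "\<And>n. X n \<in> hvec (L2 \<mu>)" and C: "Cauchy_seq X" for X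
  proof -
    have meas [measurable]: "X n \<in> borel_measurable \<mu>" for n using X by (simp add: L2_vec_iff)
    have "\<exists>M. \<forall>m\<ge>M. \<forall>n\<ge>M. nrm (X m - X n) < (1/2) ^ k" for k
      using C unfolding Cauchy_seq_def by simp
    then obtain M where M: "\<And>k m n. m \<ge> M k \<Longrightarrow> n \<ge> M k \<Longrightarrow> nrm (X m - X n) < (1/2) ^ k"
      by metis
    \<comment> \<open>Partial sums are monotone in \<open>k\<close> and dominate each
      \<open>M k\<close>.\<close>
    define r where "r k = (\<Sum>i\<le>k. M i)" for k
    have rM: "r k \<ge> M k" for k unfolding r_def by (rule member_le_sum) auto
    have r_mono: "r k \<le> r j" if "k \<le> j" for k j
      unfolding r_def using that by (intro sum_mono2) auto
    define D where "D k x = (cmod (X (r (Suc k)) x - X (r k) x))\<^sup>2" for k x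
    have D_meas [measurable]: "D k \<in> borel_measurable \<mu>" for k
      unfolding D_def by measurable
    have D_int: "(\<integral>\<^sup>+x. ennreal (D k x) \<partial>\<mu>) \<le> ennreal ((1/4) ^ k)" for k
    proof -
      have "(\<integral>\<^sup>+x. ennreal (D k x) \<partial>\<mu>) = ennreal ((nrm (X (r (Suc k)) - X (r k)))\<^sup>2)"
        using nn_integral_L2[of "X (r (Suc k)) - X (r k)"] X by (simp add: D_def)
      also have "(nrm (X (r (Suc k)) - X (r k)))\<^sup>2 \<le> ((1/2) ^ k)\<^sup>2"
        using M[of k "r (Suc k)" "r k"] rM[of k] r_mono[of k "Suc k"] X
        by (intro power_mono) (auto intro: less_imp_le)
      also have "((1/2::real) ^ k)\<^sup>2 = (1/4) ^ k"
        by (simp add: power_mult[symmetric] mult.commute[of k 2]) (simp add: power_mult power2_eq_square)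
      finally show ?thesis by (simp add: ennreal_leI)
    qed
    have "(\<integral>\<^sup>+x. (\<Sum>k. ennreal (2 ^ k * D k x)) \<partial>\<mu>) = (\<Sum>k. \<integral>\<^sup>+x. ennreal (2 ^ k * D k x) \<partial>\<mu>)"
      by (intro nn_integral_suminf) measurable
    \<comment> \<open>The weight \<open>2 ^ k\<close> is small enough to keep the sum of the
      integrals finite and large enough to force geometric decay of \<open>D k x\<close> at almost
      every point, so that the increments themselves are summable there.\<close>
    also have "\<dots> \<le> (\<Sum>k. ennreal ((1/2) ^ k))"
    proof (rule suminf_le)
      fix k
      have "(\<integral>\<^sup>+x. ennreal (2 ^ k * D k x) \<partial>\<mu>) = ennreal (2 ^ k) * (\<integral>\<^sup>+x. ennreal (D k x) \<partial>\<mu>)"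
        by (subst nn_integral_cmult[symmetric]) (auto simp: ennreal_mult D_def)
      also have "\<dots> \<le> ennreal (2 ^ k) * ennreal ((1/4) ^ k)"
        by (intro mult_left_mono D_int) auto
      also have "\<dots> = ennreal ((1/2) ^ k)"
        by (simp add: ennreal_mult[symmetric] power_mult_distrib[symmetric])
      finally show "(\<integral>\<^sup>+x. ennreal (2 ^ k * D k x) \<partial>\<mu>) \<le> ennreal ((1/2) ^ k)" .
    qed auto
    also have "\<dots> = ennreal (\<Sum>k. (1/2) ^ k)"
      by (rule suminf_ennreal2[OF _ summable_geometric]) auto
    also have "\<dots> < \<infinity>"
      by (simp only: ennreal_less_top infinity_ennreal_def)
    finally have "AE x in \<mu>. (\<Sum>k. ennreal (2 ^ k * D k x)) \<noteq> \<infinity>"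
      by (intro nn_integral_noteq_infinite) auto
    then have conv: "AE x in \<mu>. convergent (\<lambda>k. X (r k) x)"
    proof (eventually_elim)
      fix x assume fin: "(\<Sum>k. ennreal (2 ^ k * D k x)) \<noteq> \<infinity>"
      obtain c where c: "c \<ge> 0" "(\<Sum>k. ennreal (2 ^ k * D k x)) = ennreal c"
        using fin by (cases "\<Sum>k. ennreal (2 ^ k * D k x)") auto
      have "2 ^ k * D k x \<le> c" for k
      proof -
        have "ennreal (2 ^ k * D k x) \<le> (\<Sum>k. ennreal (2 ^ k * D k x))"
          using sum_le_suminf[of "\<lambda>k. ennreal (2 ^ k * D k x)" "{k}"] by simp
        then show ?thesis using c by simp
      qed
      then have le: "cmod (X (r (Suc k)) x - X (r k) x) \<le> sqrt c * (sqrt (1/2)) ^ k" for k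
      proof -
        have "(cmod (X (r (Suc k)) x - X (r k) x))\<^sup>2 \<le> c * (1/2) ^ k"
          using \<open>\<And>k. 2 ^ k * D k x \<le> c\<close>[of k] by (simp add: D_def field_simps)
        also have "\<dots> = (sqrt c * (sqrt (1/2)) ^ k)\<^sup>2"
          using c(1) by (simp add: power_mult_distrib power_mult[symmetric] mult.commute[of k 2])
            (simp add: power_mult power_divide)
        finally show ?thesis
          by (rule power2_le_imp_le) (use c(1) in simp)
      qed
      have "summable (\<lambda>k. sqrt c * (sqrt (1/2)) ^ k)"
        by (intro summable_mult summable_geometric) simp
      then have "summable (\<lambda>k. X (r (Suc k)) x - X (r k) x)"
        by (rule summable_comparison_test'[where N = 0]) (use le in auto)
      then have "convergent (\<lambda>n. \<Sum>k<n. X (r (Suc k)) x - X (r k) x)"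
        by (simp add: summable_iff_convergent)
      then have "convergent (\<lambda>n. X (r n) x - X (r 0) x)"
        using sum_lessThan_telescope[of "\<lambda>k. X (r k) x"] by simp
      from convergent_add[OF this convergent_const[of "X (r 0) x"]]
      show "convergent (\<lambda>k. X (r k) x)"
        by simp
    qed
    \<comment> \<open>Where the subsequence diverges this value is arbitrary, which concerns a null
      set.\<close>
    define f where "f x = lim (\<lambda>k. X (r k) x)" for x
    have f_meas [measurable]: "f \<in> borel_measurable \<mu>"
      unfolding f_def by measurable
    have lim: "AE x in \<mu>. (\<lambda>k. X (r k) x) \<longlonglongrightarrow> f x"
      using conv unfolding f_def by (auto simp: convergent_LIMSEQ_iff)
    \<comment> \<open>The comparison is with every \<open>n\<close> beyond \<open>r k\<close>, so
      convergence follows for the whole sequence and not just for the subsequence.\<close>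
    have fatou: "(\<integral>\<^sup>+x. ennreal ((cmod (X n x - f x))\<^sup>2) \<partial>\<mu>) \<le> ennreal (((1/2) ^ k)\<^sup>2)" if n: "n \<ge> r k" for n k
    proof -
      have "(\<integral>\<^sup>+x. ennreal ((cmod (X n x - f x))\<^sup>2) \<partial>\<mu>)
          = (\<integral>\<^sup>+x. liminf (\<lambda>j. ennreal ((cmod (X n x - X (r j) x))\<^sup>2)) \<partial>\<mu>)"
      proof (rule nn_integral_cong_AE, use lim in eventually_elim)
        fix x assume "(\<lambda>k. X (r k) x) \<longlonglongrightarrow> f x"
        then have "(\<lambda>j. ennreal ((cmod (X n x - X (r j) x))\<^sup>2)) \<longlonglongrightarrow> ennreal ((cmod (X n x - f x))\<^sup>2)"
          by (intro tendsto_ennrealI tendsto_power tendsto_norm tendsto_diff tendsto_const)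
        then show "ennreal ((cmod (X n x - f x))\<^sup>2) = liminf (\<lambda>j. ennreal ((cmod (X n x - X (r j) x))\<^sup>2))"
          by (intro lim_imp_Liminf[symmetric] trivial_limit_sequentially)
      qed
      also have "\<dots> \<le> liminf (\<lambda>j. \<integral>\<^sup>+x. ennreal ((cmod (X n x - X (r j) x))\<^sup>2) \<partial>\<mu>)"
        by (intro nn_integral_liminf) measurable
      also have "\<dots> \<le> liminf (\<lambda>j. ennreal (((1/2) ^ k)\<^sup>2))"
      proof (rule Liminf_mono, rule eventually_sequentiallyI[of k])
        fix j assume "j \<ge> k"
        have "(\<integral>\<^sup>+x. ennreal ((cmod (X n x - X (r j) x))\<^sup>2) \<partial>\<mu>) = ennreal ((nrm (X n - X (r j)))\<^sup>2)"
          using nn_integral_L2[of "X n - X (r j)"] X by simp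
        also have "\<dots> \<le> ennreal (((1/2) ^ k)\<^sup>2)"
          using M[of k n "r j"] rM[of k] r_mono[OF \<open>j \<ge> k\<close>] n X
          by (intro ennreal_leI power_mono) (auto intro: less_imp_le)
        finally show "(\<integral>\<^sup>+x. ennreal ((cmod (X n x - X (r j) x))\<^sup>2) \<partial>\<mu>) \<le> ennreal (((1/2) ^ k)\<^sup>2)" .
      qed
      also have "\<dots> = ennreal (((1/2) ^ k)\<^sup>2)"
        by (simp add: Liminf_const)
      finally show ?thesis .
    qed
    have diff: "X n - f \<in> hvec (L2 \<mu>)" if "n \<ge> r 0" for n
      using fatou[of 0 n] that unfolding L2_vec_iff fun_diff_def
      by (auto intro!: integrableI_bounded simp: le_less_trans ennreal_less_top)
    \<comment> \<open>Square-integrability of \<open>f\<close> is obtained from that of a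
      difference, to which Fatou's bound applies.\<close>
    have "X (r 0) - (X (r 0) - f) \<in> hvec (L2 \<mu>)"
      by (intro V_diff X diff order_refl)
    then have fV: "f \<in> hvec (L2 \<mu>)" by (simp add: fun_diff_def)
    have "tends X f"
      unfolding tends_def
    proof (rule LIMSEQ_I)
      fix e :: real assume "e > 0"
      obtain k where k: "(1/2) ^ k < e"
        using real_arch_pow_inv[OF \<open>e > 0\<close>, of "1/2"] by auto
      have "nrm (X n - f) \<le> (1/2) ^ k" if "n \<ge> r k" for n
      proof (rule power2_le_imp_le)
        have "ennreal ((nrm (X n - f))\<^sup>2) \<le> ennreal (((1/2) ^ k)\<^sup>2)"
          using fatou[OF that] nn_integral_L2[of "X n - f"] X fV by simp
        then show "(nrm (X n - f))\<^sup>2 \<le> ((1/2) ^ k)\<^sup>2" by simp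
      qed simp
      then show "\<exists>no. \<forall>n\<ge>no. norm (nrm (X n - f) - 0) < e"
        using k X fV by (intro exI[of _ "r k"]) (force intro: order_le_less_trans)
    qed
    then show ?thesis using fV by blast
  qed
  note * = this
  show ?thesis
  proof (intro complete_semi_inner.intro semi_inner complete_semi_inner_axioms.intro)
    fix X assume X: "\<And>n. X n \<in> hvec (L2 \<mu>)" "Cauchy_seq X"
    show "\<exists>x\<in>hvec (L2 \<mu>). tends X x" by (rule *[OF X])
  qed
qed

section \<open>The Poincare inequality and Rellich's theorem in a box\<close>

lemma nn_integral_lborel_affine:
  fixes G :: "'e::euclidean_space \<Rightarrow> ennreal"
  assumes G [measurable]: "G \<in> borel_measurable borel" and s: "s > 0"
  shows "(\<integral>\<^sup>+y. G (a + s *\<^sub>R y) \<partial>lborel) = ennreal (1 / s ^ DIM('e)) * (\<integral>\<^sup>+y. G y \<partial>lborel)"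
proof -
  have "(\<integral>\<^sup>+y. G y \<partial>lborel) = (\<integral>\<^sup>+y. G y \<partial>(density (distr lborel borel (\<lambda>x. a + s *\<^sub>R x)) (\<lambda>_. ennreal (\<bar>s\<bar> ^ DIM('e)))))"
    using lborel_affine[of s a] s by (metis less_irrefl)
  also have "\<dots> = (\<integral>\<^sup>+y. ennreal (s ^ DIM('e)) * G (a + s *\<^sub>R y) \<partial>lborel)"
    using s by (simp add: nn_integral_density nn_integral_distr)
  also have "\<dots> = ennreal (s ^ DIM('e)) * (\<integral>\<^sup>+y. G (a + s *\<^sub>R y) \<partial>lborel)"
    by (rule nn_integral_cmult) measurable
  finally have "ennreal (1 / s ^ DIM('e)) * (\<integral>\<^sup>+y. G y \<partial>lborel) =
      (ennreal (1 / s ^ DIM('e)) * ennreal (s ^ DIM('e))) * (\<integral>\<^sup>+y. G (a + s *\<^sub>R y) \<partial>lborel)"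
    by (simp add: mult.assoc)
  also have "ennreal (1 / s ^ DIM('e)) * ennreal (s ^ DIM('e)) = 1"
    using s by (simp flip: ennreal_mult)
  finally show ?thesis by simp
qed

text \<open>The fundamental theorem of calculus along the segment from \<open>x\<close> to
  \<open>y\<close>, followed by the Cauchy-Schwarz inequality on the unit interval. Nonnegative
  integrals on the right side let Fubini's theorem apply later.\<close>

lemma increment_square_le:
  fixes u :: "'e::euclidean_space \<Rightarrow> real" and D :: "'e \<Rightarrow> 'e \<Rightarrow>\<^sub>L real"
  assumes Q: "convex Q" and xy: "x \<in> Q" "y \<in> Q"
    and deriv: "\<And>p. p \<in> Q \<Longrightarrow> (u has_derivative blinfun_apply (D p)) (at p)"
    and cont: "continuous_on Q D"
  shows "ennreal ((u x - u y)\<^sup>2) \<le> ennreal ((norm (y - x))\<^sup>2) *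
    (\<integral>\<^sup>+t. ennreal ((norm (D ((1 - t) *\<^sub>R x + t *\<^sub>R y)))\<^sup>2) * indicator {0..1} t \<partial>lborel)"
proof -
  define \<gamma> where "\<gamma> t = (1 - t) *\<^sub>R x + t *\<^sub>R y" for t :: real
  define f where "f t = blinfun_apply (D (\<gamma> t)) (y - x)" for t
  define c where "c = u y - u x"
  have \<gamma>Q: "\<gamma> t \<in> Q" if "t \<in> {0..1}" for t
    using Q xy that unfolding \<gamma>_def by (auto intro: convexD)
  have D_cont: "continuous_on {0..1} (\<lambda>t. D (\<gamma> t))"
    by (rule continuous_on_compose2[OF cont]) (use \<gamma>Q in \<open>auto simp: \<gamma>_def intro!: continuous_intros\<close>)
  have f_cont: "continuous_on {0..1} f"
    unfolding f_def using D_cont by (intro continuous_intros)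
  have FTC: "(\<integral>t. indicator {0..1} t *\<^sub>R f t \<partial>lborel) = (u \<circ> \<gamma>) 1 - (u \<circ> \<gamma>) 0"
  proof (rule integral_FTC_Icc)
    fix t :: real assume t: "0 \<le> t" "t \<le> 1"
    have "(\<gamma> has_vector_derivative (y - x)) (at t within {0..1})"
      unfolding \<gamma>_def by (auto intro!: derivative_eq_intros simp: algebra_simps)
    moreover have "t \<in> {0..1}" using t by simp
    from has_derivative_at_withinI[OF deriv[OF \<gamma>Q[OF this]]]
    have "(u has_derivative blinfun_apply (D (\<gamma> t))) (at (\<gamma> t) within \<gamma> ` {0..1})" .
    ultimately show "(u \<circ> \<gamma> has_vector_derivative f t) (at t within {0..1})"
      unfolding f_def by (rule vector_derivative_diff_chain_within)
  qed (use f_cont in auto)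
  have int: "integrable lborel (\<lambda>t. indicator {0..1} t *\<^sub>R h t)" if "continuous_on {0..1} h" for h :: "real \<Rightarrow> real"
    using borel_integrable_atLeastAtMost'[OF that] by (simp add: set_integrable_def)
  have f2: "integrable lborel (\<lambda>t. indicator {0..1} t *\<^sub>R (f t)\<^sup>2)"
    by (intro int continuous_intros f_cont)
  have one: "(\<integral>t. indicator {0..1} (t::real) *\<^sub>R (1::real) \<partial>lborel) = 1" "integrable lborel (\<lambda>t::real. indicator {0..1} t *\<^sub>R (1::real))"
    using content_real[of 0 1] int[of "\<lambda>_. 1", OF continuous_on_const] by auto
  \<comment> \<open>The Cauchy-Schwarz inequality in variance form: \<open>c\<close> is the mean of
    \<open>f\<close> on the interval.\<close>
  have "0 \<le> (\<integral>t. indicator {0..1} t *\<^sub>R (f t - c)\<^sup>2 \<partial>lborel)"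
    by (intro integral_nonneg_AE) auto
  also have "(\<integral>t. indicator {0..1} t *\<^sub>R (f t - c)\<^sup>2 \<partial>lborel) =
      (\<integral>t. indicator {0..1} t *\<^sub>R (f t)\<^sup>2 - (2 * c) * (indicator {0..1} t *\<^sub>R f t) + c\<^sup>2 * (indicator {0..1} t *\<^sub>R 1) \<partial>lborel)"
    by (intro Bochner_Integration.integral_cong) (auto simp: power2_diff algebra_simps indicator_def)
  also have "\<dots> = (\<integral>t. indicator {0..1} t *\<^sub>R (f t)\<^sup>2 \<partial>lborel) - (2 * c) * c + c\<^sup>2 * 1"
  proof -
    have "(\<integral>t. A t - k * B t + l * C t \<partial>lborel) = (\<integral>t. A t \<partial>lborel) - k * (\<integral>t. B t \<partial>lborel) + l * (\<integral>t. C t \<partial>lborel)"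
      if "integrable lborel A" "integrable lborel B" "integrable lborel C" for A B C :: "real \<Rightarrow> real" and k l
      using that by simp
    moreover have "(\<integral>t. indicator {0..1} t *\<^sub>R f t \<partial>lborel) = c"
      using FTC by (simp add: c_def \<gamma>_def)
    ultimately show ?thesis
      using f2 int[OF f_cont] one by (simp only:)
  qed
  finally have "c\<^sup>2 \<le> (\<integral>t. indicator {0..1} t *\<^sub>R (f t)\<^sup>2 \<partial>lborel)"
    by (simp add: power2_eq_square)
  then have "ennreal (c\<^sup>2) \<le> ennreal (\<integral>t. indicator {0..1} t *\<^sub>R (f t)\<^sup>2 \<partial>lborel)"
    by (rule ennreal_leI)
  also have "\<dots> = (\<integral>\<^sup>+t. ennreal (indicator {0..1} t *\<^sub>R (f t)\<^sup>2) \<partial>lborel)"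
    by (rule nn_integral_eq_integral[symmetric, OF f2]) auto
  also have "\<dots> \<le> (\<integral>\<^sup>+t. ennreal ((norm (y - x))\<^sup>2) * (ennreal ((norm (D (\<gamma> t)))\<^sup>2) * indicator {0..1} t) \<partial>lborel)"
  proof (rule nn_integral_mono)
    fix t :: real
    have "\<bar>f t\<bar> \<le> norm (D (\<gamma> t)) * norm (y - x)"
      unfolding f_def using norm_blinfun[of "D (\<gamma> t)" "y - x"] by simp
    then have "(f t)\<^sup>2 \<le> (norm (D (\<gamma> t)) * norm (y - x))\<^sup>2"
      by (metis abs_ge_zero power2_abs power_mono)
    then show "ennreal (indicator {0..1} t *\<^sub>R (f t)\<^sup>2) \<le> ennreal ((norm (y - x))\<^sup>2) * (ennreal ((norm (D (\<gamma> t)))\<^sup>2) * indicator {0..1} t)"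
      by (auto simp: indicator_def power_mult_distrib mult.commute ennreal_leI simp flip: ennreal_mult)
  qed
  also have "\<dots> = ennreal ((norm (y - x))\<^sup>2) * (\<integral>\<^sup>+t. ennreal ((norm (D (\<gamma> t)))\<^sup>2) * indicator {0..1} t \<partial>lborel)"
  proof (rule nn_integral_cmult)
    have "continuous_on {0..1} (\<lambda>t. (norm (D (\<gamma> t)))\<^sup>2)"
      by (intro continuous_intros D_cont)
    then have "(\<lambda>t. (norm (D (\<gamma> t)))\<^sup>2 * indicator {0..1} t) \<in> borel_measurable lborel"
      using borel_measurable_continuous_on_indicator[of "{0..1::real}" "\<lambda>t. (norm (D (\<gamma> t)))\<^sup>2"]
      by (simp add: mult.commute)
    then have "(\<lambda>t. ennreal ((norm (D (\<gamma> t)))\<^sup>2 * indicator {0..1} t)) \<in> borel_measurable lborel"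
      by measurable
    moreover have "ennreal ((norm (D (\<gamma> t)))\<^sup>2 * indicator {0..1} t) = ennreal ((norm (D (\<gamma> t)))\<^sup>2) * indicator {0..1} t" for t
      by (simp add: indicator_def)
    ultimately show "(\<lambda>t. ennreal ((norm (D (\<gamma> t)))\<^sup>2) * indicator {0..1} t) \<in> borel_measurable lborel"
      by simp
  qed
  finally show ?thesis
    by (simp add: c_def \<gamma>_def power2_commute)
qed

text \<open>In a convex combination of \<open>x\<close> and \<open>y\<close> one of the two weights is at least \<open>1/2\<close>, and
  the integral over the corresponding point is estimated by dilation.\<close>

lemma nn_integral_convex_combination_le:
  fixes G :: "'e::euclidean_space \<Rightarrow> ennreal"
  assumes G [measurable]: "G \<in> borel_measurable borel" and Q [measurable]: "Q \<in> sets borel"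
    and t: "0 \<le> t" "t \<le> 1"
  shows "(\<integral>\<^sup>+x. \<integral>\<^sup>+y. indicator Q x * indicator Q y * G ((1 - t) *\<^sub>R x + t *\<^sub>R y) \<partial>lborel \<partial>lborel)
    \<le> 2 ^ DIM('e) * emeasure lborel Q * (\<integral>\<^sup>+x. G x \<partial>lborel)"
proof -
  have bound: "(\<integral>\<^sup>+x. \<integral>\<^sup>+y. indicator Q x * indicator Q y * G ((1 - s) *\<^sub>R x + s *\<^sub>R y) \<partial>lborel \<partial>lborel)
    \<le> 2 ^ DIM('e) * emeasure lborel Q * (\<integral>\<^sup>+x. G x \<partial>lborel)" if s: "1/2 \<le> s" "s \<le> 1" for s :: real
  proof -
    have "(\<integral>\<^sup>+y. indicator Q x * indicator Q y * G ((1 - s) *\<^sub>R x + s *\<^sub>R y) \<partial>lborel)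
        \<le> indicator Q x * (2 ^ DIM('e) * (\<integral>\<^sup>+x. G x \<partial>lborel))" for x
    proof -
      have "(\<integral>\<^sup>+y. indicator Q x * indicator Q y * G ((1 - s) *\<^sub>R x + s *\<^sub>R y) \<partial>lborel)
          \<le> (\<integral>\<^sup>+y. indicator Q x * G ((1 - s) *\<^sub>R x + s *\<^sub>R y) \<partial>lborel)"
        by (intro nn_integral_mono) (auto simp: indicator_def)
      also have "\<dots> = indicator Q x * (ennreal (1 / s ^ DIM('e)) * (\<integral>\<^sup>+x. G x \<partial>lborel))"
        using s by (subst nn_integral_cmult) (auto simp: nn_integral_lborel_affine)
      also have "\<dots> \<le> indicator Q x * (2 ^ DIM('e) * (\<integral>\<^sup>+x. G x \<partial>lborel))"
      proof (intro mult_left_mono mult_right_mono)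
        have "1 / s ^ DIM('e) \<le> 2 ^ DIM('e)"
          using power_mono[of "1 / s" 2 "DIM('e)"] s by (simp add: power_one_over field_simps)
        then have "ennreal (1 / s ^ DIM('e)) \<le> ennreal (2 ^ DIM('e))"
          by (rule ennreal_leI)
        then show "ennreal (1 / s ^ DIM('e)) \<le> 2 ^ DIM('e)"
          by (simp add: ennreal_power[symmetric])
      qed auto
      finally show ?thesis .
    qed
    then have "(\<integral>\<^sup>+x. \<integral>\<^sup>+y. indicator Q x * indicator Q y * G ((1 - s) *\<^sub>R x + s *\<^sub>R y) \<partial>lborel \<partial>lborel)
        \<le> (\<integral>\<^sup>+x. indicator Q x * (2 ^ DIM('e) * (\<integral>\<^sup>+x. G x \<partial>lborel)) \<partial>lborel)"
      by (intro nn_integral_mono)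
    also have "\<dots> = emeasure lborel Q * (2 ^ DIM('e) * (\<integral>\<^sup>+x. G x \<partial>lborel))"
      by (subst nn_integral_multc) auto
    finally show ?thesis by (simp add: mult_ac)
  qed
  show ?thesis
  proof (cases "1/2 \<le> t")
    case True
    then show ?thesis using bound t by simp
  next
    case False
    have "(\<integral>\<^sup>+x. \<integral>\<^sup>+y. indicator Q x * indicator Q y * G ((1 - t) *\<^sub>R x + t *\<^sub>R y) \<partial>lborel \<partial>lborel)
        = (\<integral>\<^sup>+y. \<integral>\<^sup>+x. indicator Q x * indicator Q y * G ((1 - t) *\<^sub>R x + t *\<^sub>R y) \<partial>lborel \<partial>lborel)"
      by (rule lborel_pair.Fubini'[symmetric]) measurable
    also have "\<dots> = (\<integral>\<^sup>+y. \<integral>\<^sup>+x. indicator Q y * indicator Q x * G ((1 - (1 - t)) *\<^sub>R y + (1 - t) *\<^sub>R x) \<partial>lborel \<partial>lborel)"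
      by (simp add: mult.commute add.commute)
    also have "\<dots> \<le> 2 ^ DIM('e) * emeasure lborel Q * (\<integral>\<^sup>+x. G x \<partial>lborel)"
      using bound[of "1 - t"] False t by simp
    finally show ?thesis .
  qed
qed

text \<open>For fixed \<open>t\<close> the double integral over \<open>x\<close> and
  \<open>y\<close> has a bound that does not depend on \<open>t\<close>, so the integral over the
  segment parameter is moved outside; the diameter supplies the factor
  \<open>d\<^sup>2\<close>.\<close>

lemma double_increment_le:
  fixes u :: "'e::euclidean_space \<Rightarrow> real" and D :: "'e \<Rightarrow> 'e \<Rightarrow>\<^sub>L real"
  assumes Q: "convex Q" "compact Q" and d: "\<And>x y. x \<in> Q \<Longrightarrow> y \<in> Q \<Longrightarrow> norm (y - x) \<le> d"
    and deriv: "\<And>p. p \<in> Q \<Longrightarrow> (u has_derivative blinfun_apply (D p)) (at p)"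
    and cont: "continuous_on Q D"
  shows "(\<integral>\<^sup>+x. \<integral>\<^sup>+y. indicator Q x * indicator Q y * ennreal ((u x - u y)\<^sup>2) \<partial>lborel \<partial>lborel)
    \<le> ennreal (d\<^sup>2) * (2 ^ DIM('e) * emeasure lborel Q * (\<integral>\<^sup>+x. indicator Q x * ennreal ((norm (D x))\<^sup>2) \<partial>lborel))"
proof -
  have Qm [measurable]: "Q \<in> sets borel" using Q by (simp add: compact_imp_closed borel_closed)
  define G where "G p = indicator Q p * ennreal ((norm (D p))\<^sup>2)" for p
  have Gm [measurable]: "G \<in> borel_measurable borel"
  proof -
    have "(\<lambda>p. indicator Q p *\<^sub>R (norm (D p))\<^sup>2) \<in> borel_measurable borel"
      using cont by (intro borel_measurable_continuous_on_indicator continuous_intros) auto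
    then have "(\<lambda>p. ennreal (indicator Q p *\<^sub>R (norm (D p))\<^sup>2)) \<in> borel_measurable borel"
      by measurable
    moreover have "ennreal (indicator Q p *\<^sub>R (norm (D p))\<^sup>2) = G p" for p
      by (auto simp: indicator_def G_def)
    ultimately show ?thesis by (simp only:)
  qed
  define F where "F x y t = indicator Q x * indicator Q y * G ((1 - t) *\<^sub>R x + t *\<^sub>R y) * indicator {0..1} t"
    for x y and t :: real
  have pointwise: "indicator Q x * indicator Q y * ennreal ((u x - u y)\<^sup>2) \<le> ennreal (d\<^sup>2) * (\<integral>\<^sup>+t. F x y t \<partial>lborel)" for x y
  proof (cases "x \<in> Q \<and> y \<in> Q")
    case True
    then have xy: "x \<in> Q" "y \<in> Q" by auto
    have "ennreal ((u x - u y)\<^sup>2) \<le> ennreal ((norm (y - x))\<^sup>2) *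
        (\<integral>\<^sup>+t. ennreal ((norm (D ((1 - t) *\<^sub>R x + t *\<^sub>R y)))\<^sup>2) * indicator {0..1} t \<partial>lborel)"
      by (rule increment_square_le[OF Q(1) xy deriv cont])
    also have "(\<integral>\<^sup>+t. ennreal ((norm (D ((1 - t) *\<^sub>R x + t *\<^sub>R y)))\<^sup>2) * indicator {0..1} t \<partial>lborel) = (\<integral>\<^sup>+t. F x y t \<partial>lborel)"
    proof (rule nn_integral_cong)
      fix t :: real
      have "(1 - t) *\<^sub>R x + t *\<^sub>R y \<in> Q" if "t \<in> {0..1}"
        using Q xy that by (auto intro: convexD)
      then show "ennreal ((norm (D ((1 - t) *\<^sub>R x + t *\<^sub>R y)))\<^sup>2) * indicator {0..1} t = F x y t"
        using xy by (auto simp: F_def G_def indicator_def)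
    qed
    also have "ennreal ((norm (y - x))\<^sup>2) * (\<integral>\<^sup>+t. F x y t \<partial>lborel) \<le> ennreal (d\<^sup>2) * (\<integral>\<^sup>+t. F x y t \<partial>lborel)"
      using d[OF xy] by (intro mult_right_mono ennreal_leI power_mono) auto
    finally show ?thesis using xy by simp
  qed (auto simp: indicator_def)
  have [measurable]: "(\<lambda>(x, y, t). F x y t) \<in> borel_measurable (borel \<Otimes>\<^sub>M borel \<Otimes>\<^sub>M borel)"
    unfolding F_def by measurable
  have "(\<integral>\<^sup>+x. \<integral>\<^sup>+y. indicator Q x * indicator Q y * ennreal ((u x - u y)\<^sup>2) \<partial>lborel \<partial>lborel)
      \<le> (\<integral>\<^sup>+x. \<integral>\<^sup>+y. ennreal (d\<^sup>2) * (\<integral>\<^sup>+t. F x y t \<partial>lborel) \<partial>lborel \<partial>lborel)"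
    by (intro nn_integral_mono pointwise)
  also have "\<dots> = ennreal (d\<^sup>2) * (\<integral>\<^sup>+x. \<integral>\<^sup>+y. \<integral>\<^sup>+t. F x y t \<partial>lborel \<partial>lborel \<partial>lborel)"
    unfolding F_def by (subst nn_integral_cmult, measurable)+
  also have "(\<integral>\<^sup>+x. \<integral>\<^sup>+y. \<integral>\<^sup>+t. F x y t \<partial>lborel \<partial>lborel \<partial>lborel) = (\<integral>\<^sup>+x. \<integral>\<^sup>+t. \<integral>\<^sup>+y. F x y t \<partial>lborel \<partial>lborel \<partial>lborel)"
    unfolding F_def by (intro nn_integral_cong lborel_pair.Fubini') measurable
  also have "\<dots> = (\<integral>\<^sup>+t. \<integral>\<^sup>+x. \<integral>\<^sup>+y. F x y t \<partial>lborel \<partial>lborel \<partial>lborel)"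
    unfolding F_def by (intro lborel_pair.Fubini') measurable
  also have "\<dots> \<le> (\<integral>\<^sup>+t. indicator {0..1} t * (2 ^ DIM('e) * emeasure lborel Q * (\<integral>\<^sup>+x. G x \<partial>lborel)) \<partial>(lborel :: real measure))"
  proof (rule nn_integral_mono)
    fix t :: real
    show "(\<integral>\<^sup>+x. \<integral>\<^sup>+y. F x y t \<partial>lborel \<partial>lborel) \<le> indicator {0..1} t * (2 ^ DIM('e) * emeasure lborel Q * (\<integral>\<^sup>+x. G x \<partial>lborel))"
      using nn_integral_convex_combination_le[OF Gm Qm, of t] by (cases "t \<in> {0..1}") (auto simp: F_def)
  qed
  also have "\<dots> = 2 ^ DIM('e) * emeasure lborel Q * (\<integral>\<^sup>+x. G x \<partial>lborel)"
    by (subst nn_integral_multc) auto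
  finally show ?thesis
    by (simp add: G_def mult_left_mono)
qed

lemma integrable_on_compact:
  fixes f :: "'e::euclidean_space \<Rightarrow> real"
  assumes "compact Q" "continuous_on Q f"
  shows "integrable lborel (\<lambda>x. indicator Q x * f x)"
  using borel_integrable_compact[OF assms] by (simp add: mult.commute indicator_def if_distrib cong: if_cong)

text \<open>The double integral of \<open>(u x - u y)\<^sup>2\<close> over \<open>Q\<close> equals
  \<open>2 * m * b - 2 * a\<^sup>2\<close>, where \<open>m\<close> is the measure of
  \<open>Q\<close> and \<open>a\<close>, \<open>b\<close> are the integrals of \<open>u\<close> and
  of its square. Comparing with the gradient bound gives the inequality, with a constant that is not
  sharp.\<close>

lemma Poincare_inequality:
  fixes u :: "'e::euclidean_space \<Rightarrow> real" and D :: "'e \<Rightarrow> 'e \<Rightarrow>\<^sub>L real"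
  assumes Q: "convex Q" "compact Q" and d: "\<And>x y. x \<in> Q \<Longrightarrow> y \<in> Q \<Longrightarrow> norm (y - x) \<le> d"
    and deriv: "\<And>p. p \<in> Q \<Longrightarrow> (u has_derivative blinfun_apply (D p)) (at p)"
    and cont: "continuous_on Q D"
  shows "(\<integral>x. indicator Q x * (u x)\<^sup>2 \<partial>lborel) \<le> (1 / measure lborel Q) * (\<integral>x. indicator Q x * u x \<partial>lborel)\<^sup>2
    + d\<^sup>2 * 2 ^ DIM('e) * (\<integral>x. indicator Q x * (norm (D x))\<^sup>2 \<partial>lborel)"
proof -
  have Qm [measurable]: "Q \<in> sets borel" using Q by (simp add: compact_imp_closed borel_closed)
  have fin: "emeasure lborel Q < \<infinity>" using Q(2) by (intro emeasure_bounded_finite compact_imp_bounded)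
  define m where "m = measure lborel Q"
  have em: "emeasure lborel Q = ennreal m" using fin by (simp add: m_def emeasure_eq_ennreal_measure)
  have u_cont: "continuous_on Q u"
    using deriv by (meson continuous_at_imp_continuous_on has_derivative_continuous)
  have iQ: "integrable lborel (\<lambda>x. indicator Q x * f x)" if "continuous_on Q f" for f :: "'e \<Rightarrow> real"
    by (rule integrable_on_compact[OF Q(2) that])
  have i0: "integrable lborel (\<lambda>x. indicator Q x * (1::real))" by (intro iQ continuous_intros)
  have i1: "integrable lborel (\<lambda>x. indicator Q x * u x)" by (intro iQ u_cont)
  have i2: "integrable lborel (\<lambda>x. indicator Q x * (u x)\<^sup>2)" by (intro iQ continuous_intros u_cont)
  have i3: "integrable lborel (\<lambda>x. indicator Q x * (norm (D x))\<^sup>2)" by (intro iQ continuous_intros cont)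
  define a where "a = (\<integral>x. indicator Q x * u x \<partial>lborel)"
  define b where "b = (\<integral>x. indicator Q x * (u x)\<^sup>2 \<partial>lborel)"
  define c where "c = (\<integral>x. indicator Q x * (norm (D x))\<^sup>2 \<partial>lborel)"
  have m_int: "(\<integral>x. indicator Q x * (1::real) \<partial>lborel) = m" by (simp add: m_def)
  have c0: "c \<ge> 0" unfolding c_def by (intro integral_nonneg_AE) auto
  have m0: "m \<ge> 0" by (simp add: m_def)
  have inner: "(\<integral>\<^sup>+y. indicator Q x * indicator Q y * ennreal ((u x - u y)\<^sup>2) \<partial>lborel)
      = ennreal (indicator Q x * ((u x)\<^sup>2 * m - 2 * u x * a + b))" for x
  proof (cases "x \<in> Q")
    case True
    have "integrable lborel (\<lambda>y. indicator Q y * (u x - u y)\<^sup>2)"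
      by (intro iQ continuous_intros u_cont)
    then have "(\<integral>\<^sup>+y. ennreal (indicator Q y * (u x - u y)\<^sup>2) \<partial>lborel) = ennreal (\<integral>y. indicator Q y * (u x - u y)\<^sup>2 \<partial>lborel)"
      by (intro nn_integral_eq_integral) auto
    also have "(\<integral>y. indicator Q y * (u x - u y)\<^sup>2 \<partial>lborel) =
        (\<integral>y. (u x)\<^sup>2 * (indicator Q y * 1) - 2 * u x * (indicator Q y * u y) + indicator Q y * (u y)\<^sup>2 \<partial>lborel)"
      by (intro Bochner_Integration.integral_cong) (auto simp: power2_diff indicator_def)
    also have "\<dots> = (u x)\<^sup>2 * m - 2 * u x * a + b"
      using i0 i1 i2 m_int by (simp add: a_def b_def)
    finally have "(\<integral>\<^sup>+y. ennreal (indicator Q y * (u x - u y)\<^sup>2) \<partial>lborel) = ennreal ((u x)\<^sup>2 * m - 2 * u x * a + b)" .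
    moreover have "indicator Q x * indicator Q y * ennreal ((u x - u y)\<^sup>2) = ennreal (indicator Q y * (u x - u y)\<^sup>2)" for y
      using True by (simp add: indicator_def)
    ultimately show ?thesis using True by simp
  qed auto
  have nonneg: "0 \<le> indicator Q x * ((u x)\<^sup>2 * m - 2 * u x * a + b)" for x
  proof -
    have "0 \<le> (\<integral>y. (u x)\<^sup>2 * (indicator Q y * 1) - 2 * u x * (indicator Q y * u y) + indicator Q y * (u y)\<^sup>2 \<partial>lborel)"
    proof (intro integral_nonneg_AE AE_I2)
      fix y
      have "(u x)\<^sup>2 * (indicator Q y * 1) - 2 * u x * (indicator Q y * u y) + indicator Q y * (u y)\<^sup>2 = indicator Q y * (u x - u y)\<^sup>2"
        by (simp add: power2_diff indicator_def)
      then show "0 \<le> (u x)\<^sup>2 * (indicator Q y * 1) - 2 * u x * (indicator Q y * u y) + indicator Q y * (u y)\<^sup>2" by simp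
    qed
    also have "\<dots> = (u x)\<^sup>2 * m - 2 * u x * a + b"
      using i0 i1 i2 m_int by (simp add: a_def b_def)
    finally show ?thesis by simp
  qed
  have eq: "indicator Q x * ((u x)\<^sup>2 * m - 2 * u x * a + b)
      = m * (indicator Q x * (u x)\<^sup>2) - 2 * a * (indicator Q x * u x) + b * (indicator Q x * 1)" for x
    by (simp add: indicator_def)
  have "(\<integral>\<^sup>+x. \<integral>\<^sup>+y. indicator Q x * indicator Q y * ennreal ((u x - u y)\<^sup>2) \<partial>lborel \<partial>lborel)
      = (\<integral>\<^sup>+x. ennreal (indicator Q x * ((u x)\<^sup>2 * m - 2 * u x * a + b)) \<partial>lborel)"
    by (simp add: inner)
  also have "\<dots> = ennreal (\<integral>x. indicator Q x * ((u x)\<^sup>2 * m - 2 * u x * a + b) \<partial>lborel)"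
    using nonneg i0 i1 i2 unfolding eq by (intro nn_integral_eq_integral) auto
  also have "(\<integral>x. indicator Q x * ((u x)\<^sup>2 * m - 2 * u x * a + b) \<partial>lborel) = m * b - 2 * a * a + b * m"
    unfolding eq using i0 i1 i2 m_int by (simp add: a_def b_def)
  finally have "ennreal (m * b - 2 * a * a + b * m) \<le> ennreal (d\<^sup>2) * (2 ^ DIM('e) * emeasure lborel Q
      * (\<integral>\<^sup>+x. indicator Q x * ennreal ((norm (D x))\<^sup>2) \<partial>lborel))"
    using double_increment_le[OF Q d deriv cont] by simp
  also have "(\<integral>\<^sup>+x. indicator Q x * ennreal ((norm (D x))\<^sup>2) \<partial>lborel) = (\<integral>\<^sup>+x. ennreal (indicator Q x * (norm (D x))\<^sup>2) \<partial>lborel)"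
    by (intro nn_integral_cong) (simp add: indicator_def)
  also have "\<dots> = ennreal c"
    unfolding c_def using i3 by (intro nn_integral_eq_integral) auto
  also have "ennreal (d\<^sup>2) * (2 ^ DIM('e) * emeasure lborel Q * ennreal c) = ennreal (d\<^sup>2 * (2 ^ DIM('e) * m * c))"
    using m0 c0 by (simp add: em ennreal_mult ennreal_power[symmetric])
  finally have main: "m * b - 2 * a * a + b * m \<le> d\<^sup>2 * (2 ^ DIM('e) * m * c)"
    using m0 c0 by (simp add: ennreal_le_iff)
  show ?thesis
  proof (cases "m = 0")
    \<comment> \<open>For a set of measure 0 the term with the quotient is 0 by the convention for
      division, and the left side vanishes as well.\<close>
    case True
    have "AE x in lborel. x \<notin> Q"
      using em True by (intro AE_not_in) (auto simp: null_sets_def)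
    then have "b = 0"
      unfolding b_def by (intro integral_eq_zero_AE) (auto simp: indicator_def)
    then show ?thesis
      using c0 by (simp add: b_def c_def a_def)
  next
    case False
    then have "m > 0" using m0 by simp
    then have "b \<le> a\<^sup>2 / m + d\<^sup>2 * 2 ^ DIM('e) * c / 2"
      using main by (simp add: field_simps power2_eq_square)
    also have "\<dots> \<le> a\<^sup>2 / m + d\<^sup>2 * 2 ^ DIM('e) * c"
      using c0 by simp
    finally show ?thesis by (simp add: a_def b_def c_def m_def)
  qed
qed

text \<open>Rellich's theorem as an inequality: on each small box the Poincare inequality has a
  small constant, and the integrals over the boxes are the finitely many functionals. A function on
  which they vanish has small norm relative to its gradient.\<close>

lemma Rellich_box:
  fixes a b :: "'e::euclidean_space"
  assumes "\<epsilon> > 0"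
  shows "\<exists>P C. finite P \<and> (\<forall>k\<in>P. compact k \<and> k \<subseteq> cbox a b) \<and> 0 \<le> C \<and>
    (\<forall>u D. (\<forall>p\<in>cbox a b. (u has_derivative blinfun_apply (D p)) (at p)) \<longrightarrow> continuous_on (cbox a b) D \<longrightarrow>
      (\<integral>x. indicator (cbox a b) x * (u x)\<^sup>2 \<partial>lborel) \<le>
        \<epsilon> * (\<integral>x. indicator (cbox a b) x * (norm (D x))\<^sup>2 \<partial>lborel)
        + C * (\<Sum>k\<in>P. (\<integral>x. indicator k x * u x \<partial>lborel)\<^sup>2))"
proof -
  \<comment> \<open>With this \<open>r\<close> the constant of the Poincare inequality for sets of
    diameter \<open>2 * r\<close> becomes exactly \<open>\<epsilon>\<close>.\<close>
  define r where "r = sqrt (\<epsilon> / 2 ^ DIM('e)) / 2"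
  have r: "r > 0" "(2 * r)\<^sup>2 * 2 ^ DIM('e) = \<epsilon>" using assms by (auto simp: r_def)
  \<comment> \<open>A tagged division that is fine for a constant gauge consists of boxes inside
    balls of radius \<open>r\<close>; the tags are dropped afterwards.\<close>
  have "gauge (\<lambda>x::'e. ball x r)" using r(1) by (rule gauge_ball)
  from fine_division_exists[OF this, of a b] obtain q where q: "q tagged_division_of cbox a b" "(\<lambda>x. ball x r) fine q"
    by blast
  define P where "P = snd ` q"
  have P: "P division_of cbox a b"
    unfolding P_def by (rule division_of_tagged_division[OF q(1)])
  have fin: "finite P" using P by (rule division_of_finite)
  have box: "\<exists>l h. k = cbox l h" "k \<subseteq> cbox a b" if "k \<in> P" for k
    using P that by (auto simp: division_of_def)
  have small: "norm (y - x) \<le> 2 * r" if "k \<in> P" "x \<in> k" "y \<in> k" for k x y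
  proof -
    obtain z where "(z, k) \<in> q" using \<open>k \<in> P\<close> by (auto simp: P_def)
    then have "k \<subseteq> ball z r" using q(2) by (auto simp: fine_def)
    then have "dist z x < r" "dist z y < r" using that by auto
    then show ?thesis using dist_triangle3[of y x z] by (simp add: dist_norm)
  qed
  \<comment> \<open>A degenerate box contributes 0, by the convention for division.\<close>
  define C where "C = (\<Sum>k\<in>P. 1 / measure lborel k)"
  have C0: "C \<ge> 0" unfolding C_def by (intro sum_nonneg) auto
  have Cle: "1 / measure lborel k \<le> C" if "k \<in> P" for k
    unfolding C_def using fin that by (intro member_le_sum) auto
  have split: "(\<integral>x. indicator (cbox a b) x * f x \<partial>lborel) = (\<Sum>k\<in>P. \<integral>x. indicator k x * f x \<partial>lborel)"
    if f: "continuous_on (cbox a b) f" for f :: "'e \<Rightarrow> real"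
  proof -
    have HK: "(\<integral>x. indicator k x * f x \<partial>lborel) = integral k f" if "compact k" "k \<subseteq> cbox a b" for k
    proof -
      have "set_integrable lborel k f"
        using integrable_on_compact[OF that(1) continuous_on_subset[OF f that(2)]] by (simp add: set_integrable_def)
      from set_borel_integral_eq_integral(2)[OF this] show ?thesis
        by (simp add: set_lebesgue_integral_def)
    qed
    have "integral (cbox a b) f = (\<Sum>k\<in>P. integral k f)"
      by (rule integral_combine_division_topdown[OF integrable_continuous[OF f] P])
    moreover have "compact k" if "k \<in> P" for k using box(1)[OF that] by auto
    ultimately show ?thesis
      using box(2) by (simp add: HK)
  qed
  have "(\<integral>x. indicator (cbox a b) x * (u x)\<^sup>2 \<partial>lborel) \<le>
        \<epsilon> * (\<integral>x. indicator (cbox a b) x * (norm (D x))\<^sup>2 \<partial>lborel)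
        + C * (\<Sum>k\<in>P. (\<integral>x. indicator k x * u x \<partial>lborel)\<^sup>2)"
    if deriv: "\<And>p. p \<in> cbox a b \<Longrightarrow> (u has_derivative blinfun_apply (D p)) (at p)"
      and cont: "continuous_on (cbox a b) D" for u and D :: "'e \<Rightarrow> 'e \<Rightarrow>\<^sub>L real"
  proof -
    have u_cont: "continuous_on (cbox a b) u"
      using deriv by (meson continuous_at_imp_continuous_on has_derivative_continuous)
    have "(\<integral>x. indicator (cbox a b) x * (u x)\<^sup>2 \<partial>lborel) = (\<Sum>k\<in>P. \<integral>x. indicator k x * (u x)\<^sup>2 \<partial>lborel)"
      by (intro split continuous_intros u_cont)
    also have "\<dots> \<le> (\<Sum>k\<in>P. C * (\<integral>x. indicator k x * u x \<partial>lborel)\<^sup>2 + \<epsilon> * (\<integral>x. indicator k x * (norm (D x))\<^sup>2 \<partial>lborel))"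
    proof (rule sum_mono)
      fix k assume k: "k \<in> P"
      obtain l h where lh: "k = cbox l h" using box(1)[OF k] by blast
      have "(\<integral>x. indicator k x * (u x)\<^sup>2 \<partial>lborel) \<le> (1 / measure lborel k) * (\<integral>x. indicator k x * u x \<partial>lborel)\<^sup>2
          + (2 * r)\<^sup>2 * 2 ^ DIM('e) * (\<integral>x. indicator k x * (norm (D x))\<^sup>2 \<partial>lborel)"
        using box(2)[OF k] lh
        by (intro Poincare_inequality[where u = u and D = D] small[OF k] deriv continuous_on_subset[OF cont]) auto
      also have "\<dots> \<le> C * (\<integral>x. indicator k x * u x \<partial>lborel)\<^sup>2 + \<epsilon> * (\<integral>x. indicator k x * (norm (D x))\<^sup>2 \<partial>lborel)"
        unfolding r(2) using Cle[OF k] by (intro add_right_mono mult_right_mono) auto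
      finally show "(\<integral>x. indicator k x * (u x)\<^sup>2 \<partial>lborel) \<le> C * (\<integral>x. indicator k x * u x \<partial>lborel)\<^sup>2 + \<epsilon> * (\<integral>x. indicator k x * (norm (D x))\<^sup>2 \<partial>lborel)" .
    qed
    also have "\<dots> = C * (\<Sum>k\<in>P. (\<integral>x. indicator k x * u x \<partial>lborel)\<^sup>2) + \<epsilon> * (\<Sum>k\<in>P. \<integral>x. indicator k x * (norm (D x))\<^sup>2 \<partial>lborel)"
      by (simp add: sum.distrib sum_distrib_left)
    also have "(\<Sum>k\<in>P. \<integral>x. indicator k x * (norm (D x))\<^sup>2 \<partial>lborel) = (\<integral>x. indicator (cbox a b) x * (norm (D x))\<^sup>2 \<partial>lborel)"
      by (intro split[symmetric] continuous_intros cont)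
    finally show ?thesis by simp
  qed
  moreover have "compact k \<and> k \<subseteq> cbox a b" if "k \<in> P" for k
    using box[OF that] by auto
  ultimately show ?thesis
    using fin C0 by (intro exI[of _ P] exI[of _ C]) auto
qed

section \<open>\<open>C\<^sup>1\<close> functions and covectors\<close>

text \<open>A total choice of derivative. It is meaningful where \<open>f\<close> is differentiable,
  and uniqueness of derivatives makes it the witness in \<open>C1_on\<close>.\<close>

definition Dr :: "('b::real_normed_vector \<Rightarrow> 'c::real_normed_vector) \<Rightarrow> 'b \<Rightarrow> 'b \<Rightarrow>\<^sub>L 'c" where
  "Dr f p = Blinfun (frechet_derivative f (at p))"

lemma Dr_eq:
  assumes "(f has_derivative blinfun_apply D) (at p)"
  shows "Dr f p = D"
  unfolding Dr_def frechet_derivative_at[OF assms, symmetric] by (rule blinfun_apply_inverse)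

lemma C1_on_iff:
  "C1_on S f \<longleftrightarrow> (\<forall>p\<in>S. (f has_derivative blinfun_apply (Dr f p)) (at p)) \<and> continuous_on S (Dr f)"
proof
  assume "C1_on S f"
  then obtain D where D: "\<forall>p\<in>S. (f has_derivative blinfun_apply (D p)) (at p)" "continuous_on S D"
    by (auto simp: C1_on_def)
  then have "\<And>p. p \<in> S \<Longrightarrow> Dr f p = D p" using Dr_eq by blast
  then show "(\<forall>p\<in>S. (f has_derivative blinfun_apply (Dr f p)) (at p)) \<and> continuous_on S (Dr f)"
    using D by (auto cong: continuous_on_cong)
qed (auto simp: C1_on_def)

lemma C1_onI:
  "(\<And>p. p \<in> S \<Longrightarrow> (f has_derivative blinfun_apply (D p)) (at p)) \<Longrightarrow> continuous_on S D \<Longrightarrow> C1_on S f"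
  by (auto simp: C1_on_def)

lemma C1_on_has_derivative:
  "C1_on S f \<Longrightarrow> p \<in> S \<Longrightarrow> (f has_derivative blinfun_apply (Dr f p)) (at p)"
  by (simp add: C1_on_iff)

lemma C1_on_continuous_Dr: "C1_on S f \<Longrightarrow> continuous_on S (Dr f)"
  by (simp add: C1_on_iff)

lemma C1_on_continuous: "C1_on S f \<Longrightarrow> continuous_on S f"
  by (meson C1_on_has_derivative continuous_at_imp_continuous_on has_derivative_continuous)

lemma C1_on_subset: "C1_on T f \<Longrightarrow> S \<subseteq> T \<Longrightarrow> C1_on S f"
  by (auto simp: C1_on_iff intro: continuous_on_subset)

lemma Dr_cong:
  assumes "open S" "p \<in> S" "\<And>q. q \<in> S \<Longrightarrow> f q = g q"
  shows "Dr f p = Dr g p"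
proof -
  have "(f has_derivative D) (at p) \<longleftrightarrow> (g has_derivative D) (at p)" for D
    using assms has_derivative_transform_within_open[of f D p UNIV S g]
      has_derivative_transform_within_open[of g D p UNIV S f] by auto
  then show ?thesis by (simp add: Dr_def frechet_derivative_def)
qed

lemma C1_on_cong:
  assumes "open S" "\<And>q. q \<in> S \<Longrightarrow> f q = g q" "C1_on S f"
  shows "C1_on S g"
proof (rule C1_onI[of _ _ "Dr f"])
  fix p assume "p \<in> S"
  then show "(g has_derivative blinfun_apply (Dr f p)) (at p)"
    using assms by (intro has_derivative_transform_within_open[OF C1_on_has_derivative[OF assms(3)]]) auto
qed (use assms in \<open>simp add: C1_on_iff\<close>)

lemma C1_on_Un: "open S \<Longrightarrow> open T \<Longrightarrow> C1_on S f \<Longrightarrow> C1_on T f \<Longrightarrow> C1_on (S \<union> T) f"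
  by (auto simp: C1_on_iff intro: continuous_on_open_Un)

lemma C1_on_const: "C1_on S (\<lambda>_. k)"
  by (rule C1_onI[of _ _ "\<lambda>_. 0"]) (auto simp: zero_blinfun.rep_eq)

lemma C1_on_compose:
  assumes f: "C1_on S f" and g: "C1_on T g" and sub: "f ` S \<subseteq> T"
  shows "C1_on S (g \<circ> f)" and "p \<in> S \<Longrightarrow> Dr (g \<circ> f) p = Dr g (f p) o\<^sub>L Dr f p"
proof -
  have der: "((g \<circ> f) has_derivative blinfun_apply (Dr g (f p) o\<^sub>L Dr f p)) (at p)" if "p \<in> S" for p
    using diff_chain_at[OF C1_on_has_derivative[OF f that] C1_on_has_derivative[OF g, of "f p"]] sub that
    by (auto simp: o_def blinfun_compose.rep_eq)
  then show "p \<in> S \<Longrightarrow> Dr (g \<circ> f) p = Dr g (f p) o\<^sub>L Dr f p" by (rule Dr_eq)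
  show "C1_on S (g \<circ> f)"
  proof (rule C1_onI[OF der])
    show "continuous_on S (\<lambda>p. Dr g (f p) o\<^sub>L Dr f p)"
      by (intro bounded_bilinear.continuous_on[OF bounded_bilinear_blinfun_compose]
          continuous_on_compose2[OF C1_on_continuous_Dr[OF g] C1_on_continuous[OF f] sub] C1_on_continuous_Dr f)
  qed
qed

lemma C1_on_add:
  assumes "C1_on S f" "C1_on S g"
  shows "C1_on S (\<lambda>p. f p + g p)" and "p \<in> S \<Longrightarrow> Dr (\<lambda>p. f p + g p) p = Dr f p + Dr g p"
proof -
  have der: "((\<lambda>p. f p + g p) has_derivative blinfun_apply (Dr f p + Dr g p)) (at p)" if "p \<in> S" for p
    using has_derivative_add[OF C1_on_has_derivative[OF assms(1) that] C1_on_has_derivative[OF assms(2) that]]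
    by (simp add: plus_blinfun.rep_eq)
  then show "p \<in> S \<Longrightarrow> Dr (\<lambda>p. f p + g p) p = Dr f p + Dr g p" by (rule Dr_eq)
  show "C1_on S (\<lambda>p. f p + g p)"
    by (rule C1_onI[OF der]) (auto intro!: continuous_intros C1_on_continuous_Dr assms)
qed

lemma C1_on_linear:
  assumes "bounded_linear l" "C1_on S f"
  shows "C1_on S (\<lambda>p. l (f p))" and "p \<in> S \<Longrightarrow> Dr (\<lambda>p. l (f p)) p = Blinfun l o\<^sub>L Dr f p"
proof -
  have der: "((\<lambda>p. l (f p)) has_derivative blinfun_apply (Blinfun l o\<^sub>L Dr f p)) (at p)" if "p \<in> S" for p
    using bounded_linear.has_derivative[OF assms(1) C1_on_has_derivative[OF assms(2) that]]
    by (simp add: bounded_linear_Blinfun_apply[OF assms(1)] blinfun_compose.rep_eq o_def)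
  then show "p \<in> S \<Longrightarrow> Dr (\<lambda>p. l (f p)) p = Blinfun l o\<^sub>L Dr f p" by (rule Dr_eq)
  show "C1_on S (\<lambda>p. l (f p))"
  proof (rule C1_onI[OF der])
    show "continuous_on S (\<lambda>p. Blinfun l o\<^sub>L Dr f p)"
      by (intro bounded_bilinear.continuous_on[OF bounded_bilinear_blinfun_compose] continuous_on_const
          C1_on_continuous_Dr assms)
  qed
qed

lemma C1_on_mult:
  fixes f g :: "'b::real_normed_vector \<Rightarrow> real"
  assumes "C1_on S f" "C1_on S g"
  shows "C1_on S (\<lambda>p. f p * g p)" and "p \<in> S \<Longrightarrow> Dr (\<lambda>p. f p * g p) p = f p *\<^sub>R Dr g p + g p *\<^sub>R Dr f p"
proof -
  have der: "((\<lambda>p. f p * g p) has_derivative blinfun_apply (f p *\<^sub>R Dr g p + g p *\<^sub>R Dr f p)) (at p)" if "p \<in> S" for p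
  proof -
    have "blinfun_apply (f p *\<^sub>R Dr g p + g p *\<^sub>R Dr f p) = (\<lambda>h. f p * Dr g p h + Dr f p h * g p)"
      by (auto simp: blinfun.add_left blinfun.scaleR_left)
    then show ?thesis
      using has_derivative_mult[OF C1_on_has_derivative[OF assms(1) that] C1_on_has_derivative[OF assms(2) that]]
      by simp
  qed
  then show "p \<in> S \<Longrightarrow> Dr (\<lambda>p. f p * g p) p = f p *\<^sub>R Dr g p + g p *\<^sub>R Dr f p" by (rule Dr_eq)
  show "C1_on S (\<lambda>p. f p * g p)"
  proof (rule C1_onI[OF der])
    show "continuous_on S (\<lambda>p. f p *\<^sub>R Dr g p + g p *\<^sub>R Dr f p)"
      by (intro continuous_intros C1_on_continuous_Dr C1_on_continuous assms)
  qed
qed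

lemma blinfun_compose_simps:
  "(f + g) o\<^sub>L h = (f o\<^sub>L h) + (g o\<^sub>L h)" "(a *\<^sub>R f) o\<^sub>L h = a *\<^sub>R (f o\<^sub>L h)"
  "(f o\<^sub>L k) o\<^sub>L h = f o\<^sub>L (k o\<^sub>L h)" "f o\<^sub>L id_blinfun = f" "0 o\<^sub>L h = 0"
  by (rule blinfun_eqI, simp add: blinfun.add_left blinfun.scaleR_left)+

section \<open>Charts, transition maps and cotangent vectors\<close>

locale C1_manifold =
  fixes A :: "('a::{t2_space,second_countable_topology}, 'e::euclidean_space) chart set"
  assumes atlas: "C1_atlas A"
begin

lemma chart_at: obtains c where "c \<in> A" "x \<in> fst c"
  using atlas unfolding C1_atlas_def by blast

lemma chart:
  assumes "c \<in> A"
  shows open_chart_domain: "open (fst c)" and open_chart_image: "open (snd c ` fst c)"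
    and chart_homeomorphism: "homeomorphism (fst c) (snd c ` fst c) (snd c) (chart_inv c)"
  using atlas assms unfolding C1_atlas_def by blast+

lemma chart_inv_chart [simp]: "c \<in> A \<Longrightarrow> x \<in> fst c \<Longrightarrow> chart_inv c (snd c x) = x"
  using chart_homeomorphism homeomorphism_apply1 by metis

lemma chart_chart_inv [simp]: "c \<in> A \<Longrightarrow> p \<in> snd c ` fst c \<Longrightarrow> snd c (chart_inv c p) = p"
  using chart_homeomorphism homeomorphism_apply2 by metis

lemma chart_inv_in: "p \<in> snd c ` fst c \<Longrightarrow> chart_inv c p \<in> fst c"
  by (rule inv_into_into)

lemma chart_continuous: "c \<in> A \<Longrightarrow> continuous_on (fst c) (snd c)"
  using chart_homeomorphism homeomorphism_cont1 by blast

lemma chart_inv_continuous: "c \<in> A \<Longrightarrow> continuous_on (snd c ` fst c) (chart_inv c)"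
  using chart_homeomorphism homeomorphism_cont2 by blast

lemma open_chart_image_sub:
  assumes c: "c \<in> A" and U: "open U" "U \<subseteq> fst c"
  shows "open (snd c ` U)"
proof -
  have "snd c ` U = (chart_inv c) -` U \<inter> snd c ` fst c"
    using c U chart_inv_chart[OF c] by (force simp: image_iff)
  then show ?thesis
    using continuous_on_open_vimage[OF open_chart_image[OF c], of "chart_inv c"] chart_inv_continuous[OF c] U
    by simp
qed

lemma open_chart_inv_image:
  assumes c: "c \<in> A" and V: "open V" "V \<subseteq> snd c ` fst c"
  shows "open (chart_inv c ` V)"
proof -
  have "chart_inv c ` V = snd c -` V \<inter> fst c"
    using c V chart_inv_chart[OF c] chart_chart_inv[OF c] chart_inv_in by (force simp: image_iff)
  then show ?thesis
    using continuous_on_open_vimage[OF open_chart_domain[OF c], of "snd c"] chart_continuous[OF c] V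
    by simp
qed

lemma compact_chart_inv_image:
  "c \<in> A \<Longrightarrow> compact K \<Longrightarrow> K \<subseteq> snd c ` fst c \<Longrightarrow> compact (chart_inv c ` K)"
  using chart_inv_continuous by (blast intro: compact_continuous_image continuous_on_subset)

text \<open>The differential at \<open>x\<close> of the change of coordinates from \<open>c'\<close>
  to \<open>c\<close>; covectors transform by composition with it on the right.\<close>

definition tr :: "('a, 'e) chart \<Rightarrow> ('a, 'e) chart \<Rightarrow> 'a \<Rightarrow> 'e \<Rightarrow>\<^sub>L 'e" where
  "tr c c' x = Dr (snd c \<circ> chart_inv c') (snd c' x)"

lemma transition_C1: "c \<in> A \<Longrightarrow> c' \<in> A \<Longrightarrow> C1_on (snd c' ` (fst c' \<inter> fst c)) (snd c \<circ> chart_inv c')"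
  using atlas unfolding C1_atlas_def by blast

lemma frechet_transition:
  assumes "c \<in> A" "c' \<in> A" "x \<in> fst c" "x \<in> fst c'"
  shows "frechet_derivative (snd c \<circ> chart_inv c') (at (snd c' x)) = blinfun_apply (tr c c' x)"
  using frechet_derivative_at[OF C1_on_has_derivative[OF transition_C1[OF assms(1,2)], of "snd c' x"]] assms
  by (simp add: tr_def)

lemma tr_continuous:
  assumes "c \<in> A" "c' \<in> A"
  shows "continuous_on (fst c \<inter> fst c') (tr c c')"
  unfolding tr_def
  by (rule continuous_on_compose2[OF C1_on_continuous_Dr[OF transition_C1[OF assms]]])
    (use chart_continuous[OF assms(2)] in \<open>auto intro: continuous_on_subset\<close>)

lemma change_chart:
  assumes "c \<in> A" "c' \<in> A" "x \<in> fst c" "x \<in> fst c'" and f: "C1_on (snd c ` fst c) (f \<circ> chart_inv c)"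
  shows "Dr (f \<circ> chart_inv c') (snd c' x) = Dr (f \<circ> chart_inv c) (snd c x) o\<^sub>L tr c c' x"
proof -
  have "Dr (f \<circ> chart_inv c') (snd c' x) = Dr ((f \<circ> chart_inv c) \<circ> (snd c \<circ> chart_inv c')) (snd c' x)"
    by (rule Dr_cong[of "snd c' ` (fst c' \<inter> fst c)"])
      (use assms open_chart_image_sub[of c' "fst c' \<inter> fst c"] open_Int[OF open_chart_domain open_chart_domain] in auto)
  also have "\<dots> = Dr (f \<circ> chart_inv c) ((snd c \<circ> chart_inv c') (snd c' x)) o\<^sub>L Dr (snd c \<circ> chart_inv c') (snd c' x)"
    by (rule C1_on_compose(2)[OF transition_C1[OF assms(1,2)] f]) (use assms in auto)
  finally show ?thesis using assms by (simp add: tr_def)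
qed

text \<open>The cocycle law, by the chain rule on the common domain of the three charts; it is what
  makes \<open>lift\<close> satisfy the transformation law of covectors.\<close>

lemma tr_compose:
  assumes "c \<in> A" "c' \<in> A" "c'' \<in> A" "x \<in> fst c" "x \<in> fst c'" "x \<in> fst c''"
  shows "tr c c'' x = tr c c' x o\<^sub>L tr c' c'' x"
proof -
  have 1: "Dr (snd c \<circ> chart_inv c'') (snd c'' x) =
      Dr ((snd c \<circ> chart_inv c') \<circ> (snd c' \<circ> chart_inv c'')) (snd c'' x)"
    by (rule Dr_cong[of "snd c'' ` (fst c'' \<inter> fst c')"])
      (use assms open_chart_image_sub[of c'' "fst c'' \<inter> fst c'"] open_Int[OF open_chart_domain open_chart_domain] in auto)
  have 2: "Dr ((snd c \<circ> chart_inv c') \<circ> (snd c' \<circ> chart_inv c'')) (snd c'' x) = Dr (snd c \<circ> chart_inv c') ((snd c' \<circ> chart_inv c'') (snd c'' x)) o\<^sub>L Dr (snd c' \<circ> chart_inv c'') (snd c'' x)"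
  proof (rule C1_on_compose(2))
    let ?U = "fst c'' \<inter> fst c' \<inter> fst c"
    show "C1_on (snd c'' ` ?U) (snd c' \<circ> chart_inv c'')"
      by (rule C1_on_subset[OF transition_C1[OF assms(2,3)]]) auto
    show "C1_on (snd c' ` (fst c' \<inter> fst c)) (snd c \<circ> chart_inv c')"
      by (rule transition_C1[OF assms(1,2)])
    show "(snd c' \<circ> chart_inv c'') ` snd c'' ` ?U \<subseteq> snd c' ` (fst c' \<inter> fst c)"
    proof (rule image_subsetI, elim imageE)
      fix q y assume q: "q = snd c'' y" and y: "y \<in> ?U"
      have "(snd c' \<circ> chart_inv c'') q = snd c' y"
        using assms(3) y q by simp
      then show "(snd c' \<circ> chart_inv c'') q \<in> snd c' ` (fst c' \<inter> fst c)"
        using y by auto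
    qed
    show "snd c'' x \<in> snd c'' ` ?U"
      using assms by (intro imageI) simp
  qed
  have 3: "(snd c' \<circ> chart_inv c'') (snd c'' x) = snd c' x"
    using assms by simp
  show ?thesis unfolding tr_def 1 2 3 by (rule refl)
qed

lemma tr_self:
  assumes "c \<in> A" "x \<in> fst c"
  shows "tr c c x = id_blinfun"
  unfolding tr_def
proof (rule Dr_eq)
  have "((\<lambda>p. p) has_derivative blinfun_apply id_blinfun) (at (snd c x))"
    by (simp add: id_blinfun.rep_eq)
  then show "(snd c \<circ> chart_inv c has_derivative blinfun_apply id_blinfun) (at (snd c x))"
    by (rule has_derivative_transform_within_open[OF _ open_chart_image[OF assms(1)]])
      (use assms in auto)
qed

lemma cotangent_iff:
  "\<xi> \<in> cotangent A x \<longleftrightarrow>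
    (\<forall>c\<in>A. \<forall>c'\<in>A. x \<in> fst c \<longrightarrow> x \<in> fst c' \<longrightarrow> \<xi> c' = \<xi> c o\<^sub>L tr c c' x) \<and>
    (\<forall>c. c \<notin> A \<or> x \<notin> fst c \<longrightarrow> \<xi> c = 0)"
  unfolding cotangent_def mem_Collect_eq
  by (intro conj_cong ball_cong refl) (auto simp: frechet_transition intro: blinfun_eqI)

text \<open>Inverse to the coordinate map of \<open>c\<close> on the cotangent space
  (\<open>lift_chart\<close>, \<open>lift_eq\<close>), so that constructions in coordinates yield
  covectors in the sense of \<open>cotangent\<close>.\<close>

definition lift :: "('a, 'e) chart \<Rightarrow> 'a \<Rightarrow> ('e \<Rightarrow>\<^sub>L real) \<Rightarrow> ('a, 'e) covec" where
  "lift c x \<eta> = (\<lambda>c'. if c' \<in> A \<and> x \<in> fst c' then \<eta> o\<^sub>L tr c c' x else 0)"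

lemma lift_cotangent:
  assumes "c \<in> A" "x \<in> fst c"
  shows "lift c x \<eta> \<in> cotangent A x"
  unfolding cotangent_iff
proof (intro conjI ballI impI allI)
  fix c' c'' assume c: "c' \<in> A" "c'' \<in> A" "x \<in> fst c'" "x \<in> fst c''"
  then have "lift c x \<eta> c'' = \<eta> o\<^sub>L (tr c c' x o\<^sub>L tr c' c'' x)"
    using tr_compose[OF assms(1) c(1,2) assms(2) c(3,4)] by (simp add: lift_def)
  then show "lift c x \<eta> c'' = lift c x \<eta> c' o\<^sub>L tr c' c'' x"
    using c by (simp add: lift_def blinfun_compose_simps)
qed (auto simp: lift_def)

lemma lift_chart [simp]: "c \<in> A \<Longrightarrow> x \<in> fst c \<Longrightarrow> lift c x \<eta> c = \<eta>"
  by (simp add: lift_def tr_self blinfun_compose_simps)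

lemma cotangent_tr:
  "\<xi> \<in> cotangent A x \<Longrightarrow> c \<in> A \<Longrightarrow> c' \<in> A \<Longrightarrow> x \<in> fst c \<Longrightarrow> x \<in> fst c' \<Longrightarrow> \<xi> c' = \<xi> c o\<^sub>L tr c c' x"
  unfolding cotangent_iff by blast

lemma cotangent_outside: "\<xi> \<in> cotangent A x \<Longrightarrow> \<not> (c \<in> A \<and> x \<in> fst c) \<Longrightarrow> \<xi> c = 0"
  unfolding cotangent_iff by blast

lemma lift_eq:
  assumes "c \<in> A" "x \<in> fst c" "\<xi> \<in> cotangent A x"
  shows "lift c x (\<xi> c) = \<xi>"
proof
  fix c'
  show "lift c x (\<xi> c) c' = \<xi> c'"
    using cotangent_tr[OF assms(3,1) _ assms(2), of c'] cotangent_outside[OF assms(3), of c']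
    by (cases "c' \<in> A \<and> x \<in> fst c'") (auto simp: lift_def)
qed

lemma lift_add: "lift c x (\<eta> + \<theta>) = cov_add (lift c x \<eta>) (lift c x \<theta>)"
  by (auto simp: lift_def cov_add_def fun_eq_iff blinfun_compose_simps)

lemma lift_scale: "lift c x (a *\<^sub>R \<eta>) = cov_scale a (lift c x \<eta>)"
  by (auto simp: lift_def cov_scale_def fun_eq_iff blinfun_compose_simps)

lemma cotangentI:
  "(\<And>c c'. c \<in> A \<Longrightarrow> c' \<in> A \<Longrightarrow> x \<in> fst c \<Longrightarrow> x \<in> fst c' \<Longrightarrow> \<xi> c' = \<xi> c o\<^sub>L tr c c' x)
    \<Longrightarrow> (\<And>c. \<not> (c \<in> A \<and> x \<in> fst c) \<Longrightarrow> \<xi> c = 0) \<Longrightarrow> \<xi> \<in> cotangent A x"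
  unfolding cotangent_iff by blast

lemma cotangent_zero: "cov_zero \<in> cotangent A x"
  by (rule cotangentI) (auto simp: cov_zero_def blinfun_compose_simps)

lemma cotangent_add:
  assumes "\<xi> \<in> cotangent A x" "\<eta> \<in> cotangent A x"
  shows "cov_add \<xi> \<eta> \<in> cotangent A x"
proof (rule cotangentI)
  fix c c' assume c: "c \<in> A" "c' \<in> A" "x \<in> fst c" "x \<in> fst c'"
  show "cov_add \<xi> \<eta> c' = cov_add \<xi> \<eta> c o\<^sub>L tr c c' x"
    unfolding cov_add_def cotangent_tr[OF assms(1) c] cotangent_tr[OF assms(2) c] blinfun_compose_simps
    by (rule refl)
qed (use cotangent_outside[OF assms(1)] cotangent_outside[OF assms(2)] in \<open>simp add: cov_add_def\<close>)

lemma cotangent_scale: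
  assumes "\<xi> \<in> cotangent A x"
  shows "cov_scale a \<xi> \<in> cotangent A x"
proof (rule cotangentI)
  fix c c' assume c: "c \<in> A" "c' \<in> A" "x \<in> fst c" "x \<in> fst c'"
  show "cov_scale a \<xi> c' = cov_scale a \<xi> c o\<^sub>L tr c c' x"
    unfolding cov_scale_def cotangent_tr[OF assms c] blinfun_compose_simps by (rule refl)
qed (use cotangent_outside[OF assms] in \<open>simp add: cov_scale_def\<close>)

text \<open>Continuity in the one chart \<open>c\<close> passes to all others because the
  differentials of the transition maps are continuous. Sections over part of a chart are thus
  obtained from continuous maps into the dual of the model space.\<close>

lemma continuous_section_lift:
  assumes c: "c \<in> A" and K: "K \<subseteq> fst c" and \<eta>: "continuous_on K \<eta>"
  shows "continuous_section_on A K (\<lambda>x. lift c x (\<eta> x))"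
  unfolding continuous_section_on_def
proof (intro conjI ballI)
  show "lift c x (\<eta> x) \<in> cotangent A x" if "x \<in> K" for x
    using c K that by (auto intro: lift_cotangent)
  fix c' assume c': "c' \<in> A"
  have "continuous_on (K \<inter> fst c') (\<lambda>x. \<eta> x o\<^sub>L tr c c' x)"
    using K by (intro bounded_bilinear.continuous_on[OF bounded_bilinear_blinfun_compose]
        continuous_on_subset[OF \<eta>] continuous_on_subset[OF tr_continuous[OF c c']]) auto
  then show "continuous_on (K \<inter> fst c') (\<lambda>x. lift c x (\<eta> x) c')"
    by (rule continuous_on_eq) (use c' in \<open>auto simp: lift_def\<close>)
qed

section \<open>Real functions of class C1 and their differentials\<close>

definition C1_real :: "('a \<Rightarrow> real) \<Rightarrow> bool" where
  "C1_real u \<longleftrightarrow> (\<forall>c\<in>A. C1_on (snd c ` fst c) (u \<circ> chart_inv c))"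

definition C1c_real :: "('a \<Rightarrow> real) set" where
  "C1c_real = {u. C1_real u \<and> compact (closure {x. u x \<noteq> 0})}"

lemma differential_eq: "differential A u x = (\<lambda>c. if c \<in> A \<and> x \<in> fst c then Dr (u \<circ> chart_inv c) (snd c x) else 0)"
  unfolding differential_def Dr_def by (rule refl)

lemma differential_cotangent:
  assumes "C1_real u"
  shows "differential A u x \<in> cotangent A x"
proof (rule cotangentI)
  fix c c' assume c: "c \<in> A" "c' \<in> A" "x \<in> fst c" "x \<in> fst c'"
  have "C1_on (snd c ` fst c) (u \<circ> chart_inv c)"
    using assms c unfolding C1_real_def by blast
  then show "differential A u x c' = differential A u x c o\<^sub>L tr c c' x"
    using change_chart[of c c' x u, OF c] c unfolding differential_eq by simp
qed (auto simp: differential_eq)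

lemma differential_section:
  assumes "C1_real u"
  shows "continuous_section_on A K (differential A u)"
  unfolding continuous_section_on_def
proof (intro conjI ballI differential_cotangent assms)
  fix c assume c: "c \<in> A"
  have "continuous_on (fst c) (\<lambda>x. Dr (u \<circ> chart_inv c) (snd c x))"
    by (rule continuous_on_compose2[OF C1_on_continuous_Dr[of "snd c ` fst c"]])
      (use assms c chart_continuous[OF c] in \<open>auto simp: C1_real_def\<close>)
  then have "continuous_on (K \<inter> fst c) (\<lambda>x. Dr (u \<circ> chart_inv c) (snd c x))"
    by (rule continuous_on_subset) auto
  then show "continuous_on (K \<inter> fst c) (\<lambda>x. differential A u x c)"
    by (rule continuous_on_eq) (use c in \<open>auto simp: differential_eq\<close>)
qed

lemma C1_real_continuous: "C1_real u \<Longrightarrow> continuous_on UNIV u"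
proof -
  assume u: "C1_real u"
  have "continuous (at x) u" for x
  proof -
    obtain c where c: "c \<in> A" "x \<in> fst c" by (rule chart_at)
    have "continuous_on (fst c) (\<lambda>x. (u \<circ> chart_inv c) (snd c x))"
      by (rule continuous_on_compose2[OF C1_on_continuous[of "snd c ` fst c"]])
        (use u c chart_continuous[OF c(1)] in \<open>unfold C1_real_def, blast+\<close>)
    then have "continuous_on (fst c) u"
      by (rule continuous_on_eq) (use c in auto)
    then show ?thesis
      using c open_chart_domain[OF c(1)] by (simp add: continuous_on_eq_continuous_at)
  qed
  then show ?thesis by (simp add: continuous_at_imp_continuous_on)
qed

lemma C1_real_add:
  assumes "C1_real u" "C1_real v"
  shows "C1_real (\<lambda>x. u x + v x)"
    and "differential A (\<lambda>x. u x + v x) x = cov_add (differential A u x) (differential A v x)"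
proof -
  have o: "(\<lambda>x. u x + v x) \<circ> chart_inv c = (\<lambda>p. (u \<circ> chart_inv c) p + (v \<circ> chart_inv c) p)" for c :: "('a, 'e) chart"
    by auto
  show "C1_real (\<lambda>x. u x + v x)"
    using assms unfolding C1_real_def o by (blast intro: C1_on_add)
  show "differential A (\<lambda>x. u x + v x) x = cov_add (differential A u x) (differential A v x)"
    using assms C1_on_add(2) unfolding C1_real_def differential_eq o cov_add_def by (fastforce simp: fun_eq_iff)
qed

lemma C1_real_mult:
  assumes "C1_real u" "C1_real v"
  shows "C1_real (\<lambda>x. u x * v x)"
    and "differential A (\<lambda>x. u x * v x) x =
      cov_add (cov_scale (u x) (differential A v x)) (cov_scale (v x) (differential A u x))"
proof -
  have o: "(\<lambda>x. u x * v x) \<circ> chart_inv c = (\<lambda>p. (u \<circ> chart_inv c) p * (v \<circ> chart_inv c) p)" for c :: "('a, 'e) chart"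
    by auto
  show "C1_real (\<lambda>x. u x * v x)"
    using assms unfolding C1_real_def o by (blast intro: C1_on_mult)
  show "differential A (\<lambda>x. u x * v x) x =
      cov_add (cov_scale (u x) (differential A v x)) (cov_scale (v x) (differential A u x))"
    unfolding differential_eq o cov_add_def cov_scale_def fun_eq_iff
  proof (intro allI)
    fix c
    show "(if c \<in> A \<and> x \<in> fst c then Dr (\<lambda>p. (u \<circ> chart_inv c) p * (v \<circ> chart_inv c) p) (snd c x) else 0) =
      u x *\<^sub>R (if c \<in> A \<and> x \<in> fst c then Dr (v \<circ> chart_inv c) (snd c x) else 0)
      + v x *\<^sub>R (if c \<in> A \<and> x \<in> fst c then Dr (u \<circ> chart_inv c) (snd c x) else 0)"
      using assms C1_on_mult(2)[of "snd c ` fst c" "u \<circ> chart_inv c" "v \<circ> chart_inv c" "snd c x"]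
      by (auto simp: C1_real_def)
  qed
qed

lemma C1_real_const: "C1_real (\<lambda>_. k)" "differential A (\<lambda>_. k) x = cov_zero"
proof -
  have o: "(\<lambda>_. k) \<circ> chart_inv c = (\<lambda>_. k)" for c :: "('a, 'e) chart" by auto
  show "C1_real (\<lambda>_. k)" by (auto simp: C1_real_def o C1_on_const)
  have "Dr ((\<lambda>_. k) \<circ> chart_inv c) p = 0" for p and c :: "('a, 'e) chart"
    unfolding o by (rule Dr_eq) (simp add: zero_blinfun.rep_eq)
  then show "differential A (\<lambda>_. k) x = cov_zero"
    unfolding differential_eq cov_zero_def by auto
qed

lemma C1_real_scale:
  assumes "C1_real u"
  shows "C1_real (\<lambda>x. k * u x)" "differential A (\<lambda>x. k * u x) x = cov_scale k (differential A u x)"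
  using C1_real_mult[OF C1_real_const(1)[of k] assms] C1_real_const(2)[of k]
  by (simp_all add: cov_add_def cov_scale_def cov_zero_def)

lemma C1c_realD: "u \<in> C1c_real \<Longrightarrow> C1_real u"
  by (simp add: C1c_real_def)

text \<open>The values \<open>z\<close> and \<open>z'\<close> may have different types, so that one
  statement serves functions, sections, and pairs of them.\<close>

lemma compact_support_subset:
  assumes "compact (closure {x::'a. v x \<noteq> z})" "\<And>x. w x \<noteq> z' \<Longrightarrow> v x \<noteq> z"
  shows "compact (closure {x. w x \<noteq> z'})"
proof -
  have "closure {x. w x \<noteq> z'} \<subseteq> closure {x. v x \<noteq> z}"
    using assms(2) by (intro closure_mono) auto
  then have "closure {x. w x \<noteq> z'} = closure {x. v x \<noteq> z} \<inter> closure {x. w x \<noteq> z'}"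
    by blast
  then show ?thesis
    using compact_Int_closed[OF assms(1) closed_closure] by metis
qed

end

section \<open>R-structures\<close>

text \<open>The vector representing a covector through the Euclidean scalar product; it allows norms
  of covectors to be studied on the unit sphere of the model space.\<close>

definition covec_vec :: "('e::euclidean_space \<Rightarrow>\<^sub>L real) \<Rightarrow> 'e" where
  "covec_vec \<eta> = (\<Sum>i\<in>Basis. blinfun_apply \<eta> i *\<^sub>R i)"

lemma blinfun_inner_left_covec_vec [simp]: "blinfun_inner_left (covec_vec \<eta>) = \<eta>"
proof (rule blinfun_eqI)
  fix h :: 'a
  have "blinfun_apply \<eta> h = blinfun_apply \<eta> (\<Sum>i\<in>Basis. (h \<bullet> i) *\<^sub>R i)"
    by (simp add: euclidean_representation)
  also have "\<dots> = (\<Sum>i\<in>Basis. (h \<bullet> i) * blinfun_apply \<eta> i)"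
    by (simp add: blinfun.sum_right blinfun.scaleR_right)
  finally show "blinfun_apply (blinfun_inner_left (covec_vec \<eta>)) h = blinfun_apply \<eta> h"
    by (simp add: covec_vec_def inner_sum_right mult.commute)
qed

lemma norm_le_covec_vec: "norm \<eta> \<le> norm (covec_vec \<eta>)"
proof (rule norm_blinfun_bound)
  fix h
  have "blinfun_apply \<eta> h = h \<bullet> covec_vec \<eta>"
    using blinfun_inner_left.rep_eq[of "covec_vec \<eta>"] by simp
  then show "norm (blinfun_apply \<eta> h) \<le> norm (covec_vec \<eta>) * norm h"
    using Cauchy_Schwarz_ineq2[of h "covec_vec \<eta>"] by (simp add: mult.commute)
qed simp

lemma blinfun_inner_left_linear: "linear blinfun_inner_left"
  by (rule bounded_linear.linear[OF bounded_linear_blinfun_inner_left])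

text \<open>Every \<open>p n\<close> differs from the limit and is isolated in the set, so any value
  is continuous there; at the limit, continuity is the convergence of the values. This provides
  sections over the points of a convergent sequence.\<close>

lemma continuous_on_sequence:
  fixes p :: "nat \<Rightarrow> 'b::metric_space" and y :: "nat \<Rightarrow> 'c::metric_space"
  assumes p: "p \<longlonglongrightarrow> l" "inj p" "\<And>n. p n \<noteq> l" and y: "y \<longlonglongrightarrow> yl"
    and f: "f l = yl" "\<And>n. f (p n) = y n"
  shows "continuous_on (insert l (range p)) f"
  unfolding continuous_on_iff
proof (intro ballI allI impI)
  fix x and e :: real assume x: "x \<in> insert l (range p)" and e: "e > 0"
  obtain M where M: "\<And>n. n \<ge> M \<Longrightarrow> dist (y n) yl < e / 2"
    using metric_LIMSEQ_D[OF y, of "e / 2"] e by auto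
  define F where "F = p ` {..<M}"
  show "\<exists>d>0. \<forall>x'\<in>insert l (range p). dist x' x < d \<longrightarrow> dist (f x') (f x) < e"
  proof (cases "x = l")
    case True
    obtain d where d: "d > 0" "\<And>z. z \<in> F \<Longrightarrow> z \<noteq> l \<Longrightarrow> d \<le> dist l z"
      using finite_set_avoid[of F l] by (auto simp: F_def)
    have "dist (f x') (f x) < e" if x': "x' \<in> insert l (range p)" "dist x' x < d" for x'
    proof -
      consider "x' = l" | n where "x' = p n" using x' by auto
      then show ?thesis
      proof cases
        case 2
        have "n \<ge> M"
        proof (rule ccontr)
          assume "\<not> n \<ge> M"
          then have "p n \<in> F" by (simp add: F_def)
          then show False using d(2)[of "p n"] p(3)[of n] x' 2 True by (simp add: dist_commute)
        qed
        then show ?thesis using M[of n] 2 True f e by simp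
      qed (use True e in simp)
    qed
    then show ?thesis using d(1) by blast
  next
    case False
    then obtain m where m: "x = p m" using x by auto
    have "0 < dist (p m) l / 2" using p(3) by simp
    then obtain L where L: "\<And>n. n \<ge> L \<Longrightarrow> dist (p n) l < dist (p m) l / 2"
      using metric_LIMSEQ_D[OF p(1)] by blast
    obtain d where d: "d > 0" "\<And>z. z \<in> p ` {..<L} \<Longrightarrow> z \<noteq> p m \<Longrightarrow> d \<le> dist (p m) z"
      using finite_set_avoid[of "p ` {..<L}" "p m"] by auto
    have "x' = x" if x': "x' \<in> insert l (range p)" "dist x' x < min d (dist (p m) l / 2)" for x'
    proof (rule ccontr)
      assume ne: "x' \<noteq> x"
      consider "x' = l" | n where "x' = p n" using x' by auto
      then show False
      proof cases
        case 1
        then show ?thesis using x' m zero_le_dist[of "p m" l] by (simp add: dist_commute)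
      next
        case 2
        show ?thesis
        proof (cases "n \<ge> L")
          case True
          have "dist (p m) l \<le> dist (p n) (p m) + dist (p n) l"
            by (rule dist_triangle3)
          then show ?thesis using L[OF True] x' 2 m by simp
        next
          case False
          then have "d \<le> dist (p m) (p n)" using ne 2 m by (intro d(2)) auto
          then show ?thesis using x' 2 m by (simp add: dist_commute)
        qed
      qed
    qed
    note eq = this
    show ?thesis
    proof (intro exI[of _ "min d (dist (p m) l / 2)"] conjI ballI impI)
      show "0 < min d (dist (p m) l / 2)" using d(1) \<open>0 < dist (p m) l / 2\<close> by simp
      fix x' assume "x' \<in> insert l (range p)" "dist x' x < min d (dist (p m) l / 2)"
      then have "x' = x" by (rule eq)
      then show "dist (f x') (f x) < e" using e by simp
    qed
  qed
qed

section \<open>The scalar product on the cotangent spaces\<close>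

locale R_manifold = C1_manifold A
  for A :: "('a::{t2_space,second_countable_topology}, 'e::euclidean_space) chart set" +
  fixes N :: "('a, 'e) conorm"
  assumes R: "R_structure A N"
begin

abbreviation I :: "'a \<Rightarrow> ('a, 'e) covec \<Rightarrow> ('a, 'e) covec \<Rightarrow> real" where
  "I x \<equiv> cov_inner (N x)"

text \<open>The structure provides some scalar product inducing the norm. Polarisation shows that
  \<open>cov_inner\<close> agrees with it on the cotangent space, which makes the calculus of scalar
  products available for \<open>cov_inner\<close>.\<close>

lemma bilinear_form:
  obtains B where
    "\<And>\<xi> \<eta>. \<xi> \<in> cotangent A x \<Longrightarrow> \<eta> \<in> cotangent A x \<Longrightarrow> I x \<xi> \<eta> = B \<xi> \<eta>"
    "\<And>\<xi> \<eta>. \<xi> \<in> cotangent A x \<Longrightarrow> \<eta> \<in> cotangent A x \<Longrightarrow> B \<xi> \<eta> = B \<eta> \<xi>"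
    "\<And>\<xi> \<eta> \<zeta>. \<xi> \<in> cotangent A x \<Longrightarrow> \<eta> \<in> cotangent A x \<Longrightarrow> \<zeta> \<in> cotangent A x \<Longrightarrow>
      B (cov_add \<xi> \<eta>) \<zeta> = B \<xi> \<zeta> + B \<eta> \<zeta>"
    "\<And>a \<xi> \<eta>. \<xi> \<in> cotangent A x \<Longrightarrow> \<eta> \<in> cotangent A x \<Longrightarrow> B (cov_scale a \<xi>) \<eta> = a * B \<xi> \<eta>"
    "\<And>\<xi>. \<xi> \<in> cotangent A x \<Longrightarrow> \<xi> \<noteq> cov_zero \<Longrightarrow> B \<xi> \<xi> > 0"
    "\<And>\<xi>. \<xi> \<in> cotangent A x \<Longrightarrow> B \<xi> \<xi> \<ge> 0"
    "\<And>\<xi>. \<xi> \<in> cotangent A x \<Longrightarrow> N x \<xi> = sqrt (B \<xi> \<xi>)"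
proof -
  have "quadratic_norm_on (cotangent A x) (N x)" using R by (simp add: R_structure_def)
  then obtain B where B:
    "\<forall>\<xi>\<in>cotangent A x. \<forall>\<eta>\<in>cotangent A x. B \<xi> \<eta> = B \<eta> \<xi>"
    "\<forall>\<xi>\<in>cotangent A x. \<forall>\<eta>\<in>cotangent A x. \<forall>\<zeta>\<in>cotangent A x. B (cov_add \<xi> \<eta>) \<zeta> = B \<xi> \<zeta> + B \<eta> \<zeta>"
    "\<forall>a. \<forall>\<xi>\<in>cotangent A x. \<forall>\<eta>\<in>cotangent A x. B (cov_scale a \<xi>) \<eta> = a * B \<xi> \<eta>"
    "\<forall>\<xi>\<in>cotangent A x. \<xi> \<noteq> cov_zero \<longrightarrow> B \<xi> \<xi> > 0"
    "\<forall>\<xi>\<in>cotangent A x. N x \<xi> = sqrt (B \<xi> \<xi>)"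
    unfolding quadratic_norm_on_def by (elim exE conjE) (rule that)
  note sym = B(1)[rule_format] and add = B(2)[rule_format] and sc = B(3)[rule_format]
    and pos = B(4)[rule_format] and N = B(5)[rule_format]
  have zero: "cov_scale 0 \<xi> = cov_zero" for \<xi> :: "('a, 'e) covec"
    by (simp add: cov_scale_def cov_zero_def)
  have nonneg: "B \<xi> \<xi> \<ge> 0" if "\<xi> \<in> cotangent A x" for \<xi>
  proof (cases "\<xi> = cov_zero")
    case True
    then show ?thesis using sc[OF that that, of 0] zero[of \<xi>] by simp
  qed (use pos[OF that] in simp)
  have "I x \<xi> \<eta> = B \<xi> \<eta>" if "\<xi> \<in> cotangent A x" "\<eta> \<in> cotangent A x" for \<xi> \<eta>
  proof -
    define \<eta>' where "\<eta>' = cov_scale (- 1) \<eta>"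
    have c: "\<eta>' \<in> cotangent A x" "cov_add \<xi> \<eta> \<in> cotangent A x" "cov_add \<xi> \<eta>' \<in> cotangent A x"
      using that by (auto simp: \<eta>'_def cotangent_add cotangent_scale)
    have sq: "(N x \<zeta>)\<^sup>2 = B \<zeta> \<zeta>" if "\<zeta> \<in> cotangent A x" for \<zeta>
      using N[OF that] nonneg[OF that] by simp
    have "B (cov_add \<xi> \<theta>) (cov_add \<xi> \<theta>) = B \<xi> \<xi> + 2 * B \<xi> \<theta> + B \<theta> \<theta>" if t: "\<theta> \<in> cotangent A x" for \<theta>
    proof -
      have s: "cov_add \<xi> \<theta> \<in> cotangent A x" using \<open>\<xi> \<in> _\<close> t by (rule cotangent_add)
      have "B (cov_add \<xi> \<theta>) (cov_add \<xi> \<theta>) = B (cov_add \<xi> \<theta>) \<xi> + B (cov_add \<xi> \<theta>) \<theta>"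
        using add[OF \<open>\<xi> \<in> _\<close> t s] sym[OF \<open>\<xi> \<in> _\<close> s] sym[OF t s] by simp
      also have "\<dots> = B \<xi> \<xi> + 2 * B \<xi> \<theta> + B \<theta> \<theta>"
        using add[OF \<open>\<xi> \<in> _\<close> t \<open>\<xi> \<in> _\<close>] add[OF \<open>\<xi> \<in> _\<close> t t] sym[OF \<open>\<xi> \<in> _\<close> t] by simp
      finally show ?thesis .
    qed
    note ex = this
    have "B \<eta>' \<eta>' = B \<eta> \<eta>" "B \<xi> \<eta>' = - B \<xi> \<eta>"
      using sc[OF that(2) c(1), of "-1"] sc[OF that(2) that(2), of "-1"] sym[OF c(1) that(2)]
        sc[OF that(2) that(1), of "-1"] sym[OF c(1) that(1)] sym[OF that] by (simp_all add: \<eta>'_def)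
    then show ?thesis
      unfolding cov_inner_def \<eta>'_def[symmetric] sq[OF c(2)] sq[OF c(3)] ex[OF that(2)] ex[OF c(1)] by simp
  qed
  from that[OF this sym add sc pos nonneg N] show ?thesis .
qed

lemma I_sym: "\<xi> \<in> cotangent A x \<Longrightarrow> \<eta> \<in> cotangent A x \<Longrightarrow> I x \<xi> \<eta> = I x \<eta> \<xi>"
  by (rule bilinear_form[of x]) simp

lemma I_add_left: "\<xi> \<in> cotangent A x \<Longrightarrow> \<eta> \<in> cotangent A x \<Longrightarrow> \<zeta> \<in> cotangent A x \<Longrightarrow>
    I x (cov_add \<xi> \<eta>) \<zeta> = I x \<xi> \<zeta> + I x \<eta> \<zeta>"
  by (rule bilinear_form[of x]) (simp add: cotangent_add)

lemma I_scale_left: "\<xi> \<in> cotangent A x \<Longrightarrow> \<eta> \<in> cotangent A x \<Longrightarrow> I x (cov_scale a \<xi>) \<eta> = a * I x \<xi> \<eta>"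
  by (rule bilinear_form[of x]) (simp add: cotangent_scale)

lemma I_add_right: "\<xi> \<in> cotangent A x \<Longrightarrow> \<eta> \<in> cotangent A x \<Longrightarrow> \<zeta> \<in> cotangent A x \<Longrightarrow>
    I x \<zeta> (cov_add \<xi> \<eta>) = I x \<zeta> \<xi> + I x \<zeta> \<eta>"
  using I_add_left[of \<xi> x \<eta> \<zeta>] I_sym[of \<zeta> x] by (simp add: cotangent_add)

lemma I_scale_right: "\<xi> \<in> cotangent A x \<Longrightarrow> \<eta> \<in> cotangent A x \<Longrightarrow> I x \<eta> (cov_scale a \<xi>) = a * I x \<eta> \<xi>"
  using I_scale_left[of \<xi> x \<eta> a] I_sym[of \<eta> x] by (simp add: cotangent_scale)

lemma I_self: "\<xi> \<in> cotangent A x \<Longrightarrow> I x \<xi> \<xi> = (N x \<xi>)\<^sup>2"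
  by (rule bilinear_form[of x]) simp

lemma N_nonneg: "\<xi> \<in> cotangent A x \<Longrightarrow> 0 \<le> N x \<xi>"
  by (rule bilinear_form[of x]) simp

lemma N_pos: "\<xi> \<in> cotangent A x \<Longrightarrow> \<xi> \<noteq> cov_zero \<Longrightarrow> 0 < N x \<xi>"
  by (rule bilinear_form[of x]) simp

lemma I_zero_left: "\<eta> \<in> cotangent A x \<Longrightarrow> I x cov_zero \<eta> = 0"
  using I_scale_left[of \<eta> x \<eta> 0] by (simp add: cov_scale_def cov_zero_def)

lemma I_zero_right: "\<eta> \<in> cotangent A x \<Longrightarrow> I x \<eta> cov_zero = 0"
  using I_zero_left[of \<eta> x] I_sym[of \<eta> x cov_zero] cotangent_zero by simp

lemma N_zero: "N x cov_zero = 0"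
  using I_self[OF cotangent_zero, of x] I_zero_left[OF cotangent_zero, of x] by simp

lemma N_scale: "\<xi> \<in> cotangent A x \<Longrightarrow> N x (cov_scale a \<xi>) = \<bar>a\<bar> * N x \<xi>"
proof -
  assume \<xi>: "\<xi> \<in> cotangent A x"
  have "(N x (cov_scale a \<xi>))\<^sup>2 = (\<bar>a\<bar> * N x \<xi>)\<^sup>2"
    using \<xi> I_self[OF cotangent_scale[OF \<xi>], of a] I_self[OF \<xi>]
    by (simp add: I_scale_left I_scale_right cotangent_scale power_mult_distrib)
      (simp add: power2_eq_square mult.assoc)
  then show ?thesis
    by (rule power2_eq_imp_eq) (use \<xi> in \<open>auto simp: N_nonneg cotangent_scale\<close>)
qed

lemma I_Cauchy_Schwarz:
  assumes "\<xi> \<in> cotangent A x" "\<eta> \<in> cotangent A x"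
  shows "\<bar>I x \<xi> \<eta>\<bar> \<le> N x \<xi> * N x \<eta>"
proof -
  have "(I x \<xi> \<eta>)\<^sup>2 \<le> (N x \<xi>)\<^sup>2 * (N x \<eta>)\<^sup>2"
  proof (rule quadratic_nonneg_imp_le)
    fix s :: real
    define \<zeta> where "\<zeta> = cov_scale (- (s * I x \<xi> \<eta>)) \<eta>"
    have \<zeta>: "\<zeta> \<in> cotangent A x" using assms by (simp add: \<zeta>_def cotangent_scale)
    have "0 \<le> I x (cov_add \<xi> \<zeta>) (cov_add \<xi> \<zeta>)"
      using I_self[of "cov_add \<xi> \<zeta>" x] assms \<zeta> by (simp add: cotangent_add)
    also have "\<dots> = I x \<xi> \<xi> + 2 * I x \<xi> \<zeta> + I x \<zeta> \<zeta>"
      using assms \<zeta> by (simp add: I_add_left I_add_right cotangent_add I_sym[of \<zeta> x \<xi>])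
    also have "I x \<xi> \<zeta> = - (s * (I x \<xi> \<eta>)\<^sup>2)"
      using assms by (simp add: \<zeta>_def I_scale_right power2_eq_square)
    also have "I x \<zeta> \<zeta> = s\<^sup>2 * (I x \<xi> \<eta>)\<^sup>2 * (N x \<eta>)\<^sup>2"
      using assms I_self[OF assms(2)]
      by (simp add: \<zeta>_def I_scale_left I_scale_right cotangent_scale power2_eq_square mult_ac)
    finally show "0 \<le> (N x \<xi>)\<^sup>2 - 2 * s * (I x \<xi> \<eta>)\<^sup>2 + s\<^sup>2 * (I x \<xi> \<eta>)\<^sup>2 * (N x \<eta>)\<^sup>2"
      using I_self[OF assms(1)] by (simp add: algebra_simps)
  qed auto
  then have "\<bar>I x \<xi> \<eta>\<bar>\<^sup>2 \<le> (N x \<xi> * N x \<eta>)\<^sup>2" by (simp add: power_mult_distrib)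
  then show ?thesis by (rule power2_le_imp_le) (use assms N_nonneg in simp)
qed

lemma N_triangle:
  assumes "\<xi> \<in> cotangent A x" "\<eta> \<in> cotangent A x"
  shows "N x (cov_add \<xi> \<eta>) \<le> N x \<xi> + N x \<eta>"
proof (rule power2_le_imp_le)
  have "(N x (cov_add \<xi> \<eta>))\<^sup>2 = (N x \<xi>)\<^sup>2 + 2 * I x \<xi> \<eta> + (N x \<eta>)\<^sup>2"
    using assms I_self[of "cov_add \<xi> \<eta>" x] I_self[OF assms(1)] I_self[OF assms(2)]
    by (simp add: I_add_left I_add_right cotangent_add I_sym[of \<eta> x \<xi>])
  then show "(N x (cov_add \<xi> \<eta>))\<^sup>2 \<le> (N x \<xi> + N x \<eta>)\<^sup>2"
    using I_Cauchy_Schwarz[OF assms] by (simp add: power2_sum)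
qed (use assms N_nonneg in simp)

text \<open>Covectors at \<open>x\<close> parametrised by the model space through the chart
  \<open>c\<close>. For fixed \<open>y\<close> this is also a section over the chart domain,
  constant in coordinates.\<close>

definition Y :: "('a, 'e) chart \<Rightarrow> 'a \<Rightarrow> 'e \<Rightarrow> ('a, 'e) covec" where
  "Y c x y = lift c x (blinfun_inner_left y)"

lemma Y_cotangent: "c \<in> A \<Longrightarrow> x \<in> fst c \<Longrightarrow> Y c x y \<in> cotangent A x"
  by (simp add: Y_def lift_cotangent)

lemma Y_add: "Y c x (y + z) = cov_add (Y c x y) (Y c x z)"
  by (simp add: Y_def lift_add linear_add[OF blinfun_inner_left_linear])

lemma Y_scale: "Y c x (a *\<^sub>R y) = cov_scale a (Y c x y)"
  by (simp add: Y_def lift_scale linear_scale[OF blinfun_inner_left_linear])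

lemma Y_covec_vec: "c \<in> A \<Longrightarrow> x \<in> fst c \<Longrightarrow> \<xi> \<in> cotangent A x \<Longrightarrow> Y c x (covec_vec (\<xi> c)) = \<xi>"
  by (simp add: Y_def lift_eq)

lemma Y_nonzero:
  assumes "c \<in> A" "x \<in> fst c" "y \<noteq> 0"
  shows "Y c x y \<noteq> cov_zero"
proof
  assume "Y c x y = cov_zero"
  then have "Y c x y c = 0" by (simp add: cov_zero_def)
  then have "blinfun_inner_left y = 0" using assms by (simp add: Y_def)
  then have "blinfun_apply (blinfun_inner_left y) y = 0" by simp
  then show False using assms(3) by simp
qed

lemma Y_zero: "Y c x 0 = cov_zero"
  using Y_scale[of c x 0 0] by (simp add: cov_scale_def cov_zero_def)

text \<open>Its values at basis vectors are the coefficients of the structure in the chart;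
  measurability and boundedness of all pairings are reduced to them.\<close>

definition gram :: "('a, 'e) chart \<Rightarrow> 'a \<Rightarrow> 'e \<Rightarrow> 'e \<Rightarrow> real" where
  "gram c x y z = I x (Y c x y) (Y c x z)"

lemma bilinear_gram: "c \<in> A \<Longrightarrow> x \<in> fst c \<Longrightarrow> bilinear (gram c x)"
  unfolding bilinear_def gram_def
  by (auto intro!: linearI simp: Y_add Y_scale Y_cotangent I_add_left I_add_right I_scale_left I_scale_right)

lemma I_gram:
  assumes "c \<in> A" "x \<in> fst c" "\<xi> \<in> cotangent A x" "\<eta> \<in> cotangent A x"
  shows "I x \<xi> \<eta> = (\<Sum>(i, j)\<in>Basis \<times> Basis. blinfun_apply (\<xi> c) i * blinfun_apply (\<eta> c) j * gram c x i j)"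
proof -
  have "I x \<xi> \<eta> = gram c x (covec_vec (\<xi> c)) (covec_vec (\<eta> c))"
    using assms by (simp add: gram_def Y_covec_vec)
  also have "\<dots> = (\<Sum>(i, j)\<in>Basis \<times> Basis. gram c x (blinfun_apply (\<xi> c) i *\<^sub>R i) (blinfun_apply (\<eta> c) j *\<^sub>R j))"
    unfolding covec_vec_def by (rule bilinear_sum[OF bilinear_gram[OF assms(1,2)]])
  also have "\<dots> = (\<Sum>(i, j)\<in>Basis \<times> Basis. blinfun_apply (\<xi> c) i * blinfun_apply (\<eta> c) j * gram c x i j)"
    by (intro sum.cong) (auto simp: bilinear_lmul[OF bilinear_gram[OF assms(1,2)]]
        bilinear_rmul[OF bilinear_gram[OF assms(1,2)]])
  finally show ?thesis .
qed

text \<open>The axioms of an R-structure speak of sections without zeros, which a nonzero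
  \<open>y\<close> provides; the zero vector is treated apart.\<close>

lemma N_Y_measurable:
  assumes c: "c \<in> A" and K: "compact K" "K \<subseteq> fst c"
  shows "(\<lambda>x. N x (Y c x y)) \<in> borel_measurable (restrict_space borel K)"
    and "\<exists>C. \<forall>x\<in>K. N x (Y c x y) \<le> C"
proof -
  have "(\<lambda>x. N x (Y c x y)) \<in> borel_measurable (restrict_space borel K) \<and> (\<exists>C. \<forall>x\<in>K. N x (Y c x y) \<le> C)"
  proof (cases "y = 0")
    case True
    then show ?thesis by (simp add: Y_zero N_zero) (auto intro: exI[of _ 0])
  next
    case False
    have "continuous_section_on A K (\<lambda>x. Y c x y)"
      unfolding Y_def by (intro continuous_section_lift c K continuous_on_const)
    moreover have "\<forall>x\<in>K. Y c x y \<noteq> cov_zero"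
      using Y_nonzero[OF c _ False] K by blast
    ultimately have "(\<lambda>x. N x (Y c x y)) \<in> borel_measurable (restrict_space borel K)"
      "bounded ((\<lambda>x. N x (Y c x y)) ` K)"
      using R K(1) unfolding R_structure_def by blast+
    then show ?thesis by (auto simp: bounded_iff intro: order_trans[OF abs_ge_self])
  qed
  then show "(\<lambda>x. N x (Y c x y)) \<in> borel_measurable (restrict_space borel K)"
    "\<exists>C. \<forall>x\<in>K. N x (Y c x y) \<le> C" by auto
qed

lemma gram_measurable:
  assumes c: "c \<in> A" and K: "compact K" "K \<subseteq> fst c"
  shows "(\<lambda>x. gram c x y z) \<in> borel_measurable (restrict_space borel K)"
    and "\<exists>C. \<forall>x\<in>K. \<bar>gram c x y z\<bar> \<le> C"
proof -
  have "Y c x (y - z) = cov_add (Y c x y) (cov_scale (- 1) (Y c x z))" for x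
    using Y_add[of c x y "- 1 *\<^sub>R z"] Y_scale[of c x "- 1" z] by simp
  then have eq: "gram c x y z = ((N x (Y c x (y + z)))\<^sup>2 - (N x (Y c x (y - z)))\<^sup>2) / 4" for x
    by (simp add: gram_def cov_inner_def Y_add)
  show "(\<lambda>x. gram c x y z) \<in> borel_measurable (restrict_space borel K)"
    unfolding eq using N_Y_measurable(1)[OF c K] by measurable
  obtain C1 C2 where C: "\<And>x. x \<in> K \<Longrightarrow> N x (Y c x y) \<le> C1" "\<And>x. x \<in> K \<Longrightarrow> N x (Y c x z) \<le> C2"
    using N_Y_measurable(2)[OF c K] by meson
  have "\<bar>gram c x y z\<bar> \<le> C1 * C2" if x: "x \<in> K" for x
  proof -
    have Yc: "Y c x w \<in> cotangent A x" for w using c K x by (auto intro: Y_cotangent)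
    have "\<bar>gram c x y z\<bar> \<le> N x (Y c x y) * N x (Y c x z)"
      unfolding gram_def by (intro I_Cauchy_Schwarz Yc)
    also have "\<dots> \<le> C1 * C2"
      using C[OF x] N_nonneg[OF Yc, of y] N_nonneg[OF Yc, of z] by (intro mult_mono) auto
    finally show ?thesis .
  qed
  then show "\<exists>C. \<forall>x\<in>K. \<bar>gram c x y z\<bar> \<le> C" by blast
qed

text \<open>The sections may have zeros, so the axioms do not apply to them directly; expanding them
  in sections constant in coordinates leaves continuous coefficients and the entries of the Gram
  matrix.\<close>

lemma section_pairing_chart:
  assumes c: "c \<in> A" and K: "compact K" "K \<subseteq> fst c"
    and v: "continuous_section_on A UNIV v" and w: "continuous_section_on A UNIV w"
  shows "(\<lambda>x. I x (v x) (w x)) \<in> borel_measurable (restrict_space borel K)"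
    and "\<exists>C. \<forall>x\<in>K. \<bar>I x (v x) (w x)\<bar> \<le> C"
proof -
  have cont: "continuous_on K (\<lambda>x. blinfun_apply (s x c) i)" if "continuous_section_on A UNIV s" for s i
    using that c K unfolding continuous_section_on_def
    by (intro continuous_intros) (auto intro: continuous_on_subset)
  have cot: "s x \<in> cotangent A x" if "continuous_section_on A UNIV s" for s x
    using that by (simp add: continuous_section_on_def)
  have eq: "I x (v x) (w x) = (\<Sum>(i, j)\<in>Basis \<times> Basis. blinfun_apply (v x c) i * blinfun_apply (w x c) j * gram c x i j)"
    if "x \<in> K" for x
    using I_gram[OF c _ cot[OF v] cot[OF w], of x] that K by blast
  have "(\<lambda>x. blinfun_apply (s x c) i) \<in> borel_measurable (restrict_space borel K)"
    if "continuous_section_on A UNIV s" for s i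
    by (rule borel_measurable_continuous_on_restrict[OF cont[OF that]])
  then have "(\<lambda>x. \<Sum>(i, j)\<in>Basis \<times> Basis. blinfun_apply (v x c) i * blinfun_apply (w x c) j * gram c x i j)
      \<in> borel_measurable (restrict_space borel K)"
    using v w gram_measurable(1)[OF c K]
    by (intro borel_measurable_sum) (auto simp: case_prod_beta intro!: borel_measurable_times)
  then show "(\<lambda>x. I x (v x) (w x)) \<in> borel_measurable (restrict_space borel K)"
    by (rule measurable_cong[THEN iffD1, rotated]) (use eq in \<open>auto simp: space_restrict_space\<close>)
  have "\<exists>C. \<forall>x\<in>K. \<bar>blinfun_apply (v x c) i * blinfun_apply (w x c) j * gram c x i j\<bar> \<le> C" for i j
  proof -
    obtain C1 where C1: "\<And>x. x \<in> K \<Longrightarrow> \<bar>blinfun_apply (v x c) i\<bar> \<le> C1"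
      using compact_imp_bounded[OF compact_continuous_image[OF cont[OF v] K(1)], of i] by (auto simp: bounded_iff)
    obtain C2 where C2: "\<And>x. x \<in> K \<Longrightarrow> \<bar>blinfun_apply (w x c) j\<bar> \<le> C2"
      using compact_imp_bounded[OF compact_continuous_image[OF cont[OF w] K(1)], of j] by (auto simp: bounded_iff)
    obtain C3 where C3: "\<And>x. x \<in> K \<Longrightarrow> \<bar>gram c x i j\<bar> \<le> C3"
      using gram_measurable(2)[OF c K] by blast
    have "\<bar>blinfun_apply (v x c) i * blinfun_apply (w x c) j * gram c x i j\<bar> \<le> C1 * C2 * C3" if "x \<in> K" for x
      unfolding abs_mult using C1[OF that] C2[OF that] C3[OF that]
      by (intro mult_mono) (auto intro!: mult_nonneg_nonneg intro: order_trans[OF abs_ge_zero])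
    then show ?thesis by blast
  qed
  then obtain C where C: "\<And>i j x. x \<in> K \<Longrightarrow> \<bar>blinfun_apply (v x c) i * blinfun_apply (w x c) j * gram c x i j\<bar> \<le> C i j"
    by metis
  have "\<bar>I x (v x) (w x)\<bar> \<le> (\<Sum>(i, j)\<in>Basis \<times> Basis. C i j)" if "x \<in> K" for x
    unfolding eq[OF that] using C[OF that] by (intro order_trans[OF sum_abs] sum_mono) auto
  then show "\<exists>C. \<forall>x\<in>K. \<bar>I x (v x) (w x)\<bar> \<le> C" by blast
qed

text \<open>The open box provides a neighbourhood, the closed one a compact set on which the box
  form of Rellich's theorem can be used.\<close>

lemma chart_box:
  assumes "c \<in> A" "x \<in> fst c" "open W" "snd c x \<in> W"
  obtains a b where "cbox a b \<subseteq> W \<inter> snd c ` fst c" "snd c x \<in> box a b"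
    "open (chart_inv c ` box a b)" "x \<in> chart_inv c ` box a b"
    "compact (chart_inv c ` cbox a b)" "chart_inv c ` cbox a b \<subseteq> fst c"
proof -
  have "open (W \<inter> snd c ` fst c)" "snd c x \<in> W \<inter> snd c ` fst c"
    using assms open_chart_image by auto
  then obtain a b where ab: "cbox a b \<subseteq> W \<inter> snd c ` fst c" "snd c x \<in> box a b"
    by (rule open_contains_cbox)
  have sub: "box a b \<subseteq> snd c ` fst c" using ab(1) box_subset_cbox by blast
  show ?thesis
  proof (rule that[OF ab])
    show "open (chart_inv c ` box a b)"
      by (rule open_chart_inv_image[OF assms(1) open_box sub])
    show "x \<in> chart_inv c ` box a b"
      using ab(2) chart_inv_chart[OF assms(1,2)] by (metis imageI)
    show "compact (chart_inv c ` cbox a b)"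
      using ab(1) by (intro compact_chart_inv_image[OF assms(1) compact_cbox]) auto
    show "chart_inv c ` cbox a b \<subseteq> fst c"
      using ab(1) by (intro image_subsetI chart_inv_in) auto
  qed
qed

lemma compact_chart_neighbourhood:
  obtains c U K where "c \<in> A" "open U" "x \<in> U" "U \<subseteq> K" "compact K" "K \<subseteq> fst c"
proof -
  obtain c where c: "c \<in> A" "x \<in> fst c" by (rule chart_at)
  obtain a b where "open (chart_inv c ` box a b)" "x \<in> chart_inv c ` box a b"
    "compact (chart_inv c ` cbox a b)" "chart_inv c ` cbox a b \<subseteq> fst c"
    using chart_box[OF c open_UNIV UNIV_I] by metis
  then show ?thesis
    using that[OF c(1)] box_subset_cbox by (metis image_mono)
qed

text \<open>By second countability, countably many compact chart neighbourhoods cover the manifold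
  (Lindelof), and measurability may be tested on countably many pieces.\<close>

lemma measurable_if_chartwise:
  fixes f :: "'a \<Rightarrow> real"
  assumes "\<And>c K. c \<in> A \<Longrightarrow> compact K \<Longrightarrow> K \<subseteq> fst c \<Longrightarrow> f \<in> borel_measurable (restrict_space borel K)"
  shows "f \<in> borel_measurable borel"
proof -
  have "\<exists>U K. open U \<and> x \<in> U \<and> U \<subseteq> K \<and> compact K \<and> (\<exists>c\<in>A. K \<subseteq> fst c)" for x
    using compact_chart_neighbourhood[of x] by metis
  then obtain U K where UK: "\<And>x. open (U x)" "\<And>x. x \<in> U x" "\<And>x. U x \<subseteq> K x" "\<And>x. compact (K x)"
    "\<And>x. \<exists>c\<in>A. K x \<subseteq> fst c"
    by metis
  obtain F where F: "F \<subseteq> range U" "countable F" "\<Union>F = \<Union>(range U)"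
    using Lindelof[of "range U"] UK(1) by blast
  then obtain P where P: "countable P" "F = U ` P"
    using countable_subset_image[of F U UNIV] by blast
  show ?thesis
  proof (rule measurable_piecewise_restrict)
    show "countable (K ` P)" using P by simp
    show "\<Omega> \<inter> space borel \<in> sets borel" if "\<Omega> \<in> K ` P" for \<Omega>
      using that UK(4) by (auto intro: borel_closed compact_imp_closed)
    have cover: "UNIV \<subseteq> \<Union>F" using F(3) UK(2) by blast
    show "space borel \<subseteq> \<Union>(K ` P)"
    proof
      fix x
      have "x \<in> \<Union>(U ` P)" using cover P(2) by auto
      then obtain i where i: "i \<in> P" "x \<in> U i" by (rule UN_E)
      then show "x \<in> \<Union>(K ` P)" using subsetD[OF UK(3) i(2)] by (intro UN_I)
    qed
    fix \<Omega> assume "\<Omega> \<in> K ` P"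
    then obtain i where i: "\<Omega> = K i" by (rule imageE)
    obtain c where c: "c \<in> A" "K i \<subseteq> fst c" using UK(5)[of i] by (elim bexE) (rule that)
    show "f \<in> borel_measurable (restrict_space borel \<Omega>)"
      unfolding i by (rule assms[OF c(1) UK(4) c(2)])
  qed
qed

lemma section_pairing_measurable:
  assumes "continuous_section_on A UNIV v" "continuous_section_on A UNIV w"
  shows "(\<lambda>x. I x (v x) (w x)) \<in> borel_measurable borel"
  using section_pairing_chart(1)[OF _ _ _ assms] by (rule measurable_if_chartwise)

lemma section_pairing_bounded:
  assumes v: "continuous_section_on A UNIV v" "continuous_section_on A UNIV w" and K: "compact K"
  shows "\<exists>C. \<forall>x\<in>K. \<bar>I x (v x) (w x)\<bar> \<le> C"
proof -
  have "\<exists>U C. open U \<and> x \<in> U \<and> (\<forall>y\<in>U. \<bar>I y (v y) (w y)\<bar> \<le> C)" for x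
  proof -
    obtain c U K where *: "c \<in> A" "open U" "x \<in> U" "U \<subseteq> K" "compact K" "K \<subseteq> fst c"
      by (rule compact_chart_neighbourhood)
    then show ?thesis
      using section_pairing_chart(2)[OF *(1,5,6) v] by blast
  qed
  then obtain U C where U: "\<And>x. open (U x)" "\<And>x. x \<in> U x" "\<And>x y. y \<in> U x \<Longrightarrow> \<bar>I y (v y) (w y)\<bar> \<le> C x"
    by metis
  obtain P where P: "finite P" "K \<subseteq> (\<Union>x\<in>P. U x)"
    using compactE_image[OF K, of UNIV U] U by (metis UNIV_I UN_I subsetI)
  have "\<bar>I y (v y) (w y)\<bar> \<le> (\<Sum>x\<in>P. \<bar>C x\<bar>)" if "y \<in> K" for y
  proof -
    obtain x where x: "x \<in> P" "y \<in> U x" using P \<open>y \<in> K\<close> by blast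
    have "\<bar>I y (v y) (w y)\<bar> \<le> \<bar>C x\<bar>" using U(3)[OF x(2)] by simp
    also have "\<dots> \<le> (\<Sum>x\<in>P. \<bar>C x\<bar>)" using P(1) x by (intro member_le_sum) auto
    finally show ?thesis .
  qed
  then show ?thesis by blast
qed

text \<open>At one point the square of the norm is a quadratic form in coordinates, hence continuous
  on the unit sphere, and attains a positive minimum there.\<close>

lemma N_lower_pointwise:
  assumes c: "c \<in> A" "x \<in> fst c"
  shows "\<exists>m>0. \<forall>y. norm y = 1 \<longrightarrow> m \<le> N x (Y c x y)"
proof -
  define q where "q y = I x (Y c x y) (Y c x y)" for y
  have q: "q y = (\<Sum>(i, j)\<in>Basis \<times> Basis. (y \<bullet> i) * (y \<bullet> j) * gram c x i j)" for y
    using I_gram[OF c Y_cotangent[OF c] Y_cotangent[OF c], of y y] c by (simp add: q_def Y_def)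
      (simp add: inner_commute)
  have "continuous_on (sphere 0 1) q"
    unfolding q by (intro continuous_on_sum) (auto intro!: continuous_intros)
  moreover have "sphere (0::'e) 1 \<noteq> {}" by simp
  ultimately obtain y0 where y0: "y0 \<in> sphere 0 1" "\<And>y. y \<in> sphere 0 1 \<Longrightarrow> q y0 \<le> q y"
    using continuous_attains_inf[OF compact_sphere] by blast
  have "y0 \<noteq> 0" using y0(1) by auto
  then have "0 < N x (Y c x y0)"
    using c by (intro N_pos Y_cotangent Y_nonzero)
  moreover have "N x (Y c x y0) \<le> N x (Y c x y)" if "norm y = 1" for y
  proof (rule power2_le_imp_le)
    show "(N x (Y c x y0))\<^sup>2 \<le> (N x (Y c x y))\<^sup>2"
      using y0(2)[of y] that by (simp add: q_def I_self Y_cotangent c)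
  qed (use c in \<open>auto intro: N_nonneg Y_cotangent\<close>)
  ultimately show ?thesis by blast
qed

text \<open>The lower bound on a compact set is only assumed along continuous sections. If it failed
  uniformly in the direction, almost optimal directions at distinct points converging to a point
  would form a continuous nonvanishing section over the compact set made of these points.\<close>

lemma N_lower:
  assumes c: "c \<in> A" and K: "compact K" "K \<subseteq> fst c"
  shows "\<exists>k>0. \<forall>x\<in>K. \<forall>y. norm y = 1 \<longrightarrow> k \<le> N x (Y c x y)"
proof (rule ccontr)
  assume neg: "\<not> ?thesis"
  have small: "\<exists>x y. x \<in> K \<and> norm y = 1 \<and> N x (Y c x y) < k" if "k > 0" for k
    using neg that by (meson not_le)
  have "\<forall>x\<in>fst c. \<exists>m>0. \<forall>y. norm y = 1 \<longrightarrow> m \<le> N x (Y c x y)"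
    using N_lower_pointwise[OF c] by blast
  \<comment> \<open>The numbers \<open>m x\<close> need not have a positive lower bound on
    \<open>K\<close>; they serve to keep the points of the sequence apart.\<close>
  then obtain m where m: "\<And>x. x \<in> fst c \<Longrightarrow> m x > 0"
    "\<And>x y. x \<in> fst c \<Longrightarrow> norm y = 1 \<Longrightarrow> m x \<le> N x (Y c x y)"
    by metis
  define P where "P n s \<longleftrightarrow> fst s \<in> K \<and> norm (snd s) = 1 \<and> N (fst s) (Y c (fst s) (snd s)) < 1 / (real n + 1)"
    for n and s :: "'a \<times> 'e"
  \<comment> \<open>Asking for a norm below the value of \<open>m\<close> at the previous point
    forces the values of \<open>m\<close> to decrease strictly, hence the points to be
    distinct.\<close>
  have "\<exists>s. \<forall>n. P n (s n) \<and> m (fst (s (Suc n))) < m (fst (s n))"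
  proof (rule dependent_nat_choice)
    show "\<exists>s. P 0 s" using small[of 1] by (auto simp: P_def)
    fix s n assume "P n s"
    then have s: "fst s \<in> fst c" using K by (auto simp: P_def)
    obtain x y where xy: "x \<in> K" "norm y = 1" "N x (Y c x y) < min (m (fst s)) (1 / (real (Suc n) + 1))"
      using small[of "min (m (fst s)) (1 / (real (Suc n) + 1))"] m(1)[OF s] by auto
    then have "P (Suc n) (x, y)" "m (fst (x, y)) < m (fst s)"
      using m(2)[of x y] K by (auto simp: P_def)
    then show "\<exists>t. P (Suc n) t \<and> m (fst t) < m (fst s)" by blast
  qed
  then obtain s where s: "\<And>n. P n (s n)" "\<And>n. m (fst (s (Suc n))) < m (fst (s n))" by blast
  define x where "x n = fst (s n)" for n
  define y where "y n = snd (s n)" for n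
  have x: "x n \<in> K" "x n \<in> fst c" and y: "norm (y n) = 1" and Nxy: "N (x n) (Y c (x n) (y n)) < 1 / (real n + 1)" for n
    using s(1)[of n] K by (auto simp: P_def x_def y_def)
  have "- m (x n) < - m (x (Suc n))" for n
    using s(2)[of n] by (simp add: x_def)
  then have decreasing: "- m (x i) < - m (x j)" if "i < j" for i j
    using that by (rule lift_Suc_mono_less[of "\<lambda>n. - m (x n)"])
  have inj_x: "inj x"
  proof (rule injI)
    fix i j assume "x i = x j"
    then show "i = j" using decreasing[of i j] decreasing[of j i] by (cases i j rule: linorder_cases) auto
  qed
  have cpt: "compact (snd c ` K \<times> sphere (0::'e) 1)"
    using K chart_continuous[OF c]
    by (intro compact_Times compact_continuous_image compact_sphere) (auto intro: continuous_on_subset)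
  have "(snd c (x n), y n) \<in> snd c ` K \<times> sphere 0 1" for n
    using x y by simp
  from cpt[unfolded compact_def, rule_format, of "\<lambda>n. (snd c (x n), y n)", OF this]
  obtain l r where l: "l \<in> snd c ` K \<times> sphere 0 1" and r: "strict_mono (r :: nat \<Rightarrow> nat)"
    and lim: "((\<lambda>n. (snd c (x n), y n)) \<circ> r) \<longlonglongrightarrow> l"
    by (elim bexE exE conjE) (rule that)
  define p0 y0 where "p0 = fst l" and "y0 = snd l"
  have p0: "p0 \<in> snd c ` K" and y0: "norm y0 = 1" using l by (auto simp: p0_def y0_def)
  define q where "q n = snd c (x (r n))" for n
  have "(\<lambda>n. fst (((\<lambda>n. (snd c (x n), y n)) \<circ> r) n)) \<longlonglongrightarrow> p0"
    unfolding p0_def by (rule tendsto_fst[OF lim])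
  then have q_lim: "q \<longlonglongrightarrow> p0" by (simp add: q_def[abs_def] o_def)
  have "(\<lambda>n. snd (((\<lambda>n. (snd c (x n), y n)) \<circ> r) n)) \<longlonglongrightarrow> y0"
    unfolding y0_def by (rule tendsto_snd[OF lim])
  then have y_lim: "(\<lambda>n. y (r n)) \<longlonglongrightarrow> y0" by (simp add: o_def)
  have inv_q: "chart_inv c (q n) = x (r n)" for n using x c by (simp add: q_def)
  have inj_q: "inj q"
  proof (rule injI)
    fix i j assume "q i = q j"
    then have "x (r i) = x (r j)" using inv_q by metis
    then show "i = j" using inj_x strict_mono_imp_inj_on[OF r] by (meson injD)
  qed
  \<comment> \<open>An injective sequence meets its limit at most once; a shift of the index removes
    that term.\<close>
  have "finite (q -` {p0})" by (rule finite_vimageI[OF _ inj_q]) simp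
  then obtain n0 where n0: "\<And>n. q n = p0 \<Longrightarrow> n < n0"
    unfolding finite_nat_set_iff_bounded by auto
  define p where "p n = q (n + n0)" for n
  have p: "p \<longlonglongrightarrow> p0" "inj p" "\<And>n. p n \<noteq> p0"
  proof -
    show "p \<longlonglongrightarrow> p0"
      using LIMSEQ_ignore_initial_segment[OF q_lim, of n0] by (simp add: p_def[abs_def])
    show "inj p"
    proof (rule injI)
      fix i j assume "p i = p j"
      then show "i = j" using injD[OF inj_q, of "i + n0" "j + n0"] by (simp add: p_def)
    qed
    show "p n \<noteq> p0" for n using n0[of "n + n0"] by (auto simp: p_def)
  qed
  define f where "f z = (if z = p0 then y0 else y (r (inv p z + n0)))" for z
  have fp: "f (p n) = y (r (n + n0))" and f0: "f p0 = y0" for n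
    using p(3)[of n] p(2) by (simp_all add: f_def)
  have f_cont: "continuous_on (insert p0 (range p)) f"
    by (rule continuous_on_sequence[OF p LIMSEQ_ignore_initial_segment[OF y_lim, of n0] f0 fp])
  have f_norm: "norm (f z) = 1" if "z \<in> insert p0 (range p)" for z
    using that y y0 fp f0 by auto
  define K0 where "K0 = chart_inv c ` insert p0 (range p)"
  have sub: "insert p0 (range p) \<subseteq> snd c ` fst c"
    using p0 K x by (auto simp: p_def q_def)
  have K0: "compact K0" "K0 \<subseteq> fst c"
    unfolding K0_def using sub
    by (rule compact_chart_inv_image[OF c compact_sequence_with_limit[OF p(1)]])
      (use sub in \<open>intro image_subsetI chart_inv_in, blast\<close>)
  have chart_K0: "snd c z \<in> insert p0 (range p)" if "z \<in> K0" for z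
  proof -
    obtain w where w: "z = chart_inv c w" "w \<in> insert p0 (range p)"
      using \<open>z \<in> K0\<close> unfolding K0_def by (rule imageE)
    then show ?thesis using chart_chart_inv[OF c subsetD[OF sub w(2)]] by simp
  qed
  have "continuous_on K0 (\<lambda>z. f (snd c z))"
    by (rule continuous_on_compose2[OF f_cont])
      (use chart_K0 K0 chart_continuous[OF c] in \<open>auto intro: continuous_on_subset\<close>)
  then have "continuous_on K0 (\<lambda>z. blinfun_inner_left (f (snd c z)))"
    by (intro bounded_linear.continuous_on[OF bounded_linear_blinfun_inner_left])
  then have "continuous_section_on A K0 (\<lambda>z. Y c z (f (snd c z)))"
    unfolding Y_def by (intro continuous_section_lift c K0)
  moreover have "Y c z (f (snd c z)) \<noteq> cov_zero" if "z \<in> K0" for z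
    using f_norm[OF chart_K0[OF that]] K0 that by (intro Y_nonzero c) auto
  ultimately obtain k where k: "k > 0" "\<And>z. z \<in> K0 \<Longrightarrow> k \<le> N z (Y c z (f (snd c z)))"
    using R[unfolded R_structure_def, THEN conjunct2, rule_format, of K0 "\<lambda>z. Y c z (f (snd c z))"] K0(1)
    by auto
  \<comment> \<open>Along the sequence the section takes the almost optimal directions, so its norm
    there would both stay above \<open>k\<close> and tend to 0.\<close>
  have "k \<le> 1 / (real n + 1)" for n
  proof -
    have "chart_inv c (p n) \<in> K0" by (auto simp: K0_def)
    moreover have "chart_inv c (p n) = x (r (n + n0))" by (simp add: p_def inv_q)
    moreover have "f (snd c (x (r (n + n0)))) = y (r (n + n0))"
      using fp[of n] by (simp add: p_def q_def)
    ultimately have "k \<le> N (x (r (n + n0))) (Y c (x (r (n + n0))) (y (r (n + n0))))"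
      using k(2) by force
    also have "\<dots> \<le> 1 / (real (r (n + n0)) + 1)" by (rule less_imp_le[OF Nxy])
    also have "\<dots> \<le> 1 / (real n + 1)"
      using seq_suble[OF r, of "n + n0"] by (intro divide_left_mono) auto
    finally show ?thesis .
  qed
  note le = this
  obtain n where "1 / (real n + 1) < k"
    using reals_Archimedean[OF k(1)] by (auto simp: inverse_eq_divide add.commute)
  then show False using le[of n] by simp
qed

end

section \<open>RM-structures\<close>

locale RM_manifold = R_manifold A N
  for A :: "('a::{t2_space,second_countable_topology}, 'e::euclidean_space) chart set"
    and N :: "('a, 'e) conorm" +
  fixes \<mu> :: "'a measure"
  assumes admissible: "admissible_measure A \<mu>"
begin

lemma sets_mu [simp, measurable_cong]: "sets \<mu> = sets borel"
  using admissible by (simp add: admissible_measure_def)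

lemma space_mu [simp]: "space \<mu> = UNIV"
  using sets_eq_imp_space_eq[OF sets_mu] by simp

lemma measurable_mu: "f \<in> borel_measurable borel \<Longrightarrow> f \<in> borel_measurable \<mu>"
  using measurable_cong_sets[OF sets_mu refl] by blast

lemma chart_measurable: "c \<in> A \<Longrightarrow> snd c \<in> borel_measurable (restrict_space \<mu> (fst c))"
  using borel_measurable_continuous_on_restrict[OF chart_continuous, of c]
    measurable_cong_sets[OF sets_restrict_space_cong[OF sets_mu] refl] by blast

lemma density_near:
  assumes c: "c \<in> A" and x: "x \<in> fst c"
  obtains \<rho> W k C where "\<rho> \<in> borel_measurable borel"
    "distr (restrict_space \<mu> (fst c)) borel (snd c) = density lborel (\<lambda>p. ennreal (\<rho> p) * indicator (snd c ` fst c) p)"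
    "open W" "snd c x \<in> W" "k > (0::real)" "\<And>q. q \<in> W \<inter> snd c ` fst c \<Longrightarrow> k \<le> \<rho> q \<and> \<rho> q \<le> C"
proof -
  obtain \<rho> where \<rho>: "\<rho> \<in> borel_measurable borel"
    "distr (restrict_space \<mu> (fst c)) borel (snd c) = density lborel (\<lambda>p. ennreal (\<rho> p) * indicator (snd c ` fst c) p)"
    "\<forall>p\<in>snd c ` fst c. \<exists>W k C. open W \<and> p \<in> W \<and> k > 0 \<and> (\<forall>q\<in>W \<inter> snd c ` fst c. k \<le> \<rho> q \<and> \<rho> q \<le> C)"
    using admissible c unfolding admissible_measure_def by blast
  have "snd c x \<in> snd c ` fst c" using x by (rule imageI)
  from \<rho>(3)[rule_format, OF this] obtain W k C where
    "open W" "snd c x \<in> W" "k > 0" "\<forall>q\<in>W \<inter> snd c ` fst c. k \<le> \<rho> q \<and> \<rho> q \<le> C"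
    by (elim exE conjE) (rule that)
  then show ?thesis using that[OF \<rho>(1,2)] by blast
qed

section \<open>Integration in charts\<close>

lemma chart_preimage:
  assumes "c \<in> A" "Q \<subseteq> snd c ` fst c"
  shows "x \<in> chart_inv c ` Q \<longleftrightarrow> x \<in> fst c \<and> snd c x \<in> Q"
proof
  assume "x \<in> chart_inv c ` Q"
  then obtain q where q: "x = chart_inv c q" "q \<in> Q" by (rule imageE)
  then show "x \<in> fst c \<and> snd c x \<in> Q"
    using chart_inv_in[OF subsetD[OF assms(2) q(2)]] chart_chart_inv[OF assms(1) subsetD[OF assms(2) q(2)]] by simp
next
  assume "x \<in> fst c \<and> snd c x \<in> Q"
  then show "x \<in> chart_inv c ` Q" using chart_inv_chart[OF assms(1), of x] by (metis imageI)
qed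

text \<open>The change of variables given by a chart, over a set \<open>Q\<close> on which the
  density is known to be nonnegative.\<close>

lemma
  fixes f :: "'a \<Rightarrow> real"
  assumes c: "c \<in> A" and Q: "Q \<in> sets borel" "Q \<subseteq> snd c ` fst c"
    and \<rho>: "\<rho> \<in> borel_measurable borel" "\<And>q. q \<in> Q \<Longrightarrow> 0 \<le> \<rho> q"
    and distr: "distr (restrict_space \<mu> (fst c)) borel (snd c) = density lborel (\<lambda>p. ennreal (\<rho> p) * indicator (snd c ` fst c) p)"
    and f: "f \<in> borel_measurable borel"
  shows chart_integral: "(\<integral>x. indicator (chart_inv c ` Q) x * f x \<partial>\<mu>) = (\<integral>p. indicator Q p * (\<rho> p * f (chart_inv c p)) \<partial>lborel)"
    and chart_integrable: "integrable \<mu> (\<lambda>x. indicator (chart_inv c ` Q) x * f x) \<longleftrightarrow>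
      integrable lborel (\<lambda>p. indicator Q p * (\<rho> p * f (chart_inv c p)))"
proof -
  define g where "g p = indicator Q p * f (chart_inv c p)" for p
  \<comment> \<open>Cutting the density off at 0 and outside the image of the chart changes neither
    the image measure nor the integral over \<open>Q\<close>, and makes it nonnegative
    everywhere.\<close>
  define \<rho>' where "\<rho>' p = max 0 (\<rho> p) * indicator (snd c ` fst c) p" for p
  have im: "snd c ` fst c \<in> sets borel" using open_chart_image[OF c] by simp
  have dom: "fst c \<in> sets borel" using open_chart_domain[OF c] by simp
  have g: "g \<in> borel_measurable borel"
  proof -
    have "chart_inv c \<in> borel_measurable (restrict_space borel (snd c ` fst c))"
      by (rule borel_measurable_continuous_on_restrict[OF chart_inv_continuous[OF c]])
    then have "(\<lambda>p. f (chart_inv c p)) \<in> borel_measurable (restrict_space borel (snd c ` fst c))"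
      using f by (rule measurable_compose)
    then have "(\<lambda>p. f (chart_inv c p) * indicator (snd c ` fst c) p) \<in> borel_measurable borel"
      using im by (subst (asm) borel_measurable_restrict_space_iff) (auto simp: mult.commute)
    then have "(\<lambda>p. indicator Q p * (f (chart_inv c p) * indicator (snd c ` fst c) p)) \<in> borel_measurable borel"
      using Q(1) by measurable
    moreover have "indicator Q p * (f (chart_inv c p) * indicator (snd c ` fst c) p) = g p" for p
      using Q(2) by (auto simp: g_def indicator_def)
    ultimately show ?thesis by (simp only:)
  qed
  have \<rho>': "\<rho>' \<in> borel_measurable borel" unfolding \<rho>'_def using \<rho>(1) im by measurable
  have dens: "density lborel (\<lambda>p. ennreal (\<rho> p) * indicator (snd c ` fst c) p) = density lborel (\<lambda>p. ennreal (\<rho>' p))"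
    by (rule arg_cong[where f = "density lborel"]) (auto simp: \<rho>'_def fun_eq_iff indicator_def ennreal_max_0)
  have e1: "indicator (chart_inv c ` Q) x * f x = indicator (fst c) x *\<^sub>R g (snd c x)" for x
    using chart_preimage[OF c Q(2), of x] chart_inv_chart[OF c, of x] by (auto simp: g_def indicator_def)
  have e2: "\<rho>' p *\<^sub>R g p = indicator Q p * (\<rho> p * f (chart_inv c p))" for p
    using Q(2) \<rho>(2)[of p] by (auto simp: g_def \<rho>'_def indicator_def)
  have \<rho>'0: "0 \<le> \<rho>' p" for p by (simp add: \<rho>'_def)
  have "integrable \<mu> (\<lambda>x. indicator (chart_inv c ` Q) x * f x) \<longleftrightarrow> integrable (restrict_space \<mu> (fst c)) (\<lambda>x. g (snd c x))"
    unfolding e1 using dom by (subst integrable_restrict_space) auto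
  also have "\<dots> \<longleftrightarrow> integrable (density lborel (\<lambda>p. ennreal (\<rho>' p))) g"
    using integrable_distr_eq[OF chart_measurable[OF c] g] unfolding distr dens by simp
  also have "\<dots> \<longleftrightarrow> integrable lborel (\<lambda>p. \<rho>' p *\<^sub>R g p)"
    by (rule integrable_density) (use g \<rho>' \<rho>'0 in auto)
  finally show "integrable \<mu> (\<lambda>x. indicator (chart_inv c ` Q) x * f x) \<longleftrightarrow>
      integrable lborel (\<lambda>p. indicator Q p * (\<rho> p * f (chart_inv c p)))"
    unfolding e2 .
  have "(\<integral>x. indicator (chart_inv c ` Q) x * f x \<partial>\<mu>) = (\<integral>x. indicator (fst c) x *\<^sub>R g (snd c x) \<partial>\<mu>)"
    unfolding e1 ..
  also have "\<dots> = (\<integral>x. g (snd c x) \<partial>restrict_space \<mu> (fst c))"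
    using dom by (subst integral_restrict_space) auto
  also have "\<dots> = (\<integral>p. g p \<partial>distr (restrict_space \<mu> (fst c)) borel (snd c))"
    by (rule integral_distr[OF chart_measurable[OF c] g, symmetric])
  also have "\<dots> = (\<integral>p. g p \<partial>density lborel (\<lambda>p. ennreal (\<rho>' p)))"
    unfolding distr dens ..
  also have "\<dots> = (\<integral>p. \<rho>' p *\<^sub>R g p \<partial>lborel)"
    by (rule integral_density) (use g \<rho>' \<rho>'0 in auto)
  also have "\<dots> = (\<integral>p. indicator Q p * (\<rho> p * f (chart_inv c p)) \<partial>lborel)"
    unfolding e2 ..
  finally show "(\<integral>x. indicator (chart_inv c ` Q) x * f x \<partial>\<mu>) = (\<integral>p. indicator Q p * (\<rho> p * f (chart_inv c p)) \<partial>lborel)" .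
qed

lemma finite_near: "\<exists>U. open U \<and> x \<in> U \<and> emeasure \<mu> U < \<infinity>"
proof -
  obtain c where c: "c \<in> A" "x \<in> fst c" by (rule chart_at)
  obtain \<rho> W k C where \<rho>: "\<rho> \<in> borel_measurable borel"
    "distr (restrict_space \<mu> (fst c)) borel (snd c) = density lborel (\<lambda>p. ennreal (\<rho> p) * indicator (snd c ` fst c) p)"
    and W: "open W" "snd c x \<in> W" "k > 0" "\<And>q. q \<in> W \<inter> snd c ` fst c \<Longrightarrow> k \<le> \<rho> q \<and> \<rho> q \<le> C"
    using density_near[OF c] by blast
  obtain a b where ab: "cbox a b \<subseteq> W \<inter> snd c ` fst c" "open (chart_inv c ` box a b)" "x \<in> chart_inv c ` box a b"
    using chart_box[OF c W(1,2)] by metis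
  have sub: "box a b \<subseteq> snd c ` fst c" using ab(1) box_subset_cbox[of a b] by auto
  have im: "snd c ` fst c \<in> sets borel" using open_chart_image[OF c(1)] by simp
  have dom: "fst c \<in> sets borel" using open_chart_domain[OF c(1)] by simp
  have "chart_inv c ` box a b = snd c -` box a b \<inter> fst c"
    using chart_preimage[OF c(1) sub] by auto
  then have "emeasure \<mu> (chart_inv c ` box a b) = emeasure (restrict_space \<mu> (fst c)) (snd c -` box a b \<inter> fst c)"
    using dom by (subst emeasure_restrict_space) auto
  also have "\<dots> = emeasure (distr (restrict_space \<mu> (fst c)) borel (snd c)) (box a b)"
    using chart_measurable[OF c(1)] by (subst emeasure_distr) (auto simp: space_restrict_space)
  also have "\<dots> = (\<integral>\<^sup>+p. ennreal (\<rho> p) * indicator (snd c ` fst c) p * indicator (box a b) p \<partial>lborel)"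
    unfolding \<rho>(2) using \<rho>(1) im by (subst emeasure_density) auto
  also have "\<dots> \<le> (\<integral>\<^sup>+p. ennreal C * indicator (cbox a b) p \<partial>lborel)"
  proof (rule nn_integral_mono)
    fix p
    show "ennreal (\<rho> p) * indicator (snd c ` fst c) p * indicator (box a b) p \<le> ennreal C * indicator (cbox a b) p"
    proof (cases "p \<in> box a b")
      case True
      then have "p \<in> cbox a b" using box_subset_cbox by blast
      then have "\<rho> p \<le> C" using W(4)[of p] ab(1) by auto
      then show ?thesis using \<open>p \<in> cbox a b\<close> by (auto simp: indicator_def ennreal_leI)
    qed simp
  qed
  also have "\<dots> = ennreal C * emeasure lborel (cbox a b)"
    by (rule nn_integral_cmult_indicator) simp
  also have "\<dots> < \<infinity>"
    using emeasure_lborel_cbox_finite[of a b] by (simp add: ennreal_mult_less_top)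
  finally show ?thesis using ab by blast
qed

lemma finite_on_compact:
  assumes "compact K"
  shows "emeasure \<mu> K < \<infinity>"
proof -
  obtain U where U: "\<And>x. open (U x)" "\<And>x. x \<in> U x" "\<And>x. emeasure \<mu> (U x) < \<infinity>"
    using finite_near by metis
  obtain P where P: "finite P" "K \<subseteq> (\<Union>x\<in>P. U x)"
    using compactE_image[OF assms, of UNIV U] U(1,2) by (metis UNIV_I UN_I subsetI)
  have "emeasure \<mu> K \<le> emeasure \<mu> (\<Union>x\<in>P. U x)"
    using U(1) P(2) by (intro emeasure_mono) (auto intro!: borel_open open_UN)
  also have "\<dots> \<le> (\<Sum>x\<in>P. emeasure \<mu> (U x))"
    using U(1) P(1) by (intro emeasure_subadditive_finite) auto
  also have "\<dots> < \<infinity>"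
    using P(1) by (induction rule: finite_induct) (use U(3) in auto)
  finally show ?thesis .
qed

lemma integrable_compact_support:
  fixes f :: "'a \<Rightarrow> real"
  assumes f: "f \<in> borel_measurable borel" and K: "compact K" "\<And>x. x \<notin> K \<Longrightarrow> f x = 0"
    and C: "\<And>x. x \<in> K \<Longrightarrow> \<bar>f x\<bar> \<le> C"
  shows "integrable \<mu> f"
proof (rule integrableI_bounded_set[where A = K and B = C])
  show "K \<in> sets \<mu>" using K(1) by (simp add: borel_closed compact_imp_closed)
  show "emeasure \<mu> K < \<infinity>" by (rule finite_on_compact[OF K(1)])
qed (use f K C measurable_mu in auto)

text \<open>The real half of an element of \<open>Cc_sections\<close>; a complex section consists of
  two of these.\<close>

definition Cc_section :: "('a \<Rightarrow> ('a, 'e) covec) \<Rightarrow> bool" where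
  "Cc_section v \<longleftrightarrow> continuous_section_on A UNIV v \<and> compact (closure {x. v x \<noteq> cov_zero})"

lemma section_cotangent: "continuous_section_on A UNIV v \<Longrightarrow> v x \<in> cotangent A x"
  by (simp add: continuous_section_on_def)

lemma integrable_pairing:
  assumes v: "Cc_section v" and w: "continuous_section_on A UNIV w"
  shows "integrable \<mu> (\<lambda>x. I x (v x) (w x))"
proof -
  have v': "continuous_section_on A UNIV v" and K: "compact (closure {x. v x \<noteq> cov_zero})"
    using v by (auto simp: Cc_section_def)
  obtain C where C: "\<And>x. x \<in> closure {x. v x \<noteq> cov_zero} \<Longrightarrow> \<bar>I x (v x) (w x)\<bar> \<le> C"
    using section_pairing_bounded[OF v' w K] by blast
  show ?thesis
  proof (rule integrable_compact_support[OF section_pairing_measurable[OF v' w] K _ C])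
    fix x assume "x \<notin> closure {x. v x \<noteq> cov_zero}"
    then have "v x = cov_zero" using closure_subset[of "{x. v x \<noteq> cov_zero}"] by blast
    then show "I x (v x) (w x) = 0" using I_zero_left section_cotangent[OF w] by simp
  qed
qed

section \<open>Differentials of compactly supported functions and the form\<close>

abbreviation du :: "('a \<Rightarrow> real) \<Rightarrow> 'a \<Rightarrow> ('a, 'e) covec" where "du \<equiv> differential A"

lemma differential_outside_support:
  assumes "x \<notin> closure {x. u x \<noteq> 0}"
  shows "du u x = cov_zero"
proof -
  have "du u x c = 0" for c
  proof (cases "c \<in> A \<and> x \<in> fst c")
    case True
    define V where "V = fst c - closure {x. u x \<noteq> 0}"
    have V: "open V" "V \<subseteq> fst c" "x \<in> V"
      using True assms open_Diff[OF open_chart_domain closed_closure, of c] by (auto simp: V_def)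
    have "Dr (u \<circ> chart_inv c) (snd c x) = Dr (\<lambda>_. 0) (snd c x)"
    proof (rule Dr_cong)
      show "open (snd c ` V)" using True V by (intro open_chart_image_sub) auto
      show "snd c x \<in> snd c ` V" using V by blast
      fix q assume "q \<in> snd c ` V"
      then obtain y where y: "q = snd c y" "y \<in> V" by (rule imageE)
      then have "u y = 0" using closure_subset[of "{x. u x \<noteq> 0}"] by (auto simp: V_def)
      moreover have "chart_inv c q = y" using True y V by auto
      ultimately show "(u \<circ> chart_inv c) q = 0" by simp
    qed
    also have "\<dots> = 0" by (rule Dr_eq) (simp add: zero_blinfun.rep_eq)
    finally show ?thesis using True by (simp add: differential_eq)
  qed (auto simp: differential_eq)
  then show ?thesis by (simp add: cov_zero_def fun_eq_iff)
qed

lemma Cc_section_differential: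
  assumes "u \<in> C1c_real"
  shows "Cc_section (du u)"
  unfolding Cc_section_def
proof
  show "continuous_section_on A UNIV (du u)"
    by (rule differential_section[OF C1c_realD[OF assms]])
  have "{x. du u x \<noteq> cov_zero} \<subseteq> closure {x. u x \<noteq> 0}"
    using differential_outside_support by blast
  then have "closure {x. du u x \<noteq> cov_zero} \<subseteq> closure {x. u x \<noteq> 0}"
    by (rule closure_minimal) simp
  then have "closure {x. du u x \<noteq> cov_zero} = closure {x. u x \<noteq> 0} \<inter> closure {x. du u x \<noteq> cov_zero}"
    by blast
  moreover have "compact (closure {x. u x \<noteq> 0} \<inter> closure {x. du u x \<noteq> cov_zero})"
    using assms by (intro compact_Int_closed) (auto simp: C1c_real_def)
  ultimately show "compact (closure {x. du u x \<noteq> cov_zero})" by simp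
qed

lemma C1c_real_bounded:
  assumes "u \<in> C1c_real"
  shows "\<exists>C. \<forall>x. \<bar>u x\<bar> \<le> C"
proof -
  have "compact (u ` closure {x. u x \<noteq> 0})"
    using assms C1_real_continuous[of u]
    by (intro compact_continuous_image) (auto simp: C1c_real_def intro: continuous_on_subset)
  from compact_imp_bounded[OF this] obtain C where C: "\<And>x. x \<in> closure {x. u x \<noteq> 0} \<Longrightarrow> \<bar>u x\<bar> \<le> C"
    by (auto simp: bounded_iff)
  have "\<bar>u x\<bar> \<le> max C 0" for x
    using C[of x] closure_subset[of "{x. u x \<noteq> 0}"] by (cases "u x = 0") (auto simp: max.coboundedI1)
  then show ?thesis by blast
qed

lemma C1_real_measurable: "C1_real u \<Longrightarrow> u \<in> borel_measurable borel"
  using C1_real_continuous by (rule borel_measurable_continuous_onI)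

lemma integrable_product:
  assumes u: "u \<in> C1c_real" and v: "v \<in> C1c_real"
  shows "integrable \<mu> (\<lambda>x. u x * v x)"
proof -
  obtain C1 where C1: "\<And>x. \<bar>u x\<bar> \<le> C1" using C1c_real_bounded[OF u] by blast
  obtain C2 where C2: "\<And>x. \<bar>v x\<bar> \<le> C2" using C1c_real_bounded[OF v] by blast
  show ?thesis
  proof (rule integrable_compact_support)
    show "compact (closure {x. u x \<noteq> 0})" using u by (simp add: C1c_real_def)
    show "(\<lambda>x. u x * v x) \<in> borel_measurable borel"
      using C1_real_measurable[OF C1c_realD[OF u]] C1_real_measurable[OF C1c_realD[OF v]] by simp
    show "u x * v x = 0" if "x \<notin> closure {x. u x \<noteq> 0}" for x
      using that closure_subset[of "{x. u x \<noteq> 0}"] by auto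
    show "\<bar>u x * v x\<bar> \<le> C1 * C2" for x
      unfolding abs_mult using C1[of x] C2[of x] by (intro mult_mono) auto
  qed
qed

lemma integrable_energy:
  assumes "u \<in> C1c_real" "v \<in> C1c_real"
  shows "integrable \<mu> (\<lambda>x. I x (du u x) (du v x))"
  using assms Cc_section_differential Cc_section_def by (intro integrable_pairing) auto

lemma measurable_energy:
  "C1_real u \<Longrightarrow> C1_real v \<Longrightarrow> (\<lambda>x. I x (du u x) (du v x)) \<in> borel_measurable borel"
  by (intro section_pairing_measurable differential_section)

text \<open>The pairing of \<open>(\<Delta> - z) u\<close> with \<open>v\<close> in weak
  form.\<close>

definition form :: "real \<Rightarrow> ('a \<Rightarrow> real) \<Rightarrow> ('a \<Rightarrow> real) \<Rightarrow> real" where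
  "form z u v = (\<integral>x. I x (du u x) (du v x) \<partial>\<mu>) - z * (\<integral>x. u x * v x \<partial>\<mu>)"

text \<open>The density of the squared norm of the form domain, named separately because it is also
  integrated over compact pieces.\<close>

definition dens :: "('a \<Rightarrow> real) \<Rightarrow> 'a \<Rightarrow> real" where
  "dens u x = (u x)\<^sup>2 + I x (du u x) (du u x)"

definition sq1 :: "('a \<Rightarrow> real) \<Rightarrow> real" where
  "sq1 u = (\<integral>x. dens u x \<partial>\<mu>)"

lemma dens_nonneg: "C1_real u \<Longrightarrow> 0 \<le> dens u x"
  using I_self[OF differential_cotangent, of u x] by (simp add: dens_def)

lemma dens_eq: "C1_real u \<Longrightarrow> dens u x = (u x)\<^sup>2 + (N x (du u x))\<^sup>2"
  using I_self[OF differential_cotangent, of u x] by (simp add: dens_def)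

lemma integrable_dens: "u \<in> C1c_real \<Longrightarrow> integrable \<mu> (dens u)"
  unfolding dens_def[abs_def] using integrable_product[of u u] integrable_energy[of u u] by (simp add: power2_eq_square)

lemma sq1_nonneg: "u \<in> C1c_real \<Longrightarrow> 0 \<le> sq1 u"
  unfolding sq1_def using dens_nonneg C1c_realD by (intro integral_nonneg_AE) auto

lemma local_integrable:
  fixes f :: "'a \<Rightarrow> real"
  assumes "K \<in> sets borel" "integrable \<mu> f"
  shows "integrable \<mu> (\<lambda>x. indicator K x * f x)"
  using integrable_real_mult_indicator[of K \<mu> f] assms by (simp add: mult.commute)

end

section \<open>Local compactness and the Caccioppoli inequality\<close>

text \<open>Squaring removes the corner of the positive part at 0, where the difference quotient is
  \<open>max 0 s\<close>. Composed with a polynomial this gives a cutoff of class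
  \<open>C\<^sup>1\<close>, the regularity available on the manifold.\<close>

lemma max_square_derivative: "((\<lambda>t. (max 0 t)\<^sup>2) has_real_derivative 2 * max 0 t) (at t)"
proof -
  consider "t > 0" | "t < 0" | "t = 0" by linarith
  then show ?thesis
  proof cases
    case 1
    have "((\<lambda>t. t\<^sup>2) has_real_derivative 2 * t) (at t)"
      by (auto intro!: derivative_eq_intros)
    then have "((\<lambda>t. (max 0 t)\<^sup>2) has_real_derivative 2 * t) (at t)"
      by (rule has_field_derivative_transform_within_open[where S = "{0<..}"]) (use 1 in auto)
    then show ?thesis using 1 by simp
  next
    case 2
    have "((\<lambda>t. 0) has_real_derivative 0) (at t)" by simp
    then have "((\<lambda>t. (max 0 t)\<^sup>2) has_real_derivative 0) (at t)"
      by (rule has_field_derivative_transform_within_open[where S = "{..<0}"]) (use 2 in auto)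
    then show ?thesis using 2 by simp
  next
    case 3
    have "(\<lambda>s::real. max 0 s) \<midarrow>0\<rightarrow> 0"
      by (rule tendsto_eq_intros) (auto intro!: tendsto_eq_intros)
    then have "(\<lambda>s::real. ((max 0 s)\<^sup>2 - (max 0 0)\<^sup>2) / (s - 0)) \<midarrow>0\<rightarrow> 0"
      by (rule Lim_transform_eventually)
        (auto simp: eventually_at_filter max_def power2_eq_square intro!: always_eventually)
    then show ?thesis using 3 by (simp add: has_field_derivative_iff)
  qed
qed

text \<open>The factor makes the value at distance \<open>s / 2\<close> equal to 1, since the square
  of \<open>s\<^sup>2 - s\<^sup>2 / 4\<close> is \<open>9 / 16 * s ^ 4\<close>; the value at the
  centre is 16/9. A lower bound by 1 on the smaller ball takes the place of a plateau.\<close>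

definition bump :: "'e::euclidean_space \<Rightarrow> real \<Rightarrow> 'e \<Rightarrow> real" where
  "bump p0 s p = 16 / (9 * s ^ 4) * (max 0 (s\<^sup>2 - (p - p0) \<bullet> (p - p0)))\<^sup>2"

lemma bump_C1: "C1_on UNIV (bump p0 s)"
proof -
  have h: "C1_on UNIV (\<lambda>t::real. (max 0 t)\<^sup>2)"
  proof (rule C1_onI[of _ _ "\<lambda>t. (2 * max 0 t) *\<^sub>R id_blinfun"])
    show "((\<lambda>t. (max 0 t)\<^sup>2) has_derivative blinfun_apply ((2 * max 0 t) *\<^sub>R id_blinfun)) (at t)" for t :: real
    proof -
      have "blinfun_apply ((2 * max 0 t) *\<^sub>R id_blinfun) = (\<lambda>x. 2 * max 0 t * x)"
        by (auto simp: blinfun.scaleR_left)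
      then show ?thesis using max_square_derivative[of t] by (simp add: has_field_derivative_def)
    qed
  qed (intro continuous_intros)
  have g: "C1_on UNIV (\<lambda>p. s\<^sup>2 - (p - p0) \<bullet> (p - p0))"
  proof (rule C1_onI[of _ _ "\<lambda>p. blinfun_inner_left (- 2 *\<^sub>R (p - p0))"])
    show "((\<lambda>p. s\<^sup>2 - (p - p0) \<bullet> (p - p0)) has_derivative blinfun_apply (blinfun_inner_left (- 2 *\<^sub>R (p - p0)))) (at p)" for p
    proof -
      have "blinfun_apply (blinfun_inner_left (- 2 *\<^sub>R (p - p0))) = (\<lambda>h. 0 - ((p - p0) \<bullet> (h - 0) + (h - 0) \<bullet> (p - p0)))"
        by (auto simp: inner_commute)
      then show ?thesis
        by (simp only:) (intro derivative_intros)
    qed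
  qed (intro bounded_linear.continuous_on[OF bounded_linear_blinfun_inner_left] continuous_intros)
  have "C1_on UNIV (\<lambda>p. 16 / (9 * s ^ 4) * ((\<lambda>t::real. (max 0 t)\<^sup>2) \<circ> (\<lambda>p. s\<^sup>2 - (p - p0) \<bullet> (p - p0))) p)"
    by (intro C1_on_linear(1)[OF bounded_linear_mult_right] C1_on_compose(1)[OF g h]) simp
  then show ?thesis by (simp add: bump_def[abs_def])
qed

lemma bump_nonneg: "0 \<le> bump p0 s p"
  by (simp add: bump_def)

lemma bump_ge_1:
  assumes "s > 0" "p \<in> ball p0 (s / 2)"
  shows "1 \<le> bump p0 s p"
proof -
  have "(p - p0) \<bullet> (p - p0) \<le> (s / 2)\<^sup>2"
    using assms by (simp add: power2_norm_eq_inner[symmetric] dist_norm norm_minus_commute power_mono less_imp_le)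
  then have "3 / 4 * s\<^sup>2 \<le> max 0 (s\<^sup>2 - (p - p0) \<bullet> (p - p0))"
    by (intro max.coboundedI2) (simp add: power_divide)
  then have "(3 / 4 * s\<^sup>2)\<^sup>2 \<le> (max 0 (s\<^sup>2 - (p - p0) \<bullet> (p - p0)))\<^sup>2"
    by (intro power_mono) auto
  then have "16 / (9 * s ^ 4) * (3 / 4 * s\<^sup>2)\<^sup>2 \<le> bump p0 s p"
    unfolding bump_def by (intro mult_left_mono) auto
  moreover have "16 / (9 * s ^ 4) * (3 / 4 * s\<^sup>2)\<^sup>2 = 1"
    using assms by (simp add: power_mult_distrib power_divide field_simps)
  ultimately show ?thesis by simp
qed

lemma bump_zero:
  assumes "s > 0" "p \<notin> cball p0 s"
  shows "bump p0 s p = 0"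
proof -
  have "s\<^sup>2 \<le> (norm (p - p0))\<^sup>2"
    using assms by (intro power_mono) (auto simp: dist_norm norm_minus_commute)
  then show ?thesis by (simp add: bump_def power2_norm_eq_inner)
qed

context RM_manifold
begin

section \<open>Rellich's theorem near a point\<close>

definition L2_real :: "('a \<Rightarrow> real) \<Rightarrow> bool" where
  "L2_real g \<longleftrightarrow> g \<in> borel_measurable borel \<and> integrable \<mu> (\<lambda>x. (g x)\<^sup>2)"

text \<open>Extension by zero stays of class \<open>C\<^sup>1\<close> because the closed ball
  corresponds to a compact, hence closed, subset \<open>L\<close> of the manifold: every chart
  domain is covered by its intersection with \<open>fst c\<close>, where \<open>b\<close> is a bump
  in coordinates, and by the complement of \<open>L\<close>, where \<open>b\<close>
  vanishes.\<close>

lemma chart_bump: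
  assumes c: "c \<in> A" and s: "s > 0" "cball p0 s \<subseteq> snd c ` fst c"
  defines "b \<equiv> (\<lambda>x. if x \<in> fst c then bump p0 s (snd c x) else 0)"
  shows "b \<in> C1c_real" and "\<And>x. x \<notin> chart_inv c ` cball p0 s \<Longrightarrow> b x = 0"
proof -
  define L where "L = chart_inv c ` cball p0 s"
  have L: "compact L" unfolding L_def by (rule compact_chart_inv_image[OF c compact_cball s(2)])
  show zero: "b x = 0" if "x \<notin> chart_inv c ` cball p0 s" for x
    using that bump_zero[OF s(1), of "snd c x"] chart_preimage[OF c s(2), of x] by (auto simp: b_def)
  have "C1_on (snd c' ` fst c') (b \<circ> chart_inv c')" if c': "c' \<in> A" for c'
  proof -
    have o1: "open (snd c' ` (fst c' \<inter> fst c))"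
      using open_chart_domain[OF c] open_chart_domain[OF c'] by (intro open_chart_image_sub c') auto
    have o2: "open (snd c' ` (fst c' - L))"
      using open_chart_domain[OF c'] compact_imp_closed[OF L] by (intro open_chart_image_sub c' open_Diff) auto
    have "C1_on (snd c' ` (fst c' \<inter> fst c)) (bump p0 s \<circ> (snd c \<circ> chart_inv c'))"
      by (rule C1_on_compose(1)[OF transition_C1[OF c c'] bump_C1]) simp
    then have 1: "C1_on (snd c' ` (fst c' \<inter> fst c)) (b \<circ> chart_inv c')"
      by (rule C1_on_cong[OF o1, rotated]) (use c' in \<open>auto simp: b_def\<close>)
    have 2: "C1_on (snd c' ` (fst c' - L)) (b \<circ> chart_inv c')"
      by (rule C1_on_cong[OF o2 _ C1_on_const[of _ 0]]) (use c' zero in \<open>auto simp: L_def\<close>)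
    have "L \<subseteq> fst c" unfolding L_def using s(2) by (intro image_subsetI chart_inv_in) auto
    then have "snd c' ` fst c' = snd c' ` (fst c' \<inter> fst c) \<union> snd c' ` (fst c' - L)" by blast
    then show ?thesis using C1_on_Un[OF o1 o2 1 2] by simp
  qed
  moreover have "compact (closure {x. b x \<noteq> 0})"
  proof -
    have "closure {x. b x \<noteq> 0} \<subseteq> L"
      using zero compact_imp_closed[OF L] by (intro closure_minimal) (auto simp: L_def)
    then have "closure {x. b x \<noteq> 0} = L \<inter> closure {x. b x \<noteq> 0}" by blast
    then show ?thesis using compact_Int_closed[OF L closed_closure] by metis
  qed
  ultimately show "b \<in> C1c_real" by (simp add: C1c_real_def C1_real_def)
qed

text \<open>The functionals are given by square-integrable functions, so that they are admissible in
  the estimates characterising the Fredholm property.\<close>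

definition Rellich_set :: "'a set \<Rightarrow> bool" where
  "Rellich_set K \<longleftrightarrow> (\<forall>\<epsilon>>0. \<exists>G C. finite G \<and> (\<forall>g\<in>G. L2_real g) \<and> 0 \<le> C \<and>
    (\<forall>u\<in>C1c_real. (\<integral>x. indicator K x * (u x)\<^sup>2 \<partial>\<mu>) \<le>
       \<epsilon> * (\<integral>x. indicator K x * I x (du u x) (du u x) \<partial>\<mu>) + C * (\<Sum>g\<in>G. (\<integral>x. g x * u x \<partial>\<mu>)\<^sup>2)))"

text \<open>The box inequality is carried over by a chart: the density lies between \<open>k\<close>
  and \<open>C\<close> there, and the norm of a covector is at least \<open>m\<close> times the norm
  of its coordinates, by the uniform lower bound. The cutoff \<open>b\<close> comes with the set
  because the Caccioppoli inequality requires it to be supported in the same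
  \<open>K\<close>.\<close>

lemma local_Rellich:
  obtains U K b where "open U" "x0 \<in> U" "compact K" "b \<in> C1c_real" "\<And>x. 0 \<le> b x" "\<And>x. x \<in> U \<Longrightarrow> 1 \<le> b x"
    "\<And>x. x \<notin> K \<Longrightarrow> b x = 0" "Rellich_set K"
proof -
  obtain c where c: "c \<in> A" and x0: "x0 \<in> fst c" by (rule chart_at)
  obtain \<rho> W k C where \<rho>: "\<rho> \<in> borel_measurable borel"
    and distr: "distr (restrict_space \<mu> (fst c)) borel (snd c) = density lborel (\<lambda>p. ennreal (\<rho> p) * indicator (snd c ` fst c) p)"
    and W: "open W" "snd c x0 \<in> W" "k > 0" "\<And>q. q \<in> W \<inter> snd c ` fst c \<Longrightarrow> k \<le> \<rho> q \<and> \<rho> q \<le> C"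
    using density_near[OF c x0] by blast
  obtain l h where Q: "cbox l h \<subseteq> W \<inter> snd c ` fst c" and p0: "snd c x0 \<in> box l h"
    and K: "compact (chart_inv c ` cbox l h)" "chart_inv c ` cbox l h \<subseteq> fst c"
    using chart_box[OF c x0 W(1,2)] by metis
  define K where "K = chart_inv c ` cbox l h"
  note K = K[folded K_def]
  have Qim: "cbox l h \<subseteq> snd c ` fst c" using Q by blast
  have \<rho>b: "k \<le> \<rho> p" "\<rho> p \<le> C" if "p \<in> cbox l h" for p using W(4)[of p] Q that by auto
  have k0: "0 < k" by (rule W)
  have C0: "0 < C" using \<rho>b[of "snd c x0"] p0 k0 box_subset_cbox[of l h] by fastforce
  obtain s where s: "s > 0" "cball (snd c x0) s \<subseteq> box l h"
    using open_contains_cball_eq[OF open_box] p0 by meson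
  define b where "b = (\<lambda>x. if x \<in> fst c then bump (snd c x0) s (snd c x) else 0)"
  have s': "cball (snd c x0) s \<subseteq> snd c ` fst c" using s(2) Qim box_subset_cbox[of l h] by blast
  have b: "b \<in> C1c_real" unfolding b_def by (rule chart_bump(1)[OF c s(1) s'])
  have b0: "b x = 0" if "x \<notin> chart_inv c ` cball (snd c x0) s" for x
    using chart_bump(2)[OF c s(1) s' that] by (simp add: b_def)
  define U where "U = chart_inv c ` ball (snd c x0) (s / 2)"
  have sU: "ball (snd c x0) (s / 2) \<subseteq> snd c ` fst c"
    using s' s(1) by (auto dest: subsetD simp: subset_iff)
  show ?thesis
  proof (rule that)
    show "open U" unfolding U_def by (rule open_chart_inv_image[OF c open_ball sU])
    show "x0 \<in> U" using chart_preimage[OF c sU, of x0] x0 s(1) by (simp add: U_def)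
    show "compact K" by (rule K)
    show "b \<in> C1c_real" by (rule b)
    show "0 \<le> b x" for x by (simp add: b_def bump_nonneg)
    show "1 \<le> b x" if "x \<in> U" for x
      using that chart_preimage[OF c sU, of x] bump_ge_1[OF s(1), of "snd c x"] by (simp add: b_def U_def)
    show "b x = 0" if "x \<notin> K" for x
    proof (rule b0)
      show "x \<notin> chart_inv c ` cball (snd c x0) s"
        using that s(2) box_subset_cbox[of l h] unfolding K_def by blast
    qed
    obtain m where m: "m > 0" "\<And>x y. x \<in> K \<Longrightarrow> norm y = 1 \<Longrightarrow> m \<le> N x (Y c x y)"
      using N_lower[OF c K] by blast
    have Nm: "m * norm (\<xi> c) \<le> N x \<xi>" if x: "x \<in> K" and \<xi>: "\<xi> \<in> cotangent A x" for x \<xi>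
    proof -
      have xc: "x \<in> fst c" using x K by blast
      define y where "y = covec_vec (\<xi> c)"
      have \<xi>y: "\<xi> = Y c x y" using Y_covec_vec[OF c xc \<xi>] by (simp add: y_def)
      have "m * norm y \<le> N x (Y c x y)"
      proof (cases "y = 0")
        case True
        then show ?thesis using N_nonneg[OF Y_cotangent[OF c xc]] by simp
      next
        case False
        have "Y c x y = cov_scale (norm y) (Y c x (y /\<^sub>R norm y))"
          using False by (simp add: Y_scale[symmetric])
        then have "N x (Y c x y) = norm y * N x (Y c x (y /\<^sub>R norm y))"
          using N_scale[OF Y_cotangent[OF c xc], of "norm y"] by simp
        moreover have "m \<le> N x (Y c x (y /\<^sub>R norm y))"
          using False by (intro m x) simp
        from mult_left_mono[OF this norm_ge_zero[of y]]
        have "norm y * m \<le> norm y * N x (Y c x (y /\<^sub>R norm y))" .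
        ultimately show ?thesis by (simp add: mult.commute)
      qed
      moreover have "m * norm (\<xi> c) \<le> m * norm y"
        using norm_le_covec_vec[of "\<xi> c"] m(1) by (simp add: y_def)
      ultimately show ?thesis using \<xi>y by simp
    qed
    \<comment> \<open>Dividing by the density turns integrals against \<open>\<mu>\<close> into
      Lebesgue integrals in the chart, which are the functionals of the box inequality.\<close>
    define r where "r x = indicator (fst c) x * (1 / \<rho> (snd c x))" for x
    have r: "r \<in> borel_measurable borel"
    proof -
      have "snd c \<in> borel_measurable (restrict_space borel (fst c))"
        by (rule borel_measurable_continuous_on_restrict[OF chart_continuous[OF c]])
      then have "(\<lambda>x. \<rho> (snd c x)) \<in> borel_measurable (restrict_space borel (fst c))"
        using \<rho> by (rule measurable_compose)
      then have "(\<lambda>x. 1 / \<rho> (snd c x)) \<in> borel_measurable (restrict_space borel (fst c))"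
        by measurable
      then show ?thesis
        using open_chart_domain[OF c] unfolding r_def[abs_def]
        by (subst (asm) borel_measurable_restrict_space_iff) auto
    qed
    show "Rellich_set K"
      unfolding Rellich_set_def
    proof (intro allI impI)
      fix \<epsilon> :: real assume \<epsilon>: "\<epsilon> > 0"
      \<comment> \<open>Compensates the upper bound of the density on the left side and the lower
        bounds of density and norm on the side of the gradient.\<close>
      define \<epsilon>' where "\<epsilon>' = \<epsilon> * (k * m\<^sup>2) / C"
      have \<epsilon>'0: "\<epsilon>' > 0" using \<epsilon> k0 m(1) C0 by (simp add: \<epsilon>'_def)
      obtain P C' where PC: "finite P" "\<forall>q\<in>P. compact q \<and> q \<subseteq> cbox l h" "0 \<le> C'"
        "\<forall>u D. (\<forall>p\<in>cbox l h. (u has_derivative blinfun_apply (D p)) (at p)) \<longrightarrow> continuous_on (cbox l h) D \<longrightarrow>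
          (\<integral>x. indicator (cbox l h) x * (u x)\<^sup>2 \<partial>lborel) \<le>
            \<epsilon>' * (\<integral>x. indicator (cbox l h) x * (norm (D x))\<^sup>2 \<partial>lborel)
            + C' * (\<Sum>k\<in>P. (\<integral>x. indicator k x * u x \<partial>lborel)\<^sup>2)"
        using Rellich_box[OF \<epsilon>'0, of l h] by (elim exE conjE) (rule that)
      have P: "finite P" "\<And>q. q \<in> P \<Longrightarrow> compact q" "\<And>q. q \<in> P \<Longrightarrow> q \<subseteq> cbox l h" "0 \<le> C'"
        using PC(1-3) by simp_all
      note Rell = PC(4)[rule_format]
      define g where "g q x = indicator (chart_inv c ` q) x * r x" for q x
      have qb: "q \<in> sets borel" if "q \<in> P" for q using P(2)[OF that] by (simp add: compact_imp_closed borel_closed)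
      have qim: "q \<subseteq> snd c ` fst c" if "q \<in> P" for q using P(3)[OF that] Qim by blast
      have gL2: "L2_real (g q)" if q: "q \<in> P" for q
        unfolding L2_real_def
      proof
        have cq: "compact (chart_inv c ` q)" by (rule compact_chart_inv_image[OF c P(2)[OF q] qim[OF q]])
        then have "chart_inv c ` q \<in> sets borel" by (simp add: compact_imp_closed borel_closed)
        then show gm: "g q \<in> borel_measurable borel"
          unfolding g_def[abs_def] using r by measurable
        show "integrable \<mu> (\<lambda>x. (g q x)\<^sup>2)"
        proof (rule integrable_compact_support[OF _ cq])
          show "(\<lambda>x. (g q x)\<^sup>2) \<in> borel_measurable borel" using gm by measurable
          show "(g q x)\<^sup>2 = 0" if "x \<notin> chart_inv c ` q" for x using that by (simp add: g_def)
          show "\<bar>(g q x)\<^sup>2\<bar> \<le> (1 / k)\<^sup>2" if "x \<in> chart_inv c ` q" for x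
          proof -
            have "snd c x \<in> cbox l h" "x \<in> fst c"
              using chart_preimage[OF c qim[OF q], of x] that P(3)[OF q] by auto
            then have "0 \<le> g q x" "g q x \<le> 1 / k"
              using \<rho>b[of "snd c x"] k0 that by (auto simp: g_def r_def frac_le)
            then show ?thesis by (simp add: power_mono)
          qed
        qed
      qed
      have main: "(\<integral>x. indicator K x * (u x)\<^sup>2 \<partial>\<mu>) \<le>
          \<epsilon> * (\<integral>x. indicator K x * I x (du u x) (du u x) \<partial>\<mu>)
            + (C * C') * (\<Sum>q\<in>P. (\<integral>x. g q x * u x \<partial>\<mu>)\<^sup>2)" if u: "u \<in> C1c_real" for u
      proof -
        define w where "w = u \<circ> chart_inv c"
        note uC1 = C1c_realD[OF u]
        have wC1: "C1_on (snd c ` fst c) w" using uC1 c by (simp add: C1_real_def w_def)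
        have w_cont: "continuous_on (cbox l h) w"
          by (rule continuous_on_subset[OF C1_on_continuous[OF wC1] Qim])
        have D_cont: "continuous_on (cbox l h) (Dr w)"
          by (rule continuous_on_subset[OF C1_on_continuous_Dr[OF wC1] Qim])
        have um: "u \<in> borel_measurable borel" by (rule C1_real_measurable[OF uC1])
        have Em: "(\<lambda>x. I x (du u x) (du u x)) \<in> borel_measurable borel" by (rule measurable_energy[OF uC1 uC1])
        have \<rho>0: "0 \<le> \<rho> q" if "q \<in> cbox l h" for q using \<rho>b[OF that] k0 by simp
        have Qb: "cbox l h \<in> sets borel" by simp
        have "(\<integral>x. indicator K x * (u x)\<^sup>2 \<partial>\<mu>) = (\<integral>p. indicator (cbox l h) p * (\<rho> p * (w p)\<^sup>2) \<partial>lborel)"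
          unfolding K_def w_def o_def using um by (intro chart_integral[OF c Qb Qim \<rho> \<rho>0 distr]) auto
        also have "\<dots> \<le> (\<integral>p. C * (indicator (cbox l h) p * (w p)\<^sup>2) \<partial>lborel)"
        proof (rule integral_mono')
          show "integrable lborel (\<lambda>p. C * (indicator (cbox l h) p * (w p)\<^sup>2))"
            by (intro integrable_mult_right integrable_on_compact compact_cbox continuous_intros w_cont)
          show "indicator (cbox l h) p * (\<rho> p * (w p)\<^sup>2) \<le> C * (indicator (cbox l h) p * (w p)\<^sup>2)" for p
            using \<rho>b(2)[of p] by (auto simp: indicator_def intro!: mult_right_mono)
          show "0 \<le> C * (indicator (cbox l h) p * (w p)\<^sup>2)" for p using C0 by simp
        qed
        also have "\<dots> = C * (\<integral>p. indicator (cbox l h) p * (w p)\<^sup>2 \<partial>lborel)" by simp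
        finally have A: "(\<integral>x. indicator K x * (u x)\<^sup>2 \<partial>\<mu>) \<le> C * (\<integral>p. indicator (cbox l h) p * (w p)\<^sup>2 \<partial>lborel)" .
        have B: "(\<integral>p. indicator (cbox l h) p * (norm (Dr w p))\<^sup>2 \<partial>lborel) \<le>
            (1 / (k * m\<^sup>2)) * (\<integral>x. indicator K x * I x (du u x) (du u x) \<partial>\<mu>)"
        proof -
          let ?E = "\<lambda>x. I x (du u x) (du u x)"
          have Kb: "K \<in> sets borel" using K(1) by (simp add: compact_imp_closed borel_closed)
          have "integrable \<mu> (\<lambda>x. indicator K x * ?E x)"
            by (rule local_integrable[OF Kb integrable_energy[OF u u]])
          then have int: "integrable lborel (\<lambda>p. indicator (cbox l h) p * (\<rho> p * ?E (chart_inv c p)))"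
            unfolding K_def using chart_integrable[OF c Qb Qim \<rho> \<rho>0 distr Em] by simp
          have le: "(norm (Dr w p))\<^sup>2 \<le> (1 / (k * m\<^sup>2)) * (\<rho> p * ?E (chart_inv c p))" if p: "p \<in> cbox l h" for p
          proof -
            define x where "x = chart_inv c p"
            have pim: "p \<in> snd c ` fst c" using p Qim by blast
            have x: "x \<in> K" "x \<in> fst c" "snd c x = p"
              using p chart_inv_in[OF pim] chart_chart_inv[OF c pim] by (auto simp: x_def K_def)
            have cot: "du u x \<in> cotangent A x" by (rule differential_cotangent[OF uC1])
            have "du u x c = Dr w p" using c x by (simp add: differential_eq w_def)
            then have "m * norm (Dr w p) \<le> N x (du u x)" using Nm[OF x(1) cot] by simp
            then have "(m * norm (Dr w p))\<^sup>2 \<le> ?E x"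
              using m(1) by (simp add: I_self[OF cot] power_mono)
            then have "k * (m * norm (Dr w p))\<^sup>2 \<le> \<rho> p * ?E x"
              using \<rho>b(1)[OF p] k0 by (intro mult_mono) auto
            then show ?thesis using k0 m(1) by (simp add: x_def field_simps power_mult_distrib)
          qed
          have "(\<integral>p. indicator (cbox l h) p * (norm (Dr w p))\<^sup>2 \<partial>lborel)
              \<le> (\<integral>p. (1 / (k * m\<^sup>2)) * (indicator (cbox l h) p * (\<rho> p * ?E (chart_inv c p))) \<partial>lborel)"
          proof (rule integral_mono')
            show "integrable lborel (\<lambda>p. (1 / (k * m\<^sup>2)) * (indicator (cbox l h) p * (\<rho> p * ?E (chart_inv c p))))"
              by (rule integrable_mult_right[OF int])
            show "indicator (cbox l h) p * (norm (Dr w p))\<^sup>2 \<le> (1 / (k * m\<^sup>2)) * (indicator (cbox l h) p * (\<rho> p * ?E (chart_inv c p)))" for p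
              using le[of p] by (cases "p \<in> cbox l h") auto
            show "0 \<le> (1 / (k * m\<^sup>2)) * (indicator (cbox l h) p * (\<rho> p * ?E (chart_inv c p)))" for p
              using le[of p] by (cases "p \<in> cbox l h") (auto intro: order_trans[OF zero_le_power2])
          qed
          also have "\<dots> = (1 / (k * m\<^sup>2)) * (\<integral>p. indicator (cbox l h) p * (\<rho> p * ?E (chart_inv c p)) \<partial>lborel)" by simp
          also have "(\<integral>p. indicator (cbox l h) p * (\<rho> p * ?E (chart_inv c p)) \<partial>lborel) = (\<integral>x. indicator K x * ?E x \<partial>\<mu>)"
            unfolding K_def by (rule chart_integral[OF c Qb Qim \<rho> \<rho>0 distr Em, symmetric])
          finally show ?thesis .
        qed
        have Gq: "(\<integral>p. indicator q p * w p \<partial>lborel) = (\<integral>x. g q x * u x \<partial>\<mu>)" if q: "q \<in> P" for q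
        proof -
          have "(\<integral>x. g q x * u x \<partial>\<mu>) = (\<integral>x. indicator (chart_inv c ` q) x * (r x * u x) \<partial>\<mu>)"
            by (simp add: g_def mult.assoc)
          also have "\<dots> = (\<integral>p. indicator q p * (\<rho> p * (r (chart_inv c p) * u (chart_inv c p))) \<partial>lborel)"
            using r um P(3)[OF q] \<rho>0
            by (intro chart_integral[OF c qb[OF q] qim[OF q] \<rho> _ distr]) auto
          also have "\<dots> = (\<integral>p. indicator q p * w p \<partial>lborel)"
          proof (intro Bochner_Integration.integral_cong refl)
            fix p
            show "indicator q p * (\<rho> p * (r (chart_inv c p) * u (chart_inv c p))) = indicator q p * w p"
            proof (cases "p \<in> q")
              case True
              then have pim: "p \<in> snd c ` fst c" and "p \<in> cbox l h" using qim[OF q] P(3)[OF q] by auto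
              then have "r (chart_inv c p) = 1 / \<rho> p" "\<rho> p \<noteq> 0"
                using chart_inv_in[OF pim] chart_chart_inv[OF c pim] \<rho>b(1)[of p] k0 by (auto simp: r_def)
              then show ?thesis by (simp add: w_def)
            qed simp
          qed
          finally show ?thesis by simp
        qed
        have "(\<integral>p. indicator (cbox l h) p * (w p)\<^sup>2 \<partial>lborel) \<le>
            \<epsilon>' * (\<integral>p. indicator (cbox l h) p * (norm (Dr w p))\<^sup>2 \<partial>lborel)
            + C' * (\<Sum>q\<in>P. (\<integral>p. indicator q p * w p \<partial>lborel)\<^sup>2)"
          by (rule Rell) (use C1_on_has_derivative[OF wC1] Qim D_cont in auto)
        also have "(\<Sum>q\<in>P. (\<integral>p. indicator q p * w p \<partial>lborel)\<^sup>2) = (\<Sum>q\<in>P. (\<integral>x. g q x * u x \<partial>\<mu>)\<^sup>2)"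
          by (intro sum.cong refl) (simp add: Gq)
        also have "\<epsilon>' * (\<integral>p. indicator (cbox l h) p * (norm (Dr w p))\<^sup>2 \<partial>lborel)
            \<le> \<epsilon>' * ((1 / (k * m\<^sup>2)) * (\<integral>x. indicator K x * I x (du u x) (du u x) \<partial>\<mu>))"
          using B \<epsilon>'0 by (intro mult_left_mono) auto
        finally have "C * (\<integral>p. indicator (cbox l h) p * (w p)\<^sup>2 \<partial>lborel) \<le>
            C * (\<epsilon>' * ((1 / (k * m\<^sup>2)) * (\<integral>x. indicator K x * I x (du u x) (du u x) \<partial>\<mu>))
            + C' * (\<Sum>q\<in>P. (\<integral>x. g q x * u x \<partial>\<mu>)\<^sup>2))"
          using C0 by (intro mult_left_mono) auto
        also have "\<dots> = \<epsilon> * (\<integral>x. indicator K x * I x (du u x) (du u x) \<partial>\<mu>)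
            + (C * C') * (\<Sum>q\<in>P. (\<integral>x. g q x * u x \<partial>\<mu>)\<^sup>2)"
          using C0 k0 m(1) by (simp add: \<epsilon>'_def distrib_left)
        finally show ?thesis using A by linarith
      qed
      \<comment> \<open>Different boxes may give the same function, so a sum over \<open>P\<close>
        is bounded by the number of boxes times the sum over \<open>G\<close>.\<close>
      define G where "G = g ` P"
      have "(\<integral>x. indicator K x * (u x)\<^sup>2 \<partial>\<mu>) \<le> \<epsilon> * (\<integral>x. indicator K x * I x (du u x) (du u x) \<partial>\<mu>)
          + (C * C' * real (card P)) * (\<Sum>g\<in>G. (\<integral>x. g x * u x \<partial>\<mu>)\<^sup>2)" if u: "u \<in> C1c_real" for u
      proof -
        have "(\<Sum>q\<in>P. (\<integral>x. g q x * u x \<partial>\<mu>)\<^sup>2) \<le> (\<Sum>q\<in>P. (\<Sum>g\<in>G. (\<integral>x. g x * u x \<partial>\<mu>)\<^sup>2))"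
        proof (rule sum_mono)
          fix q assume "q \<in> P"
          then show "(\<integral>x. g q x * u x \<partial>\<mu>)\<^sup>2 \<le> (\<Sum>g\<in>G. (\<integral>x. g x * u x \<partial>\<mu>)\<^sup>2)"
            using P(1) by (intro member_le_sum[of "g q" G "\<lambda>g. (\<integral>x. g x * u x \<partial>\<mu>)\<^sup>2"]) (auto simp: G_def)
        qed
        then have "(C * C') * (\<Sum>q\<in>P. (\<integral>x. g q x * u x \<partial>\<mu>)\<^sup>2) \<le> (C * C') * (real (card P) * (\<Sum>g\<in>G. (\<integral>x. g x * u x \<partial>\<mu>)\<^sup>2))"
          using C0 P(4) by (intro mult_left_mono) auto
        then show ?thesis using main[OF u] by (simp add: mult.assoc)
      qed
      moreover have "finite G" "\<forall>g\<in>G. L2_real g" "0 \<le> C * C' * real (card P)"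
        using P(1,4) gL2 C0 by (auto simp: G_def)
      ultimately show "\<exists>G C. finite G \<and> (\<forall>g\<in>G. L2_real g) \<and> 0 \<le> C \<and>
        (\<forall>u\<in>C1c_real. (\<integral>x. indicator K x * (u x)\<^sup>2 \<partial>\<mu>) \<le>
          \<epsilon> * (\<integral>x. indicator K x * I x (du u x) (du u x) \<partial>\<mu>) + C * (\<Sum>g\<in>G. (\<integral>x. g x * u x \<partial>\<mu>)\<^sup>2))"
        by (intro exI[of _ G] exI[of _ "C * C' * real (card P)"]) blast
    qed
  qed
qed

end

lemma square_sum_le: "(a + b)\<^sup>2 \<le> 2 * a\<^sup>2 + 2 * (b::real)\<^sup>2"
  using sum_squares_bound[of a b] by (simp add: power2_sum)

lemma mult_le_epsilon_squares:
  fixes a b e :: real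
  assumes "e > 0"
  shows "a * b \<le> e * b\<^sup>2 + a\<^sup>2 / (4 * e)"
proof -
  have "0 \<le> (a / (2 * sqrt e) - sqrt e * b)\<^sup>2" by simp
  also have "\<dots> = a\<^sup>2 / (4 * e) - a * b + e * b\<^sup>2"
    using assms by (simp add: power2_diff power_mult_distrib power_divide)
  finally show ?thesis by simp
qed

context RM_manifold
begin

text \<open>The real counterpart of \<open>weakly_bounded\<close>, tested with real
  functions.\<close>

definition weak :: "real \<Rightarrow> ('a \<Rightarrow> real) \<Rightarrow> real \<Rightarrow> bool" where
  "weak z u M \<longleftrightarrow> (\<forall>v\<in>C1c_real. \<bar>form z u v\<bar> \<le> M * sqrt (sq1 v))"

section \<open>The Caccioppoli inequality\<close>

lemma C1c_real_mult:
  assumes "C1_real b" "u \<in> C1c_real"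
  shows "(\<lambda>x. b x * u x) \<in> C1c_real"
  unfolding C1c_real_def mem_Collect_eq
proof
  show "C1_real (\<lambda>x. b x * u x)" by (rule C1_real_mult(1)[OF assms(1) C1c_realD[OF assms(2)]])
  show "compact (closure {x. b x * u x \<noteq> 0})"
    by (rule compact_support_subset[of u 0]) (use assms(2) in \<open>auto simp: C1c_real_def\<close>)
qed

text \<open>Testing with \<open>b\<^sup>2 u\<close> yields the energy of \<open>u\<close> weighted
  by \<open>b\<^sup>2\<close> and a cross term with the differential of \<open>b\<close>, which is
  absorbed into half of the energy. The dual norm enters through the norm of the test function, at
  most \<open>C1\<close> times that of \<open>u\<close>; hence the product
  \<open>M * sqrt (sq1 u)\<close> in the bound.\<close>

lemma local_Caccioppoli:
  assumes b: "b \<in> C1c_real" and K: "compact K" "\<And>x. x \<notin> K \<Longrightarrow> b x = 0"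
  shows "\<exists>C\<ge>0. \<forall>u\<in>C1c_real. \<forall>M\<ge>0. weak z u M \<longrightarrow>
    (\<integral>x. (b x)\<^sup>2 * I x (du u x) (du u x) \<partial>\<mu>) \<le> C * (M * sqrt (sq1 u) + (\<integral>x. indicator K x * (u x)\<^sup>2 \<partial>\<mu>))"
proof -
  note bC = C1c_realD[OF b]
  obtain B where B: "\<And>x. \<bar>b x\<bar> \<le> B" using C1c_real_bounded[OF b] by blast
  have Kb: "K \<in> sets borel" using K(1) by (simp add: borel_closed compact_imp_closed)
  have "closure {x. b x \<noteq> 0} \<subseteq> K"
    using K by (intro closure_minimal compact_imp_closed) auto
  then have db0: "du b x = cov_zero" if "x \<notin> K" for x
    using that by (intro differential_outside_support) blast
  have cot: "du v x \<in> cotangent A x" if "C1_real v" for v x by (rule differential_cotangent[OF that])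
  obtain L where L: "\<And>x. x \<in> K \<Longrightarrow> \<bar>I x (du b x) (du b x)\<bar> \<le> L"
    using section_pairing_bounded[OF differential_section[OF bC] differential_section[OF bC] K(1)] by blast
  define L1 where "L1 = max L 0"
  have db: "I x (du b x) (du b x) \<le> L1 * indicator K x" for x
    using L[of x] db0[of x] I_zero_left[OF cotangent_zero, of x] by (cases "x \<in> K") (auto simp: L1_def)
  have L10: "L1 \<ge> 0" by (simp add: L1_def)
  \<comment> \<open>Any point of the manifold serves here.\<close>
  have B0: "B \<ge> 0" using B[of undefined] by simp
  have b2: "(b x)\<^sup>2 \<le> B\<^sup>2 * indicator K x" for x
  proof (cases "x \<in> K")
    case True
    have "(b x)\<^sup>2 \<le> B\<^sup>2" using B[of x] power_mono[of "\<bar>b x\<bar>" B 2] by simp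
    then show ?thesis using True by simp
  qed (simp add: K(2))
  \<comment> \<open>Three contributions to the norm of \<open>b\<^sup>2 u\<close>: the gradient of
    \<open>u\<close>, the gradient of \<open>b\<close>, and the function itself.\<close>
  define C1 where "C1 = sqrt (2 * (B\<^sup>2)\<^sup>2 + 8 * B\<^sup>2 * L1 + (B\<^sup>2)\<^sup>2)"
  define C where "C = 2 * (C1 + \<bar>z\<bar> * B\<^sup>2 + 2 * L1)"
  have C0: "C1 \<ge> 0" "C \<ge> 0" using L10 by (auto simp: C_def C1_def)
  have "(\<integral>x. (b x)\<^sup>2 * I x (du u x) (du u x) \<partial>\<mu>) \<le> C * (M * sqrt (sq1 u) + (\<integral>x. indicator K x * (u x)\<^sup>2 \<partial>\<mu>))"
    if u: "u \<in> C1c_real" and M: "M \<ge> 0" and w: "weak z u M" for u M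
  proof -
    note uC = C1c_realD[OF u]
    define v where "v x = b x * (b x * u x)" for x
    have bu: "C1_real (\<lambda>x. b x * u x)" by (rule C1_real_mult(1)[OF bC uC])
    have v: "v \<in> C1c_real"
      unfolding v_def[abs_def] by (intro C1c_real_mult bC u)
    let ?E = "\<lambda>x. I x (du u x) (du u x)"
    have dv: "du v x = cov_add (cov_scale (b x) (cov_add (cov_scale (b x) (du u x)) (cov_scale (u x) (du b x))))
        (cov_scale (b x * u x) (du b x))" for x
      unfolding v_def[abs_def] C1_real_mult(2)[OF bC bu] C1_real_mult(2)[OF bC uC] ..
    have Iuv: "I x (du u x) (du v x) = (b x)\<^sup>2 * ?E x + 2 * (b x * u x) * I x (du u x) (du b x)" for x
      unfolding dv using cot[OF uC, of x] cot[OF bC, of x]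
      by (simp add: I_add_right I_scale_right cotangent_add cotangent_scale power2_eq_square algebra_simps)
    have E0: "?E x \<ge> 0" for x using I_self[OF cot[OF uC]] by simp
    \<comment> \<open>The weights are chosen such that half of the energy term in \<open>Iuv\<close>
      is left after the cross term has been subtracted.\<close>
    have cross: "\<bar>2 * (b x * u x) * I x (du u x) (du b x)\<bar> \<le> (b x)\<^sup>2 * ?E x / 2 + 2 * L1 * (indicator K x * (u x)\<^sup>2)" for x
    proof -
      have "\<bar>2 * (b x * u x) * I x (du u x) (du b x)\<bar> \<le> 2 * (\<bar>b x\<bar> * \<bar>u x\<bar>) * (N x (du u x) * N x (du b x))"
        unfolding abs_mult using I_Cauchy_Schwarz[OF cot[OF uC] cot[OF bC], of x] by (intro mult_mono) auto
      also have "\<dots> = 2 * ((\<bar>b x\<bar> * N x (du u x)) * (\<bar>u x\<bar> * N x (du b x)))" by simp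
      also have "\<dots> \<le> (\<bar>b x\<bar> * N x (du u x))\<^sup>2 / 2 + 2 * (\<bar>u x\<bar> * N x (du b x))\<^sup>2"
        using mult_le_epsilon_squares[of 1 "\<bar>b x\<bar> * N x (du u x)" "\<bar>u x\<bar> * N x (du b x)"] by simp
      also have "\<dots> = (b x)\<^sup>2 * ?E x / 2 + 2 * ((u x)\<^sup>2 * I x (du b x) (du b x))"
        using I_self[OF cot[OF uC], of x] I_self[OF cot[OF bC], of x] by (simp add: power_mult_distrib)
      also have "(u x)\<^sup>2 * I x (du b x) (du b x) \<le> (u x)\<^sup>2 * (L1 * indicator K x)"
        by (intro mult_left_mono db) simp
      finally show ?thesis by (simp add: mult_ac)
    qed
    have v2: "u x * v x \<le> B\<^sup>2 * (indicator K x * (u x)\<^sup>2)" "0 \<le> u x * v x" for x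
    proof -
      have e: "u x * v x = (b x)\<^sup>2 * (u x)\<^sup>2" by (simp add: v_def power2_eq_square)
      show "0 \<le> u x * v x" unfolding e by simp
      have "(b x)\<^sup>2 * (u x)\<^sup>2 \<le> (B\<^sup>2 * indicator K x) * (u x)\<^sup>2" by (intro mult_right_mono b2) simp
      then show "u x * v x \<le> B\<^sup>2 * (indicator K x * (u x)\<^sup>2)" unfolding e by (simp add: mult.assoc)
    qed
    have int_uK: "integrable \<mu> (\<lambda>x. indicator K x * (u x)\<^sup>2)"
      using integrable_product[OF u u] by (intro local_integrable Kb) (simp add: power2_eq_square)
    have int_uv: "integrable \<mu> (\<lambda>x. u x * v x)" by (rule integrable_product[OF u v])
    have int_E: "integrable \<mu> (\<lambda>x. I x (du u x) (du v x))" by (rule integrable_energy[OF u v])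
    have "sq1 v \<le> C1\<^sup>2 * sq1 u"
    proof -
      have "dens v x \<le> C1\<^sup>2 * dens u x" for x
      proof -
        have bx: "(b x)\<^sup>2 \<le> B\<^sup>2" "I x (du b x) (du b x) \<le> L1" "0 \<le> I x (du b x) (du b x)"
          using b2[of x] db[of x] L10 I_self[OF cot[OF bC]] zero_le_power2[of B]
          by (cases "x \<in> K"; simp)+
        have Nv: "N x (du v x) \<le> (b x)\<^sup>2 * N x (du u x) + 2 * (\<bar>b x\<bar> * \<bar>u x\<bar> * N x (du b x))"
        proof -
          have "N x (du v x) \<le> \<bar>b x\<bar> * (\<bar>b x\<bar> * N x (du u x) + \<bar>u x\<bar> * N x (du b x)) + \<bar>b x * u x\<bar> * N x (du b x)"
          proof -
            have "N x (du v x) \<le> N x (cov_scale (b x) (cov_add (cov_scale (b x) (du u x)) (cov_scale (u x) (du b x))))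
                + N x (cov_scale (b x * u x) (du b x))"
              unfolding dv by (intro N_triangle cotangent_scale cotangent_add cot uC bC)
            also have "N x (cov_scale (b x) (cov_add (cov_scale (b x) (du u x)) (cov_scale (u x) (du b x)))) =
                \<bar>b x\<bar> * N x (cov_add (cov_scale (b x) (du u x)) (cov_scale (u x) (du b x)))"
              by (intro N_scale cotangent_scale cotangent_add cot uC bC)
            also have "N x (cov_add (cov_scale (b x) (du u x)) (cov_scale (u x) (du b x))) \<le>
                N x (cov_scale (b x) (du u x)) + N x (cov_scale (u x) (du b x))"
              by (intro N_triangle cotangent_scale cot uC bC)
            also have "N x (cov_scale (b x) (du u x)) = \<bar>b x\<bar> * N x (du u x)" by (intro N_scale cot uC)
            also have "N x (cov_scale (u x) (du b x)) = \<bar>u x\<bar> * N x (du b x)" by (intro N_scale cot bC)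
            also have "N x (cov_scale (b x * u x) (du b x)) = \<bar>b x * u x\<bar> * N x (du b x)" by (intro N_scale cot bC)
            finally show ?thesis by (simp add: mult_left_mono)
          qed
          also have "\<dots> = (b x)\<^sup>2 * N x (du u x) + 2 * (\<bar>b x\<bar> * \<bar>u x\<bar> * N x (du b x))"
            by (simp add: abs_mult algebra_simps) (simp add: power2_eq_square)
          finally show ?thesis .
        qed
        have p4: "((b x)\<^sup>2)\<^sup>2 \<le> (B\<^sup>2)\<^sup>2" by (rule power_mono[OF bx(1)]) simp
        have p2: "(b x)\<^sup>2 * I x (du b x) (du b x) \<le> B\<^sup>2 * L1"
          by (rule mult_mono[OF bx(1,2) _ bx(3)]) simp
        have "(N x (du v x))\<^sup>2 \<le> ((b x)\<^sup>2 * N x (du u x) + 2 * (\<bar>b x\<bar> * \<bar>u x\<bar> * N x (du b x)))\<^sup>2"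
          using Nv N_nonneg[OF cot[OF C1c_realD[OF v]]] by (intro power_mono) auto
        also have "\<dots> \<le> 2 * ((b x)\<^sup>2 * N x (du u x))\<^sup>2 + 2 * (2 * (\<bar>b x\<bar> * \<bar>u x\<bar> * N x (du b x)))\<^sup>2"
          by (rule square_sum_le)
        also have "\<dots> = 2 * (((b x)\<^sup>2)\<^sup>2 * ?E x) + 8 * ((b x)\<^sup>2 * I x (du b x) (du b x) * (u x)\<^sup>2)"
          using I_self[OF cot[OF uC], of x] I_self[OF cot[OF bC], of x] by (simp add: power_mult_distrib)
        also have "\<dots> \<le> 2 * ((B\<^sup>2)\<^sup>2 * ?E x) + 8 * (B\<^sup>2 * L1 * (u x)\<^sup>2)"
          using mult_right_mono[OF p4 E0[of x]] mult_right_mono[OF p2, of "(u x)\<^sup>2"] by simp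
        finally have 1: "(N x (du v x))\<^sup>2 \<le> 2 * ((B\<^sup>2)\<^sup>2 * ?E x) + 8 * (B\<^sup>2 * L1 * (u x)\<^sup>2)" .
        have "(v x)\<^sup>2 = ((b x)\<^sup>2)\<^sup>2 * (u x)\<^sup>2" by (simp add: v_def power2_eq_square)
        also have "\<dots> \<le> (B\<^sup>2)\<^sup>2 * (u x)\<^sup>2" by (rule mult_right_mono[OF p4]) simp
        finally have 2: "(v x)\<^sup>2 \<le> (B\<^sup>2)\<^sup>2 * (u x)\<^sup>2" .
        have sq: "C1\<^sup>2 = 2 * (B\<^sup>2)\<^sup>2 + 8 * B\<^sup>2 * L1 + (B\<^sup>2)\<^sup>2" using L10 by (simp add: C1_def)
        have "0 \<le> (8 * B\<^sup>2 * L1 + (B\<^sup>2)\<^sup>2) * ?E x + 2 * (B\<^sup>2)\<^sup>2 * (u x)\<^sup>2"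
          using L10 E0[of x] by (intro add_nonneg_nonneg mult_nonneg_nonneg) auto
        then show ?thesis
          using 1 2 unfolding sq dens_eq[OF C1c_realD[OF v]] unfolding dens_def by (simp add: algebra_simps)
      qed
      then have "sq1 v \<le> (\<integral>x. C1\<^sup>2 * dens u x \<partial>\<mu>)"
        unfolding sq1_def by (intro integral_mono integrable_dens v integrable_mult_right u) auto
      then show ?thesis by (simp add: sq1_def)
    qed
    then have "sqrt (sq1 v) \<le> sqrt (C1\<^sup>2 * sq1 u)" by (rule real_sqrt_le_mono)
    then have sv: "sqrt (sq1 v) \<le> C1 * sqrt (sq1 u)" using C0 by (simp add: real_sqrt_mult)
    have "(\<integral>x. (b x)\<^sup>2 * ?E x / 2 \<partial>\<mu>) \<le> (\<integral>x. I x (du u x) (du v x) + 2 * L1 * (indicator K x * (u x)\<^sup>2) \<partial>\<mu>)"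
    proof (rule integral_mono')
      show "integrable \<mu> (\<lambda>x. I x (du u x) (du v x) + 2 * L1 * (indicator K x * (u x)\<^sup>2))"
        by (intro Bochner_Integration.integrable_add integrable_mult_right int_uK int_E)
      show *: "(b x)\<^sup>2 * ?E x / 2 \<le> I x (du u x) (du v x) + 2 * L1 * (indicator K x * (u x)\<^sup>2)" for x
        using cross[of x] unfolding Iuv by linarith
      show "0 \<le> I x (du u x) (du v x) + 2 * L1 * (indicator K x * (u x)\<^sup>2)" for x
        using *[of x] E0[of x] by (rule_tac order_trans[OF _ *]) simp
    qed
    also have "\<dots> = form z u v + z * (\<integral>x. u x * v x \<partial>\<mu>) + 2 * L1 * (\<integral>x. indicator K x * (u x)\<^sup>2 \<partial>\<mu>)"
      using int_uK int_E by (simp add: form_def)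
    also have "form z u v \<le> C1 * (M * sqrt (sq1 u))"
      using w v sv mult_left_mono[OF sv M] unfolding weak_def by (fastforce simp: mult_ac)
    also have "z * (\<integral>x. u x * v x \<partial>\<mu>) \<le> \<bar>z\<bar> * (B\<^sup>2 * (\<integral>x. indicator K x * (u x)\<^sup>2 \<partial>\<mu>))"
    proof -
      have i0: "0 \<le> (\<integral>x. u x * v x \<partial>\<mu>)" using v2(2) by (intro integral_nonneg_AE) auto
      have "(\<integral>x. u x * v x \<partial>\<mu>) \<le> (\<integral>x. B\<^sup>2 * (indicator K x * (u x)\<^sup>2) \<partial>\<mu>)"
        by (intro integral_mono int_uv integrable_mult_right int_uK v2)
      also have "\<dots> = B\<^sup>2 * (\<integral>x. indicator K x * (u x)\<^sup>2 \<partial>\<mu>)" by simp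
      finally have "\<bar>z\<bar> * (\<integral>x. u x * v x \<partial>\<mu>) \<le> \<bar>z\<bar> * (B\<^sup>2 * (\<integral>x. indicator K x * (u x)\<^sup>2 \<partial>\<mu>))"
        by (intro mult_left_mono) auto
      moreover have "z * (\<integral>x. u x * v x \<partial>\<mu>) \<le> \<bar>z\<bar> * (\<integral>x. u x * v x \<partial>\<mu>)"
        using i0 by (intro mult_right_mono) auto
      ultimately show ?thesis by linarith
    qed
    finally have half: "(\<integral>x. (b x)\<^sup>2 * ?E x \<partial>\<mu>) / 2 \<le> C1 * (M * sqrt (sq1 u))
        + \<bar>z\<bar> * (B\<^sup>2 * (\<integral>x. indicator K x * (u x)\<^sup>2 \<partial>\<mu>)) + 2 * L1 * (\<integral>x. indicator K x * (u x)\<^sup>2 \<partial>\<mu>)"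
      by simp
    define X where "X = M * sqrt (sq1 u)"
    define Z where "Z = (\<integral>x. indicator K x * (u x)\<^sup>2 \<partial>\<mu>)"
    have XZ: "0 \<le> X" "0 \<le> Z"
      unfolding X_def Z_def using M sq1_nonneg[OF u] by (auto intro!: integral_nonneg_AE)
    have "0 \<le> C1 * Z" "0 \<le> \<bar>z\<bar> * B\<^sup>2 * X" "0 \<le> L1 * X" using C0 XZ L10 by auto
    then show ?thesis
      using half unfolding C_def X_def[symmetric] Z_def[symmetric] by (simp add: algebra_simps)
  qed
  then show ?thesis using C0 by blast
qed

text \<open>On \<open>V\<close> the norm of the form domain is small up to terms that the right side
  of the Fredholm estimate tolerates. Squares are used because integrals over different sets
  add.\<close>

definition controlled :: "real \<Rightarrow> 'a set \<Rightarrow> bool" where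
  "controlled z V \<longleftrightarrow> V \<in> sets borel \<and> (\<forall>\<epsilon>>0. \<exists>G C. finite G \<and> (\<forall>g\<in>G. L2_real g) \<and> 0 \<le> C \<and>
    (\<forall>u\<in>C1c_real. \<forall>M\<ge>0. weak z u M \<longrightarrow> (\<integral>x. indicator V x * dens u x \<partial>\<mu>) \<le>
       \<epsilon> * sq1 u + C * (M\<^sup>2 + (\<Sum>g\<in>G. (\<integral>x. g x * u x \<partial>\<mu>)\<^sup>2))))"

text \<open>The Caccioppoli inequality bounds the energy on \<open>U\<close> by the square integral
  of \<open>u\<close> over \<open>K\<close> and a mixed term; Rellich's inequality makes the former
  small, and the mixed term is split. Half of \<open>\<epsilon>\<close> is spent on each.\<close>

lemma controlled_near: "\<exists>U. open U \<and> x0 \<in> U \<and> controlled z U"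
proof -
  obtain U K b where U: "open U" "x0 \<in> U" and K: "compact K" and b: "b \<in> C1c_real" "\<And>x. 0 \<le> b x" "\<And>x. x \<in> U \<Longrightarrow> 1 \<le> b x"
    "\<And>x. x \<notin> K \<Longrightarrow> b x = 0" and Rell: "Rellich_set K"
    using local_Rellich[of x0] by blast
  obtain C where C: "C \<ge> 0" and Cacc: "\<And>u M. u \<in> C1c_real \<Longrightarrow> M \<ge> 0 \<Longrightarrow> weak z u M \<Longrightarrow>
    (\<integral>x. (b x)\<^sup>2 * I x (du u x) (du u x) \<partial>\<mu>) \<le> C * (M * sqrt (sq1 u) + (\<integral>x. indicator K x * (u x)\<^sup>2 \<partial>\<mu>))"
    using local_Caccioppoli[OF b(1) K b(4), of z] by blast
  have Kb: "K \<in> sets borel" using K by (simp add: borel_closed compact_imp_closed)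
  have UK: "U \<subseteq> K" using b(3,4) by force
  have "controlled z U"
    unfolding controlled_def
  proof (intro conjI allI impI)
    show "U \<in> sets borel" using U by simp
    fix \<epsilon> :: real assume \<epsilon>: "\<epsilon> > 0"
    \<comment> \<open>The square integral of \<open>u\<close> over \<open>K\<close> enters once
      directly and \<open>C\<close> times through the Caccioppoli inequality, hence the factor
      \<open>C + 1\<close>.\<close>
    define \<delta> where "\<delta> = \<epsilon> / (2 * (C + 1))"
    have \<delta>: "\<delta> > 0" "(C + 1) * \<delta> = \<epsilon> / 2" using \<epsilon> C by (auto simp: \<delta>_def field_simps)
    obtain G C' where G: "finite G" "\<forall>g\<in>G. L2_real g" "0 \<le> C'" and R: "\<forall>u\<in>C1c_real. (\<integral>x. indicator K x * (u x)\<^sup>2 \<partial>\<mu>) \<le>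
       \<delta> * (\<integral>x. indicator K x * I x (du u x) (du u x) \<partial>\<mu>) + C' * (\<Sum>g\<in>G. (\<integral>x. g x * u x \<partial>\<mu>)\<^sup>2)"
      using Rell[unfolded Rellich_set_def, rule_format, OF \<delta>(1)] by (elim exE conjE) (rule that)
    note R = R[rule_format]
    \<comment> \<open>The second summand arises from splitting \<open>C * M * sqrt (sq1 u)\<close>
      by the weighted inequality between arithmetic and geometric mean.\<close>
    define C2 where "C2 = (C + 1) * C' + C\<^sup>2 / (2 * \<epsilon>)"
    have C2: "0 \<le> C2" using C G(3) \<epsilon> by (simp add: C2_def)
    have "(\<integral>x. indicator U x * dens u x \<partial>\<mu>) \<le> \<epsilon> * sq1 u + C2 * (M\<^sup>2 + (\<Sum>g\<in>G. (\<integral>x. g x * u x \<partial>\<mu>)\<^sup>2))"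
      if u: "u \<in> C1c_real" and M: "M \<ge> 0" and w: "weak z u M" for u M
    proof -
      note uC = C1c_realD[OF u]
      let ?E = "\<lambda>x. I x (du u x) (du u x)"
      define S where "S = (\<Sum>g\<in>G. (\<integral>x. g x * u x \<partial>\<mu>)\<^sup>2)"
      define Z where "Z = (\<integral>x. indicator K x * (u x)\<^sup>2 \<partial>\<mu>)"
      have S0: "0 \<le> S" unfolding S_def by (intro sum_nonneg) auto
      have E0: "?E x \<ge> 0" for x using I_self[OF differential_cotangent[OF uC]] by simp
      have s0: "0 \<le> sq1 u" by (rule sq1_nonneg[OF u])
      have int_uK: "integrable \<mu> (\<lambda>x. indicator K x * (u x)\<^sup>2)"
        using integrable_product[OF u u] by (intro local_integrable Kb) (simp add: power2_eq_square)
      have int_bE: "integrable \<mu> (\<lambda>x. (b x)\<^sup>2 * ?E x)"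
      proof -
        obtain B where B: "\<And>x. \<bar>b x\<bar> \<le> B" using C1c_real_bounded[OF b(1)] by blast
        show ?thesis
        proof (rule Bochner_Integration.integrable_bound[of \<mu> "\<lambda>x. B\<^sup>2 * ?E x"])
          show "integrable \<mu> (\<lambda>x. B\<^sup>2 * ?E x)" by (intro integrable_mult_right integrable_energy u)
          show "(\<lambda>x. (b x)\<^sup>2 * ?E x) \<in> borel_measurable \<mu>"
            using C1_real_measurable[OF C1c_realD[OF b(1)]] measurable_energy[OF uC uC]
            by (intro measurable_mu borel_measurable_times borel_measurable_power) auto
          have "(b x)\<^sup>2 * ?E x \<le> B\<^sup>2 * ?E x" for x
            using power_mono[OF B[of x], of 2] E0[of x] by (intro mult_right_mono) auto
          then show "AE x in \<mu>. norm ((b x)\<^sup>2 * ?E x) \<le> norm (B\<^sup>2 * ?E x)"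
            using E0 by (simp add: abs_mult)
        qed
      qed
      have "(\<integral>x. indicator U x * dens u x \<partial>\<mu>) \<le> (\<integral>x. indicator K x * (u x)\<^sup>2 + (b x)\<^sup>2 * ?E x \<partial>\<mu>)"
      proof (rule integral_mono')
        show "integrable \<mu> (\<lambda>x. indicator K x * (u x)\<^sup>2 + (b x)\<^sup>2 * ?E x)"
          by (rule Bochner_Integration.integrable_add[OF int_uK int_bE])
        show "0 \<le> indicator K x * (u x)\<^sup>2 + (b x)\<^sup>2 * ?E x" for x using E0[of x] by simp
        show "indicator U x * dens u x \<le> indicator K x * (u x)\<^sup>2 + (b x)\<^sup>2 * ?E x" for x
        proof (cases "x \<in> U")
          case True
          then have "1 \<le> (b x)\<^sup>2" using b(3)[of x] by (simp add: one_le_power)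
          then have "1 * ?E x \<le> (b x)\<^sup>2 * ?E x" using E0[of x] by (intro mult_right_mono) auto
          then show ?thesis using True UK by (auto simp: dens_def)
        qed (use E0[of x] in simp)
      qed
      also have "\<dots> = Z + (\<integral>x. (b x)\<^sup>2 * ?E x \<partial>\<mu>)"
        using int_uK int_bE by (simp add: Z_def)
      also have "\<dots> \<le> Z + C * (M * sqrt (sq1 u) + Z)"
        using Cacc[OF u M w] by (simp add: Z_def)
      also have "\<dots> = (C + 1) * Z + (C * M) * sqrt (sq1 u)"
        by (simp add: algebra_simps)
      also have "(C * M) * sqrt (sq1 u) \<le> (\<epsilon> / 2) * sq1 u + C\<^sup>2 / (2 * \<epsilon>) * M\<^sup>2"
        using mult_le_epsilon_squares[of "\<epsilon> / 2" "C * M" "sqrt (sq1 u)"] \<epsilon> s0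
        by (simp add: power_mult_distrib)
      also have "(C + 1) * Z \<le> (C + 1) * (\<delta> * sq1 u + C' * S)"
      proof (intro mult_left_mono)
        have "(\<integral>x. indicator K x * ?E x \<partial>\<mu>) \<le> sq1 u"
          unfolding sq1_def
        proof (rule integral_mono'[OF integrable_dens[OF u]])
          show "indicator K x * ?E x \<le> dens u x" for x using E0[of x] by (simp add: dens_def indicator_def)
          show "0 \<le> dens u x" for x by (rule dens_nonneg[OF uC])
        qed
        then have "\<delta> * (\<integral>x. indicator K x * ?E x \<partial>\<mu>) \<le> \<delta> * sq1 u" using \<delta>(1) by simp
        then show "Z \<le> \<delta> * sq1 u + C' * S" using R[OF u] by (simp add: Z_def S_def)
      qed (use C in simp)
      also have "(C + 1) * (\<delta> * sq1 u + C' * S) = \<epsilon> / 2 * sq1 u + (C + 1) * C' * S"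
        using \<delta>(2) by (metis distrib_left mult.assoc)
      finally have "(\<integral>x. indicator U x * dens u x \<partial>\<mu>) \<le> \<epsilon> * sq1 u + ((C + 1) * C' * S + C\<^sup>2 / (2 * \<epsilon>) * M\<^sup>2)"
        by simp
      moreover have "0 \<le> (C + 1) * C' * M\<^sup>2" "0 \<le> C\<^sup>2 / (2 * \<epsilon>) * S"
        using C G(3) \<epsilon> S0 by auto
      ultimately show ?thesis unfolding S_def[symmetric] C2_def distrib_left distrib_right by linarith
    qed
    then show "\<exists>G C. finite G \<and> (\<forall>g\<in>G. L2_real g) \<and> 0 \<le> C \<and>
      (\<forall>u\<in>C1c_real. \<forall>M\<ge>0. weak z u M \<longrightarrow> (\<integral>x. indicator U x * dens u x \<partial>\<mu>) \<le>
         \<epsilon> * sq1 u + C * (M\<^sup>2 + (\<Sum>g\<in>G. (\<integral>x. g x * u x \<partial>\<mu>)\<^sup>2)))"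
      using G C2 by (intro exI[of _ G] exI[of _ C2]) blast
  qed
  then show ?thesis using U by blast
qed

lemma controlled_Un:
  assumes "controlled z V" "controlled z W"
  shows "controlled z (V \<union> W)"
  unfolding controlled_def
proof (intro conjI allI impI)
  show "V \<union> W \<in> sets borel" using assms by (auto simp: controlled_def)
  fix \<epsilon> :: real assume "\<epsilon> > 0"
  then have e: "\<epsilon> / 2 > 0" by simp
  obtain G1 C1 where 1: "finite G1" "\<forall>g\<in>G1. L2_real g" "0 \<le> C1"
    "\<forall>u\<in>C1c_real. \<forall>M\<ge>0. weak z u M \<longrightarrow> (\<integral>x. indicator V x * dens u x \<partial>\<mu>) \<le>
       \<epsilon> / 2 * sq1 u + C1 * (M\<^sup>2 + (\<Sum>g\<in>G1. (\<integral>x. g x * u x \<partial>\<mu>)\<^sup>2))"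
    using assms(1)[unfolded controlled_def, THEN conjunct2, rule_format, OF e] by (elim exE conjE) (rule that)
  obtain G2 C2 where 2: "finite G2" "\<forall>g\<in>G2. L2_real g" "0 \<le> C2"
    "\<forall>u\<in>C1c_real. \<forall>M\<ge>0. weak z u M \<longrightarrow> (\<integral>x. indicator W x * dens u x \<partial>\<mu>) \<le>
       \<epsilon> / 2 * sq1 u + C2 * (M\<^sup>2 + (\<Sum>g\<in>G2. (\<integral>x. g x * u x \<partial>\<mu>)\<^sup>2))"
    using assms(2)[unfolded controlled_def, THEN conjunct2, rule_format, OF e] by (elim exE conjE) (rule that)
  have "(\<integral>x. indicator (V \<union> W) x * dens u x \<partial>\<mu>) \<le>
       \<epsilon> * sq1 u + (C1 + C2) * (M\<^sup>2 + (\<Sum>g\<in>G1 \<union> G2. (\<integral>x. g x * u x \<partial>\<mu>)\<^sup>2))"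
    if u: "u \<in> C1c_real" and M: "M \<ge> 0" and w: "weak z u M" for u M
  proof -
    define f where "f g = (\<integral>x. g x * u x \<partial>\<mu>)\<^sup>2" for g :: "'a \<Rightarrow> real"
    have int: "integrable \<mu> (\<lambda>x. indicator V x * dens u x)" "integrable \<mu> (\<lambda>x. indicator W x * dens u x)"
      using assms by (auto simp: controlled_def intro!: local_integrable integrable_dens u)
    have "(\<integral>x. indicator (V \<union> W) x * dens u x \<partial>\<mu>) \<le> (\<integral>x. indicator V x * dens u x + indicator W x * dens u x \<partial>\<mu>)"
    proof (rule integral_mono')
      show "indicator (V \<union> W) x * dens u x \<le> indicator V x * dens u x + indicator W x * dens u x" for x
        using dens_nonneg[OF C1c_realD[OF u], of x] by (auto simp: indicator_def)
      show "0 \<le> indicator V x * dens u x + indicator W x * dens u x" for x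
        using dens_nonneg[OF C1c_realD[OF u], of x] by simp
    qed (rule Bochner_Integration.integrable_add[OF int])
    also have "\<dots> = (\<integral>x. indicator V x * dens u x \<partial>\<mu>) + (\<integral>x. indicator W x * dens u x \<partial>\<mu>)"
      using int by simp
    also have "\<dots> \<le> \<epsilon> * sq1 u + (C1 * (M\<^sup>2 + sum f G1) + C2 * (M\<^sup>2 + sum f G2))"
      using 1(4)[rule_format, OF u M w] 2(4)[rule_format, OF u M w] by (simp add: f_def)
    also have "C1 * (M\<^sup>2 + sum f G1) \<le> C1 * (M\<^sup>2 + sum f (G1 \<union> G2))"
      using 1 2 by (intro mult_left_mono add_left_mono sum_mono2) (auto simp: f_def)
    also have "C2 * (M\<^sup>2 + sum f G2) \<le> C2 * (M\<^sup>2 + sum f (G1 \<union> G2))"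
      using 1 2 by (intro mult_left_mono add_left_mono sum_mono2) (auto simp: f_def)
    finally show ?thesis by (simp add: f_def distrib_right)
  qed
  then show "\<exists>G C. finite G \<and> (\<forall>g\<in>G. L2_real g) \<and> 0 \<le> C \<and>
      (\<forall>u\<in>C1c_real. \<forall>M\<ge>0. weak z u M \<longrightarrow> (\<integral>x. indicator (V \<union> W) x * dens u x \<partial>\<mu>) \<le>
         \<epsilon> * sq1 u + C * (M\<^sup>2 + (\<Sum>g\<in>G. (\<integral>x. g x * u x \<partial>\<mu>)\<^sup>2)))"
    using 1(1-3) 2(1-3) by (intro exI[of _ "G1 \<union> G2"] exI[of _ "C1 + C2"]) auto
qed

lemma controlled_empty: "controlled z {}"
  unfolding controlled_def
proof (intro conjI allI impI)
  fix \<epsilon> :: real assume "\<epsilon> > 0"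
  then show "\<exists>G C. finite G \<and> (\<forall>g\<in>G. L2_real g) \<and> 0 \<le> C \<and>
      (\<forall>u\<in>C1c_real. \<forall>M\<ge>0. weak z u M \<longrightarrow> (\<integral>x. indicator {} x * dens u x \<partial>\<mu>) \<le>
         \<epsilon> * sq1 u + C * (M\<^sup>2 + (\<Sum>g\<in>G. (\<integral>x. g x * u x \<partial>\<mu>)\<^sup>2)))"
    using sq1_nonneg by (intro exI[of _ "{}"] exI[of _ 0]) auto
qed simp

lemma controlled_subset:
  assumes V: "controlled z V" and W: "W \<in> sets borel" "W \<subseteq> V"
  shows "controlled z W"
  unfolding controlled_def
proof (intro conjI allI impI W(1))
  fix \<epsilon> :: real assume "\<epsilon> > 0"
  from V[unfolded controlled_def, THEN conjunct2, rule_format, OF this]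
  obtain G C where G: "finite G" "\<forall>g\<in>G. L2_real g" "0 \<le> C"
    "\<forall>u\<in>C1c_real. \<forall>M\<ge>0. weak z u M \<longrightarrow> (\<integral>x. indicator V x * dens u x \<partial>\<mu>) \<le>
       \<epsilon> * sq1 u + C * (M\<^sup>2 + (\<Sum>g\<in>G. (\<integral>x. g x * u x \<partial>\<mu>)\<^sup>2))"
    by (elim exE conjE) (rule that)
  have "(\<integral>x. indicator W x * dens u x \<partial>\<mu>) \<le> (\<integral>x. indicator V x * dens u x \<partial>\<mu>)" if u: "u \<in> C1c_real" for u
  proof (rule integral_mono')
    show "integrable \<mu> (\<lambda>x. indicator V x * dens u x)"
      using V by (auto simp: controlled_def intro!: local_integrable integrable_dens u)
    show "indicator W x * dens u x \<le> indicator V x * dens u x" "0 \<le> indicator V x * dens u x" for x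
      using dens_nonneg[OF C1c_realD[OF u], of x] W(2) by (auto simp: indicator_def)
  qed
  then show "\<exists>G C. finite G \<and> (\<forall>g\<in>G. L2_real g) \<and> 0 \<le> C \<and>
      (\<forall>u\<in>C1c_real. \<forall>M\<ge>0. weak z u M \<longrightarrow> (\<integral>x. indicator W x * dens u x \<partial>\<mu>) \<le>
         \<epsilon> * sq1 u + C * (M\<^sup>2 + (\<Sum>g\<in>G. (\<integral>x. g x * u x \<partial>\<mu>)\<^sup>2)))"
    using G(1-3) order_trans[OF _ G(4)[rule_format]] by (intro exI[of _ G] exI[of _ C] conjI ballI allI impI) auto
qed

lemma controlled_compact:
  assumes "compact K"
  shows "controlled z K"
proof -
  obtain U where U: "\<And>x. open (U x)" "\<And>x. x \<in> U x" "\<And>x. controlled z (U x)"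
    using controlled_near[of _ z] by metis
  obtain P where P: "finite P" "K \<subseteq> (\<Union>x\<in>P. U x)"
    using compactE_image[OF assms, of UNIV U] U(1,2) by (metis UNIV_I UN_I subsetI)
  have "controlled z (\<Union>x\<in>P. U x)"
    using P(1) by (induction rule: finite_induct) (simp_all add: controlled_empty controlled_Un U(3))
  then show ?thesis
    by (rule controlled_subset[OF _ _ P(2)]) (use assms in \<open>simp add: borel_closed compact_imp_closed\<close>)
qed

end

section \<open>Comparison of strongly equivalent structures\<close>

text \<open>A union of two compact sets is compact, so the complements of compact sets form a filter
  base.\<close>

lemma eventually_cocompact:
  "eventually P cocompact \<longleftrightarrow> (\<exists>K. compact K \<and> (\<forall>x. x \<notin> K \<longrightarrow> P x))"
proof -
  have "eventually P cocompact \<longleftrightarrow> (\<exists>K\<in>{K. compact K}. eventually P (principal (- K)))"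
    unfolding cocompact_def
  proof (rule eventually_INF_base)
    show "{K :: 'a set. compact K} \<noteq> {}" by (auto intro: exI[of _ "{}"])
    fix K L :: "'a set" assume "K \<in> {K. compact K}" "L \<in> {K. compact K}"
    then show "\<exists>M\<in>{K. compact K}. principal (- M) \<le> inf (principal (- K)) (principal (- L))"
      by (intro bexI[of _ "K \<union> L"]) (auto intro: compact_Un)
  qed
  then show ?thesis by (auto simp: eventually_principal)
qed

lemma Cauchy_Schwarz_integral:
  fixes f g :: "'a \<Rightarrow> real"
  assumes f: "integrable M (\<lambda>x. (f x)\<^sup>2)" and g: "integrable M (\<lambda>x. (g x)\<^sup>2)" and fg: "integrable M (\<lambda>x. f x * g x)"
  shows "(\<integral>x. f x * g x \<partial>M) \<le> sqrt (\<integral>x. (f x)\<^sup>2 \<partial>M) * sqrt (\<integral>x. (g x)\<^sup>2 \<partial>M)"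
proof -
  define a b c where "a = (\<integral>x. (f x)\<^sup>2 \<partial>M)" and "b = (\<integral>x. f x * g x \<partial>M)" and "c = (\<integral>x. (g x)\<^sup>2 \<partial>M)"
  have ac: "0 \<le> a" "0 \<le> c" unfolding a_def c_def by (auto intro!: integral_nonneg_AE)
  have "b\<^sup>2 \<le> a * c"
  proof (rule quadratic_nonneg_imp_le)
    fix s :: real
    have "0 \<le> (\<integral>x. (f x - (s * b) * g x)\<^sup>2 \<partial>M)" by (intro integral_nonneg_AE) auto
    also have "(\<integral>x. (f x - (s * b) * g x)\<^sup>2 \<partial>M) = (\<integral>x. (f x)\<^sup>2 - (2 * s * b) * (f x * g x) + (s * b)\<^sup>2 * (g x)\<^sup>2 \<partial>M)"
      by (intro Bochner_Integration.integral_cong) (auto simp: power2_diff power_mult_distrib algebra_simps)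
    also have "\<dots> = a - (2 * s * b) * b + (s * b)\<^sup>2 * c"
      using f g fg by (simp add: a_def b_def c_def)
    finally show "0 \<le> a - 2 * s * b\<^sup>2 + s\<^sup>2 * b\<^sup>2 * c"
      by (simp add: power2_eq_square power_mult_distrib mult_ac)
  qed (use ac in auto)
  then have "b\<^sup>2 \<le> (sqrt a * sqrt c)\<^sup>2" using ac by (simp add: power_mult_distrib)
  then have "\<bar>b\<bar> \<le> \<bar>sqrt a * sqrt c\<bar>" by (simp only: abs_le_square_iff)
  then show ?thesis using ac by (simp add: a_def b_def c_def abs_mult)
qed

context RM_manifold
begin

text \<open>The criterion that is compared between the two structures; for real \<open>z\<close> it
  characterises the Fredholm property (\<open>Fredholm_Laplacian_iff\<close>).\<close>

definition estimate_real :: "real \<Rightarrow> bool" where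
  "estimate_real z \<longleftrightarrow> (\<exists>C G. 0 \<le> C \<and> finite G \<and> (\<forall>g\<in>G. L2_real g) \<and>
    (\<forall>u\<in>C1c_real. \<forall>M\<ge>0. weak z u M \<longrightarrow> sqrt (sq1 u) \<le> C * (M + (\<Sum>g\<in>G. \<bar>\<integral>x. g x * u x \<partial>\<mu>\<bar>))))"

end

text \<open>The factor accounts for coincidences: \<open>h\<close> may map several elements of
  \<open>G\<close> to the same function.\<close>

lemma sum_image_Un_le:
  fixes f :: "'b \<Rightarrow> real"
  assumes "finite G" "finite G'" "\<And>g. 0 \<le> f g"
  shows "(\<Sum>g\<in>G. f (h g)) \<le> real (card G) * (\<Sum>g\<in>h ` G \<union> G'. f g)"
proof -
  have "(\<Sum>g\<in>G. f (h g)) \<le> (\<Sum>g\<in>G. \<Sum>g\<in>h ` G \<union> G'. f g)"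
    using assms by (intro sum_mono member_le_sum) auto
  then show ?thesis by simp
qed

lemma sum_squares_le_square_sum:
  fixes f :: "'b \<Rightarrow> real"
  assumes "finite G"
  shows "(\<Sum>g\<in>G. (f g)\<^sup>2) \<le> (\<Sum>g\<in>G. \<bar>f g\<bar>)\<^sup>2"
  using assms
proof (induction rule: finite_induct)
  case (insert g G)
  have "0 \<le> \<bar>f g\<bar> * (\<Sum>g\<in>G. \<bar>f g\<bar>)" by (intro mult_nonneg_nonneg sum_nonneg) auto
  moreover have "(\<Sum>g\<in>insert g G. \<bar>f g\<bar>)\<^sup>2 = (f g)\<^sup>2 + (\<Sum>g\<in>G. \<bar>f g\<bar>)\<^sup>2 + 2 * (\<bar>f g\<bar> * (\<Sum>g\<in>G. \<bar>f g\<bar>))"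
    using insert(1,2) by (simp add: power2_sum)
  moreover have "(\<Sum>g\<in>insert g G. (f g)\<^sup>2) = (f g)\<^sup>2 + (\<Sum>g\<in>G. (f g)\<^sup>2)" using insert(1,2) by simp
  ultimately show ?case using insert.IH by linarith
qed simp

text \<open>All three comparison functions are bounded above by \<open>B\<close> and below by
  \<open>k\<close>, which makes the hypotheses stable under exchanging the two structures.\<close>

locale RM_pair = M: RM_manifold A N \<mu> + M': RM_manifold A N' \<mu>'
  for A :: "('a::{t2_space,second_countable_topology}, 'e::euclidean_space) chart set"
    and N N' :: "('a, 'e) conorm" and \<mu> \<mu>' :: "'a measure" +
  fixes \<alpha> \<beta> \<kappa> :: "'a \<Rightarrow> real" and k B :: real
  assumes meas: "\<kappa> \<in> borel_measurable borel"
    and upper: "\<And>x. \<alpha> x \<le> B" "\<And>x. \<beta> x \<le> B" "\<And>x. \<kappa> x \<le> B"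
    and k: "0 < k" "\<And>x. k \<le> \<alpha> x" "\<And>x. k \<le> \<beta> x" "\<And>x. k \<le> \<kappa> x"
    and N_le: "\<And>x \<xi>. \<xi> \<in> cotangent A x \<Longrightarrow> \<alpha> x * N x \<xi> \<le> N' x \<xi>"
      "\<And>x \<xi>. \<xi> \<in> cotangent A x \<Longrightarrow> N' x \<xi> \<le> \<beta> x * N x \<xi>"
    and density: "\<mu>' = density \<mu> (\<lambda>x. ennreal (\<kappa> x))"
    and lims: "(\<alpha> \<longlongrightarrow> 1) cocompact" "(\<beta> \<longlongrightarrow> 1) cocompact" "(\<kappa> \<longlongrightarrow> 1) cocompact"
begin

section \<open>Comparison of norms, measures and forms\<close>

lemma kappa_pos: "0 < \<kappa> x" "0 \<le> \<kappa> x"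
  using k(1) k(4)[of x] by auto

lemma integral_mu': "f \<in> borel_measurable borel \<Longrightarrow> (\<integral>x. f x \<partial>\<mu>') = (\<integral>x. \<kappa> x * f x \<partial>\<mu>)" for f :: "'a \<Rightarrow> real"
  unfolding density using meas kappa_pos(2)
  by (subst integral_density) (auto intro: M.measurable_mu)

lemma integrable_mu': "f \<in> borel_measurable borel \<Longrightarrow> integrable \<mu>' f \<longleftrightarrow> integrable \<mu> (\<lambda>x. \<kappa> x * f x)" for f :: "'a \<Rightarrow> real"
  unfolding density using meas kappa_pos(2)
  by (subst integrable_density) (auto intro: M.measurable_mu)

lemma differential_in_cotangent: "u \<in> M.C1c_real \<Longrightarrow> differential A u x \<in> cotangent A x"
  by (rule M.differential_cotangent[OF M.C1c_realD])

lemma B_pos: "0 < B" "k \<le> B"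
  using k(1) k(2)[of undefined] upper(1)[of undefined] by linarith+

lemma N'_sq:
  assumes "\<xi> \<in> cotangent A x"
  shows "(\<alpha> x)\<^sup>2 * (N x \<xi>)\<^sup>2 \<le> (N' x \<xi>)\<^sup>2" "(N' x \<xi>)\<^sup>2 \<le> (\<beta> x)\<^sup>2 * (N x \<xi>)\<^sup>2"
proof -
  have "0 \<le> \<alpha> x" using k(1) k(2)[of x] by simp
  then have "(\<alpha> x * N x \<xi>)\<^sup>2 \<le> (N' x \<xi>)\<^sup>2"
    using N_le(1)[OF assms] M.N_nonneg[OF assms] by (intro power_mono) auto
  then show "(\<alpha> x)\<^sup>2 * (N x \<xi>)\<^sup>2 \<le> (N' x \<xi>)\<^sup>2" by (simp add: power_mult_distrib)
  have "(N' x \<xi>)\<^sup>2 \<le> (\<beta> x * N x \<xi>)\<^sup>2"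
    using N_le(2)[OF assms] M'.N_nonneg[OF assms] by (intro power_mono) auto
  then show "(N' x \<xi>)\<^sup>2 \<le> (\<beta> x)\<^sup>2 * (N x \<xi>)\<^sup>2" by (simp add: power_mult_distrib)
qed

text \<open>With \<open>K1\<close>, the factors between the densities of the two squared norms, both
  taken relative to \<open>\<mu>\<close>: the measure contributes \<open>k\<close> or
  \<open>B\<close>, the scalar product the square of it.\<close>

definition k1 :: real where "k1 = k * min 1 (k\<^sup>2)"
definition K1 :: real where "K1 = B * max 1 (B\<^sup>2)"

lemma k1_pos: "0 < k1" and K1_pos: "0 < K1"
  using k(1) B_pos by (auto simp: k1_def K1_def less_max_iff_disj)

lemma dens_compare:
  assumes u: "u \<in> M.C1c_real"
  shows "k1 * M.dens u x \<le> \<kappa> x * M'.dens u x" "\<kappa> x * M'.dens u x \<le> K1 * M.dens u x"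
proof -
  note uC = M.C1c_realD[OF u]
  have d: "M.dens u x = (u x)\<^sup>2 + (N x (differential A u x))\<^sup>2" "M'.dens u x = (u x)\<^sup>2 + (N' x (differential A u x))\<^sup>2"
    using M.dens_eq[OF uC] M'.dens_eq[OF uC] by auto
  define n where "n = (N x (differential A u x))\<^sup>2"
  define n' where "n' = (N' x (differential A u x))\<^sup>2"
  have n0: "0 \<le> n" by (simp add: n_def)
  have "k\<^sup>2 * n \<le> (\<alpha> x)\<^sup>2 * n" using k(1) k(2)[of x] n0 by (intro mult_right_mono power_mono) auto
  then have l: "k\<^sup>2 * n \<le> n'" using N'_sq(1)[OF differential_in_cotangent[OF u], of x] by (simp add: n_def n'_def)
  have "(\<beta> x)\<^sup>2 * n \<le> B\<^sup>2 * n" using k(1) k(3)[of x] upper(2)[of x] n0 by (intro mult_right_mono power_mono) auto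
  then have r: "n' \<le> B\<^sup>2 * n" using N'_sq(2)[OF differential_in_cotangent[OF u], of x] by (simp add: n_def n'_def)
  have "min 1 (k\<^sup>2) * ((u x)\<^sup>2 + n) \<le> (u x)\<^sup>2 + n'"
  proof -
    have "min 1 (k\<^sup>2) * (u x)\<^sup>2 \<le> 1 * (u x)\<^sup>2" "min 1 (k\<^sup>2) * n \<le> k\<^sup>2 * n"
      using n0 by (intro mult_right_mono; simp)+
    then show ?thesis using l by (simp add: distrib_left)
  qed
  then have "k * (min 1 (k\<^sup>2) * ((u x)\<^sup>2 + n)) \<le> \<kappa> x * ((u x)\<^sup>2 + n')"
    using k(1) k(4)[of x] n0 by (intro mult_mono) (auto simp: kappa_pos)
  then show "k1 * M.dens u x \<le> \<kappa> x * M'.dens u x" by (simp add: d k1_def n_def n'_def mult.assoc)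
  have "(u x)\<^sup>2 + n' \<le> max 1 (B\<^sup>2) * ((u x)\<^sup>2 + n)"
  proof -
    have "1 * (u x)\<^sup>2 \<le> max 1 (B\<^sup>2) * (u x)\<^sup>2" "B\<^sup>2 * n \<le> max 1 (B\<^sup>2) * n"
      using n0 by (intro mult_right_mono; simp)+
    then show ?thesis using r by (simp add: distrib_left)
  qed
  then have "\<kappa> x * ((u x)\<^sup>2 + n') \<le> B * (max 1 (B\<^sup>2) * ((u x)\<^sup>2 + n))"
    using upper(3)[of x] B_pos by (intro mult_mono) (auto simp: n'_def)
  then show "\<kappa> x * M'.dens u x \<le> K1 * M.dens u x" by (simp add: d K1_def n_def n'_def mult.assoc)
qed

lemma dens_measurable: "u \<in> M.C1c_real \<Longrightarrow> M'.dens u \<in> borel_measurable borel"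
  using M'.measurable_energy[of u u] M.C1_real_measurable[of u] M.C1c_realD[of u]
  unfolding M'.dens_def[abs_def] by simp

lemma sq1_upper: "u \<in> M.C1c_real \<Longrightarrow> M'.sq1 u \<le> K1 * M.sq1 u"
proof -
  assume u: "u \<in> M.C1c_real"
  have "M'.sq1 u = (\<integral>x. \<kappa> x * M'.dens u x \<partial>\<mu>)"
    unfolding M'.sq1_def by (rule integral_mu'[OF dens_measurable[OF u]])
  also have "\<dots> \<le> (\<integral>x. K1 * M.dens u x \<partial>\<mu>)"
    using integrable_mu'[OF dens_measurable[OF u]] M'.integrable_dens[OF u]
    by (intro integral_mono dens_compare(2) u integrable_mult_right M.integrable_dens) auto
  also have "\<dots> = K1 * M.sq1 u" by (simp add: M.sq1_def)
  finally show ?thesis .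
qed

lemma local_lower:
  assumes u: "u \<in> M.C1c_real" and V: "V \<in> sets borel"
  shows "k1 * (\<integral>x. indicator V x * M.dens u x \<partial>\<mu>) \<le> (\<integral>x. indicator V x * M'.dens u x \<partial>\<mu>')"
proof -
  have m: "(\<lambda>x. indicator V x * M'.dens u x) \<in> borel_measurable borel"
    using V dens_measurable[OF u] by measurable
  have "integrable \<mu>' (\<lambda>x. indicator V x * M'.dens u x)"
    by (rule M'.local_integrable[OF V M'.integrable_dens[OF u]])
  then have int: "integrable \<mu> (\<lambda>x. \<kappa> x * (indicator V x * M'.dens u x))"
    using integrable_mu'[OF m] by simp
  have "k1 * (\<integral>x. indicator V x * M.dens u x \<partial>\<mu>) = (\<integral>x. k1 * (indicator V x * M.dens u x) \<partial>\<mu>)" by simp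
  also have "\<dots> \<le> (\<integral>x. \<kappa> x * (indicator V x * M'.dens u x) \<partial>\<mu>)"
    using dens_compare(1)[OF u]
    by (intro integral_mono int integrable_mult_right M.local_integrable V M.integrable_dens u) (auto simp: indicator_def)
  also have "\<dots> = (\<integral>x. indicator V x * M'.dens u x \<partial>\<mu>')" by (rule integral_mu'[OF m, symmetric])
  finally show ?thesis .
qed

text \<open>Relative to \<open>\<mu>\<close>, the second energy is the first one times a factor
  between \<open>\<kappa> x * (\<alpha> x)\<^sup>2\<close> and
  \<open>\<kappa> x * (\<beta> x)\<^sup>2\<close>, and the second mass term has the factor
  \<open>\<kappa> x\<close>. The summands measure the distance of these factors from 1 and tend to 0
  at infinity.\<close>

definition theta :: "real \<Rightarrow> 'a \<Rightarrow> real" where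
  "theta z x = \<bar>\<kappa> x * (\<alpha> x)\<^sup>2 - 1\<bar> + \<bar>\<kappa> x * (\<beta> x)\<^sup>2 - 1\<bar> + \<bar>z\<bar> * \<bar>\<kappa> x - 1\<bar>"

lemma theta_nonneg: "0 \<le> theta z x" by (simp add: theta_def)

lemma theta_bounded: "theta z x \<le> 2 * (B * B\<^sup>2 + 1) + \<bar>z\<bar> * (B + 1)"
proof -
  have a: "\<kappa> x * (\<alpha> x)\<^sup>2 \<le> B * B\<^sup>2" "\<kappa> x * (\<beta> x)\<^sup>2 \<le> B * B\<^sup>2"
    using upper[of x] k(1) k(2)[of x] k(3)[of x] B_pos by (intro mult_mono power_mono; simp)+
  have b: "0 \<le> \<kappa> x * (\<alpha> x)\<^sup>2" "0 \<le> \<kappa> x * (\<beta> x)\<^sup>2" using kappa_pos(2)[of x] by auto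
  have c: "\<bar>z\<bar> * \<bar>\<kappa> x - 1\<bar> \<le> \<bar>z\<bar> * (B + 1)"
    using upper(3)[of x] kappa_pos(2)[of x] by (intro mult_left_mono) auto
  have d: "\<bar>\<kappa> x * (\<alpha> x)\<^sup>2 - 1\<bar> \<le> B * B\<^sup>2 + 1" using a(1) b(1) by linarith
  have e: "\<bar>\<kappa> x * (\<beta> x)\<^sup>2 - 1\<bar> \<le> B * B\<^sup>2 + 1" using a(2) b(2) by linarith
  show ?thesis using add_mono[OF add_mono[OF d e] c] by (simp add: theta_def)
qed

lemma theta_small:
  assumes "\<delta> > 0"
  obtains K where "compact K" "\<And>x. x \<notin> K \<Longrightarrow> theta z x \<le> \<delta>"
proof -
  have "((\<lambda>x. theta z x) \<longlongrightarrow> \<bar>1 * 1\<^sup>2 - 1\<bar> + \<bar>1 * 1\<^sup>2 - 1\<bar> + \<bar>z\<bar> * \<bar>1 - 1\<bar>) cocompact"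
    unfolding theta_def by (intro tendsto_intros lims)
  then have "eventually (\<lambda>x. theta z x < \<delta>) cocompact"
    using assms by (intro order_tendstoD(2)) auto
  then obtain K where "compact K" "\<forall>x. x \<notin> K \<longrightarrow> theta z x < \<delta>"
    unfolding eventually_cocompact by blast
  then show ?thesis using that[of K] less_imp_le by blast
qed

text \<open>The difference \<open>D\<close> is a symmetric bilinear form, in general of no definite
  sign, whose quadratic form is bounded by \<open>t\<close> times the squared norm. Polarisation and
  the parallelogram identity bound \<open>D\<close> by a sum of squares; rescaling both covectors to
  equal norm turns the sum into the product.\<close>

lemma form_difference_pointwise:
  assumes \<xi>: "\<xi> \<in> cotangent A x" and \<eta>: "\<eta> \<in> cotangent A x"
  shows "\<bar>\<kappa> x * M'.I x \<xi> \<eta> - M.I x \<xi> \<eta>\<bar> \<le> (\<bar>\<kappa> x * (\<alpha> x)\<^sup>2 - 1\<bar> + \<bar>\<kappa> x * (\<beta> x)\<^sup>2 - 1\<bar>) * (N x \<xi> * N x \<eta>)"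
proof -
  define t where "t = \<bar>\<kappa> x * (\<alpha> x)\<^sup>2 - 1\<bar> + \<bar>\<kappa> x * (\<beta> x)\<^sup>2 - 1\<bar>"
  define D where "D \<zeta> \<zeta>' = \<kappa> x * M'.I x \<zeta> \<zeta>' - M.I x \<zeta> \<zeta>'" for \<zeta> \<zeta>'
  have diag: "\<bar>D \<zeta> \<zeta>\<bar> \<le> t * (N x \<zeta>)\<^sup>2" if \<zeta>: "\<zeta> \<in> cotangent A x" for \<zeta>
  proof -
    define n where "n = (N x \<zeta>)\<^sup>2"
    have n0: "0 \<le> n" by (simp add: n_def)
    have "\<kappa> x * ((\<alpha> x)\<^sup>2 * n) \<le> \<kappa> x * (N' x \<zeta>)\<^sup>2" "\<kappa> x * (N' x \<zeta>)\<^sup>2 \<le> \<kappa> x * ((\<beta> x)\<^sup>2 * n)"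
      using N'_sq[OF \<zeta>] kappa_pos(2)[of x] by (auto intro!: mult_left_mono simp: n_def)
    then have "(\<kappa> x * (\<alpha> x)\<^sup>2 - 1) * n \<le> D \<zeta> \<zeta>" "D \<zeta> \<zeta> \<le> (\<kappa> x * (\<beta> x)\<^sup>2 - 1) * n"
      using M.I_self[OF \<zeta>] M'.I_self[OF \<zeta>] by (simp_all add: D_def n_def algebra_simps)
    moreover have "- (t * n) \<le> (\<kappa> x * (\<alpha> x)\<^sup>2 - 1) * n"
    proof -
      have "- t \<le> \<kappa> x * (\<alpha> x)\<^sup>2 - 1" unfolding t_def by linarith
      from mult_right_mono[OF this n0] show ?thesis by simp
    qed
    moreover have "(\<kappa> x * (\<beta> x)\<^sup>2 - 1) * n \<le> t * n"
      using n0 by (intro mult_right_mono) (auto simp: t_def)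
    ultimately show ?thesis by (auto simp: n_def abs_le_iff)
  qed
  have t0: "t \<ge> 0" by (simp add: t_def)
  have gen: "\<bar>2 * D \<zeta> \<zeta>'\<bar> \<le> t * ((N x \<zeta>)\<^sup>2 + (N x \<zeta>')\<^sup>2)" if \<zeta>: "\<zeta> \<in> cotangent A x" "\<zeta>' \<in> cotangent A x" for \<zeta> \<zeta>'
  proof -
    define m where "m = cov_scale (- 1) \<zeta>'"
    have m: "m \<in> cotangent A x" using \<zeta> by (simp add: m_def M.cotangent_scale)
    have s: "cov_add \<zeta> \<zeta>' \<in> cotangent A x" "cov_add \<zeta> m \<in> cotangent A x" using \<zeta> m by (auto intro: M.cotangent_add)
    have e1: "D (cov_add \<zeta> \<zeta>') (cov_add \<zeta> \<zeta>') - D (cov_add \<zeta> m) (cov_add \<zeta> m) = 4 * D \<zeta> \<zeta>'"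
      using \<zeta> m s unfolding D_def m_def
      by (simp add: M.I_add_left M.I_add_right M'.I_add_left M'.I_add_right M.I_scale_left M.I_scale_right
          M'.I_scale_left M'.I_scale_right M.cotangent_scale M.I_sym[of \<zeta>' x \<zeta>] M'.I_sym[of \<zeta>' x \<zeta>] algebra_simps)
    have e2: "(N x (cov_add \<zeta> \<zeta>'))\<^sup>2 + (N x (cov_add \<zeta> m))\<^sup>2 = 2 * ((N x \<zeta>)\<^sup>2 + (N x \<zeta>')\<^sup>2)"
      using \<zeta> m s unfolding M.I_self[OF s(1), symmetric] M.I_self[OF s(2), symmetric] M.I_self[OF \<zeta>(1), symmetric]
        M.I_self[OF \<zeta>(2), symmetric] unfolding m_def
      by (simp add: M.I_add_left M.I_add_right M.I_scale_left M.I_scale_right M.cotangent_scale M.I_sym[of \<zeta>' x \<zeta>])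
    have "\<bar>4 * D \<zeta> \<zeta>'\<bar> \<le> \<bar>D (cov_add \<zeta> \<zeta>') (cov_add \<zeta> \<zeta>')\<bar> + \<bar>D (cov_add \<zeta> m) (cov_add \<zeta> m)\<bar>"
      unfolding e1[symmetric] by (rule abs_triangle_ineq4)
    also have "\<dots> \<le> t * ((N x (cov_add \<zeta> \<zeta>'))\<^sup>2 + (N x (cov_add \<zeta> m))\<^sup>2)"
      using diag[OF s(1)] diag[OF s(2)] by (simp add: distrib_left)
    finally have le: "\<bar>4 * D \<zeta> \<zeta>'\<bar> \<le> t * (2 * ((N x \<zeta>)\<^sup>2 + (N x \<zeta>')\<^sup>2))" unfolding e2 .
    define S where "S = t * ((N x \<zeta>)\<^sup>2 + (N x \<zeta>')\<^sup>2)"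
    have "t * (2 * ((N x \<zeta>)\<^sup>2 + (N x \<zeta>')\<^sup>2)) = 2 * S" by (simp add: S_def)
    with le have "\<bar>2 * D \<zeta> \<zeta>'\<bar> \<le> S" by linarith
    then show ?thesis by (simp add: S_def)
  qed
  have "\<bar>D \<xi> \<eta>\<bar> \<le> t * (N x \<xi> * N x \<eta>)"
  proof (cases "N x \<xi> = 0 \<or> N x \<eta> = 0")
    case True
    then have "\<xi> = cov_zero \<or> \<eta> = cov_zero" using M.N_pos[OF \<xi>] M.N_pos[OF \<eta>] by fastforce
    then have "D \<xi> \<eta> = 0"
      using \<xi> \<eta> by (auto simp: D_def M.I_zero_left M.I_zero_right M'.I_zero_left M'.I_zero_right)
    then show ?thesis using t0 M.N_nonneg[OF \<xi>] M.N_nonneg[OF \<eta>] by simp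
  next
    case False
    then have p: "0 < N x \<xi>" "0 < N x \<eta>" using M.N_nonneg[OF \<xi>] M.N_nonneg[OF \<eta>] by auto
    define c where "c = N x \<eta>"
    define d where "d = N x \<xi>"
    have s: "cov_scale c \<xi> \<in> cotangent A x" "cov_scale d \<eta> \<in> cotangent A x" using \<xi> \<eta> by (auto intro: M.cotangent_scale)
    have "D (cov_scale c \<xi>) (cov_scale d \<eta>) = c * d * D \<xi> \<eta>"
      using \<xi> \<eta> s by (simp add: D_def M.I_scale_left M.I_scale_right M'.I_scale_left M'.I_scale_right algebra_simps)
    moreover have "N x (cov_scale c \<xi>) = c * d" "N x (cov_scale d \<eta>) = c * d"
      using M.N_scale[OF \<xi>, of c] M.N_scale[OF \<eta>, of d] p by (simp_all add: c_def d_def)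
    ultimately have "\<bar>2 * (c * d * D \<xi> \<eta>)\<bar> \<le> t * ((c * d)\<^sup>2 + (c * d)\<^sup>2)"
      using gen[OF s] by simp
    then have "(c * d) * \<bar>D \<xi> \<eta>\<bar> \<le> (c * d) * (t * (c * d))"
      using p by (simp add: abs_mult c_def d_def power2_eq_square algebra_simps)
    then show ?thesis using p by (simp add: c_def d_def mult.commute)
  qed
  then show ?thesis by (simp add: D_def t_def)
qed

lemma two_dim_Cauchy_Schwarz:
  fixes a b c d :: real
  shows "a * b + c * d \<le> sqrt (c\<^sup>2 + a\<^sup>2) * sqrt (d\<^sup>2 + b\<^sup>2)"
proof -
  have "0 \<le> (a * d - c * b)\<^sup>2" by simp
  then have "(a * b + c * d)\<^sup>2 \<le> (c\<^sup>2 + a\<^sup>2) * (d\<^sup>2 + b\<^sup>2)"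
    by (simp add: power2_eq_square algebra_simps)
  then have "\<bar>a * b + c * d\<bar> \<le> sqrt ((c\<^sup>2 + a\<^sup>2) * (d\<^sup>2 + b\<^sup>2))"
    using real_sqrt_le_mono[of "(a * b + c * d)\<^sup>2"] by simp
  then show ?thesis by (simp add: real_sqrt_mult)
qed

text \<open>The deviation is at most \<open>\<delta>\<close> outside \<open>K\<close> and merely
  bounded by \<open>T\<close> on it. Localising the factor of \<open>u\<close> alone leaves the full
  norm of \<open>v\<close>, as a bound on the dual norm requires.\<close>

lemma form_difference:
  assumes u: "u \<in> M.C1c_real" and v: "v \<in> M.C1c_real"
    and K: "K \<in> sets borel" "\<And>x. x \<notin> K \<Longrightarrow> theta z x \<le> \<delta>" and \<delta>: "\<delta> \<ge> 0"
    and T: "\<And>x. theta z x \<le> T"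
  shows "\<bar>M'.form z u v - M.form z u v\<bar> \<le>
    (\<delta> * sqrt (M.sq1 u) + T * sqrt (\<integral>x. indicator K x * M.dens u x \<partial>\<mu>)) * sqrt (M.sq1 v)"
proof -
  note uC = M.C1c_realD[OF u] and vC = M.C1c_realD[OF v]
  let ?du = "differential A u" and ?dv = "differential A v"
  define e where "e w x = sqrt (M.dens w x)" for w x
  have e2: "(e w x)\<^sup>2 = M.dens w x" if "w \<in> M.C1c_real" for w x
    using M.dens_nonneg[OF M.C1c_realD[OF that], of x] by (simp add: e_def)
  have e0: "0 \<le> e w x" if "w \<in> M.C1c_real" for w x
    using M.dens_nonneg[OF M.C1c_realD[OF that], of x] by (simp add: e_def)
  have em: "e w \<in> borel_measurable borel" if "w \<in> M.C1c_real" for w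
    using M.measurable_energy[of w w] M.C1_real_measurable[of w] M.C1c_realD[OF that]
    unfolding e_def[abs_def] M.dens_def[abs_def] by simp
  have T0: "0 \<le> T" using T[of undefined] theta_nonneg[of z undefined] by simp
  have Im': "(\<lambda>x. M'.I x (?du x) (?dv x)) \<in> borel_measurable borel" by (rule M'.measurable_energy[OF uC vC])
  have uvm: "(\<lambda>x. u x * v x) \<in> borel_measurable borel"
    using M.C1_real_measurable[OF uC] M.C1_real_measurable[OF vC] by simp
  have i1: "integrable \<mu> (\<lambda>x. \<kappa> x * M'.I x (?du x) (?dv x))"
    using integrable_mu'[OF Im'] M'.integrable_energy[OF u v] by simp
  have i2: "integrable \<mu> (\<lambda>x. \<kappa> x * (u x * v x))"
    using integrable_mu'[OF uvm] M'.integrable_product[OF u v] by simp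
  have i3: "integrable \<mu> (\<lambda>x. M.I x (?du x) (?dv x))" by (rule M.integrable_energy[OF u v])
  have i4: "integrable \<mu> (\<lambda>x. u x * v x)" by (rule M.integrable_product[OF u v])
  define D where "D x = (\<kappa> x * M'.I x (?du x) (?dv x) - M.I x (?du x) (?dv x)) - z * (\<kappa> x * (u x * v x) - u x * v x)" for x
  have iD: "integrable \<mu> D"
    unfolding D_def[abs_def] by (intro Bochner_Integration.integrable_diff integrable_mult_right i1 i2 i3 i4)
  have eq: "M'.form z u v - M.form z u v = (\<integral>x. D x \<partial>\<mu>)"
    unfolding M'.form_def M.form_def integral_mu'[OF Im'] integral_mu'[OF uvm] D_def
    using i1 i2 i3 i4 by (simp add: right_diff_distrib)
  have ee: "integrable \<mu> (\<lambda>x. e u x * e v x)"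
  proof (rule Bochner_Integration.integrable_bound[of \<mu> "\<lambda>x. M.dens u x + M.dens v x"])
    show "integrable \<mu> (\<lambda>x. M.dens u x + M.dens v x)"
      by (intro Bochner_Integration.integrable_add M.integrable_dens u v)
    show "(\<lambda>x. e u x * e v x) \<in> borel_measurable \<mu>"
      using em[OF u] em[OF v] by (intro M.measurable_mu) simp
    have "e u x * e v x \<le> M.dens u x + M.dens v x" for x
      using mult_le_epsilon_squares[of 1 "e u x" "e v x"] e2[OF u, of x] e2[OF v, of x] M.dens_nonneg[OF uC, of x]
      by simp
    then show "AE x in \<mu>. norm (e u x * e v x) \<le> norm (M.dens u x + M.dens v x)"
      using e0[OF u] e0[OF v] M.dens_nonneg[OF uC] M.dens_nonneg[OF vC] by (simp add: abs_mult)
  qed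
  have eK: "integrable \<mu> (\<lambda>x. (indicator K x * e u x) * e v x)"
    using M.local_integrable[OF K(1) ee] by (simp add: mult.assoc)
  have pointwise: "\<bar>D x\<bar> \<le> \<delta> * (e u x * e v x) + T * ((indicator K x * e u x) * e v x)" for x
  proof -
    have cu: "?du x \<in> cotangent A x" and cv: "?dv x \<in> cotangent A x" using differential_in_cotangent u v by auto
    have n0: "0 \<le> N x (?du x) * N x (?dv x)" using M.N_nonneg[OF cu] M.N_nonneg[OF cv] by simp
    have "\<bar>D x\<bar> \<le> \<bar>\<kappa> x * M'.I x (?du x) (?dv x) - M.I x (?du x) (?dv x)\<bar> + \<bar>z * (\<kappa> x * (u x * v x) - u x * v x)\<bar>"
      unfolding D_def by (rule abs_triangle_ineq4)
    also have "\<bar>z * (\<kappa> x * (u x * v x) - u x * v x)\<bar> = (\<bar>z\<bar> * \<bar>\<kappa> x - 1\<bar>) * (\<bar>u x\<bar> * \<bar>v x\<bar>)"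
    proof -
      have "z * (\<kappa> x * (u x * v x) - u x * v x) = (z * (\<kappa> x - 1)) * (u x * v x)" by (simp add: algebra_simps)
      then show ?thesis by (simp only: abs_mult)
    qed
    also have "\<dots> \<le> theta z x * (\<bar>u x\<bar> * \<bar>v x\<bar>)"
      by (intro mult_right_mono) (auto simp: theta_def)
    also have "\<bar>\<kappa> x * M'.I x (?du x) (?dv x) - M.I x (?du x) (?dv x)\<bar> \<le> theta z x * (N x (?du x) * N x (?dv x))"
    proof (rule order_trans[OF form_difference_pointwise[OF cu cv]])
      show "(\<bar>\<kappa> x * (\<alpha> x)\<^sup>2 - 1\<bar> + \<bar>\<kappa> x * (\<beta> x)\<^sup>2 - 1\<bar>) * (N x (?du x) * N x (?dv x)) \<le> theta z x * (N x (?du x) * N x (?dv x))"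
        using n0 by (intro mult_right_mono) (auto simp: theta_def)
    qed
    finally have "\<bar>D x\<bar> \<le> theta z x * (N x (?du x) * N x (?dv x) + \<bar>u x\<bar> * \<bar>v x\<bar>)"
      by (simp add: distrib_left)
    also have "N x (?du x) * N x (?dv x) + \<bar>u x\<bar> * \<bar>v x\<bar> \<le> e u x * e v x"
      using two_dim_Cauchy_Schwarz[of "N x (?du x)" "N x (?dv x)" "\<bar>u x\<bar>" "\<bar>v x\<bar>"]
      by (simp add: e_def M.dens_eq[OF uC] M.dens_eq[OF vC])
    finally have le: "\<bar>D x\<bar> \<le> theta z x * (e u x * e v x)"
      using theta_nonneg[of z x] by (simp add: mult_left_mono)
    have p: "0 \<le> e u x * e v x" using e0[OF u] e0[OF v] by simp
    show ?thesis
    proof (cases "x \<in> K")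
      case True
      have "theta z x * (e u x * e v x) \<le> T * (e u x * e v x)" using T[of x] p by (intro mult_right_mono)
      moreover have "0 \<le> \<delta> * (e u x * e v x)" using p \<delta> by simp
      ultimately show ?thesis using le True by simp
    next
      case False
      have "theta z x * (e u x * e v x) \<le> \<delta> * (e u x * e v x)" using K(2)[OF False] p by (intro mult_right_mono)
      then show ?thesis using le False by simp
    qed
  qed
  have "\<bar>\<integral>x. D x \<partial>\<mu>\<bar> \<le> (\<integral>x. \<bar>D x\<bar> \<partial>\<mu>)" by (rule integral_abs_bound)
  also have "\<dots> \<le> (\<integral>x. \<delta> * (e u x * e v x) + T * ((indicator K x * e u x) * e v x) \<partial>\<mu>)"
    by (intro integral_mono Bochner_Integration.integrable_add integrable_mult_right ee eK pointwise integrable_abs iD)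
  also have "\<dots> = \<delta> * (\<integral>x. e u x * e v x \<partial>\<mu>) + T * (\<integral>x. (indicator K x * e u x) * e v x \<partial>\<mu>)"
    using ee eK by simp
  finally have le: "\<bar>\<integral>x. D x \<partial>\<mu>\<bar> \<le> \<delta> * (\<integral>x. e u x * e v x \<partial>\<mu>) + T * (\<integral>x. (indicator K x * e u x) * e v x \<partial>\<mu>)" .
  have "(\<integral>x. e u x * e v x \<partial>\<mu>) \<le> sqrt (M.sq1 u) * sqrt (M.sq1 v)"
    using Cauchy_Schwarz_integral[of \<mu> "e u" "e v"] ee M.integrable_dens[OF u] M.integrable_dens[OF v]
    by (simp add: e2 u v M.sq1_def)
  from mult_left_mono[OF this \<delta>] le
  have "\<bar>\<integral>x. D x \<partial>\<mu>\<bar> \<le> \<delta> * (sqrt (M.sq1 u) * sqrt (M.sq1 v)) + T * (\<integral>x. (indicator K x * e u x) * e v x \<partial>\<mu>)"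
    by linarith
  moreover have "(\<integral>x. (indicator K x * e u x) * e v x \<partial>\<mu>) \<le> sqrt (\<integral>x. indicator K x * M.dens u x \<partial>\<mu>) * sqrt (M.sq1 v)"
  proof -
    have sq: "(indicator K x * e u x)\<^sup>2 = indicator K x * M.dens u x" for x
      by (simp add: power_mult_distrib e2 u indicator_def)
    show ?thesis
      using Cauchy_Schwarz_integral[of \<mu> "\<lambda>x. indicator K x * e u x" "e v"] eK M.integrable_dens[OF v]
        M.local_integrable[OF K(1) M.integrable_dens[OF u]]
      by (simp only: sq e2[OF v] M.sq1_def)
  qed
  from mult_left_mono[OF this T0] calculation
  show ?thesis unfolding eq by (simp add: algebra_simps)
qed

text \<open>A weak bound \<open>L\<close> for the second structure gives, by
  \<open>form_difference\<close>, the weak bound \<open>L2\<close> for the first. The estimate known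
  for the first structure then bounds the norm \<open>s\<close> of \<open>u\<close> by terms of
  which those proportional to \<open>s\<close> have total coefficient at most 1/2.\<close>

theorem estimate_transfer:
  assumes "M.estimate_real z"
  shows "M'.estimate_real z"
proof -
  obtain C G where C: "0 \<le> C" and G: "finite G" "\<forall>g\<in>G. M.L2_real g"
    and est: "\<forall>u\<in>M.C1c_real. \<forall>L\<ge>0. M.weak z u L \<longrightarrow> sqrt (M.sq1 u) \<le> C * (L + (\<Sum>g\<in>G. \<bar>\<integral>x. g x * u x \<partial>\<mu>\<bar>))"
    using assms unfolding M.estimate_real_def by (elim exE conjE) (rule that)
  define T where "T = 2 * (B * B\<^sup>2 + 1) + \<bar>z\<bar> * (B + 1)"
  have T: "theta z x \<le> T" for x unfolding T_def by (rule theta_bounded)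
  have T0: "0 \<le> T" using T[of undefined] theta_nonneg[of z undefined] by simp
  \<comment> \<open>Chosen for \<open>C * \<delta> \<le> 1 / 4\<close>; this concerns the error
    outside the compact set.\<close>
  define \<delta> where "\<delta> = 1 / (4 * (C + 1))"
  have \<delta>: "\<delta> > 0" "C * \<delta> \<le> 1 / 4" using C by (auto simp: \<delta>_def field_simps)
  obtain K where K: "compact K" "\<And>x. x \<notin> K \<Longrightarrow> theta z x \<le> \<delta>" using theta_small[OF \<delta>(1)] by blast
  have Kb: "K \<in> sets borel" using K(1) by (simp add: borel_closed compact_imp_closed)
  \<comment> \<open>Chosen for \<open>C * T * \<eta> \<le> 1 / 4\<close>; this concerns the error on
    the compact set.\<close>
  define \<eta> where "\<eta> = 1 / (4 * (C * T + 1))"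
  have CT: "0 \<le> C * T" using C T0 by simp
  have \<eta>: "\<eta> > 0" "C * T * \<eta> \<le> 1 / 4" using CT by (auto simp: \<eta>_def field_simps)
  \<comment> \<open>The local bound is one for squares in the second structure; the factors
    \<open>k1\<close> and \<open>K1\<close> convert it into the term \<open>\<eta> * s\<close> of
    the first.\<close>
  define \<epsilon> where "\<epsilon> = \<eta>\<^sup>2 * k1 / K1"
  have \<epsilon>: "\<epsilon> > 0" using \<eta>(1) k1_pos K1_pos by (simp add: \<epsilon>_def)
  \<comment> \<open>The local bound requires a weak bound on \<open>u\<close>, which is given in the
    second structure; the function is small there before it is compared with the first.\<close>
  obtain G' C' where G': "finite G'" "\<forall>g\<in>G'. M'.L2_real g" "0 \<le> C'"
    and cacc: "\<forall>u\<in>M.C1c_real. \<forall>L\<ge>0. M'.weak z u L \<longrightarrow> (\<integral>x. indicator K x * M'.dens u x \<partial>\<mu>') \<le>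
       \<epsilon> * M'.sq1 u + C' * (L\<^sup>2 + (\<Sum>g\<in>G'. (\<integral>x. g x * u x \<partial>\<mu>')\<^sup>2))"
    using M'.controlled_compact[OF K(1), of z, unfolded M'.controlled_def, THEN conjunct2, rule_format, OF \<epsilon>]
    by (elim exE conjE) (rule that)
  \<comment> \<open>The quotient \<open>h g\<close> represents with respect to \<open>\<mu>'\<close>
    the functional that \<open>g\<close> represents with respect to \<open>\<mu>\<close>.\<close>
  define h where "h g x = g x / \<kappa> x" for g and x :: 'a
  define G2 where "G2 = h ` G \<union> G'"
  have hL2: "M'.L2_real (h g)" if "g \<in> G" for g
  proof -
    have g: "g \<in> borel_measurable borel" "integrable \<mu> (\<lambda>x. (g x)\<^sup>2)"
      using G(2) that by (auto simp: M.L2_real_def)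
    have hm: "h g \<in> borel_measurable borel" unfolding h_def[abs_def] using g(1) meas by measurable
    have eq: "\<kappa> x * (h g x)\<^sup>2 = (g x)\<^sup>2 / \<kappa> x" for x
      using kappa_pos(1)[of x] by (simp add: h_def power2_eq_square)
    have "integrable \<mu> (\<lambda>x. (g x)\<^sup>2 / \<kappa> x)"
    proof (rule Bochner_Integration.integrable_bound[of \<mu> "\<lambda>x. (1 / k) * (g x)\<^sup>2"])
      show "integrable \<mu> (\<lambda>x. (1 / k) * (g x)\<^sup>2)" by (rule integrable_mult_right[OF g(2)])
      show "(\<lambda>x. (g x)\<^sup>2 / \<kappa> x) \<in> borel_measurable \<mu>"
        using g(1) meas by (intro M.measurable_mu) measurable
      have "(g x)\<^sup>2 / \<kappa> x \<le> (1 / k) * (g x)\<^sup>2" for x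
        using k(1) k(4)[of x] divide_left_mono[of k "\<kappa> x" "(g x)\<^sup>2"] by simp
      then show "AE x in \<mu>. norm ((g x)\<^sup>2 / \<kappa> x) \<le> norm ((1 / k) * (g x)\<^sup>2)"
        using kappa_pos(2) k(1) by simp
    qed
    then have "integrable \<mu>' (\<lambda>x. (h g x)\<^sup>2)"
      using integrable_mu'[of "\<lambda>x. (h g x)\<^sup>2"] hm by (simp add: eq)
    then show ?thesis using hm by (simp add: M'.L2_real_def)
  qed
  have pair: "(\<integral>x. h g x * u x \<partial>\<mu>') = (\<integral>x. g x * u x \<partial>\<mu>)" if "g \<in> G" "u \<in> M.C1c_real" for g u
  proof -
    have "(\<lambda>x. h g x * u x) \<in> borel_measurable borel"
      using hL2[OF that(1)] M.C1_real_measurable[OF M.C1c_realD[OF that(2)]] by (auto simp: M'.L2_real_def intro!: borel_measurable_times)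
    then have "(\<integral>x. h g x * u x \<partial>\<mu>') = (\<integral>x. \<kappa> x * (h g x * u x) \<partial>\<mu>)" by (rule integral_mu')
    also have "\<dots> = (\<integral>x. g x * u x \<partial>\<mu>)"
    proof (intro Bochner_Integration.integral_cong refl)
      fix x show "\<kappa> x * (h g x * u x) = g x * u x" using kappa_pos(1)[of x] by (simp add: h_def)
    qed
    finally show ?thesis .
  qed
  define c where "c = sqrt (C' / k1)"
  have c0: "0 \<le> c" using G'(3) k1_pos by (simp add: c_def)
  define F where "F = sqrt K1 * (2 * (C * (sqrt K1 + T * c + real (card G))))"
  have "sqrt (M'.sq1 u) \<le> F * (L + (\<Sum>g\<in>G2. \<bar>\<integral>x. g x * u x \<partial>\<mu>'\<bar>))"
    if u: "u \<in> M.C1c_real" and L: "L \<ge> 0" and w: "M'.weak z u L" for u L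
  proof -
    define \<Sigma> where "\<Sigma> = (\<Sum>g\<in>G2. \<bar>\<integral>x. g x * u x \<partial>\<mu>'\<bar>)"
    have \<Sigma>0: "0 \<le> \<Sigma>" unfolding \<Sigma>_def by (intro sum_nonneg) auto
    define s where "s = sqrt (M.sq1 u)"
    have s0: "0 \<le> s" and s2: "s\<^sup>2 = M.sq1 u" using M.sq1_nonneg[OF u] by (auto simp: s_def)
    define \<rho> where "\<rho> = sqrt (\<integral>x. indicator K x * M.dens u x \<partial>\<mu>)"
    have i0: "0 \<le> (\<integral>x. indicator K x * M.dens u x \<partial>\<mu>)"
      using M.dens_nonneg[OF M.C1c_realD[OF u]] by (intro integral_nonneg_AE) auto
    have \<rho>2: "\<rho>\<^sup>2 = (\<integral>x. indicator K x * M.dens u x \<partial>\<mu>)" and \<rho>0: "0 \<le> \<rho>" using i0 by (auto simp: \<rho>_def)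
    have sumG': "(\<Sum>g\<in>G'. (\<integral>x. g x * u x \<partial>\<mu>')\<^sup>2) \<le> \<Sigma>\<^sup>2"
    proof -
      have "(\<Sum>g\<in>G'. (\<integral>x. g x * u x \<partial>\<mu>')\<^sup>2) \<le> (\<Sum>g\<in>G'. \<bar>\<integral>x. g x * u x \<partial>\<mu>'\<bar>)\<^sup>2"
        by (rule sum_squares_le_square_sum[OF G'(1)])
      also have "\<dots> \<le> \<Sigma>\<^sup>2"
        unfolding \<Sigma>_def G2_def using G(1) G'(1) by (intro power_mono sum_mono2 sum_nonneg) auto
      finally show ?thesis .
    qed
    have sumG: "(\<Sum>g\<in>G. \<bar>\<integral>x. g x * u x \<partial>\<mu>\<bar>) \<le> real (card G) * \<Sigma>"
    proof -
      have "(\<Sum>g\<in>G. \<bar>\<integral>x. g x * u x \<partial>\<mu>\<bar>) = (\<Sum>g\<in>G. \<bar>\<integral>x. h g x * u x \<partial>\<mu>'\<bar>)"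
        by (intro sum.cong refl) (simp add: pair u)
      also have "\<dots> \<le> real (card G) * \<Sigma>"
        unfolding \<Sigma>_def G2_def using G(1) G'(1) by (intro sum_image_Un_le) auto
      finally show ?thesis .
    qed
    have "k1 * \<rho>\<^sup>2 \<le> \<epsilon> * M'.sq1 u + C' * (L\<^sup>2 + (\<Sum>g\<in>G'. (\<integral>x. g x * u x \<partial>\<mu>')\<^sup>2))"
      unfolding \<rho>2 using local_lower[OF u Kb] cacc[rule_format, OF u L w] by linarith
    also have "\<dots> \<le> \<epsilon> * (K1 * s\<^sup>2) + C' * (L + \<Sigma>)\<^sup>2"
    proof (intro add_mono mult_left_mono)
      show "M'.sq1 u \<le> K1 * s\<^sup>2" using sq1_upper[OF u] by (simp add: s2)
      have "0 \<le> L * \<Sigma>" using L \<Sigma>0 by simp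
      then show "L\<^sup>2 + (\<Sum>g\<in>G'. (\<integral>x. g x * u x \<partial>\<mu>')\<^sup>2) \<le> (L + \<Sigma>)\<^sup>2" using sumG' by (simp add: power2_sum)
    qed (use \<epsilon> G' in auto)
    also have "\<epsilon> * (K1 * s\<^sup>2) = k1 * (\<eta> * s)\<^sup>2"
      using K1_pos by (simp add: \<epsilon>_def power_mult_distrib)
    also have "C' * (L + \<Sigma>)\<^sup>2 = k1 * (c * (L + \<Sigma>))\<^sup>2"
      using k1_pos G'(3) by (simp add: c_def power_mult_distrib)
    finally have "k1 * \<rho>\<^sup>2 \<le> k1 * ((\<eta> * s)\<^sup>2 + (c * (L + \<Sigma>))\<^sup>2)" by (simp add: distrib_left)
    then have "\<rho>\<^sup>2 \<le> (\<eta> * s)\<^sup>2 + (c * (L + \<Sigma>))\<^sup>2" using k1_pos by simp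
    also have "\<dots> \<le> (\<eta> * s + c * (L + \<Sigma>))\<^sup>2"
    proof -
      have gen: "x\<^sup>2 + y\<^sup>2 \<le> (x + y)\<^sup>2" if "0 \<le> x" "0 \<le> y" for x y :: real
        using that by (simp add: power2_sum)
      show ?thesis using \<eta>(1) s0 c0 L \<Sigma>0 by (intro gen mult_nonneg_nonneg add_nonneg_nonneg) auto
    qed
    finally have \<rho>le: "\<rho> \<le> \<eta> * s + c * (L + \<Sigma>)"
      by (rule power2_le_imp_le) (use \<eta>(1) s0 c0 L \<Sigma>0 in auto)
    \<comment> \<open>The given bound converted to the first norm, the error outside
      \<open>K\<close>, and the error on \<open>K\<close>.\<close>
    define L2 where "L2 = sqrt K1 * L + \<delta> * s + T * \<rho>"
    have L20: "0 \<le> L2" unfolding L2_def using K1_pos L \<delta>(1) s0 T0 \<rho>0 by (intro add_nonneg_nonneg mult_nonneg_nonneg) auto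
    have "M.weak z u L2"
      unfolding M.weak_def
    proof
      fix v assume v: "v \<in> M.C1c_real"
      have "\<bar>M.form z u v\<bar> \<le> \<bar>M'.form z u v\<bar> + \<bar>M'.form z u v - M.form z u v\<bar>" by linarith
      also have "\<bar>M'.form z u v\<bar> \<le> L * sqrt (M'.sq1 v)" using w v by (simp add: M'.weak_def)
      also have "L * sqrt (M'.sq1 v) \<le> L * (sqrt K1 * sqrt (M.sq1 v))"
        using real_sqrt_le_mono[OF sq1_upper[OF v]] L by (intro mult_left_mono) (auto simp: real_sqrt_mult)
      also have "\<bar>M'.form z u v - M.form z u v\<bar> \<le> (\<delta> * s + T * \<rho>) * sqrt (M.sq1 v)"
        unfolding s_def \<rho>_def using \<delta>(1) by (intro form_difference u v Kb K(2) T) auto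
      finally show "\<bar>M.form z u v\<bar> \<le> L2 * sqrt (M.sq1 v)" by (simp add: L2_def algebra_simps)
    qed
    from est[rule_format, OF u L20 this] have "s \<le> C * (L2 + (\<Sum>g\<in>G. \<bar>\<integral>x. g x * u x \<partial>\<mu>\<bar>))" by (simp add: s_def)
    also have "\<dots> \<le> C * (sqrt K1 * L + \<delta> * s + T * (\<eta> * s + c * (L + \<Sigma>)) + real (card G) * \<Sigma>)"
      using mult_left_mono[OF add_mono[OF mult_left_mono[OF \<rho>le T0] sumG] C] by (simp add: L2_def distrib_left)
    also have "\<dots> = (C * \<delta>) * s + (C * T * \<eta>) * s + C * (sqrt K1 * L + T * c * (L + \<Sigma>) + real (card G) * \<Sigma>)"
      by (simp add: algebra_simps)
    also have "(C * \<delta>) * s \<le> 1 / 4 * s" using \<delta>(2) s0 by (rule mult_right_mono)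
    also have "(C * T * \<eta>) * s \<le> 1 / 4 * s" using \<eta>(2) s0 by (rule mult_right_mono)
    finally have "s \<le> 2 * (C * (sqrt K1 * L + T * c * (L + \<Sigma>) + real (card G) * \<Sigma>))" by simp
    also have "\<dots> \<le> 2 * (C * ((sqrt K1 + T * c + real (card G)) * (L + \<Sigma>)))"
    proof (intro mult_left_mono)
      have "0 \<le> sqrt K1 * \<Sigma>" "0 \<le> real (card G) * L" using K1_pos \<Sigma>0 L by auto
      then show "sqrt K1 * L + T * c * (L + \<Sigma>) + real (card G) * \<Sigma> \<le> (sqrt K1 + T * c + real (card G)) * (L + \<Sigma>)"
        by (simp add: algebra_simps)
    qed (use C in auto)
    finally have s_le: "s \<le> 2 * (C * ((sqrt K1 + T * c + real (card G)) * (L + \<Sigma>)))" .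
    have "sqrt (M'.sq1 u) \<le> sqrt K1 * s"
      using real_sqrt_le_mono[OF sq1_upper[OF u]] by (simp add: real_sqrt_mult s_def)
    also have "\<dots> \<le> sqrt K1 * (2 * (C * ((sqrt K1 + T * c + real (card G)) * (L + \<Sigma>))))"
      using s_le K1_pos by (intro mult_left_mono) auto
    also have "\<dots> = F * (L + \<Sigma>)" by (simp add: F_def mult_ac)
    finally show ?thesis by (simp add: \<Sigma>_def)
  qed
  moreover have "0 \<le> F" unfolding F_def using C K1_pos T0 c0 by (intro mult_nonneg_nonneg add_nonneg_nonneg) auto
  moreover have "finite G2" "\<forall>g\<in>G2. M'.L2_real g" using G(1) G' hL2 by (auto simp: G2_def)
  ultimately show ?thesis
    unfolding M'.estimate_real_def by (intro exI[of _ F] exI[of _ G2]) blast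
qed

end

section \<open>The Laplace operator\<close>

lemma cov_add_eq_plus: "cov_add = (+)" and cov_zero_eq_0: "cov_zero = 0"
  by (simp_all add: cov_add_def cov_zero_def fun_eq_iff)

lemma ccov_add_eq_plus: "ccov_add = (+)" and ccov_zero_eq_0: "ccov_zero = 0"
  by (simp_all add: ccov_add_def ccov_zero_def cov_add_eq_plus cov_zero_eq_0 fun_eq_iff plus_prod_def zero_prod_def)

context C1_manifold
begin

lemma C1c_real_add: "u \<in> C1c_real \<Longrightarrow> v \<in> C1c_real \<Longrightarrow> (\<lambda>x. u x + v x) \<in> C1c_real"
proof -
  assume u: "u \<in> C1c_real" and v: "v \<in> C1c_real"
  have eq: "closure {x. (u x, v x) \<noteq> (0, 0)} = closure {x. u x \<noteq> 0} \<union> closure {x. v x \<noteq> 0}"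
    by (subst closure_Un[symmetric]) (rule arg_cong[of _ _ closure], auto)
  have "compact (closure {x. (u x, v x) \<noteq> (0, 0)})"
    unfolding eq using u v by (auto simp: C1c_real_def intro: compact_Un)
  then have "compact (closure {x. u x + v x \<noteq> 0})" by (rule compact_support_subset) auto
  then show ?thesis using u v by (simp add: C1c_real_def C1_real_add)
qed

lemma C1c_real_scale: "u \<in> C1c_real \<Longrightarrow> (\<lambda>x. k * u x) \<in> C1c_real"
proof -
  assume u: "u \<in> C1c_real"
  then have "compact (closure {x. u x \<noteq> 0})" by (simp add: C1c_real_def)
  then have "compact (closure {x. k * u x \<noteq> 0})" by (rule compact_support_subset) auto
  then show ?thesis using u by (simp add: C1c_real_def C1_real_scale)
qed

lemma C1c_real_zero: "(\<lambda>_. 0) \<in> C1c_real"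
  using C1_real_const(1)[of 0] by (simp add: C1c_real_def)

lemma C1c_functions_iff:
  "u \<in> C1c_functions A \<longleftrightarrow> (\<lambda>x. Re (u x)) \<in> C1c_real \<and> (\<lambda>x. Im (u x)) \<in> C1c_real"
proof
  assume u: "u \<in> C1c_functions A"
  then have C1: "C1_on (snd c ` fst c) (u \<circ> chart_inv c)" if "c \<in> A" for c
    using that by (simp add: C1c_functions_def C1_functions_def)
  have supp: "compact (closure {x. u x \<noteq> 0})" using u by (simp add: C1c_functions_def)
  have "compact (closure {x. Re (u x) \<noteq> 0})" "compact (closure {x. Im (u x) \<noteq> 0})"
    by (rule compact_support_subset[OF supp]; auto)+
  moreover have "C1_real (\<lambda>x. Re (u x))" "C1_real (\<lambda>x. Im (u x))"
    unfolding C1_real_def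
    using C1_on_linear(1)[OF bounded_linear_Re C1] C1_on_linear(1)[OF bounded_linear_Im C1]
    by (simp_all add: o_def)
  ultimately show "(\<lambda>x. Re (u x)) \<in> C1c_real \<and> (\<lambda>x. Im (u x)) \<in> C1c_real" by (simp add: C1c_real_def)
next
  assume u: "(\<lambda>x. Re (u x)) \<in> C1c_real \<and> (\<lambda>x. Im (u x)) \<in> C1c_real"
  have bl: "bounded_linear (\<lambda>t::real. \<i> * of_real t)"
    by (intro bounded_linear_const_mult bounded_linear_of_real)
  have "C1_on (snd c ` fst c) (u \<circ> chart_inv c)" if c: "c \<in> A" for c
  proof -
    have "C1_on (snd c ` fst c) (\<lambda>p. of_real (Re (u (chart_inv c p))) + \<i> * of_real (Im (u (chart_inv c p))))"
      using u c by (intro C1_on_add(1) C1_on_linear(1)[OF bounded_linear_of_real] C1_on_linear(1)[OF bl])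
        (simp_all add: C1c_real_def C1_real_def o_def)
    then show ?thesis by (simp add: complex_eq[symmetric] o_def)
  qed
  moreover have "compact (closure {x. u x \<noteq> 0})"
  proof -
    have "{x. u x \<noteq> 0} = {x. Re (u x) \<noteq> 0} \<union> {x. Im (u x) \<noteq> 0}" by (auto simp: complex_eq_iff)
    then show ?thesis using u by (auto simp: C1c_real_def closure_Un intro: compact_Un)
  qed
  ultimately show "u \<in> C1c_functions A" by (simp add: C1c_functions_def C1_functions_def)
qed

lemma of_real_C1c_functions: "v \<in> C1c_real \<Longrightarrow> (\<lambda>x. of_real (v x)) \<in> C1c_functions A"
  by (simp add: C1c_functions_iff C1c_real_zero)

lemma cdifferential_add:
  assumes "u \<in> C1c_functions A" "v \<in> C1c_functions A"
  shows "cdifferential A (u + v) = cdifferential A u + cdifferential A v"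
  using assms
  by (simp add: fun_eq_iff cdifferential_def C1c_functions_iff C1_real_add(2)[OF C1c_realD C1c_realD] cov_add_eq_plus
      plus_prod_def)

lemma cdifferential_scale:
  assumes "u \<in> C1c_functions A"
  shows "cdifferential A (\<lambda>x. a * u x) = (\<lambda>x. ccov_scale a (cdifferential A u x))"
proof -
  have R: "C1_real (\<lambda>x. Re (u x))" and I: "C1_real (\<lambda>x. Im (u x))"
    using assms C1c_realD by (auto simp: C1c_functions_iff)
  note S = C1_real_scale[OF R] C1_real_scale[OF I]
  have e: "(\<lambda>x. Re (a * u x)) = (\<lambda>x. Re a * Re (u x) + - Im a * Im (u x))"
    "(\<lambda>x. Im (a * u x)) = (\<lambda>x. Re a * Im (u x) + Im a * Re (u x))"
    by auto
  have "differential A (\<lambda>x. Re (a * u x)) x =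
      cov_add (cov_scale (Re a) (differential A (\<lambda>x. Re (u x)) x)) (cov_scale (- Im a) (differential A (\<lambda>x. Im (u x)) x))" for x
    unfolding e C1_real_add(2)[OF S(1) S(3)] S(2,4) ..
  moreover have "differential A (\<lambda>x. Im (a * u x)) x =
      cov_add (cov_scale (Re a) (differential A (\<lambda>x. Im (u x)) x)) (cov_scale (Im a) (differential A (\<lambda>x. Re (u x)) x))" for x
    unfolding e C1_real_add(2)[OF S(3) S(1)] S(2,4) ..
  ultimately show ?thesis by (simp add: fun_eq_iff cdifferential_def ccov_scale_def)
qed

end

context RM_manifold
begin

section \<open>The space of covector fields\<close>

lemma Cc_section_add:
  assumes v: "Cc_section v" and w: "Cc_section w"
  shows "Cc_section (\<lambda>x. cov_add (v x) (w x))"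
proof -
  have eq: "closure {x. (v x, w x) \<noteq> (cov_zero, cov_zero)} = closure {x. v x \<noteq> cov_zero} \<union> closure {x. w x \<noteq> cov_zero}"
    by (subst closure_Un[symmetric]) (rule arg_cong[of _ _ closure], auto)
  have "compact (closure {x. (v x, w x) \<noteq> (cov_zero, cov_zero)})"
    unfolding eq using v w by (auto simp: Cc_section_def intro: compact_Un)
  then have "compact (closure {x. cov_add (v x) (w x) \<noteq> cov_zero})"
    by (rule compact_support_subset) (auto simp: cov_add_eq_plus cov_zero_eq_0)
  moreover have "continuous_on (UNIV \<inter> fst c) (\<lambda>x. cov_add (v x) (w x) c)" if "c \<in> A" for c
    unfolding cov_add_def using v w that by (intro continuous_on_add) (auto simp: Cc_section_def continuous_section_on_def)
  ultimately show ?thesis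
    using v w by (auto simp: Cc_section_def continuous_section_on_def intro: cotangent_add)
qed

lemma Cc_section_scale:
  assumes v: "Cc_section v"
  shows "Cc_section (\<lambda>x. cov_scale a (v x))"
proof -
  have supp: "compact (closure {x. v x \<noteq> cov_zero})" using v by (simp add: Cc_section_def)
  then have "compact (closure {x. cov_scale a (v x) \<noteq> cov_zero})"
    by (rule compact_support_subset) (auto simp: cov_scale_def cov_zero_def)
  moreover have "continuous_on (UNIV \<inter> fst c) (\<lambda>x. cov_scale a (v x) c)" if "c \<in> A" for c
    unfolding cov_scale_def using v that
    by (intro continuous_on_scaleR continuous_on_const) (auto simp: Cc_section_def continuous_section_on_def)
  ultimately show ?thesis
    using v by (auto simp: Cc_section_def continuous_section_on_def intro: cotangent_scale)
qed

lemma Cc_section_cotangent: "Cc_section v \<Longrightarrow> v x \<in> cotangent A x"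
  by (simp add: Cc_section_def section_cotangent)

definition section_inner :: "('a \<Rightarrow> ('a, 'e) covec) \<Rightarrow> ('a \<Rightarrow> ('a, 'e) covec) \<Rightarrow> real" where
  "section_inner v w = (\<integral>x. I x (v x) (w x) \<partial>\<mu>)"

lemma integrable_section_inner: "Cc_section v \<Longrightarrow> Cc_section w \<Longrightarrow> integrable \<mu> (\<lambda>x. I x (v x) (w x))"
  by (intro integrable_pairing) (auto simp: Cc_section_def)

lemma section_inner_sym: "Cc_section v \<Longrightarrow> Cc_section w \<Longrightarrow> section_inner v w = section_inner w v"
  unfolding section_inner_def by (intro Bochner_Integration.integral_cong refl I_sym Cc_section_cotangent)

lemma section_inner_add: "Cc_section u \<Longrightarrow> Cc_section v \<Longrightarrow> Cc_section w \<Longrightarrow> section_inner u (\<lambda>x. cov_add (v x) (w x)) = section_inner u v + section_inner u w"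
  by (simp add: section_inner_def I_add_right Cc_section_cotangent integrable_section_inner)

lemma section_inner_scale: "Cc_section u \<Longrightarrow> Cc_section v \<Longrightarrow> section_inner u (\<lambda>x. cov_scale a (v x)) = a * section_inner u v"
  by (simp add: section_inner_def I_scale_right Cc_section_cotangent)

lemma section_inner_self_nonneg: "Cc_section v \<Longrightarrow> 0 \<le> section_inner v v"
  unfolding section_inner_def by (intro integral_nonneg_AE AE_I2) (simp add: I_self Cc_section_cotangent)

lemma Cc_sections_vec_iff:
  "v \<in> hvec (Cc_sections A N \<mu>) \<longleftrightarrow> Cc_section (\<lambda>x. fst (v x)) \<and> Cc_section (\<lambda>x. snd (v x))"
proof -
  have "{x. v x \<noteq> ccov_zero} = {x. fst (v x) \<noteq> cov_zero} \<union> {x. snd (v x) \<noteq> cov_zero}"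
    by (auto simp: ccov_zero_def prod_eq_iff)
  then have eq: "closure {x. v x \<noteq> ccov_zero} = closure {x. fst (v x) \<noteq> cov_zero} \<union> closure {x. snd (v x) \<noteq> cov_zero}"
    by (simp add: closure_Un)
  have "compact (closure {x. v x \<noteq> ccov_zero}) \<longleftrightarrow>
      compact (closure {x. fst (v x) \<noteq> cov_zero}) \<and> compact (closure {x. snd (v x) \<noteq> cov_zero})"
  proof
    assume c: "compact (closure {x. v x \<noteq> ccov_zero})"
    show "compact (closure {x. fst (v x) \<noteq> cov_zero}) \<and> compact (closure {x. snd (v x) \<noteq> cov_zero})"
      by (rule conjI; rule compact_support_subset[OF c]) (auto simp: ccov_zero_def)
  qed (auto simp: eq intro: compact_Un)
  then show ?thesis by (auto simp: Cc_sections_def Cc_section_def o_def)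
qed

text \<open>The four real pairings are integrable separately, so the complex integral can be taken
  by real and imaginary parts.\<close>

lemma Cc_sections_inner:
  assumes "v \<in> hvec (Cc_sections A N \<mu>)" "w \<in> hvec (Cc_sections A N \<mu>)"
  shows "hinner (Cc_sections A N \<mu>) v w =
    Complex (section_inner (\<lambda>x. fst (v x)) (\<lambda>x. fst (w x)) + section_inner (\<lambda>x. snd (v x)) (\<lambda>x. snd (w x)))
      (section_inner (\<lambda>x. fst (v x)) (\<lambda>x. snd (w x)) - section_inner (\<lambda>x. snd (v x)) (\<lambda>x. fst (w x)))"
proof -
  have "Cc_section (\<lambda>x. fst (v x))" "Cc_section (\<lambda>x. snd (v x))" "Cc_section (\<lambda>x. fst (w x))" "Cc_section (\<lambda>x. snd (w x))"
    using assms by (simp_all add: Cc_sections_vec_iff)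
  then show ?thesis
    by (simp add: Cc_sections_def ccov_inner_def Complex_eq section_inner_def integrable_section_inner)
qed

lemma hscale_Cc_sections: "hscale (Cc_sections A N \<mu>) a v = (\<lambda>x. ccov_scale a (v x))"
  by (simp add: Cc_sections_def)

lemma semi_inner_Cc_sections: "semi_inner_hspace (Cc_sections A N \<mu>)"
proof (rule semi_inner_hspace.intro)
  let ?E = "Cc_sections A N \<mu>"
  show "hadd ?E = (+)" "hzero ?E = 0"
    by (simp_all add: Cc_sections_def ccov_add_eq_plus ccov_zero_eq_0 fun_eq_iff)
  interpret vector_space "hscale ?E"
    by unfold_locales
      (auto simp: hscale_Cc_sections fun_eq_iff prod_eq_iff ccov_scale_def cov_add_def cov_scale_def
        scaleR_add_right scaleR_add_left scaleR_diff_right scaleR_diff_left algebra_simps)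
  have fa: "(\<lambda>x. fst ((v + w) x)) = (\<lambda>x. cov_add (fst (v x)) (fst (w x)))"
    and sa: "(\<lambda>x. snd ((v + w) x)) = (\<lambda>x. cov_add (snd (v x)) (snd (w x)))" for v w :: "'a \<Rightarrow> ('a, 'e) ccovec"
    by (simp_all add: cov_add_eq_plus)
  have fs: "(\<lambda>x. fst (hscale ?E a v x)) = (\<lambda>x. cov_add (cov_scale (Re a) (fst (v x))) (cov_scale (- Im a) (snd (v x))))"
    and ss: "(\<lambda>x. snd (hscale ?E a v x)) = (\<lambda>x. cov_add (cov_scale (Re a) (snd (v x))) (cov_scale (Im a) (fst (v x))))" for a v
    by (simp_all add: hscale_Cc_sections ccov_scale_def)
  have sub: "subspace (hvec ?E)"
  proof (rule subspaceI)
    show "0 \<in> hvec ?E"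
      by (simp add: Cc_sections_vec_iff Cc_section_def continuous_section_on_def cov_zero_eq_0[symmetric] cotangent_zero)
  qed (simp_all only: Cc_sections_vec_iff fa sa fs ss Cc_section_add Cc_section_scale simp_thms)
  show "semi_inner (hscale ?E) (hvec ?E) (hinner ?E)"
  proof
    show "subspace (hvec ?E)" by (rule sub)
  next
    fix v w assume vw: "v \<in> hvec ?E" "w \<in> hvec ?E"
    then show "cnj (hinner ?E v w) = hinner ?E w v"
      unfolding Cc_sections_inner[OF vw] Cc_sections_inner[OF vw(2,1)]
      by (simp add: Cc_sections_vec_iff complex_eq_iff section_inner_sym[of "\<lambda>x. fst (v x)"] section_inner_sym[of "\<lambda>x. snd (v x)"])
  next
    fix v w y assume V: "v \<in> hvec ?E" "w \<in> hvec ?E" "y \<in> hvec ?E"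
    show "hinner ?E v (w + y) = hinner ?E v w + hinner ?E v y"
      unfolding Cc_sections_inner[OF V(1,2)] Cc_sections_inner[OF V(1,3)] Cc_sections_inner[OF V(1) subspace_add[OF sub V(2,3)]] fa sa
      using V by (simp add: Cc_sections_vec_iff complex_eq_iff section_inner_add)
  next
    fix v w a assume V: "v \<in> hvec ?E" "w \<in> hvec ?E"
    show "hinner ?E v (hscale ?E a w) = a * hinner ?E v w"
      unfolding Cc_sections_inner[OF V] Cc_sections_inner[OF V(1) subspace_scale[OF sub V(2)]] fs ss
      using V by (simp add: Cc_sections_vec_iff complex_eq_iff section_inner_add section_inner_scale Cc_section_scale algebra_simps)
  next
    fix v assume V: "v \<in> hvec ?E"
    then show "0 \<le> Re (hinner ?E v v)"
      unfolding Cc_sections_inner[OF V V] by (simp add: Cc_sections_vec_iff section_inner_self_nonneg)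
  qed
qed

lemma cdifferential_Cc_sections: "u \<in> C1c_functions A \<Longrightarrow> cdifferential A u \<in> hvec (Cc_sections A N \<mu>)"
  by (simp add: Cc_sections_vec_iff C1c_functions_iff cdifferential_def Cc_section_differential)

lemma cdifferential_K_space: "u \<in> C1c_functions A \<Longrightarrow> (\<lambda>_. cdifferential A u) \<in> hvec (K_space A N \<mu>)"
  unfolding K_space_def
  by (intro semi_inner_hspace.hcompletion_const[OF semi_inner_Cc_sections] cdifferential_Cc_sections)

lemma semi_inner_K_space: "semi_inner_hspace (K_space A N \<mu>)"
  unfolding K_space_def by (rule semi_inner_hspace.semi_inner_hcompletion[OF semi_inner_Cc_sections])

lemma C1c_functions_L2: "u \<in> C1c_functions A \<Longrightarrow> u \<in> hvec (L2 \<mu>)"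
proof -
  assume "u \<in> C1c_functions A"
  then have u: "(\<lambda>x. Re (u x)) \<in> C1c_real" "(\<lambda>x. Im (u x)) \<in> C1c_real" by (simp_all add: C1c_functions_iff)
  have "u \<in> borel_measurable \<mu>"
    using measurable_mu[OF C1_real_measurable[OF C1c_realD[OF u(1)]]] measurable_mu[OF C1_real_measurable[OF C1c_realD[OF u(2)]]]
    by (simp add: borel_measurable_complex_iff)
  moreover have "integrable \<mu> (\<lambda>x. (cmod (u x))\<^sup>2)"
    unfolding cmod_power2 using integrable_product[OF u(1) u(1)] integrable_product[OF u(2) u(2)]
    by (simp add: power2_eq_square)
  ultimately show ?thesis by (simp add: L2_vec_iff)
qed

text \<open>Differentials of core functions are embedded as constant sequences into the completion,
  so the required limits are those of \<open>hcompletion_complete\<close>.\<close>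

lemma form_core_Laplacian:
  "form_core (hscale (L2 \<mu>)) (hvec (L2 \<mu>)) (hinner (L2 \<mu>))
    (hscale (K_space A N \<mu>)) (hvec (K_space A N \<mu>)) (hinner (K_space A N \<mu>))
    (C1c_functions A) (\<lambda>u _. cdifferential A u)"
proof (rule form_core.intro[OF L2_complete semi_inner_hspace.semi_inner[OF semi_inner_K_space] form_core_axioms.intro])
  interpret L: complete_semi_inner "hscale (L2 \<mu>)" "hvec (L2 \<mu>)" "hinner (L2 \<mu>)" by (rule L2_complete)
  show "C1c_functions A \<subseteq> hvec (L2 \<mu>)" using C1c_functions_L2 by blast
  show "L.subspace (C1c_functions A)"
  proof (rule L.subspaceI)
    show "0 \<in> C1c_functions A" by (simp add: C1c_functions_iff C1c_real_zero)
    show "u + v \<in> C1c_functions A" if "u \<in> C1c_functions A" "v \<in> C1c_functions A" for u v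
      using that by (simp add: C1c_functions_iff C1c_real_add)
    show "hscale (L2 \<mu>) a u \<in> C1c_functions A" if "u \<in> C1c_functions A" for a u
      using that C1c_real_add[OF C1c_real_scale C1c_real_scale, of "\<lambda>x. Re (u x)" "\<lambda>x. Im (u x)" "Re a" "- Im a"]
        C1c_real_add[OF C1c_real_scale C1c_real_scale, of "\<lambda>x. Im (u x)" "\<lambda>x. Re (u x)" "Re a" "Im a"]
      by (simp add: C1c_functions_iff hscale_L2 add.commute)
  qed
  show "(\<lambda>_. cdifferential A u) \<in> hvec (K_space A N \<mu>)" if "u \<in> C1c_functions A" for u
    using that by (rule cdifferential_K_space)
  show "(\<lambda>_. cdifferential A (u + v)) = (\<lambda>_. cdifferential A u) + (\<lambda>_. cdifferential A v)"
    if "u \<in> C1c_functions A" "v \<in> C1c_functions A" for u v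
    unfolding cdifferential_add[OF that] by (simp add: fun_eq_iff)
  show "(\<lambda>_. cdifferential A (hscale (L2 \<mu>) a u)) = hscale (K_space A N \<mu>) a (\<lambda>_. cdifferential A u)"
    if "u \<in> C1c_functions A" for a u
    unfolding hscale_L2 cdifferential_scale[OF that] by (simp add: K_space_def hcompletion_def hscale_Cc_sections)
  show "\<exists>w\<in>hvec (K_space A N \<mu>). semi_inner.tends (hinner (K_space A N \<mu>)) (\<lambda>n _. cdifferential A (us n)) w"
    if "\<And>n. us n \<in> C1c_functions A"
      "semi_inner.Cauchy_seq (hinner (K_space A N \<mu>)) (\<lambda>n _. cdifferential A (us n))" for us
    unfolding K_space_def
    by (rule semi_inner_hspace.hcompletion_complete[OF semi_inner_Cc_sections, of "\<lambda>n. cdifferential A (us n)"])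
      (use that cdifferential_Cc_sections in \<open>auto simp: K_space_def\<close>)
qed

section \<open>Reduction to real functions\<close>

lemma L2_inner_parts:
  assumes "g \<in> hvec (L2 \<mu>)" "u \<in> hvec (L2 \<mu>)"
  shows "hinner (L2 \<mu>) g u =
    Complex (\<integral>x. Re (g x) * Re (u x) + Im (g x) * Im (u x) \<partial>\<mu>) (\<integral>x. Re (g x) * Im (u x) - Im (g x) * Re (u x) \<partial>\<mu>)"
proof (rule complex_eqI)
  note int = L2_product_integrable[OF assms]
  show "Re (hinner (L2 \<mu>) g u) = Re (Complex (\<integral>x. Re (g x) * Re (u x) + Im (g x) * Im (u x) \<partial>\<mu>)
      (\<integral>x. Re (g x) * Im (u x) - Im (g x) * Re (u x) \<partial>\<mu>))"
    using integral_Re[OF int] by (simp add: hinner_L2)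
  show "Im (hinner (L2 \<mu>) g u) = Im (Complex (\<integral>x. Re (g x) * Re (u x) + Im (g x) * Im (u x) \<partial>\<mu>)
      (\<integral>x. Re (g x) * Im (u x) - Im (g x) * Re (u x) \<partial>\<mu>))"
    using integral_Im[OF int] by (simp add: hinner_L2)
qed

lemma L2_real_parts:
  assumes "g \<in> hvec (L2 \<mu>)"
  shows "L2_real (\<lambda>x. Re (g x))" "L2_real (\<lambda>x. Im (g x))"
proof -
  have m: "g \<in> borel_measurable borel" and i: "integrable \<mu> (\<lambda>x. (cmod (g x))\<^sup>2)"
    using assms measurable_cong_sets[OF sets_mu refl] by (auto simp: L2_vec_iff)
  have mRI: "(\<lambda>x. Re (g x)) \<in> borel_measurable borel" "(\<lambda>x. Im (g x)) \<in> borel_measurable borel"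
    using m by (simp_all add: borel_measurable_complex_iff)
  have "integrable \<mu> (\<lambda>x. (Re (g x))\<^sup>2)"
    by (rule Bochner_Integration.integrable_bound[OF i])
      (use mRI measurable_mu in \<open>auto simp: cmod_power2\<close>)
  moreover have "integrable \<mu> (\<lambda>x. (Im (g x))\<^sup>2)"
    by (rule Bochner_Integration.integrable_bound[OF i])
      (use mRI measurable_mu in \<open>auto simp: cmod_power2\<close>)
  ultimately show "L2_real (\<lambda>x. Re (g x))" "L2_real (\<lambda>x. Im (g x))" using mRI by (simp_all add: L2_real_def)
qed

lemma L2_real_of_real: "L2_real g \<Longrightarrow> (\<lambda>x. of_real (g x)) \<in> hvec (L2 \<mu>)"
  by (auto simp: L2_real_def L2_vec_iff intro!: measurable_mu)

lemma form_zero_right: "C1_real u \<Longrightarrow> form r u (\<lambda>_. 0) = 0"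
  by (simp add: form_def C1_real_const(2) I_zero_right differential_cotangent)

lemma form_zero_left: "C1_real u \<Longrightarrow> form r (\<lambda>_. 0) u = 0"
  by (simp add: form_def C1_real_const(2) I_zero_left differential_cotangent)

lemma sq1_zero: "sq1 (\<lambda>_. 0) = 0"
  by (simp add: sq1_def dens_def C1_real_const(2) I_zero_left cotangent_zero)

lemma sq1_split: "u \<in> C1c_real \<Longrightarrow> sq1 u = (\<integral>x. u x * u x \<partial>\<mu>) + section_inner (du u) (du u)"
  using integrable_product[of u u] integrable_energy[of u u]
  by (simp add: sq1_def dens_def section_inner_def power2_eq_square)

text \<open>The scalar products are complexifications of real ones, so the functional of
  \<open>u\<close> is composed of the real functionals of its real and imaginary parts
  (\<open>Q_eq\<close>). Norms, weak bounds and scalar products then correspond up to factors that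
  depend on the number of functionals only.\<close>

lemma form_estimate_iff:
  "form_core.form_estimate (hvec (L2 \<mu>)) (hinner (L2 \<mu>)) (hinner (K_space A N \<mu>)) (C1c_functions A)
     (\<lambda>u _. cdifferential A u) (of_real r) \<longleftrightarrow> estimate_real r"
proof -
  interpret F: form_core "hscale (L2 \<mu>)" "hvec (L2 \<mu>)" "hinner (L2 \<mu>)"
    "hscale (K_space A N \<mu>)" "hvec (K_space A N \<mu>)" "hinner (K_space A N \<mu>)"
    "C1c_functions A" "\<lambda>u _. cdifferential A u"
    by (rule form_core_Laplacian)
  let ?H = "hinner (L2 \<mu>)" and ?K = "hinner (K_space A N \<mu>)"
  define Q where "Q u p = ?K (\<lambda>_. cdifferential A u) (\<lambda>_. cdifferential A p) - of_real r * ?H u p" for u p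
  have K: "?K (\<lambda>_. cdifferential A u) (\<lambda>_. cdifferential A p) =
      Complex (section_inner (du (\<lambda>x. Re (u x))) (du (\<lambda>x. Re (p x))) + section_inner (du (\<lambda>x. Im (u x))) (du (\<lambda>x. Im (p x))))
        (section_inner (du (\<lambda>x. Re (u x))) (du (\<lambda>x. Im (p x))) - section_inner (du (\<lambda>x. Im (u x))) (du (\<lambda>x. Re (p x))))"
    if "u \<in> C1c_functions A" "p \<in> C1c_functions A" for u p
    unfolding K_space_def semi_inner_hspace.hinner_hcompletion_const[OF semi_inner_Cc_sections]
      Cc_sections_inner[OF cdifferential_Cc_sections[OF that(1)] cdifferential_Cc_sections[OF that(2)]]
    by (simp add: cdifferential_def)
  have Q_eq: "Q u p = Complex (form r (\<lambda>x. Re (u x)) (\<lambda>x. Re (p x)) + form r (\<lambda>x. Im (u x)) (\<lambda>x. Im (p x)))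
      (form r (\<lambda>x. Re (u x)) (\<lambda>x. Im (p x)) - form r (\<lambda>x. Im (u x)) (\<lambda>x. Re (p x)))"
    if u: "u \<in> C1c_functions A" and p: "p \<in> C1c_functions A" for u p
  proof -
    have parts: "(\<lambda>x. Re (u x)) \<in> C1c_real" "(\<lambda>x. Im (u x)) \<in> C1c_real" "(\<lambda>x. Re (p x)) \<in> C1c_real" "(\<lambda>x. Im (p x)) \<in> C1c_real"
      using u p by (simp_all add: C1c_functions_iff)
    have H: "?H u p = Complex ((\<integral>x. Re (u x) * Re (p x) \<partial>\<mu>) + (\<integral>x. Im (u x) * Im (p x) \<partial>\<mu>))
        ((\<integral>x. Re (u x) * Im (p x) \<partial>\<mu>) - (\<integral>x. Im (u x) * Re (p x) \<partial>\<mu>))"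
      using parts integrable_product by (simp add: L2_inner_parts C1c_functions_L2 u p)
    show ?thesis
      unfolding Q_def K[OF u p] H form_def section_inner_def by (simp add: complex_eq_iff algebra_simps)
  qed
  have n1_sq: "(F.n1 u)\<^sup>2 = sq1 (\<lambda>x. Re (u x)) + sq1 (\<lambda>x. Im (u x))" if u: "u \<in> C1c_functions A" for u
  proof -
    have parts: "(\<lambda>x. Re (u x)) \<in> C1c_real" "(\<lambda>x. Im (u x)) \<in> C1c_real"
      using u by (simp_all add: C1c_functions_iff)
    have V: "u \<in> hvec (L2 \<mu>)" "(\<lambda>_. cdifferential A u) \<in> hvec (K_space A N \<mu>)"
      using u by (auto intro: C1c_functions_L2 cdifferential_K_space)
    have "(F.n1 u)\<^sup>2 = Re (?H u u) + Re (?K (\<lambda>_. cdifferential A u) (\<lambda>_. cdifferential A u))"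
      unfolding F.gnrm_power2[OF V] F.H.nrm_power2[OF V(1)] F.K.nrm_power2[OF V(2)] ..
    then show ?thesis
      unfolding K[OF u u] L2_inner_parts[OF V(1) V(1)] sq1_split[OF parts(1)] sq1_split[OF parts(2)]
      using parts integrable_product by simp
  qed
  have n1_nonneg: "0 \<le> F.n1 u" if "u \<in> C1c_functions A" for u
    using that by (intro F.G.nrm_nonneg) (auto intro: C1c_functions_L2 cdifferential_K_space)
  have sq_le: "sqrt (sq1 (\<lambda>x. Re (u x))) \<le> F.n1 u" "sqrt (sq1 (\<lambda>x. Im (u x))) \<le> F.n1 u"
    "F.n1 u \<le> sqrt (sq1 (\<lambda>x. Re (u x))) + sqrt (sq1 (\<lambda>x. Im (u x)))"
    if u: "u \<in> C1c_functions A" for u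
  proof -
    have s: "0 \<le> sq1 (\<lambda>x. Re (u x))" "0 \<le> sq1 (\<lambda>x. Im (u x))"
      using u sq1_nonneg by (auto simp: C1c_functions_iff)
    show "sqrt (sq1 (\<lambda>x. Re (u x))) \<le> F.n1 u" "sqrt (sq1 (\<lambda>x. Im (u x))) \<le> F.n1 u"
      by (rule real_le_lsqrt[OF n1_nonneg[OF u]] real_sqrt_le_iff[THEN iffD1];
        use s n1_sq[OF u] n1_nonneg[OF u] in \<open>auto intro: real_le_lsqrt\<close>)+
    show "F.n1 u \<le> sqrt (sq1 (\<lambda>x. Re (u x))) + sqrt (sq1 (\<lambda>x. Im (u x)))"
      by (rule power2_le_imp_le) (use s in \<open>auto simp: n1_sq[OF u] power2_sum\<close>)
  qed
  have n1_real: "F.n1 (\<lambda>x. of_real (v x)) = sqrt (sq1 v)" if "v \<in> C1c_real" for v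
    using n1_sq[OF of_real_C1c_functions[OF that]] n1_nonneg[OF of_real_C1c_functions[OF that]]
    by (simp add: sq1_zero real_sqrt_unique)
  have weak: "F.weakly_bounded (of_real r) u M \<longleftrightarrow> (\<forall>p\<in>C1c_functions A. cmod (Q u p) \<le> M * F.n1 p)" for u M
    unfolding F.weakly_bounded_def Q_def ..
  show ?thesis
  proof
    assume "F.form_estimate (of_real r)"
    then obtain C G where C: "0 \<le> C" and G: "finite G" "G \<subseteq> hvec (L2 \<mu>)"
      and est: "\<forall>u\<in>C1c_functions A. \<forall>M\<ge>0. F.weakly_bounded (of_real r) u M \<longrightarrow> F.n1 u \<le> C * (M + (\<Sum>g\<in>G. cmod (?H g u)))"
      unfolding F.form_estimate_def by (elim exE conjE) (rule that)
    define G' where "G' = (\<lambda>g x. Re (g x)) ` G \<union> (\<lambda>g x. Im (g x)) ` G"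
    \<comment> \<open>The 2 comes from the weak bound, the other summand from the real and imaginary
      parts of each element of \<open>G\<close>.\<close>
    define C' where "C' = C * (2 + 2 * real (card G))"
    have "sqrt (sq1 u) \<le> C' * (M + (\<Sum>g\<in>G'. \<bar>\<integral>x. g x * u x \<partial>\<mu>\<bar>))"
      if u: "u \<in> C1c_real" and M: "M \<ge> 0" and w: "weak r u M" for u M
    proof -
      let ?u = "\<lambda>x. complex_of_real (u x)" and ?S = "\<Sum>g\<in>G'. \<bar>\<integral>x. g x * u x \<partial>\<mu>\<bar>"
      have uD: "?u \<in> C1c_functions A" by (rule of_real_C1c_functions[OF u])
      have S0: "0 \<le> ?S" by (intro sum_nonneg) auto
      \<comment> \<open>The factor 2 arises from bounding the real and the imaginary part of the
        test function separately.\<close>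
      have "F.weakly_bounded (of_real r) ?u (2 * M)"
        unfolding weak
      proof
        fix p assume p: "p \<in> C1c_functions A"
        then have parts: "(\<lambda>x. Re (p x)) \<in> C1c_real" "(\<lambda>x. Im (p x)) \<in> C1c_real" by (simp_all add: C1c_functions_iff)
        have "Q ?u p = Complex (form r u (\<lambda>x. Re (p x))) (form r u (\<lambda>x. Im (p x)))"
          using parts by (simp add: Q_eq[OF uD p] form_zero_left C1c_realD)
        then have "cmod (Q ?u p) \<le> \<bar>form r u (\<lambda>x. Re (p x))\<bar> + \<bar>form r u (\<lambda>x. Im (p x))\<bar>"
          using cmod_le[of "Q ?u p"] by simp
        also have "\<dots> \<le> M * sqrt (sq1 (\<lambda>x. Re (p x))) + M * sqrt (sq1 (\<lambda>x. Im (p x)))"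
          using w parts by (intro add_mono) (simp_all add: weak_def)
        also have "\<dots> \<le> M * F.n1 p + M * F.n1 p"
          using sq_le(1,2)[OF p] M by (intro add_mono mult_left_mono)
        finally show "cmod (Q ?u p) \<le> 2 * M * F.n1 p" by simp
      qed
      from est[rule_format, OF uD _ this] M
      have le: "sqrt (sq1 u) \<le> C * (2 * M + (\<Sum>g\<in>G. cmod (?H g ?u)))" by (simp add: n1_real[OF u])
      have "(\<Sum>g\<in>G. cmod (?H g ?u)) \<le> (\<Sum>g\<in>G. \<bar>\<integral>x. Re (g x) * u x \<partial>\<mu>\<bar> + \<bar>\<integral>x. Im (g x) * u x \<partial>\<mu>\<bar>)"
      proof (rule sum_mono)
        fix g assume "g \<in> G"
        then have g: "g \<in> hvec (L2 \<mu>)" using G(2) by blast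
        have "?H g ?u = Complex (\<integral>x. Re (g x) * u x \<partial>\<mu>) (- (\<integral>x. Im (g x) * u x \<partial>\<mu>))"
          using L2_inner_parts[OF g C1c_functions_L2[OF uD]] by simp
        then show "cmod (?H g ?u) \<le> \<bar>\<integral>x. Re (g x) * u x \<partial>\<mu>\<bar> + \<bar>\<integral>x. Im (g x) * u x \<partial>\<mu>\<bar>"
          using cmod_le[of "?H g ?u"] by simp
      qed
      also have "\<dots> = (\<Sum>g\<in>G. \<bar>\<integral>x. Re (g x) * u x \<partial>\<mu>\<bar>) + (\<Sum>g\<in>G. \<bar>\<integral>x. Im (g x) * u x \<partial>\<mu>\<bar>)"
        by (rule sum.distrib)
      also have "\<dots> \<le> real (card G) * ?S + real (card G) * ?S"
      proof (rule add_mono)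
        show "(\<Sum>g\<in>G. \<bar>\<integral>x. Re (g x) * u x \<partial>\<mu>\<bar>) \<le> real (card G) * ?S"
          using sum_image_Un_le[of G "(\<lambda>g x. Im (g x)) ` G" "\<lambda>g. \<bar>\<integral>x. g x * u x \<partial>\<mu>\<bar>" "\<lambda>g x. Re (g x)"] G(1)
          by (simp add: G'_def)
        show "(\<Sum>g\<in>G. \<bar>\<integral>x. Im (g x) * u x \<partial>\<mu>\<bar>) \<le> real (card G) * ?S"
          using sum_image_Un_le[of G "(\<lambda>g x. Re (g x)) ` G" "\<lambda>g. \<bar>\<integral>x. g x * u x \<partial>\<mu>\<bar>" "\<lambda>g x. Im (g x)"] G(1)
          by (simp add: G'_def Un_commute)
      qed
      finally have le': "(\<Sum>g\<in>G. cmod (?H g ?u)) \<le> real (card G) * ?S + real (card G) * ?S" .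
      have "(2 + 2 * real (card G)) * (M + ?S) = 2 * M + (real (card G) * ?S + real (card G) * ?S) + 2 * ?S + 2 * (real (card G) * M)"
        by (simp add: algebra_simps)
      moreover have "0 \<le> real (card G) * M" using M by simp
      ultimately have "2 * M + (\<Sum>g\<in>G. cmod (?H g ?u)) \<le> (2 + 2 * real (card G)) * (M + ?S)"
        using le' S0 by linarith
      from mult_left_mono[OF this C] le show ?thesis by (simp add: C'_def mult.assoc)
    qed
    moreover have "0 \<le> C'" using C by (simp add: C'_def)
    moreover have "finite G'" "\<forall>g\<in>G'. L2_real g" using G L2_real_parts by (auto simp: G'_def)
    ultimately show "estimate_real r"
      unfolding estimate_real_def by (intro exI[of _ C'] exI[of _ G']) blast
  next
    assume "estimate_real r"
    then obtain C G where C: "0 \<le> C" and G: "finite G" "\<forall>g\<in>G. L2_real g"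
      and est: "\<forall>u\<in>C1c_real. \<forall>M\<ge>0. weak r u M \<longrightarrow> sqrt (sq1 u) \<le> C * (M + (\<Sum>g\<in>G. \<bar>\<integral>x. g x * u x \<partial>\<mu>\<bar>))"
      unfolding estimate_real_def by (elim exE conjE) (rule that)
    define G' :: "('a \<Rightarrow> complex) set" where "G' = (\<lambda>g x. of_real (g x)) ` G"
    define C' where "C' = 2 * C * (1 + real (card G))"
    have "F.n1 u \<le> C' * (M + (\<Sum>g\<in>G'. cmod (?H g u)))"
      if u: "u \<in> C1c_functions A" and M: "M \<ge> 0" and w: "F.weakly_bounded (of_real r) u M" for u M
    proof -
      let ?S = "\<Sum>g\<in>G'. cmod (?H g u)"
      have S0: "0 \<le> ?S" by (intro sum_nonneg) auto
      have parts: "(\<lambda>x. Re (u x)) \<in> C1c_real" "(\<lambda>x. Im (u x)) \<in> C1c_real" using u by (simp_all add: C1c_functions_iff)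
      \<comment> \<open>Against a real test function the two parts of \<open>u\<close> appear, up to
        sign, as real and imaginary part of one complex number.\<close>
      have Qv: "\<bar>form r (\<lambda>x. Re (u x)) v\<bar> \<le> M * sqrt (sq1 v)" "\<bar>form r (\<lambda>x. Im (u x)) v\<bar> \<le> M * sqrt (sq1 v)"
        if v: "v \<in> C1c_real" for v
      proof -
        let ?v = "\<lambda>x. complex_of_real (v x)"
        have vD: "?v \<in> C1c_functions A" by (rule of_real_C1c_functions[OF v])
        have eq: "Q u ?v = Complex (form r (\<lambda>x. Re (u x)) v) (- form r (\<lambda>x. Im (u x)) v)"
          using parts by (simp add: Q_eq[OF u vD] form_zero_right C1c_realD)
        have "cmod (Q u ?v) \<le> M * sqrt (sq1 v)" using w vD by (simp add: weak n1_real[OF v, symmetric])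
        then show "\<bar>form r (\<lambda>x. Re (u x)) v\<bar> \<le> M * sqrt (sq1 v)" "\<bar>form r (\<lambda>x. Im (u x)) v\<bar> \<le> M * sqrt (sq1 v)"
          using abs_Re_le_cmod[of "Q u ?v"] abs_Im_le_cmod[of "Q u ?v"] by (auto simp: eq)
      qed
      have gu: "\<bar>\<integral>x. g x * Re (u x) \<partial>\<mu>\<bar> \<le> cmod (?H (\<lambda>x. of_real (g x)) u)"
        "\<bar>\<integral>x. g x * Im (u x) \<partial>\<mu>\<bar> \<le> cmod (?H (\<lambda>x. of_real (g x)) u)" if "g \<in> G" for g
      proof -
        have eq: "?H (\<lambda>x. of_real (g x)) u = Complex (\<integral>x. g x * Re (u x) \<partial>\<mu>) (\<integral>x. g x * Im (u x) \<partial>\<mu>)"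
          using L2_inner_parts[OF L2_real_of_real C1c_functions_L2[OF u], of g] G(2) that by simp
        show "\<bar>\<integral>x. g x * Re (u x) \<partial>\<mu>\<bar> \<le> cmod (?H (\<lambda>x. of_real (g x)) u)"
          "\<bar>\<integral>x. g x * Im (u x) \<partial>\<mu>\<bar> \<le> cmod (?H (\<lambda>x. of_real (g x)) u)"
          using abs_Re_le_cmod[of "?H (\<lambda>x. of_real (g x)) u"] abs_Im_le_cmod[of "?H (\<lambda>x. of_real (g x)) u"]
          unfolding eq by simp_all
      qed
      have sumG: "(\<Sum>g\<in>G. cmod (?H (\<lambda>x. of_real (g x)) u)) \<le> real (card G) * ?S"
        using sum_image_Un_le[of G "{}" "\<lambda>g. cmod (?H g u)" "\<lambda>g x. of_real (g x)"] G(1) by (simp add: G'_def)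
      have part: "sqrt (sq1 v) \<le> C * (M + real (card G) * ?S)"
        if v: "v \<in> C1c_real" "\<forall>p\<in>C1c_real. \<bar>form r v p\<bar> \<le> M * sqrt (sq1 p)"
          and g: "\<And>g. g \<in> G \<Longrightarrow> \<bar>\<integral>x. g x * v x \<partial>\<mu>\<bar> \<le> cmod (?H (\<lambda>x. of_real (g x)) u)" for v
      proof -
        have "sqrt (sq1 v) \<le> C * (M + (\<Sum>g\<in>G. \<bar>\<integral>x. g x * v x \<partial>\<mu>\<bar>))"
          using est[rule_format, OF v(1) M] v(2) by (simp add: weak_def)
        also have "\<dots> \<le> C * (M + real (card G) * ?S)"
          by (intro mult_left_mono add_left_mono order_trans[OF sum_mono sumG] g C)
        finally show ?thesis .
      qed
      have "F.n1 u \<le> C * (M + real (card G) * ?S) + C * (M + real (card G) * ?S)"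
        using part[OF parts(1) _ gu(1)] part[OF parts(2) _ gu(2)] Qv sq_le(3)[OF u] by fastforce
      also have "\<dots> \<le> C' * (M + ?S)"
      proof -
        have "M + real (card G) * ?S \<le> (1 + real (card G)) * (M + ?S)"
        proof -
          have "(1 + real (card G)) * (M + ?S) = M + real (card G) * ?S + ?S + real (card G) * M"
            by (simp add: algebra_simps)
          moreover have "0 \<le> real (card G) * M" using M by simp
          ultimately show ?thesis using S0 by linarith
        qed
        from mult_left_mono[OF this C] show ?thesis by (simp add: C'_def mult.assoc)
      qed
      finally show ?thesis .
    qed
    moreover have "0 \<le> C'" using C by (simp add: C'_def)
    moreover have "finite G'" "G' \<subseteq> hvec (L2 \<mu>)" using G L2_real_of_real by (auto simp: G'_def)
    ultimately show "F.form_estimate (of_real r)"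
      unfolding F.form_estimate_def by (intro exI[of _ C'] exI[of _ G']) blast
  qed
qed

theorem Fredholm_Laplacian_iff:
  "Fredholm (L2 \<mu>) (op_minus_scalar (L2 \<mu>) (Laplacian A N \<mu>) z) \<longleftrightarrow> (Im z = 0 \<longrightarrow> estimate_real (Re z))"
proof -
  interpret F: form_core "hscale (L2 \<mu>)" "hvec (L2 \<mu>)" "hinner (L2 \<mu>)"
    "hscale (K_space A N \<mu>)" "hvec (K_space A N \<mu>)" "hinner (K_space A N \<mu>)"
    "C1c_functions A" "\<lambda>u _. cdifferential A u"
    by (rule form_core_Laplacian)
  \<comment> \<open>The sequence \<open>ws\<close> in the definition of the closure is determined by
    \<open>us\<close>.\<close>
  have d: "d_closed A N \<mu> = F.closure_graph"
  proof -
    have "(\<exists>us ws. (\<forall>n. (us n, ws n) \<in> {(u, \<lambda>_. cdifferential A u) | u. u \<in> C1c_functions A}) \<and> P us ws) \<longleftrightarrow>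
        (\<exists>us. (\<forall>n. us n \<in> C1c_functions A) \<and> P us (\<lambda>n _. cdifferential A (us n)))"
      for P :: "(nat \<Rightarrow> 'a \<Rightarrow> complex) \<Rightarrow> (nat \<Rightarrow> nat \<Rightarrow> 'a \<Rightarrow> ('a, 'e) ccovec) \<Rightarrow> bool"
    proof
      assume "\<exists>us ws. (\<forall>n. (us n, ws n) \<in> {(u, \<lambda>_. cdifferential A u) | u. u \<in> C1c_functions A}) \<and> P us ws"
      then obtain us ws where us: "\<forall>n. (us n, ws n) \<in> {(u, \<lambda>_. cdifferential A u) | u. u \<in> C1c_functions A}" "P us ws"
        by (elim exE conjE) (rule that)
      then have "ws = (\<lambda>n _. cdifferential A (us n))" by auto
      then show "\<exists>us. (\<forall>n. us n \<in> C1c_functions A) \<and> P us (\<lambda>n _. cdifferential A (us n))"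
        using us by (intro exI[of _ us]) auto
    next
      assume "\<exists>us. (\<forall>n. us n \<in> C1c_functions A) \<and> P us (\<lambda>n _. cdifferential A (us n))"
      then obtain us where us: "\<forall>n. us n \<in> C1c_functions A" "P us (\<lambda>n _. cdifferential A (us n))"
        by (elim exE conjE) (rule that)
      then show "\<exists>us ws. (\<forall>n. (us n, ws n) \<in> {(u, \<lambda>_. cdifferential A u) | u. u \<in> C1c_functions A}) \<and> P us ws"
        by (intro exI[of _ us] exI[of _ "\<lambda>n _. cdifferential A (us n)"]) auto
    qed
    then show ?thesis
      unfolding d_closed_def op_closure_def F.closure_graph_def
        semi_inner_hspace.htendsto_eq[OF semi_inner_L2] semi_inner_hspace.htendsto_eq[OF semi_inner_K_space]
      by simp
  qed
  have "Laplacian A N \<mu> = F.laplace"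
    unfolding Laplacian_def op_adjoint_def F.laplace_def d
    by (auto dest: F.closure_graph_V)
  then have "Fredholm (L2 \<mu>) (op_minus_scalar (L2 \<mu>) (Laplacian A N \<mu>) z) \<longleftrightarrow> (Im z = 0 \<longrightarrow> F.form_estimate z)"
    using Fredholm_iff[OF semi_inner_L2 F.S.selfadjoint_relation_axioms] F.fredholm_iff[of z] by simp
  moreover have "z = of_real (Re z)" if "Im z = 0" using that by (simp add: complex_eq_iff)
  ultimately show ?thesis using form_estimate_iff[of "Re z"] by fastforce
qed

end

text \<open>Reciprocals exchange the roles: an upper bound of \<open>N'\<close> by
  \<open>\<beta>\<close> times \<open>N\<close> is a lower bound of \<open>N\<close> by
  \<open>1 / \<beta>\<close> times \<open>N'\<close>, and the constants \<open>k\<close> and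
  \<open>B\<close> become \<open>1 / B\<close> and \<open>1 / k\<close>.\<close>

lemma (in RM_pair) RM_pair_swap:
  "RM_pair A N' N \<mu>' \<mu> (\<lambda>x. 1 / \<beta> x) (\<lambda>x. 1 / \<alpha> x) (\<lambda>x. 1 / \<kappa> x) (1 / B) (1 / k)"
proof (rule RM_pair.intro[OF M'.RM_manifold_axioms M.RM_manifold_axioms RM_pair_axioms.intro])
  have pos: "0 < \<alpha> x" "0 < \<beta> x" "0 < \<kappa> x" for x
    using k(1) k(2)[of x] k(3)[of x] k(4)[of x] by linarith+
  show "(\<lambda>x. 1 / \<kappa> x) \<in> borel_measurable borel" using meas by simp
  show "1 / \<beta> x \<le> 1 / k" "1 / \<alpha> x \<le> 1 / k" "1 / \<kappa> x \<le> 1 / k" for x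
    using k(1) k(2-4)[of x] by (simp_all add: frac_le)
  show "0 < 1 / B" using B_pos by simp
  show "1 / B \<le> 1 / \<beta> x" "1 / B \<le> 1 / \<alpha> x" "1 / B \<le> 1 / \<kappa> x" for x
    using pos[of x] upper[of x] by (simp_all add: frac_le)
  show "1 / \<beta> x * N' x \<xi> \<le> N x \<xi>" "N x \<xi> \<le> 1 / \<alpha> x * N' x \<xi>" if "\<xi> \<in> cotangent A x" for x \<xi>
    using N_le[OF that] pos[of x] by (simp_all add: field_simps)
  have "density \<mu>' (\<lambda>x. ennreal (1 / \<kappa> x)) = density \<mu> (\<lambda>x. ennreal (\<kappa> x) * ennreal (1 / \<kappa> x))"
    unfolding density using meas by (intro density_density_eq) (auto intro!: M.measurable_mu)
  also have "(\<lambda>x. ennreal (\<kappa> x) * ennreal (1 / \<kappa> x)) = (\<lambda>_. 1)"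
  proof
    fix x show "ennreal (\<kappa> x) * ennreal (1 / \<kappa> x) = 1"
      using pos(3)[of x] by (simp add: ennreal_mult[symmetric])
  qed
  finally show "\<mu> = density \<mu>' (\<lambda>x. ennreal (1 / \<kappa> x))" by (simp add: density_1)
  show "((\<lambda>x. 1 / \<beta> x) \<longlongrightarrow> 1) cocompact" "((\<lambda>x. 1 / \<alpha> x) \<longlongrightarrow> 1) cocompact" "((\<lambda>x. 1 / \<kappa> x) \<longlongrightarrow> 1) cocompact"
    using tendsto_divide[OF tendsto_const lims(1), of 1] tendsto_divide[OF tendsto_const lims(2), of 1]
      tendsto_divide[OF tendsto_const lims(3), of 1] by simp_all
qed

lemma RM_pair_of_strongly_equivalent:
  assumes M: "RM_manifold A N \<mu>" "RM_manifold A N' \<mu>'" and eq: "RM_strongly_equivalent A N \<mu> N' \<mu>'"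
  obtains \<alpha> \<beta> \<kappa> k B where "RM_pair A N N' \<mu> \<mu>' \<alpha> \<beta> \<kappa> k B"
proof -
  obtain \<alpha> \<beta> \<kappa> where via: "RM_equivalent_via A N \<mu> N' \<mu>' \<alpha> \<beta> \<kappa>"
    and lim: "(\<alpha> \<longlongrightarrow> 1) cocompact" "(\<beta> \<longlongrightarrow> 1) cocompact" "(\<kappa> \<longlongrightarrow> 1) cocompact"
    using eq unfolding RM_strongly_equivalent_def by blast
  note via = via[unfolded RM_equivalent_via_def]
  obtain k where k: "0 < k" "\<forall>x. k \<le> \<alpha> x \<and> k \<le> \<kappa> x" using via by blast
  obtain B1 B2 B3 where B: "\<forall>x. \<bar>\<alpha> x\<bar> \<le> B1" "\<forall>x. \<bar>\<beta> x\<bar> \<le> B2" "\<forall>x. \<bar>\<kappa> x\<bar> \<le> B3"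
    using via by (auto simp: bounded_iff)
  define B where "B = max B1 (max B2 B3)"
  interpret M: RM_manifold A N \<mu> by fact
  \<comment> \<open>The maximum with \<open>\<alpha>\<close> inherits the lower bound
    \<open>k\<close> without a nonzero covector having to be exhibited, and it still tends to
    1.\<close>
  have "RM_pair A N N' \<mu> \<mu>' \<alpha> (\<lambda>x. max (\<alpha> x) (\<beta> x)) \<kappa> k B"
  proof (rule RM_pair.intro[OF M RM_pair_axioms.intro])
    show "\<kappa> \<in> borel_measurable borel" "\<mu>' = density \<mu> (\<lambda>x. ennreal (\<kappa> x))" using via by blast+
    show "\<alpha> x \<le> B" "max (\<alpha> x) (\<beta> x) \<le> B" "\<kappa> x \<le> B" for x
      using B(1)[rule_format, of x] B(2)[rule_format, of x] B(3)[rule_format, of x] by (auto simp: B_def)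
    show "0 < k" "k \<le> \<alpha> x" "k \<le> max (\<alpha> x) (\<beta> x)" "k \<le> \<kappa> x" for x using k by (auto simp: le_max_iff_disj)
    show "\<alpha> x * N x \<xi> \<le> N' x \<xi>" if "\<xi> \<in> cotangent A x" for x \<xi> using via that by blast
    show "N' x \<xi> \<le> max (\<alpha> x) (\<beta> x) * N x \<xi>" if "\<xi> \<in> cotangent A x" for x \<xi>
    proof (rule order_trans)
      show "N' x \<xi> \<le> \<beta> x * N x \<xi>" using via that by blast
      show "\<beta> x * N x \<xi> \<le> max (\<alpha> x) (\<beta> x) * N x \<xi>" using M.N_nonneg[OF that] by (intro mult_right_mono) auto
    qed
    show "(\<alpha> \<longlongrightarrow> 1) cocompact" "(\<kappa> \<longlongrightarrow> 1) cocompact" by fact+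
    show "((\<lambda>x. max (\<alpha> x) (\<beta> x)) \<longlongrightarrow> 1) cocompact" using tendsto_max[OF lim(1,2)] by simp
  qed
  then show ?thesis by (rule that)
qed

theorem theorem8p4:
  fixes A :: "('a::{t2_space,second_countable_topology}, 'e::euclidean_space) chart set"
    and N N' :: "('a, 'e) conorm"
    and \<mu> \<mu>' :: "'a measure"
  assumes "C1_atlas A"
    and "\<not> compact (UNIV :: 'a set)"
    and "complete_RM_structure A N \<mu>"
    and "complete_RM_structure A N' \<mu>'"
    and "RM_strongly_equivalent A N \<mu> N' \<mu>'"
  shows "essential_spectrum (L2 \<mu>) (Laplacian A N \<mu>) =
         essential_spectrum (L2 \<mu>') (Laplacian A N' \<mu>')"
proof -
  interpret M: RM_manifold A N \<mu>
    using assms by unfold_locales (auto simp: complete_RM_structure_def RM_structure_def)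
  interpret M': RM_manifold A N' \<mu>'
    using assms by unfold_locales (auto simp: complete_RM_structure_def RM_structure_def)
  obtain \<alpha> \<beta> \<kappa> k B where P: "RM_pair A N N' \<mu> \<mu>' \<alpha> \<beta> \<kappa> k B"
    by (rule RM_pair_of_strongly_equivalent[OF M.RM_manifold_axioms M'.RM_manifold_axioms assms(5)])
  \<comment> \<open>The transfer goes in one direction; applied to the pair and to the exchanged
    pair it gives the equivalence.\<close>
  have "M.estimate_real r \<longleftrightarrow> M'.estimate_real r" for r
    using RM_pair.estimate_transfer[OF P] RM_pair.estimate_transfer[OF RM_pair.RM_pair_swap[OF P]] by blast
  then show ?thesis
    unfolding essential_spectrum_def M.Fredholm_Laplacian_iff M'.Fredholm_Laplacian_iff by simp
qed

end
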